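(* Given a double category $\mathbb{C}$, the Grothendieck construction induces a $2$-equivalence of $2$-categories \[ \textstyle\int\!\!\!\int_{\mathbb{C}}\colon \mathcal{P}_{\mathbb{C}}=[\mathbb{C}^{\mathrm{op}},\mathbb{C}\mathrm{at}]^{\mathrm{nlax}}\xrightarrow{\ \simeq\ }\mathrm{D}\mathcal{F}\mathrm{ib}(\mathbb{C}) \] from the $2$-category of lax double presheaves over $\mathbb{C}$ to the $2$-category of discrete double fibrations over $\mathbb{C}$, which is pseudo-natural in $\mathbb{C}$.
   Context: **Double categories.** A (strict) double category $\mathbb{C}$ has objects; horizontal morphisms $f\colon x\to y$ (composition $g\circ f$, identities $1_x$); vertical morphisms $u\colon x\nrightarrow x'$ (composition $u'\bullet u$, identities $e_x$); and squares $\alpha\colon[u\,{}^{f}_{f'}\,v]$ with left boundary $u\colon x\nrightarrow x'$, right boundary $v\colon y\nrightarrow y'$, top $f\colon x\to y$ and bottom $f'\colon x'\to y'$. Squares compose horizontally ($\beta\circ\alpha$, along a common vertical morphism, identities $1_u$) and vertically ($\alpha'\bullet\alpha$, along a common horizontal morphism, identities $e_f$). All compositions are strictly associative and unital, satisfy interchange, and $e_g\circ e_f=e_{g\circ f}$, $1_{u'}\bullet 1_u=1_{u'\bullet u}$, $e_{1_x}=1_{e_x}$. Double functors preserve all structure strictly. $\mathbb{C}^{\mathrm{op}}$ is obtained by reversing horizontal morphisms and squares horizontally. A square is globular if both its vertical boundaries are vertical identities. A horizontal transformation $B\colon G\Rightarrow G'\colon\mathbb{C}\to\mathbb{D}$ of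 double functors consists of horizontal morphisms $B_x\colon Gx\to G'x$ natural in horizontal morphisms and squares $B_u\colon[Gu\,{}^{B_x}_{B_{x'}}\,G'u]$ natural in squares (with respect to horizontal composition) and compatible with vertical composition and identities. A vertical transformation $A$ from $F$ to $F'$ (both $\mathbb{E}\to\mathbb{F}$) consists of vertical morphisms $A_x\colon Fx\nrightarrow F'x$ with $F'u\bullet A_x=A_{x'}\bullet Fu$ and squares $A_f\colon[A_x\,{}^{Ff}_{F'f}\,A_y]$ natural in squares (with respect to vertical composition) and compatible with horizontal composition and identities. $\mathrm{DblCat}_h$ (resp. $\mathrm{DblCat}_v$) is the $2$-category of double categories, double functors and horizontal (resp. vertical) transformations; the superscript "coop" reverses both $1$- and $2$-morphisms. $2\mathrm{Cat}$ is the $2$-category of $2$-categories, $2$-functors, $2$-natural transformations. A $2$-equivalence is a $2$-functor admitting an inverse $2$-functor up to $2$-natural isomorphisms. **Profunctors.** A profunctor $U\colon \mathcal{A}\nrightarrow\mathcal{A}'$ is a functor $\mathcal{A}^{\mathrm{op}}\times\mathcal{A}'\to\mathrm{Set}$. Composition: $(U'\bullet U)(a,a'')=\int^{a'}U'(a',a'')\times U(a,a')$; the class of $(s',s)$ is $[s',s]$. The identity profunctor is the hom functor, and one chooses $U\bullet e_{\mathcal{A}}=U=e_{\mathcal{A}'}\bullet U$ via the co-Yoneda isomorphisms. $\mathbb{C}\mathrm{at}$ is the weak double category of small categories, functors (horizontal), profunctors (vertical), with squares $[U\,{}^{F}_{F'}\,V]$ the natural transformations $U\Rightarrow V(F^{\mathrm{op}}\times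 F')$. **Lax double presheaves.** A lax double presheaf over $\mathbb{C}$ is a normal lax double functor $X\colon\mathbb{C}^{\mathrm{op}}\to\mathbb{C}\mathrm{at}$. Explicitly: a category $Xx$ for each object $x$; a functor $Xf\colon Xy\to Xx$ for each horizontal $f\colon x\to y$; a profunctor $Xu\colon Xx^{\mathrm{op}}\times Xx'\to\mathrm{Set}$ for each vertical $u\colon x\nrightarrow x'$; a natural transformation $X\alpha\colon Xv\Rightarrow Xu(Xf^{\mathrm{op}}\times Xf')$ for each square $\alpha\colon[u\,{}^{f}_{f'}\,v]$; and a natural transformation $\mu_{u,u'}\colon Xu'\bullet Xu\Rightarrow X(u'\bullet u)$ for all composable vertical $u,u'$; such that (i) horizontal compositions and identities (of horizontal morphisms and of squares) are preserved strictly; (ii) $\mu$ is natural: $X(\alpha'\bullet\alpha)\circ\mu_{v,v'}=\mu_{u,u'}(Xf^{\mathrm{op}}\times Xf'')\circ(X\alpha'\bullet X\alpha)$ for vertically composable squares $\alpha\colon[u\,{}^{f}_{f'}\,v]$, $\alpha'\colon[u'\,{}^{f'}_{f''}\,v']$, and associative: $\mu_{u,u''\bullet u'}\circ(\mu_{u',u''}\bullet Xu)=\mu_{u'\bullet u,u''}\circ(Xu''\bullet\mu_{u,u'})$ up to the associator of profunctor composition; (iii) normality: $Xe_x$ is the hom functor of $Xx$, $Xe_f$ is the action of $Xf$ on homs, and $\mu_{e_x,u}$, $\mu_{u,e_{x'}}$ are identities at $Xu$. Horizontal transformations $F\colon X\Rightarrow Y$: functors $F_x\colon Xx\to Yx$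 and natural transformations $F_u\colon Xu\Rightarrow Yu(F_x^{\mathrm{op}}\times F_{x'})$ such that $F_x\circ Xf=Yf\circ F_y$ for $f\colon x\to y$; $F_u(Xf^{\mathrm{op}}\times Xf')\circ X\alpha=Y\alpha(F_y^{\mathrm{op}}\times F_{y'})\circ F_v$ for each square $\alpha\colon[u\,{}^{f}_{f'}\,v]$; $F_{u'\bullet u}\circ\mu_{u,u'}=\mu_{u,u'}(F_x^{\mathrm{op}}\times F_{x''})\circ(F_{u'}\bullet F_u)$; and $F_{e_x}$ is the action of $F_x$ on homs. Globular modifications $A$ from $F$ to $F'$: natural transformations $A_x\colon F_x\Rightarrow F'_x$ such that $Yf\,A_y=A_x\,Xf$ for all $f\colon x\to y$, and $Yu(F_x^{\mathrm{op}}\times A_{x'})\circ F_u=Yu(A_x^{\mathrm{op}}\times F'_{x'})\circ F'_u$ for all $u\colon x\nrightarrow x'$. These form the $2$-category $\mathcal{P}_{\mathbb{C}}$. **Discrete double fibrations.** A double functor $P\colon\mathbb{E}\to\mathbb{C}$ is a discrete double fibration if (1) for every object $y_-$ of $\mathbb{E}$ and horizontal $f\colon x\to Py_-$ in $\mathbb{C}$ there is a unique horizontal morphism $P^*f\colon f^*y_-\to y_-$ in $\mathbb{E}$ with target $y_-$ and $P(P^*f)=f$; (2) for every vertical morphism $v_-$ of $\mathbb{E}$ and square $\alpha\colon[u\,{}^{f}_{f'}\,Pv_-]$ in $\mathbb{C}$ there is a unique square $P^*\alpha$ in $\mathbb{E}$ with right boundary $v_-$ and $P(P^*\alpha)=\alpha$;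 its left boundary is written $\alpha^*v_-$. $\mathrm{D}\mathcal{F}\mathrm{ib}(\mathbb{C})$ is the $2$-full sub-$2$-category of the slice $\mathrm{DblCat}_v/\mathbb{C}$ on discrete double fibrations: morphisms are double functors over $\mathbb{C}$; $2$-morphisms are vertical transformations $A$ over $\mathbb{C}$, i.e. those sent by the projection to $\mathbb{C}$ to vertical identities $e_{Px}$, $e_{Pf}$. **Grothendieck construction.** For $X$ in $\mathcal{P}_{\mathbb{C}}$, $\int\!\!\!\int_{\mathbb{C}}X$ is the double category with objects $(x,x_-)$, $x\in\mathbb{C}$, $x_-\in Xx$; horizontal morphisms $(x,x_-)\to(y,y_-)$ the horizontal $f\colon x\to y$ in $\mathbb{C}$ with $x_-=Xf(y_-)$; vertical morphisms $(x,x_-)\nrightarrow(x',x'_-)$ the pairs $(u,u_-)$ with $u\colon x\nrightarrow x'$ and $u_-\in Xu(x_-,x'_-)$; squares $[(u,u_-)\,{}^{f}_{f'}\,(v,v_-)]$ from left objects $(x,x_-),(x',x'_-)$ to right objects $(y,y_-),(y',y'_-)$ the squares $\alpha\colon[u\,{}^{f}_{f'}\,v]$ of $\mathbb{C}$ with $u_-=(X\alpha)_{y_-,y'_-}(v_-)$. Compositions and identities of horizontal morphisms and squares are those of $\mathbb{C}$; $(u',u'_-)\bullet(u,u_-)=(u'\bullet u,(\mu_{u,u'})_{x_-,x''_-}([u'_-,u_-]))$; vertical identities are $(e_x,1_{x_-})$. It has the projection $\pi_X\colon\int\!\!\!\int_{\mathbb{C}}X\to\mathbb{C}$ onto the first component.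 On a horizontal transformation $F\colon X\Rightarrow Y$, $\int\!\!\!\int_{\mathbb{C}}F$ is $(x,x_-)\mapsto(x,F_xx_-)$, $(u,u_-)\mapsto(u,(F_u)_{x_-,x'_-}u_-)$, and the identity on the underlying horizontal morphisms and squares. On a globular modification $A$, $\int\!\!\!\int_{\mathbb{C}}A$ is the vertical transformation with component $(e_x,(A_x)_{x_-})$ at $(x,x_-)$ and $e_f$ at $f$. **Pseudo-naturality.** Pseudo-natural in $\mathbb{C}$ means that the $\int\!\!\!\int_{\mathbb{C}}$ are the components of a pseudo-natural transformation $\mathcal{P}\Rightarrow\mathrm{D}\mathcal{F}\mathrm{ib}$ of pseudo-functors $\mathrm{DblCat}_h^{\mathrm{coop}}\to2\mathrm{Cat}$. Here $\mathcal{P}$ sends $\mathbb{C}$ to $\mathcal{P}_{\mathbb{C}}$, a double functor $G\colon\mathbb{C}\to\mathbb{D}$ to precomposition with $G^{\mathrm{op}}$, and $B\colon G\Rightarrow G'$ to the $2$-natural transformation with component at $X$ the horizontal transformation $X G'^{\mathrm{op}}\Rightarrow XG^{\mathrm{op}}$ with components $X(B_x)$, $X(B_u)$. And $\mathrm{D}\mathcal{F}\mathrm{ib}$ sends $G$ to pullback $G^*\colon\mathrm{D}\mathcal{F}\mathrm{ib}(\mathbb{D})\to\mathrm{D}\mathcal{F}\mathrm{ib}(\mathbb{C})$ and $B$ to the $2$-natural transformation $B^*\colon G'^*\Rightarrow G^*$ with component at $P\colon\mathbb{E}\to\mathbb{D}$ the double functor $G'^*\mathbb{E}\to G^*\mathbb{E}$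 over $\mathbb{C}$ given by $(x,x_-)\mapsto(x,(B_x)^*x_-)$, $(u,u_-)\mapsto(u,(B_u)^*u_-)$, $(f,f_-)\mapsto(f,P^*Gf)$, $(\alpha,\alpha_-)\mapsto(\alpha,P^*G\alpha)$ (unique lifts with the evident targets). *)

theory Defs
  imports Main "HOL-Library.FuncSet" "HOL-Library.Nat_Bijection"
begin

section \<open>A universe of small sets\<close>

text \<open>
  HOL has no type of all sets, so the word "small" is interpreted relative to a universe: a type
  whose elements serve as the elements of sets, a predicate selecting the small sets among the sets
  of such elements, and an injective pairing that codes tuples.  Only closure under subsets,
  insertion and unions of small families (hence replacement) is required.  The elements of a
  Grothendieck universe form an instance, with its members as the small sets and the Kuratowski
  pair as the pairing; so does every infinite type with all of its sets counted as small.
\<close>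

class universe =
  fixes small :: "'a set \<Rightarrow> bool"
    and upair :: "'a \<Rightarrow> 'a \<Rightarrow> 'a"
  assumes small_empty: "small {}"
    and small_insert: "small A \<Longrightarrow> small (insert x A)"
    and small_subset: "small A \<Longrightarrow> B \<subseteq> A \<Longrightarrow> small B"
    and small_UN: "small A \<Longrightarrow> (\<And>x. x \<in> A \<Longrightarrow> small (f x)) \<Longrightarrow> small (\<Union>x\<in>A. f x)"
    and upair_inject: "upair a b = upair c d \<Longrightarrow> a = c \<and> b = d"

definition ufst :: "'u::universe \<Rightarrow> 'u" where
  "ufst z = (THE a. \<exists>b. z = upair a b)"

definition usnd :: "'u::universe \<Rightarrow> 'u" where
  "usnd z = (THE b. \<exists>a. z = upair a b)"

lemma ufst_upair [simp]: "ufst (upair a b) = a"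
  unfolding ufst_def by (rule the_equality) (auto dest: upair_inject)

lemma usnd_upair [simp]: "usnd (upair a b) = b"
  unfolding usnd_def by (rule the_equality) (auto dest: upair_inject)

text \<open>The class is inhabited: countable sets.\<close>

instantiation nat :: universe
begin

definition small_nat :: "nat set \<Rightarrow> bool" where
  "small_nat A = True"

definition upair_nat :: "nat \<Rightarrow> nat \<Rightarrow> nat" where
  "upair_nat a b = prod_encode (a, b)"

instance
  by standard (simp_all add: small_nat_def upair_nat_def)

end


section \<open>Categories and functors\<close>

record ('o, 'a) cat =
  Obj :: "'o set"
  Arr :: "'a set"
  Dom :: "'a \<Rightarrow> 'o"
  Cod :: "'a \<Rightarrow> 'o"
  Ident :: "'o \<Rightarrow> 'a"
  Cmp :: "'a \<Rightarrow> 'a \<Rightarrow> 'a"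

locale category =
  fixes A :: "('o, 'a) cat"
  assumes Dom_in: "m \<in> Arr A \<Longrightarrow> Dom A m \<in> Obj A"
    and Cod_in: "m \<in> Arr A \<Longrightarrow> Cod A m \<in> Obj A"
    and Ident_in: "a \<in> Obj A \<Longrightarrow> Ident A a \<in> Arr A"
    and Dom_Ident: "a \<in> Obj A \<Longrightarrow> Dom A (Ident A a) = a"
    and Cod_Ident: "a \<in> Obj A \<Longrightarrow> Cod A (Ident A a) = a"
    and Cmp_in: "\<lbrakk>n \<in> Arr A; m \<in> Arr A; Cod A m = Dom A n\<rbrakk> \<Longrightarrow> Cmp A n m \<in> Arr A"
    and Dom_Cmp: "\<lbrakk>n \<in> Arr A; m \<in> Arr A; Cod A m = Dom A n\<rbrakk> \<Longrightarrow> Dom A (Cmp A n m) = Dom A m"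
    and Cod_Cmp: "\<lbrakk>n \<in> Arr A; m \<in> Arr A; Cod A m = Dom A n\<rbrakk> \<Longrightarrow> Cod A (Cmp A n m) = Cod A n"
    and Cmp_Ident_right: "m \<in> Arr A \<Longrightarrow> Cmp A m (Ident A (Dom A m)) = m"
    and Cmp_Ident_left: "m \<in> Arr A \<Longrightarrow> Cmp A (Ident A (Cod A m)) m = m"
    and Cmp_assoc: "\<lbrakk>k \<in> Arr A; n \<in> Arr A; m \<in> Arr A; Cod A m = Dom A n; Cod A n = Dom A k\<rbrakk>
      \<Longrightarrow> Cmp A k (Cmp A n m) = Cmp A (Cmp A k n) m"

definition Hom :: "('o, 'a) cat \<Rightarrow> 'o \<Rightarrow> 'o \<Rightarrow> 'a set" where
  "Hom A a b = {m \<in> Arr A. Dom A m = a \<and> Cod A m = b}"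

definition Into :: "('o, 'a) cat \<Rightarrow> 'o \<Rightarrow> 'a set" where
  "Into A a = {m \<in> Arr A. Cod A m = a}"

definition opcat :: "('o, 'a) cat \<Rightarrow> ('o, 'a) cat" where
  "opcat A = \<lparr>Obj = Obj A, Arr = Arr A, Dom = Cod A, Cod = Dom A, Ident = Ident A,
    Cmp = (\<lambda>n m. Cmp A m n)\<rparr>"

definition iso_arr :: "('o, 'a) cat \<Rightarrow> 'a \<Rightarrow> bool" where
  "iso_arr A m \<longleftrightarrow> m \<in> Arr A \<and> (\<exists>n\<in>Arr A. Dom A n = Cod A m \<and> Cod A n = Dom A m \<and>
     Cmp A n m = Ident A (Dom A m) \<and> Cmp A m n = Ident A (Cod A m))"

definition is_functor :: "('o, 'a) cat \<Rightarrow> ('p, 'b) cat \<Rightarrow> ('o \<Rightarrow> 'p) \<Rightarrow> ('a \<Rightarrow> 'b) \<Rightarrow> bool" where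
  "is_functor A B Fo Fa \<longleftrightarrow>
     Fo \<in> Obj A \<rightarrow> Obj B \<and> Fa \<in> Arr A \<rightarrow> Arr B \<and>
     (\<forall>m\<in>Arr A. Dom B (Fa m) = Fo (Dom A m) \<and> Cod B (Fa m) = Fo (Cod A m)) \<and>
     (\<forall>a\<in>Obj A. Fa (Ident A a) = Ident B (Fo a)) \<and>
     (\<forall>n\<in>Arr A. \<forall>m\<in>Arr A. Cod A m = Dom A n \<longrightarrow> Fa (Cmp A n m) = Cmp B (Fa n) (Fa m))"

text \<open>
  Small categories, and everything built from them, are compared by equality.  All their operations
  are therefore normalised to be undefined outside their domains, so that equality of records is
  equality of the structures they describe.
\<close>

locale small_category = category A for A :: "('u::universe, 'u) cat" +
  assumes small_Obj: "small (Obj A)"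
    and small_Arr: "small (Arr A)"
    and Dom_ext: "Dom A \<in> extensional (Arr A)"
    and Cod_ext: "Cod A \<in> extensional (Arr A)"
    and Ident_ext: "Ident A \<in> extensional (Obj A)"
    and Cmp_ext: "Cmp A \<in> extensional (Arr A)"
    and Cmp_ext2: "n \<in> Arr A \<Longrightarrow> Cmp A n \<in> extensional (Into A (Dom A n))"

record 'u fctr =
  fo :: "'u \<Rightarrow> 'u"
  fa :: "'u \<Rightarrow> 'u"

definition small_functor :: "('u::universe, 'u) cat \<Rightarrow> ('u, 'u) cat \<Rightarrow> 'u fctr \<Rightarrow> bool" where
  "small_functor A B F \<longleftrightarrow> is_functor A B (fo F) (fa F) \<and>
     fo F \<in> extensional (Obj A) \<and> fa F \<in> extensional (Arr A)"

definition fctr_id :: "('u, 'u) cat \<Rightarrow> 'u fctr" where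
  "fctr_id A = \<lparr>fo = (\<lambda>a\<in>Obj A. a), fa = (\<lambda>m\<in>Arr A. m)\<rparr>"

definition fctr_comp :: "('u, 'u) cat \<Rightarrow> 'u fctr \<Rightarrow> 'u fctr \<Rightarrow> 'u fctr" where
  "fctr_comp A G F = \<lparr>fo = (\<lambda>a\<in>Obj A. fo G (fo F a)), fa = (\<lambda>m\<in>Arr A. fa G (fa F m))\<rparr>"


section \<open>Profunctors\<close>

text \<open>
  A profunctor from A to A' assigns a set to each pair of objects (contravariant in the first, and
  covariant in the second argument).  The type of its elements is left open, since the elements of
  a composite are equivalence classes.
\<close>

record ('u, 'e) prof =
  pel :: "'u \<Rightarrow> 'u \<Rightarrow> 'e set"
  pact :: "'u \<Rightarrow> 'u \<Rightarrow> 'e \<Rightarrow> 'e"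

definition profunctor :: "('u, 'u) cat \<Rightarrow> ('u, 'u) cat \<Rightarrow> ('u, 'e) prof \<Rightarrow> bool" where
  "profunctor A A' U \<longleftrightarrow>
     pel U \<in> extensional (Obj A) \<and> (\<forall>a\<in>Obj A. pel U a \<in> extensional (Obj A')) \<and>
     pact U \<in> (\<Pi>\<^sub>E m\<in>Arr A. \<Pi>\<^sub>E n\<in>Arr A'.
       pel U (Cod A m) (Dom A' n) \<rightarrow>\<^sub>E pel U (Dom A m) (Cod A' n)) \<and>
     (\<forall>a\<in>Obj A. \<forall>a'\<in>Obj A'. \<forall>s\<in>pel U a a'. pact U (Ident A a) (Ident A' a') s = s) \<and>
     (\<forall>m\<in>Arr A. \<forall>k\<in>Arr A. \<forall>n\<in>Arr A'. \<forall>l\<in>Arr A'. Cod A m = Dom A k \<longrightarrow> Cod A' n = Dom A' l \<longrightarrow>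
       (\<forall>s\<in>pel U (Cod A k) (Dom A' n).
          pact U (Cmp A k m) (Cmp A' l n) s = pact U m l (pact U k n s)))"

definition small_profunctor :: "('u::universe, 'u) cat \<Rightarrow> ('u, 'u) cat \<Rightarrow> ('u, 'u) prof \<Rightarrow> bool" where
  "small_profunctor A A' U \<longleftrightarrow> profunctor A A' U \<and> (\<forall>a\<in>Obj A. \<forall>a'\<in>Obj A'. small (pel U a a'))"

definition hom_prof :: "('u, 'u) cat \<Rightarrow> ('u, 'u) prof" where
  "hom_prof A = \<lparr>pel = (\<lambda>a\<in>Obj A. \<lambda>b\<in>Obj A. Hom A a b),
     pact = (\<lambda>m\<in>Arr A. \<lambda>n\<in>Arr A. \<lambda>s\<in>Hom A (Cod A m) (Dom A n). Cmp A n (Cmp A s m))\<rparr>"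

definition prof_restrict :: "('u, 'e) prof \<Rightarrow> 'u fctr \<Rightarrow> 'u fctr \<Rightarrow> ('u, 'e) prof" where
  "prof_restrict V F F' = \<lparr>pel = (\<lambda>a a'. pel V (fo F a) (fo F' a')),
     pact = (\<lambda>m n. pact V (fa F m) (fa F' n))\<rparr>"

definition prof_nat :: "('u, 'u) cat \<Rightarrow> ('u, 'u) cat \<Rightarrow> ('u, 'e) prof \<Rightarrow> ('u, 'd) prof
    \<Rightarrow> ('u \<Rightarrow> 'u \<Rightarrow> 'e \<Rightarrow> 'd) \<Rightarrow> bool" where
  "prof_nat A A' U V \<phi> \<longleftrightarrow>
     \<phi> \<in> (\<Pi>\<^sub>E a\<in>Obj A. \<Pi>\<^sub>E a'\<in>Obj A'. pel U a a' \<rightarrow>\<^sub>E pel V a a') \<and>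
     (\<forall>m\<in>Arr A. \<forall>n\<in>Arr A'. \<forall>s\<in>pel U (Cod A m) (Dom A' n).
        \<phi> (Dom A m) (Cod A' n) (pact U m n s) = pact V m n (\<phi> (Cod A m) (Dom A' n) s))"

text \<open>
  The coend at (a, a'') of profunctors U from A to A' and U' from A' to A'' is the quotient of the
  set of all (a', s', s) by the equivalence relation generated by
  (b', s', U(1,m)s) ~ (a', U'(m,1)s', s) for m from a' to b'.
\<close>

definition coend_pairs :: "('u, 'u) cat \<Rightarrow> ('u, 'e) prof \<Rightarrow> ('u, 'd) prof \<Rightarrow> 'u \<Rightarrow> 'u
    \<Rightarrow> ('u \<times> 'e \<times> 'd) set" where
  "coend_pairs A' U' U a a'' =
     {(a', s', s). a' \<in> Obj A' \<and> s' \<in> pel U' a' a'' \<and> s \<in> pel U a a'}"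

definition coend_step :: "('u, 'u) cat \<Rightarrow> ('u, 'u) cat \<Rightarrow> ('u, 'u) cat \<Rightarrow> ('u, 'e) prof \<Rightarrow> ('u, 'd) prof
    \<Rightarrow> 'u \<Rightarrow> 'u \<Rightarrow> ('u \<times> 'e \<times> 'd) rel" where
  "coend_step A A' A'' U' U a a'' =
     {((Cod A' m, s', pact U (Ident A a) m s), (Dom A' m, pact U' m (Ident A'' a'') s', s)) |m s' s.
        m \<in> Arr A' \<and> s' \<in> pel U' (Cod A' m) a'' \<and> s \<in> pel U a (Dom A' m)}"

definition coend_rel :: "('u, 'u) cat \<Rightarrow> ('u, 'u) cat \<Rightarrow> ('u, 'u) cat \<Rightarrow> ('u, 'e) prof \<Rightarrow> ('u, 'd) prof
    \<Rightarrow> 'u \<Rightarrow> 'u \<Rightarrow> ('u \<times> 'e \<times> 'd) rel" where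
  "coend_rel A A' A'' U' U a a'' =
     (coend_step A A' A'' U' U a a'' \<union> (coend_step A A' A'' U' U a a'')\<inverse>)\<^sup>*"

text \<open>The class [s', s], for s in U(a,a') and s' in U'(a',a'').\<close>

definition coend_class :: "('u, 'u) cat \<Rightarrow> ('u, 'u) cat \<Rightarrow> ('u, 'u) cat \<Rightarrow> ('u, 'e) prof \<Rightarrow> ('u, 'd) prof
    \<Rightarrow> 'u \<Rightarrow> 'u \<Rightarrow> 'u \<Rightarrow> 'e \<Rightarrow> 'd \<Rightarrow> ('u \<times> 'e \<times> 'd) set" where
  "coend_class A A' A'' U' U a a' a'' s' s = coend_rel A A' A'' U' U a a'' `` {(a', s', s)}"

definition prof_comp :: "('u, 'u) cat \<Rightarrow> ('u, 'u) cat \<Rightarrow> ('u, 'u) cat \<Rightarrow> ('u, 'e) prof \<Rightarrow> ('u, 'd) prof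
    \<Rightarrow> ('u, ('u \<times> 'e \<times> 'd) set) prof" where
  "prof_comp A A' A'' U' U =
     \<lparr>pel = (\<lambda>a\<in>Obj A. \<lambda>a''\<in>Obj A''. coend_pairs A' U' U a a'' // coend_rel A A' A'' U' U a a''),
      pact = (\<lambda>m\<in>Arr A. \<lambda>n\<in>Arr A''.
        \<lambda>c\<in>coend_pairs A' U' U (Cod A m) (Dom A'' n) // coend_rel A A' A'' U' U (Cod A m) (Dom A'' n).
          \<Union>(a', s', s)\<in>c. coend_class A A' A'' U' U (Dom A m) a' (Cod A'' n)
            (pact U' (Ident A' a') n s') (pact U m (Ident A' a') s))\<rparr>"


section \<open>Double categories\<close>

text \<open>
  The four categories are: objects and horizontal morphisms; objects and vertical morphisms;
  vertical morphisms and squares under horizontal composition; horizontal morphisms and squares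
  under vertical composition.
\<close>

record 'u dblcat =
  HCat :: "('u, 'u) cat"
  VCat :: "('u, 'u) cat"
  SHCat :: "('u, 'u) cat"
  SVCat :: "('u, 'u) cat"

abbreviation Ob :: "'u dblcat \<Rightarrow> 'u set" where "Ob C \<equiv> Obj (HCat C)"
abbreviation Hor :: "'u dblcat \<Rightarrow> 'u set" where "Hor C \<equiv> Arr (HCat C)"
abbreviation Ver :: "'u dblcat \<Rightarrow> 'u set" where "Ver C \<equiv> Arr (VCat C)"
abbreviation Sq :: "'u dblcat \<Rightarrow> 'u set" where "Sq C \<equiv> Arr (SHCat C)"
abbreviation lft :: "'u dblcat \<Rightarrow> 'u \<Rightarrow> 'u" where "lft C \<equiv> Dom (SHCat C)"
abbreviation rgt :: "'u dblcat \<Rightarrow> 'u \<Rightarrow> 'u" where "rgt C \<equiv> Cod (SHCat C)"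
abbreviation upper :: "'u dblcat \<Rightarrow> 'u \<Rightarrow> 'u" where "upper C \<equiv> Dom (SVCat C)"
abbreviation lower :: "'u dblcat \<Rightarrow> 'u \<Rightarrow> 'u" where "lower C \<equiv> Cod (SVCat C)"

locale double_category =
  fixes C :: "'u::universe dblcat"
  assumes HCat: "small_category (HCat C)"
    and VCat: "small_category (VCat C)"
    and SHCat: "small_category (SHCat C)"
    and SVCat: "small_category (SVCat C)"
    and Obj_VCat: "Obj (VCat C) = Ob C"
    and Obj_SHCat: "Obj (SHCat C) = Ver C"
    and Obj_SVCat: "Obj (SVCat C) = Hor C"
    and Arr_SVCat: "Arr (SVCat C) = Sq C"
    and corner_upper_left: "\<alpha> \<in> Sq C \<Longrightarrow> Dom (HCat C) (upper C \<alpha>) = Dom (VCat C) (lft C \<alpha>)"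
    and corner_upper_right: "\<alpha> \<in> Sq C \<Longrightarrow> Cod (HCat C) (upper C \<alpha>) = Dom (VCat C) (rgt C \<alpha>)"
    and corner_lower_left: "\<alpha> \<in> Sq C \<Longrightarrow> Dom (HCat C) (lower C \<alpha>) = Cod (VCat C) (lft C \<alpha>)"
    and corner_lower_right: "\<alpha> \<in> Sq C \<Longrightarrow> Cod (HCat C) (lower C \<alpha>) = Cod (VCat C) (rgt C \<alpha>)"
    and upper_Cmp: "\<lbrakk>\<beta> \<in> Sq C; \<alpha> \<in> Sq C; rgt C \<alpha> = lft C \<beta>\<rbrakk>
      \<Longrightarrow> upper C (Cmp (SHCat C) \<beta> \<alpha>) = Cmp (HCat C) (upper C \<beta>) (upper C \<alpha>)"
    and lower_Cmp: "\<lbrakk>\<beta> \<in> Sq C; \<alpha> \<in> Sq C; rgt C \<alpha> = lft C \<beta>\<rbrakk>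
      \<Longrightarrow> lower C (Cmp (SHCat C) \<beta> \<alpha>) = Cmp (HCat C) (lower C \<beta>) (lower C \<alpha>)"
    and lft_Cmp: "\<lbrakk>\<alpha>' \<in> Sq C; \<alpha> \<in> Sq C; lower C \<alpha> = upper C \<alpha>'\<rbrakk>
      \<Longrightarrow> lft C (Cmp (SVCat C) \<alpha>' \<alpha>) = Cmp (VCat C) (lft C \<alpha>') (lft C \<alpha>)"
    and rgt_Cmp: "\<lbrakk>\<alpha>' \<in> Sq C; \<alpha> \<in> Sq C; lower C \<alpha> = upper C \<alpha>'\<rbrakk>
      \<Longrightarrow> rgt C (Cmp (SVCat C) \<alpha>' \<alpha>) = Cmp (VCat C) (rgt C \<alpha>') (rgt C \<alpha>)"
    and upper_Ident: "u \<in> Ver C \<Longrightarrow> upper C (Ident (SHCat C) u) = Ident (HCat C) (Dom (VCat C) u)"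
    and lower_Ident: "u \<in> Ver C \<Longrightarrow> lower C (Ident (SHCat C) u) = Ident (HCat C) (Cod (VCat C) u)"
    and lft_Ident: "f \<in> Hor C \<Longrightarrow> lft C (Ident (SVCat C) f) = Ident (VCat C) (Dom (HCat C) f)"
    and rgt_Ident: "f \<in> Hor C \<Longrightarrow> rgt C (Ident (SVCat C) f) = Ident (VCat C) (Cod (HCat C) f)"
    and interchange: "\<lbrakk>\<alpha> \<in> Sq C; \<beta> \<in> Sq C; \<alpha>' \<in> Sq C; \<beta>' \<in> Sq C; rgt C \<alpha> = lft C \<beta>;
        rgt C \<alpha>' = lft C \<beta>'; lower C \<alpha> = upper C \<alpha>'; lower C \<beta> = upper C \<beta>'\<rbrakk>
      \<Longrightarrow> Cmp (SVCat C) (Cmp (SHCat C) \<beta>' \<alpha>') (Cmp (SHCat C) \<beta> \<alpha>) =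
          Cmp (SHCat C) (Cmp (SVCat C) \<beta>' \<beta>) (Cmp (SVCat C) \<alpha>' \<alpha>)"
    and Cmp_vert_Ident: "\<lbrakk>g \<in> Hor C; f \<in> Hor C; Cod (HCat C) f = Dom (HCat C) g\<rbrakk>
      \<Longrightarrow> Cmp (SHCat C) (Ident (SVCat C) g) (Ident (SVCat C) f) = Ident (SVCat C) (Cmp (HCat C) g f)"
    and Cmp_hor_Ident: "\<lbrakk>u' \<in> Ver C; u \<in> Ver C; Cod (VCat C) u = Dom (VCat C) u'\<rbrakk>
      \<Longrightarrow> Cmp (SVCat C) (Ident (SHCat C) u') (Ident (SHCat C) u) = Ident (SHCat C) (Cmp (VCat C) u' u)"
    and Ident_Ident: "x \<in> Ob C
      \<Longrightarrow> Ident (SVCat C) (Ident (HCat C) x) = Ident (SHCat C) (Ident (VCat C) x)"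

text \<open>Double functors carry their source and target, so as to be arrows of a category.\<close>

record 'u dfun =
  dsrc :: "'u dblcat"
  dtgt :: "'u dblcat"
  fO :: "'u \<Rightarrow> 'u"
  fH :: "'u \<Rightarrow> 'u"
  fV :: "'u \<Rightarrow> 'u"
  fS :: "'u \<Rightarrow> 'u"

locale double_functor =
  fixes F :: "'u::universe dfun"
  assumes src: "double_category (dsrc F)"
    and tgt: "double_category (dtgt F)"
    and on_HCat: "small_functor (HCat (dsrc F)) (HCat (dtgt F)) \<lparr>fo = fO F, fa = fH F\<rparr>"
    and on_VCat: "small_functor (VCat (dsrc F)) (VCat (dtgt F)) \<lparr>fo = fO F, fa = fV F\<rparr>"
    and on_SHCat: "small_functor (SHCat (dsrc F)) (SHCat (dtgt F)) \<lparr>fo = fV F, fa = fS F\<rparr>"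
    and on_SVCat: "small_functor (SVCat (dsrc F)) (SVCat (dtgt F)) \<lparr>fo = fH F, fa = fS F\<rparr>"

definition dfun_id :: "'u dblcat \<Rightarrow> 'u dfun" where
  "dfun_id C = \<lparr>dsrc = C, dtgt = C, fO = (\<lambda>x\<in>Ob C. x), fH = (\<lambda>f\<in>Hor C. f), fV = (\<lambda>u\<in>Ver C. u),
     fS = (\<lambda>\<alpha>\<in>Sq C. \<alpha>)\<rparr>"

definition dfun_comp :: "'u dfun \<Rightarrow> 'u dfun \<Rightarrow> 'u dfun" where
  "dfun_comp G F = \<lparr>dsrc = dsrc F, dtgt = dtgt G,
     fO = (\<lambda>x\<in>Ob (dsrc F). fO G (fO F x)), fH = (\<lambda>f\<in>Hor (dsrc F). fH G (fH F f)),
     fV = (\<lambda>u\<in>Ver (dsrc F). fV G (fV F u)), fS = (\<lambda>\<alpha>\<in>Sq (dsrc F). fS G (fS F \<alpha>))\<rparr>"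

record 'u htrans =
  hsrc :: "'u dfun"
  htgt :: "'u dfun"
  hO :: "'u \<Rightarrow> 'u"
  hV :: "'u \<Rightarrow> 'u"

locale horizontal_transformation =
  fixes B :: "'u::universe htrans" and C D :: "'u dblcat" and G G' :: "'u dfun"
  defines "C \<equiv> dsrc (hsrc B)" and "D \<equiv> dtgt (hsrc B)" and "G \<equiv> hsrc B" and "G' \<equiv> htgt B"
  assumes src: "double_functor G"
    and tgt: "double_functor G'"
    and parallel: "dsrc G' = C" "dtgt G' = D"
    and hO_in: "hO B \<in> (\<Pi>\<^sub>E x\<in>Ob C. Hom (HCat D) (fO G x) (fO G' x))"
    and hV_in: "hV B \<in> (\<Pi>\<^sub>E u\<in>Ver C. Hom (SHCat D) (fV G u) (fV G' u))"
    and upper_hV: "u \<in> Ver C \<Longrightarrow> upper D (hV B u) = hO B (Dom (VCat C) u)"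
    and lower_hV: "u \<in> Ver C \<Longrightarrow> lower D (hV B u) = hO B (Cod (VCat C) u)"
    and natural_Hor: "f \<in> Hor C \<Longrightarrow>
      Cmp (HCat D) (fH G' f) (hO B (Dom (HCat C) f)) = Cmp (HCat D) (hO B (Cod (HCat C) f)) (fH G f)"
    and natural_Sq: "\<alpha> \<in> Sq C \<Longrightarrow>
      Cmp (SHCat D) (fS G' \<alpha>) (hV B (lft C \<alpha>)) = Cmp (SHCat D) (hV B (rgt C \<alpha>)) (fS G \<alpha>)"
    and hV_Cmp: "\<lbrakk>u' \<in> Ver C; u \<in> Ver C; Cod (VCat C) u = Dom (VCat C) u'\<rbrakk>
      \<Longrightarrow> hV B (Cmp (VCat C) u' u) = Cmp (SVCat D) (hV B u') (hV B u)"
    and hV_Ident: "x \<in> Ob C \<Longrightarrow> hV B (Ident (VCat C) x) = Ident (SVCat D) (hO B x)"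

record 'u vtrans =
  vsrc :: "'u dfun"
  vtgt :: "'u dfun"
  vO :: "'u \<Rightarrow> 'u"
  vH :: "'u \<Rightarrow> 'u"

locale vertical_transformation =
  fixes A :: "'u::universe vtrans" and E D :: "'u dblcat" and F F' :: "'u dfun"
  defines "E \<equiv> dsrc (vsrc A)" and "D \<equiv> dtgt (vsrc A)" and "F \<equiv> vsrc A" and "F' \<equiv> vtgt A"
  assumes src: "double_functor F"
    and tgt: "double_functor F'"
    and parallel: "dsrc F' = E" "dtgt F' = D"
    and vO_in: "vO A \<in> (\<Pi>\<^sub>E x\<in>Ob E. Hom (VCat D) (fO F x) (fO F' x))"
    and vH_in: "vH A \<in> (\<Pi>\<^sub>E f\<in>Hor E. Hom (SVCat D) (fH F f) (fH F' f))"
    and lft_vH: "f \<in> Hor E \<Longrightarrow> lft D (vH A f) = vO A (Dom (HCat E) f)"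
    and rgt_vH: "f \<in> Hor E \<Longrightarrow> rgt D (vH A f) = vO A (Cod (HCat E) f)"
    and natural_Ver: "u \<in> Ver E \<Longrightarrow>
      Cmp (VCat D) (fV F' u) (vO A (Dom (VCat E) u)) = Cmp (VCat D) (vO A (Cod (VCat E) u)) (fV F u)"
    and natural_Sq: "\<alpha> \<in> Sq E \<Longrightarrow>
      Cmp (SVCat D) (fS F' \<alpha>) (vH A (upper E \<alpha>)) = Cmp (SVCat D) (vH A (lower E \<alpha>)) (fS F \<alpha>)"
    and vH_Cmp: "\<lbrakk>g \<in> Hor E; f \<in> Hor E; Cod (HCat E) f = Dom (HCat E) g\<rbrakk>
      \<Longrightarrow> vH A (Cmp (HCat E) g f) = Cmp (SHCat D) (vH A g) (vH A f)"
    and vH_Ident: "x \<in> Ob E \<Longrightarrow> vH A (Ident (HCat E) x) = Ident (SHCat D) (vO A x)"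


section \<open>2-categories\<close>

text \<open>
  The three categories are: objects and 1-cells; 1-cells and 2-cells under vertical composition;
  objects and 2-cells under horizontal composition.
\<close>

record ('o, 'm, 't) twocat =
  One :: "('o, 'm) cat"
  Vert :: "('m, 't) cat"
  Horiz :: "('o, 't) cat"

abbreviation Cells0 :: "('o, 'm, 't) twocat \<Rightarrow> 'o set" where "Cells0 K \<equiv> Obj (One K)"
abbreviation Cells1 :: "('o, 'm, 't) twocat \<Rightarrow> 'm set" where "Cells1 K \<equiv> Arr (One K)"
abbreviation Cells2 :: "('o, 'm, 't) twocat \<Rightarrow> 't set" where "Cells2 K \<equiv> Arr (Vert K)"

locale twocategory =
  fixes K :: "('o, 'm, 't) twocat"
  assumes One: "category (One K)"
    and Vert: "category (Vert K)"
    and Horiz: "category (Horiz K)"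
    and Obj_Vert: "Obj (Vert K) = Cells1 K"
    and Obj_Horiz: "Obj (Horiz K) = Cells0 K"
    and Arr_Horiz: "Arr (Horiz K) = Cells2 K"
    and Dom_Dom: "\<sigma> \<in> Cells2 K \<Longrightarrow> Dom (One K) (Dom (Vert K) \<sigma>) = Dom (Horiz K) \<sigma>"
    and Dom_Cod: "\<sigma> \<in> Cells2 K \<Longrightarrow> Dom (One K) (Cod (Vert K) \<sigma>) = Dom (Horiz K) \<sigma>"
    and Cod_Dom: "\<sigma> \<in> Cells2 K \<Longrightarrow> Cod (One K) (Dom (Vert K) \<sigma>) = Cod (Horiz K) \<sigma>"
    and Cod_Cod: "\<sigma> \<in> Cells2 K \<Longrightarrow> Cod (One K) (Cod (Vert K) \<sigma>) = Cod (Horiz K) \<sigma>"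
    and Ident_Horiz: "x \<in> Cells0 K \<Longrightarrow> Ident (Horiz K) x = Ident (Vert K) (Ident (One K) x)"
    and Dom_Horiz: "\<lbrakk>\<tau> \<in> Cells2 K; \<sigma> \<in> Cells2 K; Cod (Horiz K) \<sigma> = Dom (Horiz K) \<tau>\<rbrakk>
      \<Longrightarrow> Dom (Vert K) (Cmp (Horiz K) \<tau> \<sigma>) = Cmp (One K) (Dom (Vert K) \<tau>) (Dom (Vert K) \<sigma>)"
    and Cod_Horiz: "\<lbrakk>\<tau> \<in> Cells2 K; \<sigma> \<in> Cells2 K; Cod (Horiz K) \<sigma> = Dom (Horiz K) \<tau>\<rbrakk>
      \<Longrightarrow> Cod (Vert K) (Cmp (Horiz K) \<tau> \<sigma>) = Cmp (One K) (Cod (Vert K) \<tau>) (Cod (Vert K) \<sigma>)"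
    and Horiz_Ident: "\<lbrakk>g \<in> Cells1 K; f \<in> Cells1 K; Cod (One K) f = Dom (One K) g\<rbrakk>
      \<Longrightarrow> Cmp (Horiz K) (Ident (Vert K) g) (Ident (Vert K) f) = Ident (Vert K) (Cmp (One K) g f)"
    and interchange: "\<lbrakk>\<sigma> \<in> Cells2 K; \<sigma>' \<in> Cells2 K; \<tau> \<in> Cells2 K; \<tau>' \<in> Cells2 K;
        Cod (Vert K) \<sigma> = Dom (Vert K) \<sigma>'; Cod (Vert K) \<tau> = Dom (Vert K) \<tau>';
        Cod (Horiz K) \<sigma> = Dom (Horiz K) \<tau>\<rbrakk>
      \<Longrightarrow> Cmp (Horiz K) (Cmp (Vert K) \<tau>' \<tau>) (Cmp (Vert K) \<sigma>' \<sigma>) =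
          Cmp (Vert K) (Cmp (Horiz K) \<tau>' \<sigma>') (Cmp (Horiz K) \<tau> \<sigma>)"

definition coop :: "('o, 'm, 't) twocat \<Rightarrow> ('o, 'm, 't) twocat" where
  "coop K = \<lparr>One = opcat (One K), Vert = opcat (Vert K), Horiz = opcat (Horiz K)\<rparr>"

definition full_subcat :: "'o set \<Rightarrow> ('o, 'a) cat \<Rightarrow> ('o, 'a) cat" where
  "full_subcat S A = A\<lparr>Obj := Obj A \<inter> S, Arr := {m \<in> Arr A. Dom A m \<in> S \<and> Cod A m \<in> S}\<rparr>"

definition two_full_sub :: "'o set \<Rightarrow> ('o, 'm, 't) twocat \<Rightarrow> ('o, 'm, 't) twocat" where
  "two_full_sub S K =
     (let One' = full_subcat S (One K); Horiz' = full_subcat S (Horiz K) in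
      \<lparr>One = One', Vert = (Vert K)\<lparr>Obj := Arr One', Arr := Arr Horiz'\<rparr>, Horiz = Horiz'\<rparr>)"

text \<open>
  The strict slice: 1-cells and 2-cells carry the two projections.  A 2-cell is one whose
  whiskering with the projection of the target is the identity of the projection of the source.
\<close>

definition slice :: "('o, 'm, 't) twocat \<Rightarrow> 'o \<Rightarrow> ('m, 'm \<times> 'm \<times> 'm, 'm \<times> 't \<times> 'm) twocat" where
  "slice K c =
     (let objs = {p \<in> Cells1 K. Cod (One K) p = c};
          mors = {(p, f, q). p \<in> objs \<and> q \<in> objs \<and> f \<in> Hom (One K) (Dom (One K) p) (Dom (One K) q) \<and>
                    Cmp (One K) q f = p};
          cells = {(p, \<sigma>, q). p \<in> objs \<and> q \<in> objs \<and> \<sigma> \<in> Hom (Horiz K) (Dom (One K) p) (Dom (One K) q) \<and>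
                    Cmp (Horiz K) (Ident (Vert K) q) \<sigma> = Ident (Vert K) p}
      in \<lparr>One = \<lparr>Obj = objs, Arr = mors, Dom = (\<lambda>(p, f, q). p), Cod = (\<lambda>(p, f, q). q),
            Ident = (\<lambda>p. (p, Ident (One K) (Dom (One K) p), p)),
            Cmp = (\<lambda>(q', g, r) (p, f, q). (p, Cmp (One K) g f, r))\<rparr>,
          Vert = \<lparr>Obj = mors, Arr = cells, Dom = (\<lambda>(p, \<sigma>, q). (p, Dom (Vert K) \<sigma>, q)),
            Cod = (\<lambda>(p, \<sigma>, q). (p, Cod (Vert K) \<sigma>, q)),
            Ident = (\<lambda>(p, f, q). (p, Ident (Vert K) f, q)),
            Cmp = (\<lambda>(p', \<tau>, q') (p, \<sigma>, q). (p, Cmp (Vert K) \<tau> \<sigma>, q))\<rparr>,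
          Horiz = \<lparr>Obj = objs, Arr = cells, Dom = (\<lambda>(p, \<sigma>, q). p), Cod = (\<lambda>(p, \<sigma>, q). q),
            Ident = (\<lambda>p. (p, Ident (Horiz K) (Dom (One K) p), p)),
            Cmp = (\<lambda>(q', \<tau>, r) (p, \<sigma>, q). (p, Cmp (Horiz K) \<tau> \<sigma>, r))\<rparr>\<rparr>)"

record ('o, 'm, 't, 'p, 'n, 's) twofun =
  on0 :: "'o \<Rightarrow> 'p"
  on1 :: "'m \<Rightarrow> 'n"
  on2 :: "'t \<Rightarrow> 's"

definition twofunctor :: "('o, 'm, 't) twocat \<Rightarrow> ('p, 'n, 's) twocat
    \<Rightarrow> ('o, 'm, 't, 'p, 'n, 's) twofun \<Rightarrow> bool" where
  "twofunctor K L F \<longleftrightarrow> is_functor (One K) (One L) (on0 F) (on1 F) \<and>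
     is_functor (Vert K) (Vert L) (on1 F) (on2 F) \<and> is_functor (Horiz K) (Horiz L) (on0 F) (on2 F)"

definition twofun_id :: "('o, 'm, 't, 'o, 'm, 't) twofun" where
  "twofun_id = \<lparr>on0 = (\<lambda>X. X), on1 = (\<lambda>f. f), on2 = (\<lambda>\<sigma>. \<sigma>)\<rparr>"

definition twofun_comp :: "('p, 'n, 's, 'q, 'l, 'r) twofun \<Rightarrow> ('o, 'm, 't, 'p, 'n, 's) twofun
    \<Rightarrow> ('o, 'm, 't, 'q, 'l, 'r) twofun" where
  "twofun_comp G F = \<lparr>on0 = on0 G \<circ> on0 F, on1 = on1 G \<circ> on1 F, on2 = on2 G \<circ> on2 F\<rparr>"

definition two_natural :: "('o, 'm, 't) twocat \<Rightarrow> ('p, 'n, 's) twocat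
    \<Rightarrow> ('o, 'm, 't, 'p, 'n, 's) twofun \<Rightarrow> ('o, 'm, 't, 'p, 'n, 's) twofun \<Rightarrow> ('o \<Rightarrow> 'n) \<Rightarrow> bool" where
  "two_natural K L F G \<eta> \<longleftrightarrow>
     (\<forall>X\<in>Cells0 K. \<eta> X \<in> Hom (One L) (on0 F X) (on0 G X)) \<and>
     (\<forall>f\<in>Cells1 K. Cmp (One L) (on1 G f) (\<eta> (Dom (One K) f)) =
        Cmp (One L) (\<eta> (Cod (One K) f)) (on1 F f)) \<and>
     (\<forall>\<sigma>\<in>Cells2 K. Cmp (Horiz L) (on2 G \<sigma>) (Ident (Vert L) (\<eta> (Dom (Horiz K) \<sigma>))) =
        Cmp (Horiz L) (Ident (Vert L) (\<eta> (Cod (Horiz K) \<sigma>))) (on2 F \<sigma>))"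

definition two_natural_iso :: "('o, 'm, 't) twocat \<Rightarrow> ('p, 'n, 's) twocat
    \<Rightarrow> ('o, 'm, 't, 'p, 'n, 's) twofun \<Rightarrow> ('o, 'm, 't, 'p, 'n, 's) twofun \<Rightarrow> ('o \<Rightarrow> 'n) \<Rightarrow> bool" where
  "two_natural_iso K L F G \<eta> \<longleftrightarrow> two_natural K L F G \<eta> \<and> (\<forall>X\<in>Cells0 K. iso_arr (One L) (\<eta> X))"

definition two_equivalence :: "('o, 'm, 't) twocat \<Rightarrow> ('p, 'n, 's) twocat
    \<Rightarrow> ('o, 'm, 't, 'p, 'n, 's) twofun \<Rightarrow> bool" where
  "two_equivalence K L F \<longleftrightarrow> twocategory K \<and> twocategory L \<and> twofunctor K L F \<and>
     (\<exists>G. twofunctor L K G \<and>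
        (\<exists>\<eta>. two_natural_iso K K twofun_id (twofun_comp G F) \<eta>) \<and>
        (\<exists>\<epsilon>. two_natural_iso L L (twofun_comp F G) twofun_id \<epsilon>))"


section \<open>Pseudo-functors to the 2-category of 2-categories\<close>

text \<open>
  The values of the two pseudo-functors to be compared are 2-categories of different HOL types, so
  the 2-category of 2-categories is not formed as a single object; instead the definitions of
  pseudo-functor and pseudo-natural transformation are spelled out for it.  The structure cells
  of a pseudo-functor are 2-natural isomorphisms, from the composite (identity) of the values to the
  value of the composite (identity).
\<close>

record ('k, 'f, 'b, 'o, 'm, 't) pseudofun =
  ps0 :: "'k \<Rightarrow> ('o, 'm, 't) twocat"
  ps1 :: "'f \<Rightarrow> ('o, 'm, 't, 'o, 'm, 't) twofun"
  ps2 :: "'b \<Rightarrow> 'o \<Rightarrow> 'm"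
  ps_comp :: "'f \<Rightarrow> 'f \<Rightarrow> 'o \<Rightarrow> 'm"
  ps_unit :: "'k \<Rightarrow> 'o \<Rightarrow> 'm"

locale pseudofunctor =
  fixes K :: "('k, 'f, 'b) twocat"
    and F :: "('k, 'f, 'b, 'o, 'm, 't) pseudofun"
  assumes source: "twocategory K"
    and ps0: "k \<in> Cells0 K \<Longrightarrow> twocategory (ps0 F k)"
    and ps1: "f \<in> Cells1 K \<Longrightarrow>
      twofunctor (ps0 F (Dom (One K) f)) (ps0 F (Cod (One K) f)) (ps1 F f)"
    and ps2: "b \<in> Cells2 K \<Longrightarrow>
      two_natural (ps0 F (Dom (Horiz K) b)) (ps0 F (Cod (Horiz K) b))
        (ps1 F (Dom (Vert K) b)) (ps1 F (Cod (Vert K) b)) (ps2 F b)"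
    and ps2_Ident: "\<lbrakk>f \<in> Hom (One K) k l; X \<in> Cells0 (ps0 F k)\<rbrakk> \<Longrightarrow>
      ps2 F (Ident (Vert K) f) X = Ident (One (ps0 F l)) (on0 (ps1 F f) X)"
    and ps2_Vert: "\<lbrakk>b \<in> Hom (Horiz K) k l; c \<in> Hom (Horiz K) k l; Cod (Vert K) b = Dom (Vert K) c;
        X \<in> Cells0 (ps0 F k)\<rbrakk> \<Longrightarrow>
      ps2 F (Cmp (Vert K) c b) X = Cmp (One (ps0 F l)) (ps2 F c X) (ps2 F b X)"
    and ps_comp: "\<lbrakk>f \<in> Hom (One K) k l; g \<in> Hom (One K) l m\<rbrakk> \<Longrightarrow>
      two_natural_iso (ps0 F k) (ps0 F m) (twofun_comp (ps1 F g) (ps1 F f))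
        (ps1 F (Cmp (One K) g f)) (ps_comp F g f)"
    and ps_unit: "k \<in> Cells0 K \<Longrightarrow>
      two_natural_iso (ps0 F k) (ps0 F k) twofun_id (ps1 F (Ident (One K) k)) (ps_unit F k)"
    and ps_comp_natural: "\<lbrakk>b \<in> Hom (Horiz K) k l; c \<in> Hom (Horiz K) l m; X \<in> Cells0 (ps0 F k);
        f = Dom (Vert K) b; f' = Cod (Vert K) b; g = Dom (Vert K) c; g' = Cod (Vert K) c\<rbrakk> \<Longrightarrow>
      Cmp (One (ps0 F m)) (ps_comp F g' f' X)
        (Cmp (One (ps0 F m)) (ps2 F c (on0 (ps1 F f') X)) (on1 (ps1 F g) (ps2 F b X))) =
      Cmp (One (ps0 F m)) (ps2 F (Cmp (Horiz K) c b) X) (ps_comp F g f X)"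
    and ps_comp_assoc: "\<lbrakk>f \<in> Hom (One K) k l; g \<in> Hom (One K) l m; h \<in> Hom (One K) m n;
        X \<in> Cells0 (ps0 F k)\<rbrakk> \<Longrightarrow>
      Cmp (One (ps0 F n)) (ps_comp F (Cmp (One K) h g) f X) (ps_comp F h g (on0 (ps1 F f) X)) =
      Cmp (One (ps0 F n)) (ps_comp F h (Cmp (One K) g f) X) (on1 (ps1 F h) (ps_comp F g f X))"
    and ps_comp_unit_right: "\<lbrakk>f \<in> Hom (One K) k l; X \<in> Cells0 (ps0 F k)\<rbrakk> \<Longrightarrow>
      Cmp (One (ps0 F l)) (ps_comp F f (Ident (One K) k) X) (on1 (ps1 F f) (ps_unit F k X)) =
      Ident (One (ps0 F l)) (on0 (ps1 F f) X)"
    and ps_comp_unit_left: "\<lbrakk>f \<in> Hom (One K) k l; X \<in> Cells0 (ps0 F k)\<rbrakk> \<Longrightarrow>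
      Cmp (One (ps0 F l)) (ps_comp F (Ident (One K) l) f X) (ps_unit F l (on0 (ps1 F f) X)) =
      Ident (One (ps0 F l)) (on0 (ps1 F f) X)"

text \<open>
  The component of a pseudo-natural transformation at a 1-cell f from k to l is a 2-natural
  isomorphism, with components pn f X from G f (T k X) to T l (F f X).
\<close>

locale pseudonatural =
  fixes K :: "('k, 'f, 'b) twocat"
    and F :: "('k, 'f, 'b, 'o, 'm, 't) pseudofun"
    and G :: "('k, 'f, 'b, 'p, 'n, 's) pseudofun"
    and T :: "'k \<Rightarrow> ('o, 'm, 't, 'p, 'n, 's) twofun"
    and pn :: "'f \<Rightarrow> 'o \<Rightarrow> 'n"
  assumes source: "pseudofunctor K F"
    and target: "pseudofunctor K G"
    and component: "k \<in> Cells0 K \<Longrightarrow> twofunctor (ps0 F k) (ps0 G k) (T k)"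
    and pn: "f \<in> Hom (One K) k l \<Longrightarrow>
      two_natural_iso (ps0 F k) (ps0 G l) (twofun_comp (ps1 G f) (T k))
        (twofun_comp (T l) (ps1 F f)) (pn f)"
    and pn_natural: "\<lbrakk>b \<in> Hom (Horiz K) k l; X \<in> Cells0 (ps0 F k)\<rbrakk> \<Longrightarrow>
      Cmp (One (ps0 G l)) (pn (Cod (Vert K) b) X) (ps2 G b (on0 (T k) X)) =
      Cmp (One (ps0 G l)) (on1 (T l) (ps2 F b X)) (pn (Dom (Vert K) b) X)"
    and pn_comp: "\<lbrakk>f \<in> Hom (One K) k l; g \<in> Hom (One K) l m; X \<in> Cells0 (ps0 F k)\<rbrakk> \<Longrightarrow>
      Cmp (One (ps0 G m)) (pn (Cmp (One K) g f) X) (ps_comp G g f (on0 (T k) X)) =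
      Cmp (One (ps0 G m)) (on1 (T m) (ps_comp F g f X))
        (Cmp (One (ps0 G m)) (pn g (on0 (ps1 F f) X)) (on1 (ps1 G g) (pn f X)))"
    and pn_unit: "\<lbrakk>k \<in> Cells0 K; X \<in> Cells0 (ps0 F k)\<rbrakk> \<Longrightarrow>
      Cmp (One (ps0 G k)) (pn (Ident (One K) k) X) (ps_unit G k (on0 (T k) X)) =
      on1 (T k) (ps_unit F k X)"


section \<open>The 2-categories of double categories\<close>

definition htrans_id :: "'u dfun \<Rightarrow> 'u htrans" where
  "htrans_id G = \<lparr>hsrc = G, htgt = G,
     hO = (\<lambda>x\<in>Ob (dsrc G). Ident (HCat (dtgt G)) (fO G x)),
     hV = (\<lambda>u\<in>Ver (dsrc G). Ident (SHCat (dtgt G)) (fV G u))\<rparr>"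

definition htrans_vcomp :: "'u htrans \<Rightarrow> 'u htrans \<Rightarrow> 'u htrans" where
  "htrans_vcomp B' B =
     (let C = dsrc (hsrc B); D = dtgt (hsrc B) in
      \<lparr>hsrc = hsrc B, htgt = htgt B',
       hO = (\<lambda>x\<in>Ob C. Cmp (HCat D) (hO B' x) (hO B x)),
       hV = (\<lambda>u\<in>Ver C. Cmp (SHCat D) (hV B' u) (hV B u))\<rparr>)"

definition htrans_hcomp :: "'u htrans \<Rightarrow> 'u htrans \<Rightarrow> 'u htrans" where
  "htrans_hcomp L B =
     (let C = dsrc (hsrc B); E = dtgt (hsrc L); H = hsrc L; G' = htgt B in
      \<lparr>hsrc = dfun_comp H (hsrc B), htgt = dfun_comp (htgt L) G',
       hO = (\<lambda>x\<in>Ob C. Cmp (HCat E) (hO L (fO G' x)) (fH H (hO B x))),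
       hV = (\<lambda>u\<in>Ver C. Cmp (SHCat E) (hV L (fV G' u)) (fS H (hV B u)))\<rparr>)"

definition DblCat_One :: "('u::universe dblcat, 'u dfun) cat" where
  "DblCat_One = \<lparr>Obj = Collect double_category, Arr = Collect double_functor, Dom = dsrc,
     Cod = dtgt, Ident = dfun_id, Cmp = dfun_comp\<rparr>"

definition DblCat_h :: "('u::universe dblcat, 'u dfun, 'u htrans) twocat" where
  "DblCat_h = \<lparr>One = DblCat_One,
     Vert = \<lparr>Obj = Collect double_functor, Arr = Collect horizontal_transformation,
       Dom = hsrc, Cod = htgt, Ident = htrans_id, Cmp = htrans_vcomp\<rparr>,
     Horiz = \<lparr>Obj = Collect double_category, Arr = Collect horizontal_transformation,
       Dom = dsrc \<circ> hsrc, Cod = dtgt \<circ> hsrc, Ident = htrans_id \<circ> dfun_id, Cmp = htrans_hcomp\<rparr>\<rparr>"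

definition vtrans_id :: "'u dfun \<Rightarrow> 'u vtrans" where
  "vtrans_id F = \<lparr>vsrc = F, vtgt = F,
     vO = (\<lambda>x\<in>Ob (dsrc F). Ident (VCat (dtgt F)) (fO F x)),
     vH = (\<lambda>f\<in>Hor (dsrc F). Ident (SVCat (dtgt F)) (fH F f))\<rparr>"

definition vtrans_vcomp :: "'u vtrans \<Rightarrow> 'u vtrans \<Rightarrow> 'u vtrans" where
  "vtrans_vcomp A' A =
     (let E = dsrc (vsrc A); D = dtgt (vsrc A) in
      \<lparr>vsrc = vsrc A, vtgt = vtgt A',
       vO = (\<lambda>x\<in>Ob E. Cmp (VCat D) (vO A' x) (vO A x)),
       vH = (\<lambda>f\<in>Hor E. Cmp (SVCat D) (vH A' f) (vH A f))\<rparr>)"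

definition vtrans_hcomp :: "'u vtrans \<Rightarrow> 'u vtrans \<Rightarrow> 'u vtrans" where
  "vtrans_hcomp L A =
     (let E = dsrc (vsrc A); D = dtgt (vsrc L); H = vsrc L; F' = vtgt A in
      \<lparr>vsrc = dfun_comp H (vsrc A), vtgt = dfun_comp (vtgt L) F',
       vO = (\<lambda>x\<in>Ob E. Cmp (VCat D) (vO L (fO F' x)) (fV H (vO A x))),
       vH = (\<lambda>f\<in>Hor E. Cmp (SVCat D) (vH L (fH F' f)) (fS H (vH A f)))\<rparr>)"

definition DblCat_v :: "('u::universe dblcat, 'u dfun, 'u vtrans) twocat" where
  "DblCat_v = \<lparr>One = DblCat_One,
     Vert = \<lparr>Obj = Collect double_functor, Arr = Collect vertical_transformation,
       Dom = vsrc, Cod = vtgt, Ident = vtrans_id, Cmp = vtrans_vcomp\<rparr>,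
     Horiz = \<lparr>Obj = Collect double_category, Arr = Collect vertical_transformation,
       Dom = dsrc \<circ> vsrc, Cod = dtgt \<circ> vsrc, Ident = vtrans_id \<circ> dfun_id, Cmp = vtrans_hcomp\<rparr>\<rparr>"


section \<open>Lax double presheaves\<close>

record 'u psh =
  pcat :: "'u \<Rightarrow> ('u, 'u) cat"
  pfun :: "'u \<Rightarrow> 'u fctr"
  pprof :: "'u \<Rightarrow> ('u, 'u) prof"
  psq :: "'u \<Rightarrow> 'u \<Rightarrow> 'u \<Rightarrow> 'u \<Rightarrow> 'u"
  pmu :: "'u \<Rightarrow> 'u \<Rightarrow> 'u \<Rightarrow> 'u \<Rightarrow> ('u \<times> 'u \<times> 'u) set \<Rightarrow> 'u"

abbreviation psh_comp_class :: "'u dblcat \<Rightarrow> 'u psh \<Rightarrow> 'u \<Rightarrow> 'u \<Rightarrow> 'u \<Rightarrow> 'u \<Rightarrow> 'u \<Rightarrow> 'u \<Rightarrow> 'u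
    \<Rightarrow> ('u \<times> 'u \<times> 'u) set" where
  "psh_comp_class C X u u' a a' a'' s' s \<equiv>
     coend_class (pcat X (Dom (VCat C) u)) (pcat X (Dom (VCat C) u')) (pcat X (Cod (VCat C) u'))
       (pprof X u') (pprof X u) a a' a'' s' s"

text \<open>
  Normality: under the co-Yoneda isomorphisms, the class of a pair of an element and an arrow is the
  result of the action of the arrow on the element, so the last two conditions state that the two
  comparison maps are the identity.
\<close>

locale lax_double_presheaf =
  fixes C :: "'u::universe dblcat"
    and X :: "'u psh"
  assumes base: "double_category C"
    and pcat_ext: "pcat X \<in> extensional (Ob C)"
    and pfun_ext: "pfun X \<in> extensional (Hor C)"
    and pprof_ext: "pprof X \<in> extensional (Ver C)"
    and psq_ext: "psq X \<in> extensional (Sq C)"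
    and pmu_ext: "pmu X \<in> extensional (Ver C)"
    and pmu_ext2: "u \<in> Ver C \<Longrightarrow>
      pmu X u \<in> extensional {u' \<in> Ver C. Dom (VCat C) u' = Cod (VCat C) u}"
    and pcat: "x \<in> Ob C \<Longrightarrow> small_category (pcat X x)"
    and pfun: "f \<in> Hom (HCat C) x y \<Longrightarrow> small_functor (pcat X y) (pcat X x) (pfun X f)"
    and pprof: "u \<in> Hom (VCat C) x x' \<Longrightarrow> small_profunctor (pcat X x) (pcat X x') (pprof X u)"
    and psq: "\<lbrakk>\<alpha> \<in> Hom (SHCat C) u v; v \<in> Hom (VCat C) y y'\<rbrakk> \<Longrightarrow>
      prof_nat (pcat X y) (pcat X y') (pprof X v)
        (prof_restrict (pprof X u) (pfun X (upper C \<alpha>)) (pfun X (lower C \<alpha>))) (psq X \<alpha>)"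
    and pmu: "\<lbrakk>u \<in> Hom (VCat C) x x'; u' \<in> Hom (VCat C) x' x''\<rbrakk> \<Longrightarrow>
      prof_nat (pcat X x) (pcat X x'')
        (prof_comp (pcat X x) (pcat X x') (pcat X x'') (pprof X u') (pprof X u))
        (pprof X (Cmp (VCat C) u' u)) (pmu X u u')"
    and pfun_Cmp: "\<lbrakk>f \<in> Hom (HCat C) x y; g \<in> Hom (HCat C) y z\<rbrakk> \<Longrightarrow>
      pfun X (Cmp (HCat C) g f) = fctr_comp (pcat X z) (pfun X f) (pfun X g)"
    and pfun_Ident: "x \<in> Ob C \<Longrightarrow> pfun X (Ident (HCat C) x) = fctr_id (pcat X x)"
    and psq_Cmp: "\<lbrakk>\<alpha> \<in> Hom (SHCat C) u v; \<beta> \<in> Hom (SHCat C) v w; w \<in> Hom (VCat C) z z';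
        a \<in> Obj (pcat X z); a' \<in> Obj (pcat X z'); s \<in> pel (pprof X w) a a'\<rbrakk> \<Longrightarrow>
      psq X (Cmp (SHCat C) \<beta> \<alpha>) a a' s =
        psq X \<alpha> (fo (pfun X (upper C \<beta>)) a) (fo (pfun X (lower C \<beta>)) a') (psq X \<beta> a a' s)"
    and psq_Ident: "\<lbrakk>u \<in> Hom (VCat C) x x'; a \<in> Obj (pcat X x); a' \<in> Obj (pcat X x');
        s \<in> pel (pprof X u) a a'\<rbrakk> \<Longrightarrow>
      psq X (Ident (SHCat C) u) a a' s = s"
    and pmu_natural: "\<lbrakk>\<alpha> \<in> Hom (SHCat C) u v; \<alpha>' \<in> Hom (SHCat C) u' v'; lower C \<alpha> = upper C \<alpha>';
        v \<in> Hom (VCat C) y y'; v' \<in> Hom (VCat C) y' y'';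
        f = upper C \<alpha>; f' = lower C \<alpha>; f'' = lower C \<alpha>';
        a \<in> Obj (pcat X y); a' \<in> Obj (pcat X y'); a'' \<in> Obj (pcat X y'');
        s \<in> pel (pprof X v) a a'; s' \<in> pel (pprof X v') a' a''\<rbrakk> \<Longrightarrow>
      psq X (Cmp (SVCat C) \<alpha>' \<alpha>) a a'' (pmu X v v' a a'' (psh_comp_class C X v v' a a' a'' s' s)) =
      pmu X u u' (fo (pfun X f) a) (fo (pfun X f'') a'')
        (psh_comp_class C X u u' (fo (pfun X f) a) (fo (pfun X f') a') (fo (pfun X f'') a'')
          (psq X \<alpha>' a' a'' s') (psq X \<alpha> a a' s))"
    and pmu_assoc: "\<lbrakk>u \<in> Hom (VCat C) x x'; u' \<in> Hom (VCat C) x' x''; u'' \<in> Hom (VCat C) x'' x''';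
        a \<in> Obj (pcat X x); a' \<in> Obj (pcat X x'); a'' \<in> Obj (pcat X x''); a''' \<in> Obj (pcat X x''');
        s \<in> pel (pprof X u) a a'; s' \<in> pel (pprof X u') a' a''; s'' \<in> pel (pprof X u'') a'' a'''\<rbrakk> \<Longrightarrow>
      pmu X u (Cmp (VCat C) u'' u') a a'''
        (psh_comp_class C X u (Cmp (VCat C) u'' u') a a' a'''
          (pmu X u' u'' a' a''' (psh_comp_class C X u' u'' a' a'' a''' s'' s')) s) =
      pmu X (Cmp (VCat C) u' u) u'' a a'''
        (psh_comp_class C X (Cmp (VCat C) u' u) u'' a a'' a'''
          s'' (pmu X u u' a a'' (psh_comp_class C X u u' a a' a'' s' s)))"
    and normal_pprof: "x \<in> Ob C \<Longrightarrow> pprof X (Ident (VCat C) x) = hom_prof (pcat X x)"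
    and normal_psq: "\<lbrakk>f \<in> Hom (HCat C) x y; a \<in> Obj (pcat X y); b \<in> Obj (pcat X y);
        m \<in> Hom (pcat X y) a b\<rbrakk> \<Longrightarrow>
      psq X (Ident (SVCat C) f) a b m = fa (pfun X f) m"
    and normal_pmu_left: "\<lbrakk>u \<in> Hom (VCat C) x x'; a \<in> Obj (pcat X x); b \<in> Obj (pcat X x);
        a' \<in> Obj (pcat X x'); m \<in> Hom (pcat X x) a b; s \<in> pel (pprof X u) b a'\<rbrakk> \<Longrightarrow>
      pmu X (Ident (VCat C) x) u a a' (psh_comp_class C X (Ident (VCat C) x) u a b a' s m) =
        pact (pprof X u) m (Ident (pcat X x') a') s"
    and normal_pmu_right: "\<lbrakk>u \<in> Hom (VCat C) x x'; a \<in> Obj (pcat X x); a' \<in> Obj (pcat X x');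
        b' \<in> Obj (pcat X x'); s \<in> pel (pprof X u) a a'; m \<in> Hom (pcat X x') a' b'\<rbrakk> \<Longrightarrow>
      pmu X u (Ident (VCat C) x') a b' (psh_comp_class C X u (Ident (VCat C) x') a a' b' m s) =
        pact (pprof X u) (Ident (pcat X x) a) m s"

record 'u ptrans =
  psrc :: "'u psh"
  ptgt :: "'u psh"
  tfun :: "'u \<Rightarrow> 'u fctr"
  tprof :: "'u \<Rightarrow> 'u \<Rightarrow> 'u \<Rightarrow> 'u \<Rightarrow> 'u"

locale presheaf_transformation =
  fixes C :: "'u::universe dblcat"
    and F :: "'u ptrans"
    and X Y :: "'u psh"
  defines "X \<equiv> psrc F" and "Y \<equiv> ptgt F"
  assumes src: "lax_double_presheaf C X"
    and tgt: "lax_double_presheaf C Y"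
    and tfun_ext: "tfun F \<in> extensional (Ob C)"
    and tprof_ext: "tprof F \<in> extensional (Ver C)"
    and tfun: "x \<in> Ob C \<Longrightarrow> small_functor (pcat X x) (pcat Y x) (tfun F x)"
    and tprof: "u \<in> Hom (VCat C) x x' \<Longrightarrow>
      prof_nat (pcat X x) (pcat X x') (pprof X u)
        (prof_restrict (pprof Y u) (tfun F x) (tfun F x')) (tprof F u)"
    and tfun_natural: "f \<in> Hom (HCat C) x y \<Longrightarrow>
      fctr_comp (pcat X y) (tfun F x) (pfun X f) = fctr_comp (pcat X y) (pfun Y f) (tfun F y)"
    and tprof_natural: "\<lbrakk>\<alpha> \<in> Hom (SHCat C) u v; v \<in> Hom (VCat C) y y';
        a \<in> Obj (pcat X y); a' \<in> Obj (pcat X y'); s \<in> pel (pprof X v) a a'\<rbrakk> \<Longrightarrow>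
      tprof F u (fo (pfun X (upper C \<alpha>)) a) (fo (pfun X (lower C \<alpha>)) a') (psq X \<alpha> a a' s) =
      psq Y \<alpha> (fo (tfun F y) a) (fo (tfun F y') a') (tprof F v a a' s)"
    and tprof_pmu: "\<lbrakk>u \<in> Hom (VCat C) x x'; u' \<in> Hom (VCat C) x' x'';
        a \<in> Obj (pcat X x); a' \<in> Obj (pcat X x'); a'' \<in> Obj (pcat X x'');
        s \<in> pel (pprof X u) a a'; s' \<in> pel (pprof X u') a' a''\<rbrakk> \<Longrightarrow>
      tprof F (Cmp (VCat C) u' u) a a'' (pmu X u u' a a'' (psh_comp_class C X u u' a a' a'' s' s)) =
      pmu Y u u' (fo (tfun F x) a) (fo (tfun F x'') a'')
        (psh_comp_class C Y u u' (fo (tfun F x) a) (fo (tfun F x') a') (fo (tfun F x'') a'')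
          (tprof F u' a' a'' s') (tprof F u a a' s))"
    and tprof_Ident: "\<lbrakk>x \<in> Ob C; a \<in> Obj (pcat X x); b \<in> Obj (pcat X x); m \<in> Hom (pcat X x) a b\<rbrakk> \<Longrightarrow>
      tprof F (Ident (VCat C) x) a b m = fa (tfun F x) m"

record 'u pmod =
  msrc :: "'u ptrans"
  mtgt :: "'u ptrans"
  mcomp :: "'u \<Rightarrow> 'u \<Rightarrow> 'u"

locale globular_modification =
  fixes C :: "'u::universe dblcat"
    and A :: "'u pmod"
    and X Y :: "'u psh"
    and F F' :: "'u ptrans"
  defines "X \<equiv> psrc (msrc A)" and "Y \<equiv> ptgt (msrc A)" and "F \<equiv> msrc A" and "F' \<equiv> mtgt A"
  assumes src: "presheaf_transformation C F"
    and tgt: "presheaf_transformation C F'"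
    and parallel: "psrc F' = X" "ptgt F' = Y"
    and mcomp_in: "mcomp A \<in> (\<Pi>\<^sub>E x\<in>Ob C. \<Pi>\<^sub>E a\<in>Obj (pcat X x).
      Hom (pcat Y x) (fo (tfun F x) a) (fo (tfun F' x) a))"
    and mcomp_natural: "\<lbrakk>x \<in> Ob C; m \<in> Hom (pcat X x) a b\<rbrakk> \<Longrightarrow>
      Cmp (pcat Y x) (fa (tfun F' x) m) (mcomp A x a) =
      Cmp (pcat Y x) (mcomp A x b) (fa (tfun F x) m)"
    and mcomp_Hor: "\<lbrakk>f \<in> Hom (HCat C) x y; b \<in> Obj (pcat X y)\<rbrakk> \<Longrightarrow>
      fa (pfun Y f) (mcomp A y b) = mcomp A x (fo (pfun X f) b)"
    and mcomp_Ver: "\<lbrakk>u \<in> Hom (VCat C) x x'; a \<in> Obj (pcat X x); a' \<in> Obj (pcat X x');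
        s \<in> pel (pprof X u) a a'\<rbrakk> \<Longrightarrow>
      pact (pprof Y u) (Ident (pcat Y x) (fo (tfun F x) a)) (mcomp A x' a') (tprof F u a a' s) =
      pact (pprof Y u) (mcomp A x a) (Ident (pcat Y x') (fo (tfun F' x') a')) (tprof F' u a a' s)"

definition ptrans_id :: "'u dblcat \<Rightarrow> 'u psh \<Rightarrow> 'u ptrans" where
  "ptrans_id C X = \<lparr>psrc = X, ptgt = X, tfun = (\<lambda>x\<in>Ob C. fctr_id (pcat X x)),
     tprof = (\<lambda>u\<in>Ver C. \<lambda>a\<in>Obj (pcat X (Dom (VCat C) u)). \<lambda>a'\<in>Obj (pcat X (Cod (VCat C) u)).
       \<lambda>s\<in>pel (pprof X u) a a'. s)\<rparr>"

definition ptrans_comp :: "'u dblcat \<Rightarrow> 'u ptrans \<Rightarrow> 'u ptrans \<Rightarrow> 'u ptrans" where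
  "ptrans_comp C G F =
     (let X = psrc F in
      \<lparr>psrc = X, ptgt = ptgt G,
       tfun = (\<lambda>x\<in>Ob C. fctr_comp (pcat X x) (tfun G x) (tfun F x)),
       tprof = (\<lambda>u\<in>Ver C. \<lambda>a\<in>Obj (pcat X (Dom (VCat C) u)). \<lambda>a'\<in>Obj (pcat X (Cod (VCat C) u)).
         \<lambda>s\<in>pel (pprof X u) a a'.
           tprof G u (fo (tfun F (Dom (VCat C) u)) a) (fo (tfun F (Cod (VCat C) u)) a')
             (tprof F u a a' s))\<rparr>)"

definition pmod_id :: "'u dblcat \<Rightarrow> 'u ptrans \<Rightarrow> 'u pmod" where
  "pmod_id C F = \<lparr>msrc = F, mtgt = F,
     mcomp = (\<lambda>x\<in>Ob C. \<lambda>a\<in>Obj (pcat (psrc F) x). Ident (pcat (ptgt F) x) (fo (tfun F x) a))\<rparr>"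

definition pmod_vcomp :: "'u dblcat \<Rightarrow> 'u pmod \<Rightarrow> 'u pmod \<Rightarrow> 'u pmod" where
  "pmod_vcomp C A' A = \<lparr>msrc = msrc A, mtgt = mtgt A',
     mcomp = (\<lambda>x\<in>Ob C. \<lambda>a\<in>Obj (pcat (psrc (msrc A)) x).
       Cmp (pcat (ptgt (msrc A)) x) (mcomp A' x a) (mcomp A x a))\<rparr>"

definition pmod_hcomp :: "'u dblcat \<Rightarrow> 'u pmod \<Rightarrow> 'u pmod \<Rightarrow> 'u pmod" where
  "pmod_hcomp C B A =
     \<lparr>msrc = ptrans_comp C (msrc B) (msrc A), mtgt = ptrans_comp C (mtgt B) (mtgt A),
      mcomp = (\<lambda>x\<in>Ob C. \<lambda>a\<in>Obj (pcat (psrc (msrc A)) x).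
        Cmp (pcat (ptgt (msrc B)) x) (mcomp B x (fo (tfun (mtgt A) x) a))
          (fa (tfun (msrc B) x) (mcomp A x a)))\<rparr>"

definition Psh :: "'u::universe dblcat \<Rightarrow> ('u psh, 'u ptrans, 'u pmod) twocat" where
  "Psh C =
     \<lparr>One = \<lparr>Obj = Collect (lax_double_presheaf C), Arr = Collect (presheaf_transformation C),
        Dom = psrc, Cod = ptgt, Ident = ptrans_id C, Cmp = ptrans_comp C\<rparr>,
      Vert = \<lparr>Obj = Collect (presheaf_transformation C), Arr = Collect (globular_modification C),
        Dom = msrc, Cod = mtgt, Ident = pmod_id C, Cmp = pmod_vcomp C\<rparr>,
      Horiz = \<lparr>Obj = Collect (lax_double_presheaf C), Arr = Collect (globular_modification C),
        Dom = psrc \<circ> msrc, Cod = ptgt \<circ> msrc, Ident = pmod_id C \<circ> ptrans_id C,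
        Cmp = pmod_hcomp C\<rparr>\<rparr>"


section \<open>Discrete double fibrations\<close>

locale discrete_double_fibration = double_functor P for P :: "'u::universe dfun" +
  assumes hor_lift: "\<lbrakk>e \<in> Ob (dsrc P); f \<in> Hor (dtgt P); Cod (HCat (dtgt P)) f = fO P e\<rbrakk> \<Longrightarrow>
      \<exists>!h. h \<in> Hor (dsrc P) \<and> Cod (HCat (dsrc P)) h = e \<and> fH P h = f"
    and sq_lift: "\<lbrakk>v \<in> Ver (dsrc P); \<alpha> \<in> Sq (dtgt P); rgt (dtgt P) \<alpha> = fV P v\<rbrakk> \<Longrightarrow>
      \<exists>!\<sigma>. \<sigma> \<in> Sq (dsrc P) \<and> rgt (dsrc P) \<sigma> = v \<and> fS P \<sigma> = \<alpha>"

definition hlift :: "'u dfun \<Rightarrow> 'u \<Rightarrow> 'u \<Rightarrow> 'u" where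
  "hlift P f e = (THE h. h \<in> Hor (dsrc P) \<and> Cod (HCat (dsrc P)) h = e \<and> fH P h = f)"

definition slift :: "'u dfun \<Rightarrow> 'u \<Rightarrow> 'u \<Rightarrow> 'u" where
  "slift P \<alpha> v = (THE \<sigma>. \<sigma> \<in> Sq (dsrc P) \<and> rgt (dsrc P) \<sigma> = v \<and> fS P \<sigma> = \<alpha>)"

definition DFib :: "'u::universe dblcat
    \<Rightarrow> ('u dfun, 'u dfun \<times> 'u dfun \<times> 'u dfun, 'u dfun \<times> 'u vtrans \<times> 'u dfun) twocat" where
  "DFib C = two_full_sub (Collect discrete_double_fibration) (slice DblCat_v C)"


section \<open>The Grothendieck construction\<close>

text \<open>
  An object (x,a) is coded as a pair.  A horizontal morphism over f is determined by its target and
  coded as (f,b) with b over the target of f.  A vertical morphism (u,s) is coded together with its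
  end points a and a'.  A square over \<open>\<alpha>\<close> is determined by its right boundary and coded
  like it, with \<open>\<alpha>\<close> in place of the vertical morphism.
\<close>

definition vcode :: "'u::universe \<Rightarrow> 'u \<Rightarrow> 'u \<Rightarrow> 'u \<Rightarrow> 'u" where
  "vcode u a a' s = upair u (upair (upair a a') s)"

definition vbase :: "'u::universe \<Rightarrow> 'u" where "vbase z = ufst z"
definition vdomc :: "'u::universe \<Rightarrow> 'u" where "vdomc z = ufst (ufst (usnd z))"
definition vcodc :: "'u::universe \<Rightarrow> 'u" where "vcodc z = usnd (ufst (usnd z))"
definition velem :: "'u::universe \<Rightarrow> 'u" where "velem z = usnd (usnd z)"

definition groth_Ob :: "'u::universe dblcat \<Rightarrow> 'u psh \<Rightarrow> 'u set" where
  "groth_Ob C X = {upair x a |x a. x \<in> Ob C \<and> a \<in> Obj (pcat X x)}"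

definition groth_Hor :: "'u::universe dblcat \<Rightarrow> 'u psh \<Rightarrow> 'u set" where
  "groth_Hor C X = {upair f b |f b. f \<in> Hor C \<and> b \<in> Obj (pcat X (Cod (HCat C) f))}"

definition groth_Ver :: "'u::universe dblcat \<Rightarrow> 'u psh \<Rightarrow> 'u set" where
  "groth_Ver C X = {vcode u a a' s |u a a' s. u \<in> Ver C \<and> a \<in> Obj (pcat X (Dom (VCat C) u)) \<and>
     a' \<in> Obj (pcat X (Cod (VCat C) u)) \<and> s \<in> pel (pprof X u) a a'}"

definition groth_Sq :: "'u::universe dblcat \<Rightarrow> 'u psh \<Rightarrow> 'u set" where
  "groth_Sq C X = {vcode \<alpha> b b' t |\<alpha> b b' t. \<alpha> \<in> Sq C \<and> vcode (rgt C \<alpha>) b b' t \<in> groth_Ver C X}"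

definition groth :: "'u::universe dblcat \<Rightarrow> 'u psh \<Rightarrow> 'u dblcat" where
  "groth C X =
     (let O' = groth_Ob C X; H = groth_Hor C X; V = groth_Ver C X; S = groth_Sq C X;
          hD = (\<lambda>h\<in>H. upair (Dom (HCat C) (ufst h)) (fo (pfun X (ufst h)) (usnd h)));
          hC = (\<lambda>h\<in>H. upair (Cod (HCat C) (ufst h)) (usnd h));
          vD = (\<lambda>w\<in>V. upair (Dom (VCat C) (vbase w)) (vdomc w));
          vC = (\<lambda>w\<in>V. upair (Cod (VCat C) (vbase w)) (vcodc w));
          sL = (\<lambda>\<sigma>\<in>S. vcode (lft C (vbase \<sigma>))
                  (fo (pfun X (upper C (vbase \<sigma>))) (vdomc \<sigma>))
                  (fo (pfun X (lower C (vbase \<sigma>))) (vcodc \<sigma>))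
                  (psq X (vbase \<sigma>) (vdomc \<sigma>) (vcodc \<sigma>) (velem \<sigma>)));
          sR = (\<lambda>\<sigma>\<in>S. vcode (rgt C (vbase \<sigma>)) (vdomc \<sigma>) (vcodc \<sigma>) (velem \<sigma>));
          sU = (\<lambda>\<sigma>\<in>S. upair (upper C (vbase \<sigma>)) (vdomc \<sigma>));
          sB = (\<lambda>\<sigma>\<in>S. upair (lower C (vbase \<sigma>)) (vcodc \<sigma>));
          vmul = (\<lambda>w' w. pmu X (vbase w) (vbase w') (vdomc w) (vcodc w')
                   (psh_comp_class C X (vbase w) (vbase w') (vdomc w) (vcodc w) (vcodc w')
                     (velem w') (velem w)))
      in \<lparr>HCat = \<lparr>Obj = O', Arr = H, Dom = hD, Cod = hC,
            Ident = (\<lambda>p\<in>O'. upair (Ident (HCat C) (ufst p)) (usnd p)),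
            Cmp = (\<lambda>k\<in>H. \<lambda>h\<in>{h \<in> H. hC h = hD k}.
              upair (Cmp (HCat C) (ufst k) (ufst h)) (usnd k))\<rparr>,
          VCat = \<lparr>Obj = O', Arr = V, Dom = vD, Cod = vC,
            Ident = (\<lambda>p\<in>O'. vcode (Ident (VCat C) (ufst p)) (usnd p) (usnd p)
              (Ident (pcat X (ufst p)) (usnd p))),
            Cmp = (\<lambda>w'\<in>V. \<lambda>w\<in>{w \<in> V. vC w = vD w'}.
              vcode (Cmp (VCat C) (vbase w') (vbase w)) (vdomc w) (vcodc w') (vmul w' w))\<rparr>,
          SHCat = \<lparr>Obj = V, Arr = S, Dom = sL, Cod = sR,
            Ident = (\<lambda>w\<in>V. vcode (Ident (SHCat C) (vbase w)) (vdomc w) (vcodc w) (velem w)),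
            Cmp = (\<lambda>\<tau>\<in>S. \<lambda>\<sigma>\<in>{\<sigma> \<in> S. sR \<sigma> = sL \<tau>}.
              vcode (Cmp (SHCat C) (vbase \<tau>) (vbase \<sigma>)) (vdomc \<tau>) (vcodc \<tau>) (velem \<tau>))\<rparr>,
          SVCat = \<lparr>Obj = H, Arr = S, Dom = sU, Cod = sB,
            Ident = (\<lambda>h\<in>H. vcode (Ident (SVCat C) (ufst h)) (usnd h) (usnd h)
              (Ident (pcat X (Cod (HCat C) (ufst h))) (usnd h))),
            Cmp = (\<lambda>\<sigma>'\<in>S. \<lambda>\<sigma>\<in>{\<sigma> \<in> S. sB \<sigma> = sU \<sigma>'}.
              vcode (Cmp (SVCat C) (vbase \<sigma>') (vbase \<sigma>)) (vdomc \<sigma>) (vcodc \<sigma>')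
                (vmul (sR \<sigma>') (sR \<sigma>)))\<rparr>\<rparr>)"

definition groth_proj :: "'u::universe dblcat \<Rightarrow> 'u psh \<Rightarrow> 'u dfun" where
  "groth_proj C X = \<lparr>dsrc = groth C X, dtgt = C, fO = (\<lambda>p\<in>groth_Ob C X. ufst p),
     fH = (\<lambda>h\<in>groth_Hor C X. ufst h), fV = (\<lambda>w\<in>groth_Ver C X. vbase w),
     fS = (\<lambda>\<sigma>\<in>groth_Sq C X. vbase \<sigma>)\<rparr>"

text \<open>
  The squares of the image are coded by the images of their right boundaries, and the horizontal
  morphisms by the images of their targets; their underlying cells do not change.
\<close>

definition groth_map :: "'u::universe dblcat \<Rightarrow> 'u ptrans \<Rightarrow> 'u dfun" where
  "groth_map C F =
     (let X = psrc F; Y = ptgt F;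
          img = (\<lambda>u z. vcode (vbase z) (fo (tfun F (Dom (VCat C) u)) (vdomc z))
            (fo (tfun F (Cod (VCat C) u)) (vcodc z)) (tprof F u (vdomc z) (vcodc z) (velem z)))
      in \<lparr>dsrc = groth C X, dtgt = groth C Y,
          fO = (\<lambda>p\<in>groth_Ob C X. upair (ufst p) (fo (tfun F (ufst p)) (usnd p))),
          fH = (\<lambda>h\<in>groth_Hor C X. upair (ufst h) (fo (tfun F (Cod (HCat C) (ufst h))) (usnd h))),
          fV = (\<lambda>w\<in>groth_Ver C X. img (vbase w) w),
          fS = (\<lambda>\<sigma>\<in>groth_Sq C X. img (rgt C (vbase \<sigma>)) \<sigma>)\<rparr>)"

definition groth_mod :: "'u::universe dblcat \<Rightarrow> 'u pmod \<Rightarrow> 'u vtrans" where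
  "groth_mod C A =
     (let X = psrc (msrc A); F = msrc A; F' = mtgt A;
          comp = (\<lambda>w x a. vcode w (fo (tfun F x) a) (fo (tfun F' x) a) (mcomp A x a))
      in \<lparr>vsrc = groth_map C F, vtgt = groth_map C F',
          vO = (\<lambda>p\<in>groth_Ob C X. comp (Ident (VCat C) (ufst p)) (ufst p) (usnd p)),
          vH = (\<lambda>h\<in>groth_Hor C X.
            comp (Ident (SVCat C) (ufst h)) (Cod (HCat C) (ufst h)) (usnd h))\<rparr>)"

definition Groth :: "'u::universe dblcat \<Rightarrow> ('u psh, 'u ptrans, 'u pmod,
    'u dfun, 'u dfun \<times> 'u dfun \<times> 'u dfun, 'u dfun \<times> 'u vtrans \<times> 'u dfun) twofun" where
  "Groth C = \<lparr>on0 = groth_proj C,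
     on1 = (\<lambda>F. (groth_proj C (psrc F), groth_map C F, groth_proj C (ptgt F))),
     on2 = (\<lambda>A. (groth_proj C (psrc (msrc A)), groth_mod C A, groth_proj C (ptgt (msrc A))))\<rparr>"


section \<open>Presheaves as a pseudo-functor of the base\<close>

definition psh_pre :: "'u dfun \<Rightarrow> 'u psh \<Rightarrow> 'u psh" where
  "psh_pre G X =
     (let C = dsrc G in
      \<lparr>pcat = (\<lambda>x\<in>Ob C. pcat X (fO G x)), pfun = (\<lambda>f\<in>Hor C. pfun X (fH G f)),
       pprof = (\<lambda>u\<in>Ver C. pprof X (fV G u)), psq = (\<lambda>\<alpha>\<in>Sq C. psq X (fS G \<alpha>)),
       pmu = (\<lambda>u\<in>Ver C. \<lambda>u'\<in>{u' \<in> Ver C. Dom (VCat C) u' = Cod (VCat C) u}.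
         pmu X (fV G u) (fV G u'))\<rparr>)"

definition ptrans_pre :: "'u dfun \<Rightarrow> 'u ptrans \<Rightarrow> 'u ptrans" where
  "ptrans_pre G F = \<lparr>psrc = psh_pre G (psrc F), ptgt = psh_pre G (ptgt F),
     tfun = (\<lambda>x\<in>Ob (dsrc G). tfun F (fO G x)), tprof = (\<lambda>u\<in>Ver (dsrc G). tprof F (fV G u))\<rparr>"

definition pmod_pre :: "'u dfun \<Rightarrow> 'u pmod \<Rightarrow> 'u pmod" where
  "pmod_pre G A = \<lparr>msrc = ptrans_pre G (msrc A), mtgt = ptrans_pre G (mtgt A),
     mcomp = (\<lambda>x\<in>Ob (dsrc G). mcomp A (fO G x))\<rparr>"

definition psh_htrans :: "'u htrans \<Rightarrow> 'u psh \<Rightarrow> 'u ptrans" where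
  "psh_htrans B X = \<lparr>psrc = psh_pre (htgt B) X, ptgt = psh_pre (hsrc B) X,
     tfun = (\<lambda>x\<in>Ob (dsrc (hsrc B)). pfun X (hO B x)),
     tprof = (\<lambda>u\<in>Ver (dsrc (hsrc B)). psq X (hV B u))\<rparr>"

text \<open>
  Pseudo-functors on \<open>coop DblCat_h\<close>, in which the composite of H followed by G is the
  double functor H after G.  Precomposition is strictly functorial, so the structure
  isomorphisms are identities.
\<close>

definition Psh_pf :: "('u::universe dblcat, 'u dfun, 'u htrans, 'u psh, 'u ptrans, 'u pmod) pseudofun"
  where
  "Psh_pf = \<lparr>ps0 = Psh, ps1 = (\<lambda>G. \<lparr>on0 = psh_pre G, on1 = ptrans_pre G, on2 = pmod_pre G\<rparr>),
     ps2 = psh_htrans,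
     ps_comp = (\<lambda>G H X. ptrans_id (dsrc G) (psh_pre G (psh_pre H X))),
     ps_unit = ptrans_id\<rparr>"


section \<open>Discrete double fibrations as a pseudo-functor of the base\<close>

text \<open>All cells of the pullback along G of P are coded as pairs (c,e) with Gc = Pe.\<close>

definition pull_set :: "'u::universe set \<Rightarrow> 'u set \<Rightarrow> ('u \<Rightarrow> 'u) \<Rightarrow> ('u \<Rightarrow> 'u) \<Rightarrow> 'u set" where
  "pull_set S T g p = {upair c e |c e. c \<in> S \<and> e \<in> T \<and> g c = p e}"

definition pull_cat :: "('u::universe, 'u) cat \<Rightarrow> ('u, 'u) cat \<Rightarrow> 'u fctr \<Rightarrow> 'u fctr \<Rightarrow> ('u, 'u) cat" where
  "pull_cat A B G P =
     (let objs = pull_set (Obj A) (Obj B) (fo G) (fo P); arrs = pull_set (Arr A) (Arr B) (fa G) (fa P);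
          D = (\<lambda>z\<in>arrs. upair (Dom A (ufst z)) (Dom B (usnd z)));
          E = (\<lambda>z\<in>arrs. upair (Cod A (ufst z)) (Cod B (usnd z)))
      in \<lparr>Obj = objs, Arr = arrs, Dom = D, Cod = E,
          Ident = (\<lambda>z\<in>objs. upair (Ident A (ufst z)) (Ident B (usnd z))),
          Cmp = (\<lambda>w\<in>arrs. \<lambda>z\<in>{z \<in> arrs. E z = D w}.
            upair (Cmp A (ufst w) (ufst z)) (Cmp B (usnd w) (usnd z)))\<rparr>)"

definition pull :: "'u::universe dfun \<Rightarrow> 'u dfun \<Rightarrow> 'u dblcat" where
  "pull G P =
     (let C = dsrc G; E = dsrc P in
      \<lparr>HCat = pull_cat (HCat C) (HCat E) \<lparr>fo = fO G, fa = fH G\<rparr> \<lparr>fo = fO P, fa = fH P\<rparr>,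
       VCat = pull_cat (VCat C) (VCat E) \<lparr>fo = fO G, fa = fV G\<rparr> \<lparr>fo = fO P, fa = fV P\<rparr>,
       SHCat = pull_cat (SHCat C) (SHCat E) \<lparr>fo = fV G, fa = fS G\<rparr> \<lparr>fo = fV P, fa = fS P\<rparr>,
       SVCat = pull_cat (SVCat C) (SVCat E) \<lparr>fo = fH G, fa = fS G\<rparr> \<lparr>fo = fH P, fa = fS P\<rparr>\<rparr>)"

definition pull_proj :: "'u::universe dfun \<Rightarrow> 'u dfun \<Rightarrow> 'u dfun" where
  "pull_proj G P = \<lparr>dsrc = pull G P, dtgt = dsrc G, fO = (\<lambda>z\<in>Ob (pull G P). ufst z),
     fH = (\<lambda>z\<in>Hor (pull G P). ufst z), fV = (\<lambda>z\<in>Ver (pull G P). ufst z),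
     fS = (\<lambda>z\<in>Sq (pull G P). ufst z)\<rparr>"

definition pull_map :: "'u::universe dfun \<Rightarrow> 'u dfun \<times> 'u dfun \<times> 'u dfun \<Rightarrow> 'u dfun" where
  "pull_map G = (\<lambda>(P, F, Q). \<lparr>dsrc = pull G P, dtgt = pull G Q,
     fO = (\<lambda>z\<in>Ob (pull G P). upair (ufst z) (fO F (usnd z))),
     fH = (\<lambda>z\<in>Hor (pull G P). upair (ufst z) (fH F (usnd z))),
     fV = (\<lambda>z\<in>Ver (pull G P). upair (ufst z) (fV F (usnd z))),
     fS = (\<lambda>z\<in>Sq (pull G P). upair (ufst z) (fS F (usnd z)))\<rparr>)"

definition pull_vtrans :: "'u::universe dfun \<Rightarrow> 'u dfun \<times> 'u vtrans \<times> 'u dfun \<Rightarrow> 'u vtrans" where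
  "pull_vtrans G = (\<lambda>(P, A, Q). \<lparr>vsrc = pull_map G (P, vsrc A, Q), vtgt = pull_map G (P, vtgt A, Q),
     vO = (\<lambda>z\<in>Ob (pull G P). upair (Ident (VCat (dsrc G)) (ufst z)) (vO A (usnd z))),
     vH = (\<lambda>z\<in>Hor (pull G P). upair (Ident (SVCat (dsrc G)) (ufst z)) (vH A (usnd z)))\<rparr>)"

text \<open>
  For B from G to G', the double functor from the pullback along G' to the pullback along G.  The
  horizontal morphism (f,h) with h over G'f is sent to the lift of Gf whose target is the image of
  the target of (f,h), and likewise for squares and their right boundaries.
\<close>

definition pull_htrans :: "'u::universe htrans \<Rightarrow> 'u dfun \<Rightarrow> 'u dfun" where
  "pull_htrans B P =
     (let G = hsrc B; G' = htgt B; C = dsrc G; E = dsrc P; Q = pull G' P;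
          reO = (\<lambda>x e. Dom (HCat E) (hlift P (hO B x) e));
          reV = (\<lambda>u w. lft E (slift P (hV B u) w))
      in \<lparr>dsrc = Q, dtgt = pull G P,
          fO = (\<lambda>z\<in>Ob Q. upair (ufst z) (reO (ufst z) (usnd z))),
          fH = (\<lambda>z\<in>Hor Q. upair (ufst z) (hlift P (fH G (ufst z))
            (reO (Cod (HCat C) (ufst z)) (Cod (HCat E) (usnd z))))),
          fV = (\<lambda>z\<in>Ver Q. upair (ufst z) (reV (ufst z) (usnd z))),
          fS = (\<lambda>z\<in>Sq Q. upair (ufst z) (slift P (fS G (ufst z))
            (reV (rgt C (ufst z)) (rgt E (usnd z)))))\<rparr>)"

text \<open>The canonical isomorphism (c,(Gc,e)) \<open>\<mapsto>\<close> (c,e) from the iterated pullback along H and G.\<close>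

definition pull_assoc :: "'u::universe dfun \<Rightarrow> 'u dfun \<Rightarrow> 'u dfun \<Rightarrow> 'u dfun" where
  "pull_assoc G H P =
     (let Q = pull G (pull_proj H P); r = (\<lambda>z. upair (ufst z) (usnd (usnd z))) in
      \<lparr>dsrc = Q, dtgt = pull (dfun_comp H G) P, fO = (\<lambda>z\<in>Ob Q. r z), fH = (\<lambda>z\<in>Hor Q. r z),
       fV = (\<lambda>z\<in>Ver Q. r z), fS = (\<lambda>z\<in>Sq Q. r z)\<rparr>)"

text \<open>The canonical isomorphism e \<open>\<mapsto>\<close> (Pe,e) to the pullback along the identity.\<close>

definition pull_unit :: "'u::universe dblcat \<Rightarrow> 'u dfun \<Rightarrow> 'u dfun" where
  "pull_unit C P =
     (let E = dsrc P in
      \<lparr>dsrc = E, dtgt = pull (dfun_id C) P, fO = (\<lambda>e\<in>Ob E. upair (fO P e) e),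
       fH = (\<lambda>e\<in>Hor E. upair (fH P e) e), fV = (\<lambda>e\<in>Ver E. upair (fV P e) e),
       fS = (\<lambda>e\<in>Sq E. upair (fS P e) e)\<rparr>)"

definition DFib_pf :: "('u::universe dblcat, 'u dfun, 'u htrans,
    'u dfun, 'u dfun \<times> 'u dfun \<times> 'u dfun, 'u dfun \<times> 'u vtrans \<times> 'u dfun) pseudofun" where
  "DFib_pf = \<lparr>ps0 = DFib,
     ps1 = (\<lambda>G. \<lparr>on0 = pull_proj G,
       on1 = (\<lambda>(P, F, Q). (pull_proj G P, pull_map G (P, F, Q), pull_proj G Q)),
       on2 = (\<lambda>(P, A, Q). (pull_proj G P, pull_vtrans G (P, A, Q), pull_proj G Q))\<rparr>),
     ps2 = (\<lambda>B P. (pull_proj (htgt B) P, pull_htrans B P, pull_proj (hsrc B) P)),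
     ps_comp = (\<lambda>G H P. (pull_proj G (pull_proj H P), pull_assoc G H P,
       pull_proj (dfun_comp H G) P)),
     ps_unit = (\<lambda>C P. (P, pull_unit C P, pull_proj (dfun_id C) P))\<rparr>"

end

theory Submission imports Defs begin

text \<open>
  In a discrete double fibration every horizontal morphism and every square of the total double
  category is the unique lift of its image in the base, so all information sits in the objects
  and the vertical morphisms. A double functor over the base is determined by what it does to
  these (over_eqI), and an assignment on them extends to a double functor as soon as it respects
  vertical composition and sends lifts to lifts (overI); a vertical transformation over the base
  is the same as a suitable family of vertical morphisms (over_cellI, over_cell_eqI). These four
  facts reduce every equation between double functors or transformations over the base to a
  computation with codes for objects and vertical morphisms.

  Lax double presheaves are as economical, because of normality: the arrows of the fibre over
  \<open>x\<close> are the elements of the profunctor at the vertical identity of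
  \<open>x\<close>, and acting by an arrow is composing with it through the comparison map. A
  transformation of presheaves is therefore a family of maps on objects and on elements of
  profunctors that commutes with reindexing and with composition (ptransfI, ptrans_eqI), which
  is exactly a double functor over the base between the total double categories
  (groth_map_trans, groth_map_inject); globular modifications correspond in the same way to
  vertical transformations over the base (groth_mod_surj, groth_mod_inject). Conversely the
  fibres of a discrete double fibration form a lax double presheaf: the objects over
  \<open>x\<close> with the vertical morphisms over the vertical identity form a category, the
  vertical morphisms over \<open>u\<close> form a profunctor, unique lifts give the reindexing
  and vertical composition gives the comparison maps (fibre_presheaf). Its total double category
  is the given one up to renaming (fibre_iso). A 2-functor that is bijective on 1-cells and on
  2-cells between any two objects and essentially surjective is a 2-equivalence
  (two_equivalence_criterion).

  For the dependence on the base, an object of the pullback of the total double category of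
  \<open>X\<close> along \<open>G\<close> is a pair of \<open>x\<close> and an object
  \<open>a\<close> of the fibre of \<open>X\<close> over \<open>G x\<close>, together with a
  redundant copy of \<open>G x\<close>; dropping the copy is an isomorphism onto the total
  double category of \<open>X\<close> precomposed with \<open>G\<close> (pn_map_over,
  pn_map_iso). All coherence equations compare double functors over a base and hold because both
  sides agree on codes; compatibility with horizontal transformations uses that the lift of
  \<open>f\<close> with target \<open>(y, b)\<close> starts at the value of the reindexing
  functor of \<open>f\<close> at \<open>b\<close> (groth_re).
\<close>

section \<open>Categories and 2-categories\<close>

lemma Hom_iff [simp]: "m \<in> Hom A a b \<longleftrightarrow> m \<in> Arr A \<and> Dom A m = a \<and> Cod A m = b"
  by (simp add: Hom_def)

context category
begin

lemma Cmp_Ident_r: "m \<in> Arr A \<Longrightarrow> Dom A m = a \<Longrightarrow> Cmp A m (Ident A a) = m"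
  using Cmp_Ident_right by blast

lemma Cmp_Ident_l: "m \<in> Arr A \<Longrightarrow> Cod A m = a \<Longrightarrow> Cmp A (Ident A a) m = m"
  using Cmp_Ident_left by blast

lemmas cat [simp] = Dom_in Cod_in Ident_in Dom_Ident Cod_Ident Cmp_in Dom_Cmp Cod_Cmp
  Cmp_Ident_r Cmp_Ident_l

end

lemma category_opcat: "category A \<Longrightarrow> category (opcat A)"
proof -
  assume "category A"
  then interpret category A .
  show ?thesis by unfold_locales (simp_all add: opcat_def Cmp_assoc)
qed

text \<open>
  Transport of structure along injective maps that commute with all operations: every axiom is
  either closure or an equation, and equations may be tested after applying an injection.
\<close>

lemma category_transport:
  assumes B: "category B" and inj: "inj \<phi>o" "inj \<phi>a"
    and Obj: "\<And>a. a \<in> Obj A \<longleftrightarrow> \<phi>o a \<in> Obj B" and Arr: "\<And>m. m \<in> Arr A \<longleftrightarrow> \<phi>a m \<in> Arr B"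
    and Dom: "\<And>m. \<phi>o (Dom A m) = Dom B (\<phi>a m)" and Cod: "\<And>m. \<phi>o (Cod A m) = Cod B (\<phi>a m)"
    and Ident: "\<And>a. \<phi>a (Ident A a) = Ident B (\<phi>o a)"
    and Cmp: "\<And>n m. \<phi>a (Cmp A n m) = Cmp B (\<phi>a n) (\<phi>a m)"
  shows "category A"
proof -
  interpret category B by (rule B)
  note eqs = inj[THEN inj_eq, symmetric]
  show ?thesis
    by unfold_locales (simp_all add: eqs(1) eqs(2) Obj Arr Dom Cod Ident Cmp Cmp_assoc del: category.cat)
qed

context twocategory
begin

sublocale O1: category "One K" by (rule One)
sublocale V2: category "Vert K" by (rule Vert)
sublocale H2: category "Horiz K" by (rule Horiz)

lemmas sets [simp] = Obj_Vert Obj_Horiz Arr_Horiz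

lemmas V2_cat [simp] = V2.cat[unfolded Obj_Vert]
lemmas H2_cat [simp] = H2.cat[unfolded Obj_Horiz Arr_Horiz]
lemmas H2_assoc = H2.Cmp_assoc[unfolded Arr_Horiz]

lemmas bounds [simp] = Dom_Dom Dom_Cod Cod_Dom Cod_Cod Dom_Horiz Cod_Horiz

lemma Dom_Ident2 [simp]: "f \<in> Cells1 K \<Longrightarrow> Dom (Horiz K) (Ident (Vert K) f) = Dom (One K) f"
  by (metis Dom_Dom V2_cat(3,4))

lemma Cod_Ident2 [simp]: "f \<in> Cells1 K \<Longrightarrow> Cod (Horiz K) (Ident (Vert K) f) = Cod (One K) f"
  by (metis Cod_Dom V2_cat(3,4))

lemma vert_parallel:
  assumes "\<tau> \<in> Cells2 K" "\<sigma> \<in> Cells2 K" "Cod (Vert K) \<sigma> = Dom (Vert K) \<tau>"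
  shows "Dom (Horiz K) \<tau> = Dom (Horiz K) \<sigma>" "Cod (Horiz K) \<tau> = Cod (Horiz K) \<sigma>"
  using assms by (metis Dom_Dom Dom_Cod, metis Cod_Dom Cod_Cod)

lemma Dom_Vert_Cmp [simp]:
  "\<lbrakk>\<tau> \<in> Cells2 K; \<sigma> \<in> Cells2 K; Cod (Vert K) \<sigma> = Dom (Vert K) \<tau>\<rbrakk>
    \<Longrightarrow> Dom (Horiz K) (Cmp (Vert K) \<tau> \<sigma>) = Dom (Horiz K) \<sigma>"
  by (metis Dom_Dom V2_cat(6,7))

lemma Cod_Vert_Cmp [simp]:
  "\<lbrakk>\<tau> \<in> Cells2 K; \<sigma> \<in> Cells2 K; Cod (Vert K) \<sigma> = Dom (Vert K) \<tau>\<rbrakk>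
    \<Longrightarrow> Cod (Horiz K) (Cmp (Vert K) \<tau> \<sigma>) = Cod (Horiz K) \<sigma>"
  by (metis Cod_Dom V2_cat(6,7))

end

lemma twocategory_coop:
  assumes "twocategory K" shows "twocategory (coop K)"
proof -
  interpret twocategory K by (rule assms)
  show ?thesis
  proof (rule twocategory.intro)
    show "category (One (coop K))" "category (Vert (coop K))" "category (Horiz (coop K))"
      by (simp_all add: coop_def category_opcat One Vert Horiz)
  next
    fix \<sigma> \<sigma>' \<tau> \<tau>'
    assume c: "\<sigma> \<in> Cells2 (coop K)" "\<sigma>' \<in> Cells2 (coop K)" "\<tau> \<in> Cells2 (coop K)" "\<tau>' \<in> Cells2 (coop K)"
      and v: "Cod (Vert (coop K)) \<sigma> = Dom (Vert (coop K)) \<sigma>'" "Cod (Vert (coop K)) \<tau> = Dom (Vert (coop K)) \<tau>'"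
      and h: "Cod (Horiz (coop K)) \<sigma> = Dom (Horiz (coop K)) \<tau>"
    have c': "\<sigma> \<in> Cells2 K" "\<sigma>' \<in> Cells2 K" "\<tau> \<in> Cells2 K" "\<tau>' \<in> Cells2 K"
      using c by (simp_all add: coop_def opcat_def)
    have v': "Dom (Vert K) \<sigma> = Cod (Vert K) \<sigma>'" "Dom (Vert K) \<tau> = Cod (Vert K) \<tau>'"
      and h': "Dom (Horiz K) \<sigma> = Cod (Horiz K) \<tau>" using v h by (simp_all add: coop_def opcat_def)
    have "Cod (Horiz K) \<tau>' = Dom (Horiz K) \<sigma>'"
      using vert_parallel[of \<sigma> \<sigma>'] vert_parallel[of \<tau> \<tau>'] c' v' h' by simp
    from interchange[OF c'(4,3,2,1) v'(2,1)[symmetric] this]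
    show "Cmp (Horiz (coop K)) (Cmp (Vert (coop K)) \<tau>' \<tau>) (Cmp (Vert (coop K)) \<sigma>' \<sigma>) =
      Cmp (Vert (coop K)) (Cmp (Horiz (coop K)) \<tau>' \<sigma>') (Cmp (Horiz (coop K)) \<tau> \<sigma>)"
      by (simp add: coop_def opcat_def)
  qed (simp_all add: coop_def opcat_def Ident_Horiz Horiz_Ident)
qed

lemma twocategory_transport:
  assumes L: "twocategory L" and inj: "inj \<phi>0" "inj \<phi>1" "inj \<phi>2"
    and cat: "category (One K)" "category (Vert K)" "category (Horiz K)"
    and same_sets: "Obj (Vert K) = Cells1 K" "Obj (Horiz K) = Cells0 K" "Arr (Horiz K) = Cells2 K"
    and mem: "\<And>x. x \<in> Cells0 K \<longleftrightarrow> \<phi>0 x \<in> Cells0 L" "\<And>f. f \<in> Cells1 K \<longleftrightarrow> \<phi>1 f \<in> Cells1 L"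
      "\<And>\<sigma>. \<sigma> \<in> Cells2 K \<longleftrightarrow> \<phi>2 \<sigma> \<in> Cells2 L"
    and ops: "\<And>f. \<phi>0 (Dom (One K) f) = Dom (One L) (\<phi>1 f)" "\<And>f. \<phi>0 (Cod (One K) f) = Cod (One L) (\<phi>1 f)"
      "\<And>\<sigma>. \<phi>1 (Dom (Vert K) \<sigma>) = Dom (Vert L) (\<phi>2 \<sigma>)" "\<And>\<sigma>. \<phi>1 (Cod (Vert K) \<sigma>) = Cod (Vert L) (\<phi>2 \<sigma>)"
      "\<And>\<sigma>. \<phi>0 (Dom (Horiz K) \<sigma>) = Dom (Horiz L) (\<phi>2 \<sigma>)" "\<And>\<sigma>. \<phi>0 (Cod (Horiz K) \<sigma>) = Cod (Horiz L) (\<phi>2 \<sigma>)"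
      "\<And>x. \<phi>1 (Ident (One K) x) = Ident (One L) (\<phi>0 x)" "\<And>f. \<phi>2 (Ident (Vert K) f) = Ident (Vert L) (\<phi>1 f)"
      "\<And>x. \<phi>2 (Ident (Horiz K) x) = Ident (Horiz L) (\<phi>0 x)"
      "\<And>g f. \<phi>1 (Cmp (One K) g f) = Cmp (One L) (\<phi>1 g) (\<phi>1 f)"
      "\<And>\<tau> \<sigma>. \<phi>2 (Cmp (Vert K) \<tau> \<sigma>) = Cmp (Vert L) (\<phi>2 \<tau>) (\<phi>2 \<sigma>)"
      "\<And>\<tau> \<sigma>. \<phi>2 (Cmp (Horiz K) \<tau> \<sigma>) = Cmp (Horiz L) (\<phi>2 \<tau>) (\<phi>2 \<sigma>)"
  shows "twocategory K"
proof -
  interpret twocategory L by (rule L)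
  note eqs = inj[THEN inj_eq, symmetric]
  show ?thesis
    by (rule twocategory.intro)
      (simp_all add: cat same_sets eqs(1) eqs(2) eqs(3) mem ops Ident_Horiz Horiz_Ident interchange)
qed

text \<open>
  These predicates describe the 1-cells and 2-cells of a slice by the middle component of a
  triple; the laws of the slice then become laws of the ambient 2-category for the middle
  components.
\<close>

definition slice_mor :: "('o, 'm, 't) twocat \<Rightarrow> 'o \<Rightarrow> 'm \<Rightarrow> 'm \<Rightarrow> 'm \<Rightarrow> bool" where
  "slice_mor K c p f q \<longleftrightarrow> p \<in> Cells1 K \<and> Cod (One K) p = c \<and> q \<in> Cells1 K \<and> Cod (One K) q = c \<and>
     f \<in> Hom (One K) (Dom (One K) p) (Dom (One K) q) \<and> Cmp (One K) q f = p"

definition slice_cell :: "('o, 'm, 't) twocat \<Rightarrow> 'o \<Rightarrow> 'm \<Rightarrow> 't \<Rightarrow> 'm \<Rightarrow> bool" where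
  "slice_cell K c p \<sigma> q \<longleftrightarrow> p \<in> Cells1 K \<and> Cod (One K) p = c \<and> q \<in> Cells1 K \<and> Cod (One K) q = c \<and>
     \<sigma> \<in> Hom (Horiz K) (Dom (One K) p) (Dom (One K) q) \<and>
     Cmp (Horiz K) (Ident (Vert K) q) \<sigma> = Ident (Vert K) p"

lemma slice_One [simp]: "Obj (One (slice K c)) = {p \<in> Cells1 K. Cod (One K) p = c}"
  "(p, f, q) \<in> Arr (One (slice K c)) \<longleftrightarrow> slice_mor K c p f q"
  "Dom (One (slice K c)) (p, f, q) = p" "Cod (One (slice K c)) (p, f, q) = q"
  "Ident (One (slice K c)) p = (p, Ident (One K) (Dom (One K) p), p)"
  "Cmp (One (slice K c)) (q', g, r) (p, f, q) = (p, Cmp (One K) g f, r)"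
  by (auto simp: slice_def Let_def slice_mor_def)

lemma slice_Vert [simp]: "Obj (Vert (slice K c)) = Cells1 (slice K c)"
  "(p, \<sigma>, q) \<in> Arr (Vert (slice K c)) \<longleftrightarrow> slice_cell K c p \<sigma> q"
  "Dom (Vert (slice K c)) (p, \<sigma>, q) = (p, Dom (Vert K) \<sigma>, q)"
  "Cod (Vert (slice K c)) (p, \<sigma>, q) = (p, Cod (Vert K) \<sigma>, q)"
  "Ident (Vert (slice K c)) (p, f, q) = (p, Ident (Vert K) f, q)"
  "Cmp (Vert (slice K c)) (p', \<tau>, q') (p, \<sigma>, q) = (p, Cmp (Vert K) \<tau> \<sigma>, q)"
  by (auto simp: slice_def Let_def slice_cell_def)

lemma slice_Horiz [simp]: "Obj (Horiz (slice K c)) = Cells0 (slice K c)"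
  "Arr (Horiz (slice K c)) = Cells2 (slice K c)"
  "Dom (Horiz (slice K c)) (p, \<sigma>, q) = p" "Cod (Horiz (slice K c)) (p, \<sigma>, q) = q"
  "Ident (Horiz (slice K c)) p = (p, Ident (Horiz K) (Dom (One K) p), p)"
  "Cmp (Horiz (slice K c)) (q', \<tau>, r) (p, \<sigma>, q) = (p, Cmp (Horiz K) \<tau> \<sigma>, r)"
  by (auto simp: slice_def Let_def)

context twocategory
begin

lemma slice_mor_Ident: "\<lbrakk>p \<in> Cells1 K; Cod (One K) p = c\<rbrakk> \<Longrightarrow> slice_mor K c p (Ident (One K) (Dom (One K) p)) p"
  by (simp add: slice_mor_def)

lemma slice_mor_Cmp:
  assumes g: "slice_mor K c q g r" and f: "slice_mor K c p f q"
  shows "slice_mor K c p (Cmp (One K) g f) r"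
proof -
  have "Cmp (One K) r (Cmp (One K) g f) = Cmp (One K) (Cmp (One K) r g) f"
    using g f by (intro O1.Cmp_assoc) (auto simp: slice_mor_def)
  then have "Cmp (One K) r (Cmp (One K) g f) = p"
    using g f by (simp only: slice_mor_def)
  then show ?thesis
    using g f unfolding slice_mor_def Hom_iff by (metis O1.Cmp_in O1.Dom_Cmp O1.Cod_Cmp)
qed

lemma slice_cell_bounds:
  assumes "slice_cell K c p \<sigma> q"
  shows "slice_mor K c p (Dom (Vert K) \<sigma>) q" "slice_mor K c p (Cod (Vert K) \<sigma>) q"
proof -
  have c: "p \<in> Cells1 K" "Cod (One K) p = c" "q \<in> Cells1 K" "Cod (One K) q = c"
    "\<sigma> \<in> Cells2 K" "Dom (Horiz K) \<sigma> = Dom (One K) p" "Cod (Horiz K) \<sigma> = Dom (One K) q"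
    and w: "Cmp (Horiz K) (Ident (Vert K) q) \<sigma> = Ident (Vert K) p"
    using assms by (auto simp: slice_cell_def)
  have h: "Cod (Horiz K) \<sigma> = Dom (Horiz K) (Ident (Vert K) q)" using c by simp
  have "Cmp (One K) q (Dom (Vert K) \<sigma>) = p"
    using Dom_Horiz[OF _ _ h] c(1,3,5) w by (metis V2_cat(3,4))
  moreover have "Cmp (One K) q (Cod (Vert K) \<sigma>) = p"
    using Cod_Horiz[OF _ _ h] c(1,3,5) w by (metis V2_cat(3,5))
  ultimately show "slice_mor K c p (Dom (Vert K) \<sigma>) q" "slice_mor K c p (Cod (Vert K) \<sigma>) q"
    using c by (simp_all only: slice_mor_def Hom_iff bounds V2_cat simp_thms)
qed

lemma slice_cell_Ident:
  assumes "slice_mor K c p f q"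
  shows "slice_cell K c p (Ident (Vert K) f) q"
proof -
  have "Cmp (Horiz K) (Ident (Vert K) q) (Ident (Vert K) f) = Ident (Vert K) (Cmp (One K) q f)"
    using assms by (intro Horiz_Ident) (auto simp: slice_mor_def)
  then show ?thesis
    using assms unfolding slice_cell_def slice_mor_def Hom_iff
    by (metis V2_cat(3) Dom_Ident2 Cod_Ident2 Arr_Horiz)
qed

lemma slice_cell_vert:
  assumes "slice_cell K c p \<tau> q" "slice_cell K c p \<sigma> q" "Cod (Vert K) \<sigma> = Dom (Vert K) \<tau>"
  shows "slice_cell K c p (Cmp (Vert K) \<tau> \<sigma>) q"
  using assms interchange[of \<sigma> \<tau> "Ident (Vert K) q" "Ident (Vert K) q"]
  by (simp add: slice_cell_def)

lemma slice_cell_horiz: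
  assumes "slice_cell K c q \<tau> r" "slice_cell K c p \<sigma> q"
  shows "slice_cell K c p (Cmp (Horiz K) \<tau> \<sigma>) r"
  using assms H2_assoc[of "Ident (Vert K) r" \<tau> \<sigma>] by (simp add: slice_cell_def)

lemma slice_mor_laws:
  "slice_mor K c p f q \<Longrightarrow> Cmp (One K) f (Ident (One K) (Dom (One K) p)) = f"
  "slice_mor K c p f q \<Longrightarrow> Cmp (One K) (Ident (One K) (Dom (One K) q)) f = f"
  "\<lbrakk>slice_mor K c r h s; slice_mor K c q g r; slice_mor K c p f q\<rbrakk>
    \<Longrightarrow> Cmp (One K) h (Cmp (One K) g f) = Cmp (One K) (Cmp (One K) h g) f"
  "\<lbrakk>slice_mor K c q g r; slice_mor K c p f q\<rbrakk>
    \<Longrightarrow> Cmp (Horiz K) (Ident (Vert K) g) (Ident (Vert K) f) = Ident (Vert K) (Cmp (One K) g f)"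
  by (simp_all add: slice_mor_def O1.Cmp_assoc Horiz_Ident)

lemma slice_cell_laws:
  "slice_cell K c p \<sigma> q \<Longrightarrow> Cmp (Vert K) \<sigma> (Ident (Vert K) (Dom (Vert K) \<sigma>)) = \<sigma>"
  "slice_cell K c p \<sigma> q \<Longrightarrow> Cmp (Vert K) (Ident (Vert K) (Cod (Vert K) \<sigma>)) \<sigma> = \<sigma>"
  "\<lbrakk>slice_cell K c p \<upsilon> q; slice_cell K c p \<tau> q; slice_cell K c p \<sigma> q;
     Cod (Vert K) \<sigma> = Dom (Vert K) \<tau>; Cod (Vert K) \<tau> = Dom (Vert K) \<upsilon>\<rbrakk>
    \<Longrightarrow> Cmp (Vert K) \<upsilon> (Cmp (Vert K) \<tau> \<sigma>) = Cmp (Vert K) (Cmp (Vert K) \<upsilon> \<tau>) \<sigma>"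
  "slice_cell K c p \<sigma> q \<Longrightarrow> Cmp (Horiz K) \<sigma> (Ident (Horiz K) (Dom (One K) p)) = \<sigma>"
  "slice_cell K c p \<sigma> q \<Longrightarrow> Cmp (Horiz K) (Ident (Horiz K) (Dom (One K) q)) \<sigma> = \<sigma>"
  "\<lbrakk>slice_cell K c r \<upsilon> s; slice_cell K c q \<tau> r; slice_cell K c p \<sigma> q\<rbrakk>
    \<Longrightarrow> Cmp (Horiz K) \<upsilon> (Cmp (Horiz K) \<tau> \<sigma>) = Cmp (Horiz K) (Cmp (Horiz K) \<upsilon> \<tau>) \<sigma>"
  "\<lbrakk>slice_cell K c q \<tau> r; slice_cell K c p \<sigma> q\<rbrakk>
    \<Longrightarrow> Dom (Vert K) (Cmp (Horiz K) \<tau> \<sigma>) = Cmp (One K) (Dom (Vert K) \<tau>) (Dom (Vert K) \<sigma>)"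
  "\<lbrakk>slice_cell K c q \<tau> r; slice_cell K c p \<sigma> q\<rbrakk>
    \<Longrightarrow> Cod (Vert K) (Cmp (Horiz K) \<tau> \<sigma>) = Cmp (One K) (Cod (Vert K) \<tau>) (Cod (Vert K) \<sigma>)"
  "\<lbrakk>slice_cell K c p \<sigma> q; slice_cell K c p \<sigma>' q; slice_cell K c q \<tau> r; slice_cell K c q \<tau>' r;
     Cod (Vert K) \<sigma> = Dom (Vert K) \<sigma>'; Cod (Vert K) \<tau> = Dom (Vert K) \<tau>'\<rbrakk>
    \<Longrightarrow> Cmp (Horiz K) (Cmp (Vert K) \<tau>' \<tau>) (Cmp (Vert K) \<sigma>' \<sigma>) =
        Cmp (Vert K) (Cmp (Horiz K) \<tau>' \<sigma>') (Cmp (Horiz K) \<tau> \<sigma>)"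
  by (simp_all add: slice_cell_def V2.Cmp_assoc H2_assoc interchange)

lemma slice_cell_vert_bounds:
  "\<lbrakk>slice_cell K c p \<tau> q; slice_cell K c p \<sigma> q; Cod (Vert K) \<sigma> = Dom (Vert K) \<tau>\<rbrakk>
    \<Longrightarrow> Dom (Vert K) (Cmp (Vert K) \<tau> \<sigma>) = Dom (Vert K) \<sigma>"
  "\<lbrakk>slice_cell K c p \<tau> q; slice_cell K c p \<sigma> q; Cod (Vert K) \<sigma> = Dom (Vert K) \<tau>\<rbrakk>
    \<Longrightarrow> Cod (Vert K) (Cmp (Vert K) \<tau> \<sigma>) = Cod (Vert K) \<tau>"
  "slice_mor K c p f q \<Longrightarrow> Dom (Vert K) (Ident (Vert K) f) = f"
  "slice_mor K c p f q \<Longrightarrow> Cod (Vert K) (Ident (Vert K) f) = f"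
  by (simp_all add: slice_cell_def slice_mor_def)

lemma slice_cell_Ident_Horiz:
  "\<lbrakk>p \<in> Cells1 K; Cod (One K) p = c\<rbrakk> \<Longrightarrow> slice_cell K c p (Ident (Horiz K) (Dom (One K) p)) p"
  by (simp add: Ident_Horiz slice_mor_Ident slice_cell_Ident)

lemma slice_objs: "slice_mor K c p f q \<Longrightarrow> p \<in> Cells1 K \<and> Cod (One K) p = c \<and> q \<in> Cells1 K \<and> Cod (One K) q = c"
  "slice_cell K c p \<sigma> q \<Longrightarrow> p \<in> Cells1 K \<and> Cod (One K) p = c \<and> q \<in> Cells1 K \<and> Cod (One K) q = c"
  by (simp_all add: slice_mor_def slice_cell_def)

lemma twocategory_slice: "twocategory (slice K c)"
proof (rule twocategory.intro)
  note facts = slice_mor_Ident slice_mor_Cmp slice_cell_bounds slice_cell_Ident slice_cell_vert slice_cell_horiz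
    slice_mor_laws slice_cell_laws slice_cell_vert_bounds slice_cell_Ident_Horiz
  show "category (One (slice K c))"
    by (rule category.intro) (auto intro: facts dest: slice_objs)
  show "category (Vert (slice K c))"
    by (rule category.intro) (auto intro: facts dest: slice_objs)
  show "category (Horiz (slice K c))"
    by (rule category.intro) (auto intro: facts dest: slice_objs)
qed (auto intro: slice_mor_laws slice_cell_laws dest: slice_objs simp: Ident_Horiz)

end

lemma twocategory_two_full_sub:
  assumes "twocategory K" shows "twocategory (two_full_sub S K)"
proof -
  interpret twocategory K by (rule assms)
  show ?thesis
  proof (rule twocategory.intro)
    show "category (One (two_full_sub S K))"
      by (rule category.intro) (simp_all add: two_full_sub_def full_subcat_def Let_def O1.Cmp_assoc)
    show "category (Vert (two_full_sub S K))"
      by (rule category.intro) (simp_all add: two_full_sub_def full_subcat_def Let_def V2.Cmp_assoc vert_parallel[symmetric])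
    show "category (Horiz (two_full_sub S K))"
      by (rule category.intro) (simp_all add: two_full_sub_def full_subcat_def Let_def H2_assoc)
  next
    fix \<sigma> \<sigma>' \<tau> \<tau>'
    let ?L = "two_full_sub S K"
    assume "\<sigma> \<in> Cells2 ?L" "\<sigma>' \<in> Cells2 ?L" "\<tau> \<in> Cells2 ?L" "\<tau>' \<in> Cells2 ?L"
      "Cod (Vert ?L) \<sigma> = Dom (Vert ?L) \<sigma>'" "Cod (Vert ?L) \<tau> = Dom (Vert ?L) \<tau>'"
      "Cod (Horiz ?L) \<sigma> = Dom (Horiz ?L) \<tau>"
    then show "Cmp (Horiz ?L) (Cmp (Vert ?L) \<tau>' \<tau>) (Cmp (Vert ?L) \<sigma>' \<sigma>) =
      Cmp (Vert ?L) (Cmp (Horiz ?L) \<tau>' \<sigma>') (Cmp (Horiz ?L) \<tau> \<sigma>)"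
      using interchange[of \<sigma> \<sigma>' \<tau> \<tau>'] unfolding two_full_sub_def full_subcat_def Let_def by simp
  qed (simp_all add: two_full_sub_def full_subcat_def Let_def Ident_Horiz Horiz_Ident)
qed

subsection \<open>A criterion for 2-equivalences\<close>

text \<open>
  A fully faithful functor with chosen isomorphisms onto every object of the target has an
  inverse by conjugation. The locale is used for 1-cells and, with the identity 2-cells on the
  same isomorphisms, for 2-cells composed along objects; sharing the choices is what makes the
  two inverses fit together.
\<close>

locale fully_faithful_with_inverses =
  K: category K + L: category L for K :: "('o, 'm) cat" and L :: "('p, 'n) cat" +
  fixes Fo :: "'o \<Rightarrow> 'p" and Fa :: "'m \<Rightarrow> 'n" and Go :: "'p \<Rightarrow> 'o" and e e' :: "'p \<Rightarrow> 'n"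
  assumes F: "is_functor K L Fo Fa"
    and full: "\<lbrakk>x \<in> Obj K; y \<in> Obj K; g \<in> Hom L (Fo x) (Fo y)\<rbrakk> \<Longrightarrow> \<exists>f\<in>Hom K x y. Fa f = g"
    and faithful: "\<lbrakk>f \<in> Hom K x y; f' \<in> Hom K x y; Fa f = Fa f'\<rbrakk> \<Longrightarrow> f = f'"
    and Go_in [simp]: "p \<in> Obj L \<Longrightarrow> Go p \<in> Obj K"
    and e: "p \<in> Obj L \<Longrightarrow> e p \<in> Hom L (Fo (Go p)) p"
    and e': "p \<in> Obj L \<Longrightarrow> e' p \<in> Hom L p (Fo (Go p))"
    and e_e': "p \<in> Obj L \<Longrightarrow> Cmp L (e p) (e' p) = Ident L p"
    and e'_e: "p \<in> Obj L \<Longrightarrow> Cmp L (e' p) (e p) = Ident L (Fo (Go p))"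
begin

lemma F_simps [simp]:
  "x \<in> Obj K \<Longrightarrow> Fo x \<in> Obj L" "f \<in> Arr K \<Longrightarrow> Fa f \<in> Arr L"
  "f \<in> Arr K \<Longrightarrow> Dom L (Fa f) = Fo (Dom K f)" "f \<in> Arr K \<Longrightarrow> Cod L (Fa f) = Fo (Cod K f)"
  "x \<in> Obj K \<Longrightarrow> Fa (Ident K x) = Ident L (Fo x)"
  "\<lbrakk>g \<in> Arr K; f \<in> Arr K; Cod K f = Dom K g\<rbrakk> \<Longrightarrow> Fa (Cmp K g f) = Cmp L (Fa g) (Fa f)"
  using F by (auto simp: is_functor_def)

lemma e_simps [simp]:
  "p \<in> Obj L \<Longrightarrow> e p \<in> Arr L" "p \<in> Obj L \<Longrightarrow> Dom L (e p) = Fo (Go p)" "p \<in> Obj L \<Longrightarrow> Cod L (e p) = p"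
  "p \<in> Obj L \<Longrightarrow> e' p \<in> Arr L" "p \<in> Obj L \<Longrightarrow> Cod L (e' p) = Fo (Go p)" "p \<in> Obj L \<Longrightarrow> Dom L (e' p) = p"
  using e e' by auto

definition conj_arr :: "'n \<Rightarrow> 'n" where
  "conj_arr g = Cmp L (e' (Cod L g)) (Cmp L g (e (Dom L g)))"

definition Ga :: "'n \<Rightarrow> 'm" where
  "Ga g = (SOME f. f \<in> Hom K (Go (Dom L g)) (Go (Cod L g)) \<and> Fa f = conj_arr g)"

lemma Ga:
  assumes "g \<in> Arr L"
  shows "Ga g \<in> Hom K (Go (Dom L g)) (Go (Cod L g))" "Fa (Ga g) = conj_arr g"
proof -
  have "conj_arr g \<in> Hom L (Fo (Go (Dom L g))) (Fo (Go (Cod L g)))"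
    using assms by (simp add: conj_arr_def)
  then have "\<exists>f. f \<in> Hom K (Go (Dom L g)) (Go (Cod L g)) \<and> Fa f = conj_arr g"
    using full[of "Go (Dom L g)" "Go (Cod L g)" "conj_arr g"] assms by (auto simp: Bex_def)
  then have "Ga g \<in> Hom K (Go (Dom L g)) (Go (Cod L g)) \<and> Fa (Ga g) = conj_arr g"
    unfolding Ga_def by (rule someI_ex)
  then show "Ga g \<in> Hom K (Go (Dom L g)) (Go (Cod L g))" "Fa (Ga g) = conj_arr g" by auto
qed

lemma Ga_simps [simp]:
  "g \<in> Arr L \<Longrightarrow> Ga g \<in> Arr K" "g \<in> Arr L \<Longrightarrow> Dom K (Ga g) = Go (Dom L g)"
  "g \<in> Arr L \<Longrightarrow> Cod K (Ga g) = Go (Cod L g)" "g \<in> Arr L \<Longrightarrow> Fa (Ga g) = conj_arr g"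
  using Ga by auto

lemma Ga_eqI: "\<lbrakk>g \<in> Arr L; f \<in> Hom K (Go (Dom L g)) (Go (Cod L g)); Fa f = conj_arr g\<rbrakk> \<Longrightarrow> Ga g = f"
  using faithful[OF Ga(1)] by simp

lemma e_cancel [simp]: "\<lbrakk>p \<in> Obj L; g \<in> Arr L; Cod L g = p\<rbrakk> \<Longrightarrow> Cmp L (e p) (Cmp L (e' p) g) = g"
  by (simp add: L.Cmp_assoc e_e')

lemma conj_arr_Cmp:
  assumes "h \<in> Arr L" "g \<in> Arr L" "Cod L g = Dom L h"
  shows "Cmp L (conj_arr h) (conj_arr g) = conj_arr (Cmp L h g)"
proof -
  have "Cmp L (Cmp L h (e (Dom L h))) (Cmp L (e' (Dom L h)) (Cmp L g (e (Dom L g)))) =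
    Cmp L h (Cmp L g (e (Dom L g)))"
    using assms by (simp add: L.Cmp_assoc[symmetric])
  then show ?thesis
    using assms by (simp add: conj_arr_def L.Cmp_assoc[symmetric])
qed

lemma inverse_functor: "is_functor L K Go Ga"
proof -
  have "Ga (Ident L p) = Ident K (Go p)" if "p \<in> Obj L" for p
    using that by (intro Ga_eqI) (simp_all add: conj_arr_def e'_e)
  moreover have "Ga (Cmp L h g) = Cmp K (Ga h) (Ga g)"
    if "h \<in> Arr L" "g \<in> Arr L" "Cod L g = Dom L h" for h g
    using that by (intro Ga_eqI) (simp_all add: conj_arr_Cmp)
  ultimately show ?thesis by (simp add: is_functor_def)
qed

lemma counit_natural: "g \<in> Arr L \<Longrightarrow> Cmp L g (e (Dom L g)) = Cmp L (e (Cod L g)) (Fa (Ga g))"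
  by (simp add: conj_arr_def)

definition unit :: "'o \<Rightarrow> 'm" where
  "unit x = (SOME f. f \<in> Hom K x (Go (Fo x)) \<and> Fa f = e' (Fo x))"

lemma unit_simps [simp]:
  assumes "x \<in> Obj K"
  shows "unit x \<in> Arr K" "Dom K (unit x) = x" "Cod K (unit x) = Go (Fo x)" "Fa (unit x) = e' (Fo x)"
proof -
  have "\<exists>f. f \<in> Hom K x (Go (Fo x)) \<and> Fa f = e' (Fo x)"
    using full[of x "Go (Fo x)" "e' (Fo x)"] assms by (auto simp: Bex_def)
  then have "unit x \<in> Hom K x (Go (Fo x)) \<and> Fa (unit x) = e' (Fo x)"
    unfolding unit_def by (rule someI_ex)
  then show "unit x \<in> Arr K" "Dom K (unit x) = x" "Cod K (unit x) = Go (Fo x)" "Fa (unit x) = e' (Fo x)"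
    by auto
qed

lemma unit_eqI: "\<lbrakk>x \<in> Obj K; f \<in> Hom K x (Go (Fo x)); Fa f = e' (Fo x)\<rbrakk> \<Longrightarrow> unit x = f"
  using faithful[of "unit x" x "Go (Fo x)" f] by simp

lemma unit_natural:
  assumes f: "f \<in> Arr K"
  shows "Cmp K (Ga (Fa f)) (unit (Dom K f)) = Cmp K (unit (Cod K f)) f"
proof (rule faithful)
  have "Cmp L (Cmp L (Fa f) (e (Fo (Dom K f)))) (e' (Fo (Dom K f))) = Fa f"
    using f by (simp add: L.Cmp_assoc[symmetric] e_e')
  then show "Fa (Cmp K (Ga (Fa f)) (unit (Dom K f))) = Fa (Cmp K (unit (Cod K f)) f)"
    using f by (simp add: conj_arr_def L.Cmp_assoc[symmetric] e_e')
qed (use f in simp_all)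

lemma unit_iso:
  assumes x: "x \<in> Obj K"
  shows "iso_arr K (unit x)"
proof -
  obtain n where n: "n \<in> Arr K" "Dom K n = Go (Fo x)" "Cod K n = x" "Fa n = e (Fo x)"
    using full[of "Go (Fo x)" x "e (Fo x)"] x by auto
  have "Cmp K n (unit x) = Ident K x"
    by (rule faithful[of _ x x]) (use n x in \<open>simp_all add: e_e'\<close>)
  moreover have "Cmp K (unit x) n = Ident K (Go (Fo x))"
    by (rule faithful[of _ "Go (Fo x)" "Go (Fo x)"]) (use n x in \<open>simp_all add: e'_e\<close>)
  ultimately show ?thesis using n x unfolding iso_arr_def by auto
qed

end

text \<open>
  The inverses at the two levels have the same effect on objects. Fullness and faithfulness
  characterise the preimage of a conjugate uniquely, and this uniqueness shows that the inverse
  on 2-cells respects boundaries, vertical identities and vertical composition.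
\<close>

theorem two_equivalence_criterion:
  fixes K :: "('o, 'm, 't) twocat" and L :: "('p, 'n, 's) twocat"
  assumes K: "twocategory K" and L: "twocategory L" and F: "twofunctor K L F"
    and full1: "\<And>x y g. \<lbrakk>x \<in> Cells0 K; y \<in> Cells0 K; g \<in> Hom (One L) (on0 F x) (on0 F y)\<rbrakk>
      \<Longrightarrow> \<exists>f\<in>Hom (One K) x y. on1 F f = g"
    and faithful1: "\<And>x y f f'. \<lbrakk>f \<in> Hom (One K) x y; f' \<in> Hom (One K) x y; on1 F f = on1 F f'\<rbrakk> \<Longrightarrow> f = f'"
    and full2: "\<And>x y \<tau>. \<lbrakk>x \<in> Cells0 K; y \<in> Cells0 K; \<tau> \<in> Hom (Horiz L) (on0 F x) (on0 F y)\<rbrakk>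
      \<Longrightarrow> \<exists>\<sigma>\<in>Hom (Horiz K) x y. on2 F \<sigma> = \<tau>"
    and faithful2: "\<And>x y \<sigma> \<sigma>'. \<lbrakk>\<sigma> \<in> Hom (Horiz K) x y; \<sigma>' \<in> Hom (Horiz K) x y; on2 F \<sigma> = on2 F \<sigma>'\<rbrakk>
      \<Longrightarrow> \<sigma> = \<sigma>'"
    and surj: "\<And>p. p \<in> Cells0 L \<Longrightarrow> \<exists>x\<in>Cells0 K. \<exists>i\<in>Hom (One L) (on0 F x) p. iso_arr (One L) i"
  shows "two_equivalence K L F"
proof -
  interpret K: twocategory K by (rule K)
  interpret L: twocategory L by (rule L)
  define good where "good p = (\<lambda>(x, i, j). x \<in> Cells0 K \<and> i \<in> Hom (One L) (on0 F x) p \<and>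
      j \<in> Hom (One L) p (on0 F x) \<and> Cmp (One L) i j = Ident (One L) p \<and>
      Cmp (One L) j i = Ident (One L) (on0 F x))" for p
  have "\<exists>t. good p t" if p: "p \<in> Cells0 L" for p
  proof -
    obtain x i where x: "x \<in> Cells0 K" "i \<in> Hom (One L) (on0 F x) p" "iso_arr (One L) i"
      using surj[OF p] by blast
    then obtain j where "good p (x, i, j)"
      unfolding iso_arr_def good_def by auto
    then show ?thesis by blast
  qed
  then obtain t where t: "\<And>p. p \<in> Cells0 L \<Longrightarrow> good p (t p)" by metis
  define Go e e' where "Go p = fst (t p)" and "e p = fst (snd (t p))" and "e' p = snd (snd (t p))" for p
  have inv: "Go p \<in> Cells0 K \<and> e p \<in> Hom (One L) (on0 F (Go p)) p \<and>
      e' p \<in> Hom (One L) p (on0 F (Go p)) \<and> Cmp (One L) (e p) (e' p) = Ident (One L) p \<and>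
      Cmp (One L) (e' p) (e p) = Ident (One L) (on0 F (Go p))" if "p \<in> Cells0 L" for p
    using t[OF that] by (simp add: good_def Go_def e_def e'_def split_beta)
  have F1: "is_functor (One K) (One L) (on0 F) (on1 F)"
    and Fv: "is_functor (Vert K) (Vert L) (on1 F) (on2 F)"
    and F2: "is_functor (Horiz K) (Horiz L) (on0 F) (on2 F)"
    using F by (auto simp: twofunctor_def)
  have Fv_simps: "\<sigma> \<in> Cells2 K \<Longrightarrow> Dom (Vert L) (on2 F \<sigma>) = on1 F (Dom (Vert K) \<sigma>)"
    "\<sigma> \<in> Cells2 K \<Longrightarrow> Cod (Vert L) (on2 F \<sigma>) = on1 F (Cod (Vert K) \<sigma>)"
    "f \<in> Cells1 K \<Longrightarrow> on2 F (Ident (Vert K) f) = Ident (Vert L) (on1 F f)"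
    "\<lbrakk>\<tau> \<in> Cells2 K; \<sigma> \<in> Cells2 K; Cod (Vert K) \<sigma> = Dom (Vert K) \<tau>\<rbrakk>
      \<Longrightarrow> on2 F (Cmp (Vert K) \<tau> \<sigma>) = Cmp (Vert L) (on2 F \<tau>) (on2 F \<sigma>)" for \<sigma> \<tau> f
    using Fv by (auto simp: is_functor_def)
  interpret A1: fully_faithful_with_inverses "One K" "One L" "on0 F" "on1 F" Go e e'
  proof unfold_locales
    show "f = f'" if "f \<in> Hom (One K) x y" "f' \<in> Hom (One K) x y" "on1 F f = on1 F f'" for f f' x y
      using faithful1 that by blast
  qed (use F1 inv full1 in auto)
  interpret A2: fully_faithful_with_inverses "Horiz K" "Horiz L" "on0 F" "on2 F" Go
    "\<lambda>p. Ident (Vert L) (e p)" "\<lambda>p. Ident (Vert L) (e' p)"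
  proof unfold_locales
    show "\<sigma> = \<sigma>'" if "\<sigma> \<in> Hom (Horiz K) x y" "\<sigma>' \<in> Hom (Horiz K) x y" "on2 F \<sigma> = on2 F \<sigma>'" for \<sigma> \<sigma>' x y
      using faithful2 that by blast
    show "\<exists>f\<in>Hom (Horiz K) x y. on2 F f = g"
      if "x \<in> Obj (Horiz K)" "y \<in> Obj (Horiz K)" "g \<in> Hom (Horiz L) (on0 F x) (on0 F y)" for x y g
      using full2 that by simp
  qed (use F2 inv in \<open>auto simp: L.Horiz_Ident L.Ident_Horiz\<close>)
  have conj2: "A2.conj_arr \<tau> \<in> Cells2 L" "Dom (Vert L) (A2.conj_arr \<tau>) = A1.conj_arr (Dom (Vert L) \<tau>)"
    "Cod (Vert L) (A2.conj_arr \<tau>) = A1.conj_arr (Cod (Vert L) \<tau>)" if "\<tau> \<in> Cells2 L" for \<tau>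
    using that by (simp_all add: A2.conj_arr_def A1.conj_arr_def)
  let ?G = "\<lparr>on0 = Go, on1 = A1.Ga, on2 = A2.Ga\<rparr>"
  have D: "Dom (Vert K) (A2.Ga \<tau>) = A1.Ga (Dom (Vert L) \<tau>)" "Cod (Vert K) (A2.Ga \<tau>) = A1.Ga (Cod (Vert L) \<tau>)"
    if t: "\<tau> \<in> Cells2 L" for \<tau>
  proof -
    have G: "A2.Ga \<tau> \<in> Cells2 K" using A2.Ga_simps(1)[of \<tau>] t by simp
    show "Dom (Vert K) (A2.Ga \<tau>) = A1.Ga (Dom (Vert L) \<tau>)"
      using t G by (intro A1.Ga_eqI[symmetric]) (simp_all add: Fv_simps(1,2)[symmetric] conj2)
    show "Cod (Vert K) (A2.Ga \<tau>) = A1.Ga (Cod (Vert L) \<tau>)"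
      using t G by (intro A1.Ga_eqI[symmetric]) (simp_all add: Fv_simps(1,2)[symmetric] conj2)
  qed
  have I: "A2.Ga (Ident (Vert L) g) = Ident (Vert K) (A1.Ga g)" if "g \<in> Cells1 L" for g
    using that by (intro A2.Ga_eqI) (simp_all add: Fv_simps A1.conj_arr_def A2.conj_arr_def L.Horiz_Ident)
  \<comment> \<open>Conjugation of 2-cells is whiskering, which preserves vertical composition by interchange.\<close>
  have conj_Cmp: "A2.conj_arr (Cmp (Vert L) \<tau> \<sigma>) = Cmp (Vert L) (A2.conj_arr \<tau>) (A2.conj_arr \<sigma>)"
    if c: "\<tau> \<in> Cells2 L" "\<sigma> \<in> Cells2 L" "Cod (Vert L) \<sigma> = Dom (Vert L) \<tau>" for \<tau> \<sigma>
  proof -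
    note par = L.vert_parallel[OF c]
    let ?d = "Ident (Vert L) (e (Dom (Horiz L) \<sigma>))" and ?c = "Ident (Vert L) (e' (Cod (Horiz L) \<sigma>))"
    have "Cmp (Horiz L) (Cmp (Vert L) \<tau> \<sigma>) ?d =
        Cmp (Vert L) (Cmp (Horiz L) \<tau> ?d) (Cmp (Horiz L) \<sigma> ?d)"
      using c L.interchange[of ?d ?d \<sigma> \<tau>] by simp
    moreover have "Cmp (Horiz L) ?c (Cmp (Vert L) (Cmp (Horiz L) \<tau> ?d) (Cmp (Horiz L) \<sigma> ?d)) =
        Cmp (Vert L) (Cmp (Horiz L) ?c (Cmp (Horiz L) \<tau> ?d)) (Cmp (Horiz L) ?c (Cmp (Horiz L) \<sigma> ?d))"
      using c par L.interchange[of "Cmp (Horiz L) \<sigma> ?d" "Cmp (Horiz L) \<tau> ?d" ?c ?c] by simp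
    ultimately show ?thesis using c par by (simp add: A2.conj_arr_def)
  qed
  have "A2.Ga (Cmp (Vert L) \<tau> \<sigma>) = Cmp (Vert K) (A2.Ga \<tau>) (A2.Ga \<sigma>)"
    if c: "\<tau> \<in> Cells2 L" "\<sigma> \<in> Cells2 L" "Cod (Vert L) \<sigma> = Dom (Vert L) \<tau>" for \<tau> \<sigma>
  proof -
    have G: "A2.Ga \<tau> \<in> Cells2 K" "A2.Ga \<sigma> \<in> Cells2 K" using A2.Ga_simps(1) c by simp_all
    show ?thesis
      using c G L.vert_parallel[OF c]
      by (intro A2.Ga_eqI) (simp_all add: Fv_simps D conj_Cmp)
  qed
  then have "twofunctor L K ?G"
    using A1.inverse_functor A2.inverse_functor D I A2.Ga_simps(1) by (simp add: twofunctor_def is_functor_def)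
  moreover have "A2.unit x = Ident (Vert K) (A1.unit x)" if "x \<in> Cells0 K" for x
    using that by (intro A2.unit_eqI) (simp_all add: Fv_simps)
  then have "two_natural_iso K K twofun_id (twofun_comp ?G F) A1.unit"
    using A1.unit_natural A2.unit_natural A1.unit_iso
    by (simp add: two_natural_iso_def two_natural_def twofun_id_def twofun_comp_def)
  moreover have "iso_arr (One L) (e p)" if "p \<in> Cells0 L" for p
    using inv[OF that] unfolding iso_arr_def by auto
  then have "two_natural_iso L L (twofun_comp F ?G) twofun_id e"
    using A1.counit_natural A2.counit_natural
    by (simp add: two_natural_iso_def two_natural_def twofun_id_def twofun_comp_def)
  ultimately show ?thesis using K L F unfolding two_equivalence_def by blast
qed

section \<open>Double categories and double functors\<close>

context double_category
begin

sublocale H: small_category "HCat C" by (rule HCat)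
sublocale V: small_category "VCat C" by (rule VCat)
sublocale SH: small_category "SHCat C" by (rule SHCat)
sublocale SV: small_category "SVCat C" by (rule SVCat)

lemmas dc_sets [simp] = Obj_VCat Obj_SHCat Obj_SVCat Arr_SVCat
lemmas dc_V [simp] = V.cat[unfolded Obj_VCat]
lemmas dc_SH [simp] = SH.cat[unfolded Obj_SHCat]
lemmas dc_SV [simp] = SV.cat[unfolded Obj_SVCat Arr_SVCat]
lemmas SV_assoc = SV.Cmp_assoc[unfolded Arr_SVCat]
lemmas dc_corners [simp] = corner_upper_left corner_upper_right corner_lower_left corner_lower_right
lemmas dc_bounds [simp] = upper_Cmp lower_Cmp lft_Cmp rgt_Cmp upper_Ident lower_Ident lft_Ident rgt_Ident

end

text \<open>
  The locales for structure-preserving maps take the source and the target as separate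
  parameters, so that their cells are written without selecting them from the record of the map.
\<close>

locale dfunctor =
  fixes F :: "'u::universe dfun" and E C :: "'u dblcat"
  assumes F: "double_functor F" and dsrc [simp]: "dsrc F = E" and dtgt [simp]: "dtgt F = C"
begin

sublocale double_functor F by (rule F)

lemma dc_dom: "double_category E" and dc_cod: "double_category C"
  using src tgt by simp_all

sublocale E: double_category E by (rule dc_dom)
sublocale C: double_category C by (rule dc_cod)

lemma parts: "small_functor (HCat E) (HCat C) \<lparr>fo = fO F, fa = fH F\<rparr>"
  "small_functor (VCat E) (VCat C) \<lparr>fo = fO F, fa = fV F\<rparr>"
  "small_functor (SHCat E) (SHCat C) \<lparr>fo = fV F, fa = fS F\<rparr>"
  "small_functor (SVCat E) (SVCat C) \<lparr>fo = fH F, fa = fS F\<rparr>"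
  using on_HCat on_VCat on_SHCat on_SVCat by simp_all

lemma ext: "fO F \<in> extensional (Ob E)" "fH F \<in> extensional (Hor E)" "fV F \<in> extensional (Ver E)"
  "fS F \<in> extensional (Sq E)"
  using parts by (simp_all add: small_functor_def)

lemma on_cells [simp]:
  "x \<in> Ob E \<Longrightarrow> fO F x \<in> Ob C" "h \<in> Hor E \<Longrightarrow> fH F h \<in> Hor C" "u \<in> Ver E \<Longrightarrow> fV F u \<in> Ver C"
  "\<sigma> \<in> Sq E \<Longrightarrow> fS F \<sigma> \<in> Sq C"
  using parts by (auto simp: small_functor_def is_functor_def)

lemma on_bounds [simp]:
  "h \<in> Hor E \<Longrightarrow> Dom (HCat C) (fH F h) = fO F (Dom (HCat E) h)"
  "h \<in> Hor E \<Longrightarrow> Cod (HCat C) (fH F h) = fO F (Cod (HCat E) h)"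
  "u \<in> Ver E \<Longrightarrow> Dom (VCat C) (fV F u) = fO F (Dom (VCat E) u)"
  "u \<in> Ver E \<Longrightarrow> Cod (VCat C) (fV F u) = fO F (Cod (VCat E) u)"
  "\<sigma> \<in> Sq E \<Longrightarrow> lft C (fS F \<sigma>) = fV F (lft E \<sigma>)" "\<sigma> \<in> Sq E \<Longrightarrow> rgt C (fS F \<sigma>) = fV F (rgt E \<sigma>)"
  "\<sigma> \<in> Sq E \<Longrightarrow> upper C (fS F \<sigma>) = fH F (upper E \<sigma>)" "\<sigma> \<in> Sq E \<Longrightarrow> lower C (fS F \<sigma>) = fH F (lower E \<sigma>)"
  using parts by (auto simp: small_functor_def is_functor_def)

lemma on_Ident [simp]:
  "x \<in> Ob E \<Longrightarrow> fH F (Ident (HCat E) x) = Ident (HCat C) (fO F x)"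
  "x \<in> Ob E \<Longrightarrow> fV F (Ident (VCat E) x) = Ident (VCat C) (fO F x)"
  "u \<in> Ver E \<Longrightarrow> fS F (Ident (SHCat E) u) = Ident (SHCat C) (fV F u)"
  "h \<in> Hor E \<Longrightarrow> fS F (Ident (SVCat E) h) = Ident (SVCat C) (fH F h)"
  using parts by (auto simp: small_functor_def is_functor_def)

lemma on_Cmp [simp]:
  "\<lbrakk>k \<in> Hor E; h \<in> Hor E; Cod (HCat E) h = Dom (HCat E) k\<rbrakk>
    \<Longrightarrow> fH F (Cmp (HCat E) k h) = Cmp (HCat C) (fH F k) (fH F h)"
  "\<lbrakk>w \<in> Ver E; u \<in> Ver E; Cod (VCat E) u = Dom (VCat E) w\<rbrakk>
    \<Longrightarrow> fV F (Cmp (VCat E) w u) = Cmp (VCat C) (fV F w) (fV F u)"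
  "\<lbrakk>\<tau> \<in> Sq E; \<sigma> \<in> Sq E; rgt E \<sigma> = lft E \<tau>\<rbrakk>
    \<Longrightarrow> fS F (Cmp (SHCat E) \<tau> \<sigma>) = Cmp (SHCat C) (fS F \<tau>) (fS F \<sigma>)"
  "\<lbrakk>\<tau> \<in> Sq E; \<sigma> \<in> Sq E; lower E \<sigma> = upper E \<tau>\<rbrakk>
    \<Longrightarrow> fS F (Cmp (SVCat E) \<tau> \<sigma>) = Cmp (SVCat C) (fS F \<tau>) (fS F \<sigma>)"
  using parts by (auto simp: small_functor_def is_functor_def)

end

lemma dfunctorI:
  assumes E: "double_category E" and C: "double_category C" and st: "dsrc F = E" "dtgt F = C"
    and ext: "fO F \<in> extensional (Ob E)" "fH F \<in> extensional (Hor E)" "fV F \<in> extensional (Ver E)"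
      "fS F \<in> extensional (Sq E)"
    and O: "\<And>x. x \<in> Ob E \<Longrightarrow> fO F x \<in> Ob C"
    and H: "\<And>h. h \<in> Hor E \<Longrightarrow> fH F h \<in> Hom (HCat C) (fO F (Dom (HCat E) h)) (fO F (Cod (HCat E) h))"
    and V: "\<And>u. u \<in> Ver E \<Longrightarrow> fV F u \<in> Hom (VCat C) (fO F (Dom (VCat E) u)) (fO F (Cod (VCat E) u))"
    and S: "\<And>\<sigma>. \<sigma> \<in> Sq E \<Longrightarrow> fS F \<sigma> \<in> Hom (SHCat C) (fV F (lft E \<sigma>)) (fV F (rgt E \<sigma>))"
      "\<And>\<sigma>. \<sigma> \<in> Sq E \<Longrightarrow> fS F \<sigma> \<in> Hom (SVCat C) (fH F (upper E \<sigma>)) (fH F (lower E \<sigma>))"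
    and I: "\<And>x. x \<in> Ob E \<Longrightarrow> fH F (Ident (HCat E) x) = Ident (HCat C) (fO F x)"
      "\<And>x. x \<in> Ob E \<Longrightarrow> fV F (Ident (VCat E) x) = Ident (VCat C) (fO F x)"
      "\<And>u. u \<in> Ver E \<Longrightarrow> fS F (Ident (SHCat E) u) = Ident (SHCat C) (fV F u)"
      "\<And>h. h \<in> Hor E \<Longrightarrow> fS F (Ident (SVCat E) h) = Ident (SVCat C) (fH F h)"
    and M: "\<And>k h. \<lbrakk>k \<in> Hor E; h \<in> Hor E; Cod (HCat E) h = Dom (HCat E) k\<rbrakk>
        \<Longrightarrow> fH F (Cmp (HCat E) k h) = Cmp (HCat C) (fH F k) (fH F h)"
      "\<And>w u. \<lbrakk>w \<in> Ver E; u \<in> Ver E; Cod (VCat E) u = Dom (VCat E) w\<rbrakk>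
        \<Longrightarrow> fV F (Cmp (VCat E) w u) = Cmp (VCat C) (fV F w) (fV F u)"
      "\<And>\<tau> \<sigma>. \<lbrakk>\<tau> \<in> Sq E; \<sigma> \<in> Sq E; rgt E \<sigma> = lft E \<tau>\<rbrakk>
        \<Longrightarrow> fS F (Cmp (SHCat E) \<tau> \<sigma>) = Cmp (SHCat C) (fS F \<tau>) (fS F \<sigma>)"
      "\<And>\<tau> \<sigma>. \<lbrakk>\<tau> \<in> Sq E; \<sigma> \<in> Sq E; lower E \<sigma> = upper E \<tau>\<rbrakk>
        \<Longrightarrow> fS F (Cmp (SVCat E) \<tau> \<sigma>) = Cmp (SVCat C) (fS F \<tau>) (fS F \<sigma>)"
  shows "dfunctor F E C"
proof -
  interpret E: double_category E by (rule E)
  interpret C: double_category C by (rule C)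
  have "double_functor F"
    by (rule double_functor.intro)
      (use E C ext O H V S I M in \<open>auto simp: st small_functor_def is_functor_def\<close>)
  then show ?thesis by (simp add: dfunctor_def st)
qed

lemma dfun_eqI:
  assumes F: "dfunctor F E C" and G: "dfunctor G E C"
    and "\<And>x. x \<in> Ob E \<Longrightarrow> fO F x = fO G x" "\<And>h. h \<in> Hor E \<Longrightarrow> fH F h = fH G h"
      "\<And>u. u \<in> Ver E \<Longrightarrow> fV F u = fV G u" "\<And>\<sigma>. \<sigma> \<in> Sq E \<Longrightarrow> fS F \<sigma> = fS G \<sigma>"
  shows "F = G"
proof -
  interpret F: dfunctor F E C by (rule F)
  interpret G: dfunctor G E C by (rule G)
  have "fO F = fO G" "fH F = fH G" "fV F = fV G" "fS F = fS G"
    using assms(3-) F.ext G.ext by (auto intro: extensionalityI)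
  then show ?thesis using F.dsrc G.dsrc F.dtgt G.dtgt by simp
qed

lemma dfun_id_sel [simp]:
  "dsrc (dfun_id C) = C" "dtgt (dfun_id C) = C" "x \<in> Ob C \<Longrightarrow> fO (dfun_id C) x = x"
  "f \<in> Hor C \<Longrightarrow> fH (dfun_id C) f = f" "u \<in> Ver C \<Longrightarrow> fV (dfun_id C) u = u"
  "\<alpha> \<in> Sq C \<Longrightarrow> fS (dfun_id C) \<alpha> = \<alpha>"
  by (simp_all add: dfun_id_def)

lemma dfun_comp_sel [simp]:
  "dsrc (dfun_comp G F) = dsrc F" "dtgt (dfun_comp G F) = dtgt G"
  "x \<in> Ob (dsrc F) \<Longrightarrow> fO (dfun_comp G F) x = fO G (fO F x)"
  "h \<in> Hor (dsrc F) \<Longrightarrow> fH (dfun_comp G F) h = fH G (fH F h)"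
  "u \<in> Ver (dsrc F) \<Longrightarrow> fV (dfun_comp G F) u = fV G (fV F u)"
  "\<sigma> \<in> Sq (dsrc F) \<Longrightarrow> fS (dfun_comp G F) \<sigma> = fS G (fS F \<sigma>)"
  by (simp_all add: dfun_comp_def)

lemma dfunctor_id:
  assumes "double_category C" shows "dfunctor (dfun_id C) C C"
proof -
  interpret double_category C by (rule assms)
  show ?thesis
    by (rule dfunctorI[OF assms assms]) (simp_all, simp_all add: dfun_id_def)
qed

lemma dfunctor_comp:
  assumes "dfunctor G D C" and "dfunctor F E D" shows "dfunctor (dfun_comp G F) E C"
proof -
  interpret G: dfunctor G D C by (rule assms(1))
  interpret F: dfunctor F E D by (rule assms(2))
  show ?thesis
    by (rule dfunctorI[OF F.dc_dom G.dc_cod]) (simp_all, simp_all add: dfun_comp_def)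
qed

lemma dfunctor_iff: "dfunctor F E C \<longleftrightarrow> double_functor F \<and> dsrc F = E \<and> dtgt F = C"
  by (auto simp: dfunctor_def)

lemma double_functor_dfunctor: "double_functor F \<Longrightarrow> dfunctor F (dsrc F) (dtgt F)"
  by (simp add: dfunctor_def)

lemma dfun_comp_id_right:
  assumes "dfunctor F E C" shows "dfun_comp F (dfun_id E) = F"
proof -
  interpret dfunctor F E C by (rule assms)
  show ?thesis
    by (rule dfun_eqI[OF dfunctor_comp[OF assms dfunctor_id] assms]) (simp_all add: dc_dom)
qed

lemma dfun_comp_id_left:
  assumes "dfunctor F E C" shows "dfun_comp (dfun_id C) F = F"
proof -
  interpret dfunctor F E C by (rule assms)
  show ?thesis
    by (rule dfun_eqI[OF dfunctor_comp[OF dfunctor_id assms] assms]) (simp_all add: dc_cod)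
qed

lemma dfun_comp_assoc:
  assumes "dfunctor H D B" "dfunctor G C D" "dfunctor F E C"
  shows "dfun_comp H (dfun_comp G F) = dfun_comp (dfun_comp H G) F"
proof -
  interpret F: dfunctor F E C by (rule assms(3))
  interpret G: dfunctor G C D by (rule assms(2))
  show ?thesis
    by (rule dfun_eqI[OF dfunctor_comp[OF assms(1) dfunctor_comp[OF assms(2,3)]]
          dfunctor_comp[OF dfunctor_comp[OF assms(1,2)] assms(3)]]) simp_all
qed

lemma DblCat_One_simps [simp]:
  "Obj DblCat_One = Collect double_category" "Arr DblCat_One = Collect double_functor"
  "Dom DblCat_One = dsrc" "Cod DblCat_One = dtgt" "Ident DblCat_One = dfun_id" "Cmp DblCat_One = dfun_comp"
  by (simp_all add: DblCat_One_def)

lemma category_DblCat_One: "category DblCat_One"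
proof (rule category.intro)
  fix n m :: "'a dfun"
  assume "n \<in> Arr DblCat_One" "m \<in> Arr DblCat_One" "Cod DblCat_One m = Dom DblCat_One n"
  then show "Cmp DblCat_One n m \<in> Arr DblCat_One"
    using dfunctor_comp[of n "dtgt m" "dtgt n" m "dsrc m"] by (simp add: dfunctor_iff)
next
  fix m k n :: "'a dfun"
  assume "k \<in> Arr DblCat_One" "n \<in> Arr DblCat_One" "m \<in> Arr DblCat_One"
    "Cod DblCat_One m = Dom DblCat_One n" "Cod DblCat_One n = Dom DblCat_One k"
  then show "Cmp DblCat_One k (Cmp DblCat_One n m) = Cmp DblCat_One (Cmp DblCat_One k n) m"
    using dfun_comp_assoc[of k "dtgt n" "dtgt k" n "dtgt m" m "dsrc m"] by (simp add: dfunctor_iff)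
next
  fix a :: "'a dblcat" assume "a \<in> Obj DblCat_One"
  then show "Ident DblCat_One a \<in> Arr DblCat_One"
    using dfunctor_id[of a] by (simp add: dfunctor_iff)
qed (auto simp: double_functor.src double_functor.tgt dfun_comp_id_left[OF double_functor_dfunctor]
  dfun_comp_id_right[OF double_functor_dfunctor])

section \<open>The 2-categories of double categories\<close>

text \<open>Naturality squares of composite transformations are pasted from those of the factors.\<close>

lemma (in category) paste:
  assumes "f' \<in> Arr A" "b \<in> Arr A" "b' \<in> Arr A" "f \<in> Arr A" "a \<in> Arr A" "a' \<in> Arr A" "f0 \<in> Arr A"
    and "Cod A a = Dom A b" "Cod A b = Dom A f'" "Cod A f = Dom A b'" "Cod A a = Dom A f"
      "Cod A f0 = Dom A a'" "Cod A a' = Dom A b'"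
    and "Cmp A f' b = Cmp A b' f" "Cmp A f a = Cmp A a' f0"
  shows "Cmp A f' (Cmp A b a) = Cmp A (Cmp A b' a') f0"
proof -
  have "Cmp A f' (Cmp A b a) = Cmp A (Cmp A f' b) a" using assms(1-13) by (simp add: Cmp_assoc)
  also have "\<dots> = Cmp A (Cmp A b' f) a" by (simp only: assms(14))
  also have "\<dots> = Cmp A b' (Cmp A f a)" using assms(1-13) by (simp add: Cmp_assoc)
  also have "\<dots> = Cmp A b' (Cmp A a' f0)" by (simp only: assms(15))
  also have "\<dots> = Cmp A (Cmp A b' a') f0" using assms(1-13) by (simp add: Cmp_assoc)
  finally show ?thesis .
qed

locale htransf =
  fixes B :: "'u::universe htrans" and G G' :: "'u dfun" and C D :: "'u dblcat"
  assumes B: "horizontal_transformation B" and hsrc [simp]: "hsrc B = G" and htgt [simp]: "htgt B = G'"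
    and C: "dsrc G = C" and D: "dtgt G = D"
begin

lemmas dest = B[unfolded horizontal_transformation_def hsrc htgt C D]

sublocale G: dfunctor G C D using dest C D by (simp add: dfunctor_def)
sublocale G': dfunctor G' C D using dest by (simp add: dfunctor_def)

lemma ext: "hO B \<in> extensional (Ob C)" "hV B \<in> extensional (Ver C)"
  using dest by (auto simp: PiE_def)

lemma on_cells [simp]:
  "x \<in> Ob C \<Longrightarrow> hO B x \<in> Hor D" "x \<in> Ob C \<Longrightarrow> Dom (HCat D) (hO B x) = fO G x"
  "x \<in> Ob C \<Longrightarrow> Cod (HCat D) (hO B x) = fO G' x"
  "u \<in> Ver C \<Longrightarrow> hV B u \<in> Sq D" "u \<in> Ver C \<Longrightarrow> lft D (hV B u) = fV G u"
  "u \<in> Ver C \<Longrightarrow> rgt D (hV B u) = fV G' u"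
  "u \<in> Ver C \<Longrightarrow> upper D (hV B u) = hO B (Dom (VCat C) u)"
  "u \<in> Ver C \<Longrightarrow> lower D (hV B u) = hO B (Cod (VCat C) u)"
  using dest by (auto simp: PiE_def Pi_def)

lemma natural:
  "f \<in> Hor C \<Longrightarrow> Cmp (HCat D) (fH G' f) (hO B (Dom (HCat C) f)) = Cmp (HCat D) (hO B (Cod (HCat C) f)) (fH G f)"
  "\<alpha> \<in> Sq C \<Longrightarrow> Cmp (SHCat D) (fS G' \<alpha>) (hV B (lft C \<alpha>)) = Cmp (SHCat D) (hV B (rgt C \<alpha>)) (fS G \<alpha>)"
  using dest by auto

lemma on_vert [simp]:
  "\<lbrakk>w \<in> Ver C; u \<in> Ver C; Cod (VCat C) u = Dom (VCat C) w\<rbrakk>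
    \<Longrightarrow> hV B (Cmp (VCat C) w u) = Cmp (SVCat D) (hV B w) (hV B u)"
  "x \<in> Ob C \<Longrightarrow> hV B (Ident (VCat C) x) = Ident (SVCat D) (hO B x)"
  using dest by auto

end

lemma htransfI:
  assumes G: "dfunctor G C D" and G': "dfunctor G' C D" and st: "hsrc B = G" "htgt B = G'"
    and ext: "hO B \<in> extensional (Ob C)" "hV B \<in> extensional (Ver C)"
    and "\<And>x. x \<in> Ob C \<Longrightarrow> hO B x \<in> Hom (HCat D) (fO G x) (fO G' x)"
      "\<And>u. u \<in> Ver C \<Longrightarrow> hV B u \<in> Hom (SHCat D) (fV G u) (fV G' u)"
      "\<And>u. u \<in> Ver C \<Longrightarrow> hV B u \<in> Hom (SVCat D) (hO B (Dom (VCat C) u)) (hO B (Cod (VCat C) u))"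
      "\<And>f. f \<in> Hor C \<Longrightarrow>
        Cmp (HCat D) (fH G' f) (hO B (Dom (HCat C) f)) = Cmp (HCat D) (hO B (Cod (HCat C) f)) (fH G f)"
      "\<And>\<alpha>. \<alpha> \<in> Sq C \<Longrightarrow>
        Cmp (SHCat D) (fS G' \<alpha>) (hV B (lft C \<alpha>)) = Cmp (SHCat D) (hV B (rgt C \<alpha>)) (fS G \<alpha>)"
      "\<And>w u. \<lbrakk>w \<in> Ver C; u \<in> Ver C; Cod (VCat C) u = Dom (VCat C) w\<rbrakk>
        \<Longrightarrow> hV B (Cmp (VCat C) w u) = Cmp (SVCat D) (hV B w) (hV B u)"
      "\<And>x. x \<in> Ob C \<Longrightarrow> hV B (Ident (VCat C) x) = Ident (SVCat D) (hO B x)"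
  shows "htransf B G G' C D"
proof -
  interpret G: dfunctor G C D by (rule G)
  interpret G': dfunctor G' C D by (rule G')
  have "horizontal_transformation B"
    unfolding horizontal_transformation_def st G.dsrc G.dtgt G'.dsrc G'.dtgt
    using assms(5-) G.F G'.F by (auto simp: PiE_def)
  then show ?thesis by (simp add: htransf_def st)
qed

lemma htrans_eqI:
  assumes A: "htransf A G G' C D" and B: "htransf B G G' C D"
    and "\<And>x. x \<in> Ob C \<Longrightarrow> hO A x = hO B x" "\<And>u. u \<in> Ver C \<Longrightarrow> hV A u = hV B u"
  shows "A = B"
proof -
  interpret A: htransf A G G' C D by (rule A)
  interpret B: htransf B G G' C D by (rule B)
  have "hO A = hO B" "hV A = hV B"
    using assms(3-) A.ext B.ext by (auto intro: extensionalityI)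
  then show ?thesis using A.hsrc B.hsrc A.htgt B.htgt by simp
qed

lemma htransf_iff:
  "htransf B G G' C D \<longleftrightarrow> horizontal_transformation B \<and> hsrc B = G \<and> htgt B = G' \<and> dsrc G = C \<and> dtgt G = D"
  by (auto simp: htransf_def)

lemma horizontal_transformation_htransf:
  "horizontal_transformation B \<Longrightarrow> htransf B (hsrc B) (htgt B) (dsrc (hsrc B)) (dtgt (hsrc B))"
  by (simp add: htransf_def)

lemma htransf_id:
  assumes "dfunctor G C D" shows "htransf (htrans_id G) G G C D"
proof -
  interpret dfunctor G C D by (rule assms)
  show ?thesis
    by (rule htransfI[OF assms assms]) (simp_all add: htrans_id_def C.Cmp_hor_Ident C.Ident_Ident)
qed

lemma htransf_vcomp:
  assumes "htransf B' G' G'' C D" and "htransf B G G' C D"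
  shows "htransf (htrans_vcomp B' B) G G'' C D"
proof -
  interpret B': htransf B' G' G'' C D by (rule assms(1))
  interpret B: htransf B G G' C D by (rule assms(2))
  show ?thesis
  proof (rule htransfI[OF B.G.dfunctor_axioms B'.G'.dfunctor_axioms], goal_cases)
    case (8 f)
    then show ?case
      by (simp add: htrans_vcomp_def Let_def,
          intro B'.G.C.H.paste[where f="fH G' f"]) (simp_all add: B.natural B'.natural)
  next
    case (9 \<alpha>)
    then show ?case
      by (simp add: htrans_vcomp_def Let_def,
          intro B'.G.C.SH.paste[where f="fS G' \<alpha>"]) (simp_all add: B.natural B'.natural)
  qed (simp_all add: htrans_vcomp_def Let_def B'.G.C.interchange B'.G.C.Cmp_vert_Ident)
qed

lemma htransf_hcomp:
  assumes "htransf L H H' D E" and "htransf B G G' C D"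
  shows "htransf (htrans_hcomp L B) (dfun_comp H G) (dfun_comp H' G') C E"
proof -
  interpret L: htransf L H H' D E by (rule assms(1))
  interpret B: htransf B G G' C D by (rule assms(2))
  show ?thesis
  proof (rule htransfI[OF dfunctor_comp[OF L.G.dfunctor_axioms B.G.dfunctor_axioms]
        dfunctor_comp[OF L.G'.dfunctor_axioms B.G'.dfunctor_axioms]], goal_cases)
    case (8 f)
    then show ?case
      using L.natural(1)[of "fH G' f"] arg_cong[OF B.natural(1)[of f], of "fH H"]
      by (simp add: htrans_hcomp_def Let_def, intro L.G.C.H.paste[where f="fH H (fH G' f)"]) simp_all
  next
    case (9 \<alpha>)
    then show ?case
      using L.natural(2)[of "fS G' \<alpha>"] arg_cong[OF B.natural(2)[of \<alpha>], of "fS H"]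
      by (simp add: htrans_hcomp_def Let_def, intro L.G.C.SH.paste[where f="fS H (fS G' \<alpha>)"]) simp_all
  qed (simp_all add: htrans_hcomp_def Let_def L.G.C.interchange L.G.C.Cmp_vert_Ident)
qed

lemma DblCat_h_simps [simp]:
  "One DblCat_h = DblCat_One" "Obj (Vert DblCat_h) = Collect double_functor"
  "Arr (Vert DblCat_h) = Collect horizontal_transformation" "Dom (Vert DblCat_h) = hsrc"
  "Cod (Vert DblCat_h) = htgt" "Ident (Vert DblCat_h) = htrans_id" "Cmp (Vert DblCat_h) = htrans_vcomp"
  "Obj (Horiz DblCat_h) = Collect double_category" "Arr (Horiz DblCat_h) = Collect horizontal_transformation"
  "Dom (Horiz DblCat_h) B = dsrc (hsrc B)" "Cod (Horiz DblCat_h) B = dtgt (hsrc B)"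
  "Ident (Horiz DblCat_h) C = htrans_id (dfun_id C)" "Cmp (Horiz DblCat_h) = htrans_hcomp"
  by (simp_all add: DblCat_h_def)

lemma htrans_sel [simp]:
  "hsrc (htrans_id G) = G" "htgt (htrans_id G) = G"
  "hsrc (htrans_vcomp B' B) = hsrc B" "htgt (htrans_vcomp B' B) = htgt B'"
  "hsrc (htrans_hcomp L B) = dfun_comp (hsrc L) (hsrc B)" "htgt (htrans_hcomp L B) = dfun_comp (htgt L) (htgt B)"
  "x \<in> Ob (dsrc G) \<Longrightarrow> hO (htrans_id G) x = Ident (HCat (dtgt G)) (fO G x)"
  "u \<in> Ver (dsrc G) \<Longrightarrow> hV (htrans_id G) u = Ident (SHCat (dtgt G)) (fV G u)"
  "x \<in> Ob (dsrc (hsrc B)) \<Longrightarrow> hO (htrans_vcomp B' B) x = Cmp (HCat (dtgt (hsrc B))) (hO B' x) (hO B x)"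
  "u \<in> Ver (dsrc (hsrc B)) \<Longrightarrow> hV (htrans_vcomp B' B) u = Cmp (SHCat (dtgt (hsrc B))) (hV B' u) (hV B u)"
  "x \<in> Ob (dsrc (hsrc B)) \<Longrightarrow> hO (htrans_hcomp L B) x =
    Cmp (HCat (dtgt (hsrc L))) (hO L (fO (htgt B) x)) (fH (hsrc L) (hO B x))"
  "u \<in> Ver (dsrc (hsrc B)) \<Longrightarrow> hV (htrans_hcomp L B) u =
    Cmp (SHCat (dtgt (hsrc L))) (hV L (fV (htgt B) u)) (fS (hsrc L) (hV B u))"
  by (simp_all add: htrans_id_def htrans_vcomp_def htrans_hcomp_def Let_def)

lemma htrans_hcomp_assoc:
  assumes "htransf M K K' E E'" "htransf L H H' D E" "htransf B G G' C D"
  shows "htrans_hcomp M (htrans_hcomp L B) = htrans_hcomp (htrans_hcomp M L) B"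
proof -
  interpret M: htransf M K K' E E' by (rule assms(1))
  interpret L: htransf L H H' D E by (rule assms(2))
  interpret B: htransf B G G' C D by (rule assms(3))
  have eqs: "dfun_comp K (dfun_comp H G) = dfun_comp (dfun_comp K H) G"
    "dfun_comp K' (dfun_comp H' G') = dfun_comp (dfun_comp K' H') G'"
    by (rule dfun_comp_assoc, unfold_locales)+
  show ?thesis
    by (rule htrans_eqI[OF htransf_hcomp[OF assms(1) htransf_hcomp[OF assms(2,3)]]
          htransf_hcomp[OF htransf_hcomp[OF assms(1,2)] assms(3), folded eqs]])
      (simp_all add: M.G.C.H.Cmp_assoc M.G.C.SH.Cmp_assoc)
qed

lemma htrans_interchange:
  assumes "htransf \<sigma> F F' C D" "htransf \<sigma>' F' F'' C D" "htransf \<tau> G G' D E" "htransf \<tau>' G' G'' D E"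
  shows "htrans_hcomp (htrans_vcomp \<tau>' \<tau>) (htrans_vcomp \<sigma>' \<sigma>) =
    htrans_vcomp (htrans_hcomp \<tau>' \<sigma>') (htrans_hcomp \<tau> \<sigma>)"
proof -
  interpret s: htransf \<sigma> F F' C D by (rule assms(1))
  interpret s': htransf \<sigma>' F' F'' C D by (rule assms(2))
  interpret t: htransf \<tau> G G' D E by (rule assms(3))
  interpret t': htransf \<tau>' G' G'' D E by (rule assms(4))
  show ?thesis
  proof (rule htrans_eqI[OF htransf_hcomp[OF htransf_vcomp[OF assms(4,3)] htransf_vcomp[OF assms(2,1)]]
        htransf_vcomp[OF htransf_hcomp[OF assms(4,2)] htransf_hcomp[OF assms(3,1)]]], goal_cases)
    case (1 x)
    let ?c = "Cmp (HCat E)"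
    have "?c (hO \<tau> (fO F'' x)) (?c (fH G (hO \<sigma>' x)) (fH G (hO \<sigma> x))) =
        ?c (?c (fH G' (hO \<sigma>' x)) (hO \<tau> (fO F' x))) (fH G (hO \<sigma> x))"
      using 1 t.natural(1)[of "hO \<sigma>' x"] by (simp add: t.G.C.H.Cmp_assoc)
    then show ?case using 1 by (simp add: t.G.C.H.Cmp_assoc[symmetric])
  next
    case (2 u)
    let ?c = "Cmp (SHCat E)"
    have "?c (hV \<tau> (fV F'' u)) (?c (fS G (hV \<sigma>' u)) (fS G (hV \<sigma> u))) =
        ?c (?c (fS G' (hV \<sigma>' u)) (hV \<tau> (fV F' u))) (fS G (hV \<sigma> u))"
      using 2 t.natural(2)[of "hV \<sigma>' u"] by (simp add: t.G.C.SH.Cmp_assoc)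
    then show ?case using 2 by (simp add: t.G.C.SH.Cmp_assoc[symmetric])
  qed
qed

lemma htransf_dfunctors: "htransf B G G' C D \<Longrightarrow> dfunctor G C D" "htransf B G G' C D \<Longrightarrow> dfunctor G' C D"
proof -
  assume "htransf B G G' C D"
  then interpret htransf B G G' C D .
  show "dfunctor G C D" "dfunctor G' C D" by unfold_locales
qed

lemma horizontal_transformation_parallel:
  assumes "horizontal_transformation B"
  shows "dsrc (htgt B) = dsrc (hsrc B)" "dtgt (htgt B) = dtgt (hsrc B)" "double_functor (hsrc B)"
    "double_functor (htgt B)"
  using htransf_dfunctors[OF horizontal_transformation_htransf[OF assms]] by (auto simp: dfunctor_iff)

lemma htrans_vcomp_id:
  assumes "htransf B G G' C D"
  shows "htrans_vcomp B (htrans_id G) = B" "htrans_vcomp (htrans_id G') B = B"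
proof -
  interpret htransf B G G' C D by (rule assms)
  show "htrans_vcomp B (htrans_id G) = B"
    by (rule htrans_eqI[OF htransf_vcomp[OF assms htransf_id] assms]) (simp_all add: G.dfunctor_axioms)
  show "htrans_vcomp (htrans_id G') B = B"
    by (rule htrans_eqI[OF htransf_vcomp[OF htransf_id assms] assms]) (simp_all add: G'.dfunctor_axioms)
qed

lemma htrans_vcomp_assoc:
  assumes "htransf M G'' H C D" "htransf L G' G'' C D" "htransf B G G' C D"
  shows "htrans_vcomp M (htrans_vcomp L B) = htrans_vcomp (htrans_vcomp M L) B"
proof -
  interpret M: htransf M G'' H C D by (rule assms(1))
  interpret L: htransf L G' G'' C D by (rule assms(2))
  interpret B: htransf B G G' C D by (rule assms(3))
  show ?thesis
    by (rule htrans_eqI[OF htransf_vcomp[OF assms(1) htransf_vcomp[OF assms(2,3)]]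
          htransf_vcomp[OF htransf_vcomp[OF assms(1,2)] assms(3)]])
      (simp_all add: M.G.C.H.Cmp_assoc M.G.C.SH.Cmp_assoc)
qed

lemma htrans_hcomp_id:
  assumes "htransf B G G' C D"
  shows "htrans_hcomp B (htrans_id (dfun_id C)) = B" "htrans_hcomp (htrans_id (dfun_id D)) B = B"
proof -
  interpret htransf B G G' C D by (rule assms)
  have "htransf (htrans_hcomp B (htrans_id (dfun_id C))) G G' C D"
    using htransf_hcomp[OF assms htransf_id[OF dfunctor_id[OF G.dc_dom]]]
    by (simp add: dfun_comp_id_right[OF G.dfunctor_axioms] dfun_comp_id_right[OF G'.dfunctor_axioms])
  from htrans_eqI[OF this assms] show "htrans_hcomp B (htrans_id (dfun_id C)) = B" by simp
  have "htransf (htrans_hcomp (htrans_id (dfun_id D)) B) G G' C D"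
    using htransf_hcomp[OF htransf_id[OF dfunctor_id[OF G.dc_cod]] assms]
    by (simp add: dfun_comp_id_left[OF G.dfunctor_axioms] dfun_comp_id_left[OF G'.dfunctor_axioms])
  from htrans_eqI[OF this assms] show "htrans_hcomp (htrans_id (dfun_id D)) B = B" by simp
qed

lemma htrans_hcomp_of_ids:
  assumes "dfunctor G D E" "dfunctor F C D"
  shows "htrans_hcomp (htrans_id G) (htrans_id F) = htrans_id (dfun_comp G F)"
proof -
  interpret G: dfunctor G D E by (rule assms(1))
  interpret F: dfunctor F C D by (rule assms(2))
  show ?thesis
    by (rule htrans_eqI[OF htransf_hcomp[OF htransf_id[OF assms(1)] htransf_id[OF assms(2)]]
          htransf_id[OF dfunctor_comp[OF assms]]]) simp_all
qed

lemma twocategory_DblCat_h: "twocategory DblCat_h"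
proof -
  note ht = horizontal_transformation_htransf
  note par = horizontal_transformation_parallel
  have vert: "htransf B G G' C D"
    if "horizontal_transformation B" "hsrc B = G" "htgt B = G'" "dsrc G = C" "dtgt G = D" for B :: "'a htrans" and G G' C D
    using that by (simp add: htransf_iff)
  have vcomp: "htransf (htrans_vcomp n m) (hsrc m) (htgt n) (dsrc (hsrc m)) (dtgt (hsrc m))"
    if "horizontal_transformation n" "horizontal_transformation m" "htgt m = hsrc n" for n m :: "'a htrans"
    using that par[of m] par[of n] by (intro htransf_vcomp[of n "hsrc n"] vert) auto
  have hcomp: "htransf (htrans_hcomp n m) (dfun_comp (hsrc n) (hsrc m)) (dfun_comp (htgt n) (htgt m))
      (dsrc (hsrc m)) (dtgt (hsrc n))"
    if "horizontal_transformation n" "horizontal_transformation m" "dtgt (hsrc m) = dsrc (hsrc n)" for n m :: "'a htrans"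
    using that par[of m] par[of n] by (intro htransf_hcomp[of n _ _ "dsrc (hsrc n)"] vert) auto
  show ?thesis
  proof (rule twocategory.intro)
    show "category (One (DblCat_h :: ('a dblcat, 'a dfun, 'a htrans) twocat))"
      by (simp add: category_DblCat_One)
    show "category (Vert (DblCat_h :: ('a dblcat, 'a dfun, 'a htrans) twocat))"
    proof (rule category.intro, goal_cases)
      case (3 G)
      then show ?case using htransf_id[OF double_functor_dfunctor] by (auto simp: htransf_iff)
    next
      case (6 n m)
      then show ?case using vcomp[of n m] by (simp add: htransf_iff)
    next
      case (9 m)
      then show ?case using htrans_vcomp_id(1)[OF ht] by simp
    next
      case (10 m)
      then show ?case using htrans_vcomp_id(2)[OF ht] by simp
    next
      case (11 k n m)
      then show ?case
        using par[of m] par[of n]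
        by (simp add: htrans_vcomp_assoc[of k "hsrc k" "htgt k" "dsrc (hsrc m)" "dtgt (hsrc m)" n "hsrc n" m "hsrc m"] htransf_iff)
    qed (auto simp: par)
    show "category (Horiz (DblCat_h :: ('a dblcat, 'a dfun, 'a htrans) twocat))"
    proof (rule category.intro, goal_cases)
      case (1 m) then show ?case by (simp add: par double_functor.src)
    next
      case (2 m) then show ?case by (simp add: par double_functor.tgt)
    next
      case (3 C)
      then show ?case using htransf_id[OF dfunctor_id] by (auto simp: htransf_iff)
    next
      case (6 n m)
      then show ?case using hcomp[of n m] by (simp add: htransf_iff)
    next
      case (9 m)
      then show ?case using htrans_hcomp_id(1)[OF ht] by simp
    next
      case (10 m)
      then show ?case using htrans_hcomp_id(2)[OF ht] by simp
    next
      case (11 k n m)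
      then show ?case
        using htrans_hcomp_assoc[of k "hsrc k" "htgt k" "dsrc (hsrc k)" "dtgt (hsrc k)" n "hsrc n" "htgt n" "dsrc (hsrc n)" m]
        by (simp add: htransf_iff)
    qed (auto simp: par)
  next
    fix g f :: "'a dfun"
    assume "g \<in> Cells1 DblCat_h" "f \<in> Cells1 DblCat_h" "Cod (One DblCat_h) f = Dom (One DblCat_h) g"
    then show "Cmp (Horiz DblCat_h) (Ident (Vert DblCat_h) g) (Ident (Vert DblCat_h) f) =
        Ident (Vert DblCat_h) (Cmp (One DblCat_h) g f)"
      by (simp add: htrans_hcomp_of_ids[of g "dsrc g" "dtgt g" f "dsrc f"] dfunctor_iff)
  next
    fix \<sigma> \<sigma>' \<tau> \<tau>' :: "'a htrans"
    assume "\<sigma> \<in> Cells2 DblCat_h" "\<sigma>' \<in> Cells2 DblCat_h" "\<tau> \<in> Cells2 DblCat_h" "\<tau>' \<in> Cells2 DblCat_h"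
      "Cod (Vert DblCat_h) \<sigma> = Dom (Vert DblCat_h) \<sigma>'" "Cod (Vert DblCat_h) \<tau> = Dom (Vert DblCat_h) \<tau>'"
      "Cod (Horiz DblCat_h) \<sigma> = Dom (Horiz DblCat_h) \<tau>"
    then show "Cmp (Horiz DblCat_h) (Cmp (Vert DblCat_h) \<tau>' \<tau>) (Cmp (Vert DblCat_h) \<sigma>' \<sigma>) =
          Cmp (Vert DblCat_h) (Cmp (Horiz DblCat_h) \<tau>' \<sigma>') (Cmp (Horiz DblCat_h) \<tau> \<sigma>)"
      using htrans_interchange[of \<sigma> "hsrc \<sigma>" "hsrc \<sigma>'" "dsrc (hsrc \<sigma>)" "dtgt (hsrc \<sigma>)" \<sigma>' "htgt \<sigma>'"
          \<tau> "hsrc \<tau>" "hsrc \<tau>'" "dtgt (hsrc \<tau>)" \<tau>' "htgt \<tau>'"] par[of \<sigma>] par[of \<tau>]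
      by (simp add: htransf_iff)
  qed (auto simp: par)
qed

subsection \<open>Transposition\<close>

text \<open>
  Exchanging the two directions turns vertical into horizontal transformations.  For a double
  category the updates only replace sets by equal ones; they make the sets of objects and squares
  of the transpose those of the original record even when the axioms fail, so that transposition
  commutes with all operations without side conditions.
\<close>

definition transp :: "'u dblcat \<Rightarrow> 'u dblcat" where
  "transp C = \<lparr>HCat = (VCat C)\<lparr>Obj := Ob C\<rparr>, VCat = (HCat C)\<lparr>Obj := Obj (VCat C)\<rparr>,
     SHCat = (SVCat C)\<lparr>Arr := Sq C\<rparr>, SVCat = (SHCat C)\<lparr>Arr := Arr (SVCat C)\<rparr>\<rparr>"

definition transp_dfun :: "'u dfun \<Rightarrow> 'u dfun" where
  "transp_dfun F = \<lparr>dsrc = transp (dsrc F), dtgt = transp (dtgt F), fO = fO F, fH = fV F, fV = fH F, fS = fS F\<rparr>"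

definition transp_vtrans :: "'u vtrans \<Rightarrow> 'u htrans" where
  "transp_vtrans A = \<lparr>hsrc = transp_dfun (vsrc A), htgt = transp_dfun (vtgt A), hO = vO A, hV = vH A\<rparr>"

lemma transp_transp [simp]: "transp (transp C) = C" "transp_dfun (transp_dfun F) = F"
  by (simp_all add: transp_def transp_dfun_def)

lemma transp_inj: "inj transp" "inj transp_dfun" "inj transp_vtrans"
proof -
  show t: "inj transp" "inj transp_dfun" by (metis injI transp_transp)+
  show "inj transp_vtrans"
    by (rule injI) (auto simp: transp_vtrans_def inj_eq[OF t(2)])
qed

lemma double_category_transp: "double_category (transp C) \<longleftrightarrow> double_category C"
proof -
  have one: "double_category (transp C)" if C: "double_category C" for C :: "'u::universe dblcat"
  proof -
    interpret double_category C by (rule C)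
    have e: "HCat (transp C) = VCat C" "VCat (transp C) = HCat C" "SHCat (transp C) = SVCat C"
      "SVCat (transp C) = SHCat C"
      by (simp_all add: transp_def flip: Obj_VCat)
    show ?thesis
      by (rule double_category.intro)
        (simp_all add: e HCat VCat SHCat SVCat interchange Cmp_vert_Ident Cmp_hor_Ident Ident_Ident)
  qed
  show ?thesis using one[of C] one[of "transp C"] by auto
qed

lemma transp_double_category:
  assumes "double_category C"
  shows "HCat (transp C) = VCat C" "VCat (transp C) = HCat C" "SHCat (transp C) = SVCat C"
      "SVCat (transp C) = SHCat C"
  using double_category.Obj_VCat[OF assms] double_category.Arr_SVCat[OF assms]
  by (simp_all add: transp_def)

lemma double_functor_transp: "double_functor (transp_dfun F) \<longleftrightarrow> double_functor F"
proof -
  have one: "double_functor (transp_dfun F)" if "double_functor F" for F :: "'u::universe dfun"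
  proof -
    interpret double_functor F by fact
    show ?thesis
      by (rule double_functor.intro)
        (simp_all add: transp_dfun_def double_category_transp transp_double_category src tgt
          on_HCat on_VCat on_SHCat on_SVCat)
  qed
  show ?thesis using one[of F] one[of "transp_dfun F"] by auto
qed

lemma horizontal_transformation_transp: "horizontal_transformation (transp_vtrans A) \<longleftrightarrow> vertical_transformation A"
proof (cases "double_functor (vsrc A)")
  case True
  then interpret double_functor "vsrc A" .
  show ?thesis
    unfolding horizontal_transformation_def vertical_transformation_def
    by (simp add: transp_vtrans_def transp_dfun_def[of "vsrc A"] transp_double_category src tgt
        double_functor_transp[unfolded transp_dfun_def] inj_eq[OF transp_inj(1)])
      (simp add: transp_dfun_def transp_double_category src tgt double_category.Obj_VCat[OF src]
        double_category.Arr_SVCat[OF src] double_functor_transp[unfolded transp_dfun_def]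
        inj_eq[OF transp_inj(1)])
next
  case False
  then show ?thesis
    unfolding horizontal_transformation_def vertical_transformation_def
    by (simp add: transp_vtrans_def double_functor_transp)
qed

lemma DblCat_v_simps [simp]:
  "One DblCat_v = DblCat_One" "Obj (Vert DblCat_v) = Collect double_functor"
  "Arr (Vert DblCat_v) = Collect vertical_transformation" "Dom (Vert DblCat_v) = vsrc"
  "Cod (Vert DblCat_v) = vtgt" "Ident (Vert DblCat_v) = vtrans_id" "Cmp (Vert DblCat_v) = vtrans_vcomp"
  "Obj (Horiz DblCat_v) = Collect double_category" "Arr (Horiz DblCat_v) = Collect vertical_transformation"
  "Dom (Horiz DblCat_v) B = dsrc (vsrc B)" "Cod (Horiz DblCat_v) B = dtgt (vsrc B)"
  "Ident (Horiz DblCat_v) C = vtrans_id (dfun_id C)" "Cmp (Horiz DblCat_v) = vtrans_hcomp"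
  by (simp_all add: DblCat_v_def)

lemma transp_dfun_comp: "transp_dfun (dfun_comp G F) = dfun_comp (transp_dfun G) (transp_dfun F)"
  "transp_dfun (dfun_id C) = dfun_id (transp C)"
  by (simp_all add: transp_dfun_def dfun_comp_def dfun_id_def transp_def)

lemma transp_vtrans_ops:
  "transp_vtrans (vtrans_id F) = htrans_id (transp_dfun F)"
  "transp_vtrans (vtrans_vcomp B A) = htrans_vcomp (transp_vtrans B) (transp_vtrans A)"
  "transp_vtrans (vtrans_hcomp B A) = htrans_hcomp (transp_vtrans B) (transp_vtrans A)"
  by (simp_all add: transp_vtrans_def vtrans_id_def htrans_id_def vtrans_vcomp_def htrans_vcomp_def
      vtrans_hcomp_def htrans_hcomp_def Let_def transp_dfun_comp)
    (simp_all add: transp_dfun_def transp_def)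

lemma transp_sel [simp]:
  "hsrc (transp_vtrans A) = transp_dfun (vsrc A)" "htgt (transp_vtrans A) = transp_dfun (vtgt A)"
  "dsrc (transp_dfun F) = transp (dsrc F)" "dtgt (transp_dfun F) = transp (dtgt F)"
  by (simp_all add: transp_vtrans_def transp_dfun_def)

lemma twocategory_DblCat_v: "twocategory DblCat_v"
proof (rule twocategory_transport[OF twocategory_DblCat_h transp_inj])
  interpret h: twocategory DblCat_h by (rule twocategory_DblCat_h)
  show "category (One DblCat_v)" by (simp add: category_DblCat_One)
  show "category (Vert DblCat_v)"
    by (rule category_transport[OF h.Vert transp_inj(2,3)])
      (simp_all add: double_functor_transp horizontal_transformation_transp transp_vtrans_ops)
  show "category (Horiz DblCat_v)"
    by (rule category_transport[OF h.Horiz transp_inj(1,3)])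
      (simp_all add: double_category_transp horizontal_transformation_transp transp_vtrans_ops
        transp_dfun_comp)
qed (simp_all add: double_category_transp double_functor_transp horizontal_transformation_transp
    transp_vtrans_ops transp_dfun_comp)

section \<open>Vertical transformations and discrete double fibrations\<close>

lemma (in double_category) vert_composable:
  assumes "\<sigma> \<in> Sq C" "\<tau> \<in> Sq C" "lower C \<sigma> = upper C \<tau>"
  shows "Cod (VCat C) (lft C \<sigma>) = Dom (VCat C) (lft C \<tau>)" "Cod (VCat C) (rgt C \<sigma>) = Dom (VCat C) (rgt C \<tau>)"
  using assms corner_lower_left[of \<sigma>] corner_upper_left[of \<tau>] corner_lower_right[of \<sigma>] corner_upper_right[of \<tau>]
  by simp_all

locale vtransf =
  fixes A :: "'u::universe vtrans" and F F' :: "'u dfun" and E D :: "'u dblcat"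
  assumes A: "vertical_transformation A" and vsrc: "vsrc A = F" and vtgt: "vtgt A = F'"
    and E: "dsrc F = E" and D: "dtgt F = D"
begin

lemmas dest = A[unfolded vertical_transformation_def vsrc vtgt E D]

sublocale F: dfunctor F E D using dest E D by (simp add: dfunctor_def)
sublocale F': dfunctor F' E D using dest by (simp add: dfunctor_def)

lemma ext: "vO A \<in> extensional (Ob E)" "vH A \<in> extensional (Hor E)"
  using dest by (auto simp: PiE_def)

lemma on_cells [simp]:
  "x \<in> Ob E \<Longrightarrow> vO A x \<in> Ver D" "x \<in> Ob E \<Longrightarrow> Dom (VCat D) (vO A x) = fO F x"
  "x \<in> Ob E \<Longrightarrow> Cod (VCat D) (vO A x) = fO F' x"
  "h \<in> Hor E \<Longrightarrow> vH A h \<in> Sq D" "h \<in> Hor E \<Longrightarrow> upper D (vH A h) = fH F h"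
  "h \<in> Hor E \<Longrightarrow> lower D (vH A h) = fH F' h"
  "h \<in> Hor E \<Longrightarrow> lft D (vH A h) = vO A (Dom (HCat E) h)"
  "h \<in> Hor E \<Longrightarrow> rgt D (vH A h) = vO A (Cod (HCat E) h)"
  using dest F.C.Arr_SVCat by (auto simp: PiE_def Pi_def)

lemma natural_Ver: "u \<in> Ver E \<Longrightarrow>
    Cmp (VCat D) (fV F' u) (vO A (Dom (VCat E) u)) = Cmp (VCat D) (vO A (Cod (VCat E) u)) (fV F u)"
  using dest by auto

end

lemma vtransfI:
  assumes F: "dfunctor F E D" and F': "dfunctor F' E D" and st: "vsrc A = F" "vtgt A = F'"
    and "vO A \<in> extensional (Ob E)" "vH A \<in> extensional (Hor E)"
    and "\<And>x. x \<in> Ob E \<Longrightarrow> vO A x \<in> Hom (VCat D) (fO F x) (fO F' x)"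
      "\<And>h. h \<in> Hor E \<Longrightarrow> vH A h \<in> Hom (SVCat D) (fH F h) (fH F' h)"
      "\<And>h. h \<in> Hor E \<Longrightarrow> vH A h \<in> Hom (SHCat D) (vO A (Dom (HCat E) h)) (vO A (Cod (HCat E) h))"
      "\<And>u. u \<in> Ver E \<Longrightarrow>
        Cmp (VCat D) (fV F' u) (vO A (Dom (VCat E) u)) = Cmp (VCat D) (vO A (Cod (VCat E) u)) (fV F u)"
      "\<And>\<alpha>. \<alpha> \<in> Sq E \<Longrightarrow>
        Cmp (SVCat D) (fS F' \<alpha>) (vH A (upper E \<alpha>)) = Cmp (SVCat D) (vH A (lower E \<alpha>)) (fS F \<alpha>)"
      "\<And>k h. \<lbrakk>k \<in> Hor E; h \<in> Hor E; Cod (HCat E) h = Dom (HCat E) k\<rbrakk>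
        \<Longrightarrow> vH A (Cmp (HCat E) k h) = Cmp (SHCat D) (vH A k) (vH A h)"
      "\<And>x. x \<in> Ob E \<Longrightarrow> vH A (Ident (HCat E) x) = Ident (SHCat D) (vO A x)"
  shows "vtransf A F F' E D"
proof -
  interpret F: dfunctor F E D by (rule F)
  interpret F': dfunctor F' E D by (rule F')
  have "vertical_transformation A"
    unfolding vertical_transformation_def st F.dsrc F.dtgt F'.dsrc F'.dtgt
    using assms(5-) F.F F'.F by (auto simp: PiE_def)
  then show ?thesis by (simp add: vtransf_def st)
qed

lemma vtrans_eqI:
  assumes A: "vtransf A F F' E D" and B: "vtransf B F F' E D"
    and "\<And>x. x \<in> Ob E \<Longrightarrow> vO A x = vO B x" "\<And>h. h \<in> Hor E \<Longrightarrow> vH A h = vH B h"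
  shows "A = B"
proof -
  interpret A: vtransf A F F' E D by (rule A)
  interpret B: vtransf B F F' E D by (rule B)
  have "vO A = vO B" "vH A = vH B"
    using assms(3-) A.ext B.ext by (auto intro: extensionalityI)
  then show ?thesis using A.vsrc B.vsrc A.vtgt B.vtgt by simp
qed

lemma vtransf_iff:
  "vtransf A F F' E D \<longleftrightarrow> vertical_transformation A \<and> vsrc A = F \<and> vtgt A = F' \<and> dsrc F = E \<and> dtgt F = D"
  by (auto simp: vtransf_def)

lemma vtrans_sel [simp]:
  "vsrc (vtrans_id F) = F" "vtgt (vtrans_id F) = F"
  "vsrc (vtrans_vcomp B A) = vsrc A" "vtgt (vtrans_vcomp B A) = vtgt B"
  "vsrc (vtrans_hcomp B A) = dfun_comp (vsrc B) (vsrc A)" "vtgt (vtrans_hcomp B A) = dfun_comp (vtgt B) (vtgt A)"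
  "x \<in> Ob (dsrc F) \<Longrightarrow> vO (vtrans_id F) x = Ident (VCat (dtgt F)) (fO F x)"
  "h \<in> Hor (dsrc F) \<Longrightarrow> vH (vtrans_id F) h = Ident (SVCat (dtgt F)) (fH F h)"
  "x \<in> Ob (dsrc (vsrc A)) \<Longrightarrow> vO (vtrans_vcomp B A) x = Cmp (VCat (dtgt (vsrc A))) (vO B x) (vO A x)"
  "h \<in> Hor (dsrc (vsrc A)) \<Longrightarrow> vH (vtrans_vcomp B A) h = Cmp (SVCat (dtgt (vsrc A))) (vH B h) (vH A h)"
  "x \<in> Ob (dsrc (vsrc A)) \<Longrightarrow> vO (vtrans_hcomp B A) x =
    Cmp (VCat (dtgt (vsrc B))) (vO B (fO (vtgt A) x)) (fV (vsrc B) (vO A x))"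
  "h \<in> Hor (dsrc (vsrc A)) \<Longrightarrow> vH (vtrans_hcomp B A) h =
    Cmp (SVCat (dtgt (vsrc B))) (vH B (fH (vtgt A) h)) (fS (vsrc B) (vH A h))"
  by (simp_all add: vtrans_id_def vtrans_vcomp_def vtrans_hcomp_def Let_def)

locale fibration = dfunctor P E C for P :: "'u::universe dfun" and E C :: "'u dblcat" +
  assumes ddf: "discrete_double_fibration P"
begin

lemma lifts:
  "\<lbrakk>e \<in> Ob E; f \<in> Hor C; Cod (HCat C) f = fO P e\<rbrakk> \<Longrightarrow>
     \<exists>!h. h \<in> Hor E \<and> Cod (HCat E) h = e \<and> fH P h = f"
  "\<lbrakk>v \<in> Ver E; \<alpha> \<in> Sq C; rgt C \<alpha> = fV P v\<rbrakk> \<Longrightarrow> \<exists>!\<sigma>. \<sigma> \<in> Sq E \<and> rgt E \<sigma> = v \<and> fS P \<sigma> = \<alpha>"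
  using discrete_double_fibration.hor_lift[OF ddf, of e f]
    discrete_double_fibration.sq_lift[OF ddf, of v \<alpha>] by auto

lemma hlift [simp]:
  assumes "e \<in> Ob E" "f \<in> Hor C" "Cod (HCat C) f = fO P e"
  shows "hlift P f e \<in> Hor E" "Cod (HCat E) (hlift P f e) = e" "fH P (hlift P f e) = f"
  using theI'[OF lifts(1)[OF assms]] unfolding hlift_def dsrc by auto

lemma slift [simp]:
  assumes "v \<in> Ver E" "\<alpha> \<in> Sq C" "rgt C \<alpha> = fV P v"
  shows "slift P \<alpha> v \<in> Sq E" "rgt E (slift P \<alpha> v) = v" "fS P (slift P \<alpha> v) = \<alpha>"
  using theI'[OF lifts(2)[OF assms]] unfolding slift_def dsrc by auto

lemma hor_eqI:
  assumes "h \<in> Hor E" "k \<in> Hor E" "Cod (HCat E) h = Cod (HCat E) k" "fH P h = fH P k"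
  shows "h = k"
  using lifts(1)[of "Cod (HCat E) k" "fH P k"] assms by auto

lemma sq_eqI:
  assumes "\<sigma> \<in> Sq E" "\<tau> \<in> Sq E" "rgt E \<sigma> = rgt E \<tau>" "fS P \<sigma> = fS P \<tau>"
  shows "\<sigma> = \<tau>"
  using lifts(2)[of "rgt E \<tau>" "fS P \<tau>"] assms by auto

lemma hlift_eqI: "\<lbrakk>h \<in> Hor E; Cod (HCat E) h = e; fH P h = f\<rbrakk> \<Longrightarrow> hlift P f e = h"
  by (rule hor_eqI) auto

lemma slift_eqI: "\<lbrakk>\<sigma> \<in> Sq E; rgt E \<sigma> = v; fS P \<sigma> = \<alpha>\<rbrakk> \<Longrightarrow> slift P \<alpha> v = \<sigma>"
  by (rule sq_eqI) auto

lemma lft_slift_bounds: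
  assumes "v \<in> Ver E" "\<alpha> \<in> Sq C" "rgt C \<alpha> = fV P v"
  shows "upper E (slift P \<alpha> v) = hlift P (upper C \<alpha>) (Dom (VCat E) v)"
    "lower E (slift P \<alpha> v) = hlift P (lower C \<alpha>) (Cod (VCat E) v)"
  using assms by (auto intro!: hlift_eqI[symmetric] simp flip: on_bounds)

end

lemma fibration_iff: "fibration P E C \<longleftrightarrow> discrete_double_fibration P \<and> dsrc P = E \<and> dtgt P = C"
  by (auto simp: fibration_def fibration_axioms_def dfunctor_iff dest: discrete_double_fibration.axioms(1))

lemma fibrationI:
  assumes "dfunctor P E C"
    and "\<And>e f. \<lbrakk>e \<in> Ob E; f \<in> Hor C; Cod (HCat C) f = fO P e\<rbrakk> \<Longrightarrow>
      \<exists>!h. h \<in> Hor E \<and> Cod (HCat E) h = e \<and> fH P h = f"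
    and "\<And>v \<alpha>. \<lbrakk>v \<in> Ver E; \<alpha> \<in> Sq C; rgt C \<alpha> = fV P v\<rbrakk> \<Longrightarrow>
      \<exists>!\<sigma>. \<sigma> \<in> Sq E \<and> rgt E \<sigma> = v \<and> fS P \<sigma> = \<alpha>"
  shows "fibration P E C"
proof -
  interpret dfunctor P E C by (rule assms(1))
  have "discrete_double_fibration P"
    by (rule discrete_double_fibration.intro[OF F], unfold_locales) (use assms(2,3) in auto)
  then show ?thesis by (simp add: fibration_iff)
qed

locale over = P: fibration P E C + Q: fibration Q E' C + F: dfunctor F E E'
  for P E C F Q and E' :: "'u::universe dblcat" +
  assumes comp: "dfun_comp Q F = P"
begin

lemma on_base [simp]:
  "x \<in> Ob E \<Longrightarrow> fO Q (fO F x) = fO P x" "h \<in> Hor E \<Longrightarrow> fH Q (fH F h) = fH P h"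
  "u \<in> Ver E \<Longrightarrow> fV Q (fV F u) = fV P u" "\<sigma> \<in> Sq E \<Longrightarrow> fS Q (fS F \<sigma>) = fS P \<sigma>"
  unfolding comp[symmetric] by simp_all

lemma on_hlift: "\<lbrakk>e \<in> Ob E; f \<in> Hor C; Cod (HCat C) f = fO P e\<rbrakk> \<Longrightarrow> fH F (hlift P f e) = hlift Q f (fO F e)"
  by (rule Q.hlift_eqI[symmetric]) simp_all

lemma on_slift: "\<lbrakk>v \<in> Ver E; \<alpha> \<in> Sq C; rgt C \<alpha> = fV P v\<rbrakk> \<Longrightarrow> fS F (slift P \<alpha> v) = slift Q \<alpha> (fV F v)"
  by (rule Q.slift_eqI[symmetric]) simp_all

end

text \<open>
  Two horizontal morphisms or squares of the target with the same image in the base and the same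
  target, respectively right boundary, are equal. This yields preservation of horizontal
  composites, of all composites of squares and of the corresponding identities; what remains are
  the boundaries and the functoriality for vertical composition.
\<close>

lemma overI:
  assumes P: "fibration P E C" and Q: "fibration Q E' C" and st: "dsrc F = E" "dtgt F = E'"
    and ext: "fO F \<in> extensional (Ob E)" "fH F \<in> extensional (Hor E)" "fV F \<in> extensional (Ver E)"
      "fS F \<in> extensional (Sq E)"
    and O: "\<And>x. x \<in> Ob E \<Longrightarrow> fO F x \<in> Ob E'" "\<And>x. x \<in> Ob E \<Longrightarrow> fO Q (fO F x) = fO P x"
    and V: "\<And>u. u \<in> Ver E \<Longrightarrow> fV F u \<in> Hom (VCat E') (fO F (Dom (VCat E) u)) (fO F (Cod (VCat E) u))"
      "\<And>u. u \<in> Ver E \<Longrightarrow> fV Q (fV F u) = fV P u"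
      "\<And>x. x \<in> Ob E \<Longrightarrow> fV F (Ident (VCat E) x) = Ident (VCat E') (fO F x)"
      "\<And>w u. \<lbrakk>w \<in> Ver E; u \<in> Ver E; Cod (VCat E) u = Dom (VCat E) w\<rbrakk>
        \<Longrightarrow> fV F (Cmp (VCat E) w u) = Cmp (VCat E') (fV F w) (fV F u)"
    and H: "\<And>h. h \<in> Hor E \<Longrightarrow> fH F h \<in> Hom (HCat E') (fO F (Dom (HCat E) h)) (fO F (Cod (HCat E) h))"
      "\<And>h. h \<in> Hor E \<Longrightarrow> fH Q (fH F h) = fH P h"
    and S: "\<And>\<sigma>. \<sigma> \<in> Sq E \<Longrightarrow> fS F \<sigma> \<in> Hom (SHCat E') (fV F (lft E \<sigma>)) (fV F (rgt E \<sigma>))"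
      "\<And>\<sigma>. \<sigma> \<in> Sq E \<Longrightarrow> fS Q (fS F \<sigma>) = fS P \<sigma>"
  shows "over P E C F Q E'"
proof -
  interpret P: fibration P E C by (rule P)
  interpret Q: fibration Q E' C by (rule Q)
  note s [simp] = O V(1)[unfolded Hom_iff, THEN conjunct1] H(1)[unfolded Hom_iff, THEN conjunct1]
    S(1)[unfolded Hom_iff, THEN conjunct1] V(2-) H(2) S(2)
    V(1)[unfolded Hom_iff, THEN conjunct2, THEN conjunct1] V(1)[unfolded Hom_iff, THEN conjunct2, THEN conjunct2]
    H(1)[unfolded Hom_iff, THEN conjunct2, THEN conjunct1] H(1)[unfolded Hom_iff, THEN conjunct2, THEN conjunct2]
    S(1)[unfolded Hom_iff, THEN conjunct2, THEN conjunct1] S(1)[unfolded Hom_iff, THEN conjunct2, THEN conjunct2]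
  have b [simp]: "upper E' (fS F \<sigma>) = fH F (upper E \<sigma>)" "lower E' (fS F \<sigma>) = fH F (lower E \<sigma>)"
    if "\<sigma> \<in> Sq E" for \<sigma>
    by (rule Q.hor_eqI; use that in \<open>simp flip: Q.on_bounds(7,8)\<close>)+
  have F: "dfunctor F E E'"
  proof (rule dfunctorI[OF P.dc_dom Q.dc_dom st ext], goal_cases)
    case (6 x) show ?case by (rule Q.hor_eqI) (use 6 in \<open>simp_all\<close>)
  next
    case (8 u) show ?case by (rule Q.sq_eqI) (use 8 in \<open>simp_all\<close>)
  next
    case (9 h) show ?case by (rule Q.sq_eqI) (use 9 in \<open>simp_all\<close>)
  next
    case (10 k h) show ?case by (rule Q.hor_eqI) (use 10 in \<open>simp_all\<close>)
  next
    case (12 \<tau> \<sigma>) show ?case by (rule Q.sq_eqI) (use 12 in \<open>simp_all\<close>)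
  next
    case (13 \<tau> \<sigma>) show ?case by (rule Q.sq_eqI) (use 13 in \<open>simp_all add: P.E.vert_composable\<close>)
  qed simp_all
  interpret F: dfunctor F E E' by (rule F)
  have "dfun_comp Q F = P"
    by (rule dfun_eqI[OF dfunctor_comp[OF Q.dfunctor_axioms F] P.dfunctor_axioms]) simp_all
  then show ?thesis by unfold_locales
qed

lemma over_eqI:
  assumes "over P E C F Q E'" "over P E C G Q E'"
    and "\<And>x. x \<in> Ob E \<Longrightarrow> fO F x = fO G x" "\<And>u. u \<in> Ver E \<Longrightarrow> fV F u = fV G u"
  shows "F = G"
proof -
  interpret F: over P E C F Q E' by (rule assms(1))
  interpret G: over P E C G Q E' by (rule assms(2))
  show ?thesis
  proof (rule dfun_eqI[OF F.F.dfunctor_axioms G.F.dfunctor_axioms])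
    show "fH F h = fH G h" if "h \<in> Hor E" for h
      by (rule F.Q.hor_eqI) (use that assms(3) in simp_all)
    show "fS F \<sigma> = fS G \<sigma>" if "\<sigma> \<in> Sq E" for \<sigma>
      by (rule F.Q.sq_eqI) (use that assms(4) in simp_all)
  qed (use assms(3,4) in auto)
qed

locale over_cell = F: over P E C F Q E' + F': over P E C F' Q E' + A: vtransf A F F' E E'
  for P E C F F' A Q and E' :: "'u::universe dblcat" +
  assumes vO_base [simp]: "x \<in> Ob E \<Longrightarrow> fV Q (vO A x) = Ident (VCat C) (fO P x)"
    and vH_base [simp]: "h \<in> Hor E \<Longrightarrow> fS Q (vH A h) = Ident (SVCat C) (fH P h)"

text \<open>
  Naturality in squares and compatibility with horizontal composition follow from uniqueness of
  lifts, because both sides lie over the same square of the base and have the same right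
  boundary.
\<close>

lemma over_cellI:
  assumes F: "over P E C F Q E'" and F': "over P E C F' Q E'" and st: "vsrc A = F" "vtgt A = F'"
    and ext: "vO A \<in> extensional (Ob E)" "vH A \<in> extensional (Hor E)"
    and O: "\<And>x. x \<in> Ob E \<Longrightarrow> vO A x \<in> Hom (VCat E') (fO F x) (fO F' x)"
      "\<And>x. x \<in> Ob E \<Longrightarrow> fV Q (vO A x) = Ident (VCat C) (fO P x)"
      "\<And>u. u \<in> Ver E \<Longrightarrow>
        Cmp (VCat E') (fV F' u) (vO A (Dom (VCat E) u)) = Cmp (VCat E') (vO A (Cod (VCat E) u)) (fV F u)"
    and H: "\<And>h. h \<in> Hor E \<Longrightarrow> vH A h \<in> Hom (SHCat E') (vO A (Dom (HCat E) h)) (vO A (Cod (HCat E) h))"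
      "\<And>h. h \<in> Hor E \<Longrightarrow> fS Q (vH A h) = Ident (SVCat C) (fH P h)"
  shows "over_cell P E C F F' A Q E'"
proof -
  interpret F: over P E C F Q E' by (rule F)
  interpret F': over P E C F' Q E' by (rule F')
  note s [simp] = O(1)[unfolded Hom_iff, THEN conjunct1] O(2) H(2) H(1)[unfolded Hom_iff, THEN conjunct1]
    O(1)[unfolded Hom_iff, THEN conjunct2, THEN conjunct1] O(1)[unfolded Hom_iff, THEN conjunct2, THEN conjunct2]
    H(1)[unfolded Hom_iff, THEN conjunct2, THEN conjunct1] H(1)[unfolded Hom_iff, THEN conjunct2, THEN conjunct2]
  have b [simp]: "upper E' (vH A h) = fH F h" "lower E' (vH A h) = fH F' h" if "h \<in> Hor E" for h
    by (rule F.Q.hor_eqI; use that in \<open>simp flip: F.Q.on_bounds(7,8)\<close>)+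
  have "vtransf A F F' E E'"
  proof (rule vtransfI[OF F.F.dfunctor_axioms F'.F.dfunctor_axioms st ext], goal_cases)
    case (5 \<sigma>) show ?case by (rule F.Q.sq_eqI) (use 5 in \<open>simp_all add: O(3)\<close>)
  next
    case (6 k h) show ?case by (rule F.Q.sq_eqI) (use 6 in \<open>simp_all add: F.P.C.Cmp_vert_Ident\<close>)
  next
    case (7 x) show ?case by (rule F.Q.sq_eqI) (use 7 in \<open>simp_all add: F.P.C.Ident_Ident\<close>)
  qed (simp_all add: O(3))
  then interpret A: vtransf A F F' E E' .
  show ?thesis by unfold_locales simp_all
qed

lemma over_cell_eqI:
  assumes "over_cell P E C F F' A Q E'" "over_cell P E C F F' B Q E'"
    and "\<And>x. x \<in> Ob E \<Longrightarrow> vO A x = vO B x"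
  shows "A = B"
proof -
  interpret A: over_cell P E C F F' A Q E' by (rule assms(1))
  interpret B: over_cell P E C F F' B Q E' by (rule assms(2))
  show ?thesis
  proof (rule vtrans_eqI[OF A.A.vtransf_axioms B.A.vtransf_axioms])
    show "vH A h = vH B h" if "h \<in> Hor E" for h
      by (rule A.F.Q.sq_eqI) (use that assms(3) in simp_all)
  qed (rule assms(3))
qed

subsection \<open>The 2-category of discrete double fibrations\<close>

lemma over_comp:
  assumes "over P E C F Q E'" "over Q E' C G R E''"
  shows "over P E C (dfun_comp G F) R E''"
proof -
  interpret F: over P E C F Q E' by (rule assms(1))
  interpret G: over Q E' C G R E'' by (rule assms(2))
  interpret GF: dfunctor "dfun_comp G F" E E''
    by (rule dfunctor_comp[OF G.F.dfunctor_axioms F.F.dfunctor_axioms])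
  have "dfun_comp R (dfun_comp G F) = P"
    by (simp add: dfun_comp_assoc[OF G.Q.dfunctor_axioms G.F.dfunctor_axioms F.F.dfunctor_axioms]
        F.comp G.comp)
  then show ?thesis by unfold_locales
qed

lemma over_id:
  assumes "fibration P E C" shows "over P E C (dfun_id E) P E"
proof -
  interpret fibration P E C by (rule assms)
  interpret I: dfunctor "dfun_id E" E E by (rule dfunctor_id[OF dc_dom])
  show ?thesis by unfold_locales (rule dfun_comp_id_right[OF dfunctor_axioms])
qed

lemma DFib_One [simp]:
  "P \<in> Obj (One (DFib C)) \<longleftrightarrow> fibration P (dsrc P) C"
  "(P, F, Q) \<in> Arr (One (DFib C)) \<longleftrightarrow> over P (dsrc P) C F Q (dsrc Q)"
  "Dom (One (DFib C)) (P, F, Q) = P" "Cod (One (DFib C)) (P, F, Q) = Q"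
  "Ident (One (DFib C)) P = (P, dfun_id (dsrc P), P)"
  "Cmp (One (DFib C)) (Q', G, R) (P, F, Q) = (P, dfun_comp G F, R)"
  by (auto simp: DFib_def two_full_sub_def Let_def full_subcat_def slice_mor_def over_def over_axioms_def
      fibration_iff dfunctor_iff dest: discrete_double_fibration.axioms(1))

lemma whisker_id:
  assumes A: "vtransf A F F' E E'" and Q: "dfunctor Q E' C"
  shows "vtransf (vtrans_hcomp (vtrans_id Q) A) (dfun_comp Q F) (dfun_comp Q F') E C"
    "x \<in> Ob E \<Longrightarrow> vO (vtrans_hcomp (vtrans_id Q) A) x = fV Q (vO A x)"
    "h \<in> Hor E \<Longrightarrow> vH (vtrans_hcomp (vtrans_id Q) A) h = fS Q (vH A h)"
proof -
  interpret v: twocategory DblCat_v by (rule twocategory_DblCat_v)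
  interpret A: vtransf A F F' E E' by (rule A)
  interpret Q: dfunctor Q E' C by (rule Q)
  have "vertical_transformation (vtrans_id Q)"
    using v.V2.Ident_in[of Q] Q.F by simp
  then have "vertical_transformation (vtrans_hcomp (vtrans_id Q) A)"
    using v.H2.Cmp_in[of "vtrans_id Q" A] A.A by (simp add: A.vsrc A.vtgt)
  then show "vtransf (vtrans_hcomp (vtrans_id Q) A) (dfun_comp Q F) (dfun_comp Q F') E C"
    by (simp add: vtransf_iff A.vsrc A.vtgt)
  show "x \<in> Ob E \<Longrightarrow> vO (vtrans_hcomp (vtrans_id Q) A) x = fV Q (vO A x)"
    "h \<in> Hor E \<Longrightarrow> vH (vtrans_hcomp (vtrans_id Q) A) h = fS Q (vH A h)"
    by (simp_all add: A.vsrc A.vtgt)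
qed

lemma vtransf_id:
  assumes "dfunctor P E C" shows "vtransf (vtrans_id P) P P E C"
proof -
  interpret v: twocategory DblCat_v by (rule twocategory_DblCat_v)
  show ?thesis using v.V2.Ident_in[of P] assms by (simp add: vtransf_iff dfunctor_iff)
qed

text \<open>
  The condition that defines 2-cells of the slice equates two transformations; componentwise it
  says that the components lie over vertical identities.
\<close>

lemma over_cell_iff:
  "over_cell P E C F F' A Q E' \<longleftrightarrow> fibration P E C \<and> fibration Q E' C \<and> vtransf A F F' E E' \<and>
     vtrans_hcomp (vtrans_id Q) A = vtrans_id P"
proof
  assume "over_cell P E C F F' A Q E'"
  then interpret over_cell P E C F F' A Q E' .
  have "vtrans_hcomp (vtrans_id Q) A = vtrans_id P"
    using whisker_id[OF A.vtransf_axioms F.Q.dfunctor_axioms]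
    by (intro vtrans_eqI[OF _ vtransf_id[OF F.P.dfunctor_axioms]]) (simp_all add: F.comp F'.comp)
  then show "fibration P E C \<and> fibration Q E' C \<and> vtransf A F F' E E' \<and>
     vtrans_hcomp (vtrans_id Q) A = vtrans_id P"
    by (simp add: F.P.fibration_axioms F.Q.fibration_axioms A.vtransf_axioms)
next
  assume a: "fibration P E C \<and> fibration Q E' C \<and> vtransf A F F' E E' \<and>
     vtrans_hcomp (vtrans_id Q) A = vtrans_id P"
  then interpret P: fibration P E C by simp
  interpret Q: fibration Q E' C using a by simp
  interpret A: vtransf A F F' E E' using a by simp
  note w = whisker_id[OF A.vtransf_axioms Q.dfunctor_axioms, unfolded a[THEN conjunct2, THEN conjunct2, THEN conjunct2]]
  have "dfun_comp Q F = P" "dfun_comp Q F' = P" using w(1) by (auto simp: vtransf_iff)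
  then show "over_cell P E C F F' A Q E'"
    by unfold_locales (simp_all add: w(2,3)[symmetric])
qed

lemma DFib_Vert [simp]:
  "Obj (Vert (DFib C)) = Cells1 (DFib C)"
  "(P, A, Q) \<in> Arr (Vert (DFib C)) \<longleftrightarrow> over_cell P (dsrc P) C (vsrc A) (vtgt A) A Q (dsrc Q)"
  "Dom (Vert (DFib C)) (P, A, Q) = (P, vsrc A, Q)" "Cod (Vert (DFib C)) (P, A, Q) = (P, vtgt A, Q)"
  "Ident (Vert (DFib C)) (P, F, Q) = (P, vtrans_id F, Q)"
  "Cmp (Vert (DFib C)) (P', B, Q') (P, A, Q) = (P, vtrans_vcomp B A, Q)"
  by (auto simp: DFib_def two_full_sub_def Let_def full_subcat_def slice_cell_def over_cell_iff
      fibration_iff dfunctor_iff vtransf_iff dest: discrete_double_fibration.axioms(1))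

lemma DFib_Horiz [simp]:
  "Obj (Horiz (DFib C)) = Cells0 (DFib C)" "Arr (Horiz (DFib C)) = Cells2 (DFib C)"
  "Dom (Horiz (DFib C)) (P, A, Q) = P" "Cod (Horiz (DFib C)) (P, A, Q) = Q"
  "Ident (Horiz (DFib C)) P = (P, vtrans_id (dfun_id (dsrc P)), P)"
  "Cmp (Horiz (DFib C)) (Q', B, R) (P, A, Q) = (P, vtrans_hcomp B A, R)"
  by (auto simp: DFib_def two_full_sub_def Let_def full_subcat_def)

lemma twocategory_DFib: "twocategory (DFib C)"
  unfolding DFib_def
  by (intro twocategory_two_full_sub twocategory.twocategory_slice twocategory_DblCat_v)

lemma over_cell_ids:
  assumes "over_cell P E C F F' A Q E'" shows "vsrc A = F" "vtgt A = F'" "dsrc P = E" "dsrc Q = E'"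
proof -
  interpret over_cell P E C F F' A Q E' by (rule assms)
  show "vsrc A = F" "vtgt A = F'" "dsrc P = E" "dsrc Q = E'" by (simp_all add: A.vsrc A.vtgt)
qed

lemma over_ids:
  assumes "over P E C F Q E'" shows "dsrc P = E" "dsrc Q = E'" "dsrc F = E" "dtgt F = E'"
proof -
  interpret over P E C F Q E' by (rule assms)
  show "dsrc P = E" "dsrc Q = E'" "dsrc F = E" "dtgt F = E'" by simp_all
qed

lemma over_cell_id:
  assumes "over P E C F Q E'" shows "over_cell P E C F F (vtrans_id F) Q E'"
  using twocategory.V2_cat(3)[OF twocategory_DFib, of "(P, F, Q)" C] assms
  by (simp add: over_ids[OF assms])

lemma over_cell_hcomp:
  assumes "over_cell P E C F F' A Q E'" "over_cell Q E' C G G' B R E''"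
  shows "over_cell P E C (dfun_comp G F) (dfun_comp G' F') (vtrans_hcomp B A) R E''"
  using twocategory.H2_cat(6)[OF twocategory_DFib, of "(Q, B, R)" C "(P, A, Q)"] assms
  by (simp add: over_cell_ids[OF assms(1)] over_cell_ids[OF assms(2)])

lemma over_cell_vcomp:
  assumes "over_cell P E C F F' A Q E'" "over_cell P E C F' F'' B Q E'"
  shows "over_cell P E C F F'' (vtrans_vcomp B A) Q E'"
  using twocategory.V2_cat(6)[OF twocategory_DFib, of "(P, B, Q)" C "(P, A, Q)"] assms
  by (simp add: over_cell_ids[OF assms(1)] over_cell_ids[OF assms(2)])

text \<open>
  An inverse on objects and vertical morphisms extends to an inverse double functor, again by
  lifting.
\<close>

lemma over_iso:
  assumes "over P E C F Q E'" and bO: "bij_betw (fO F) (Ob E) (Ob E')" and bV: "bij_betw (fV F) (Ver E) (Ver E')"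
  shows "iso_arr (One (DFib C)) (P, F, Q)"
proof -
  interpret over P E C F Q E' by (rule assms(1))
  define o' where "o' = inv_into (Ob E) (fO F)"
  define v' where "v' = inv_into (Ver E) (fV F)"
  have o' [simp]: "o' y \<in> Ob E" "fO F (o' y) = y" "fO P (o' y) = fO Q y" if "y \<in> Ob E'" for y
  proof -
    show "o' y \<in> Ob E" using that bO unfolding o'_def bij_betw_def by (auto intro: inv_into_into)
    show "fO F (o' y) = y" using that bO unfolding o'_def bij_betw_def by (auto intro: f_inv_into_f)
    then show "fO P (o' y) = fO Q y" using \<open>o' y \<in> Ob E\<close> on_base(1)[of "o' y"] by simp
  qed
  have v' [simp]: "v' w \<in> Ver E" "fV F (v' w) = w" "fV P (v' w) = fV Q w" if "w \<in> Ver E'" for w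
  proof -
    show "v' w \<in> Ver E" using that bV unfolding v'_def bij_betw_def by (auto intro: inv_into_into)
    show "fV F (v' w) = w" using that bV unfolding v'_def bij_betw_def by (auto intro: f_inv_into_f)
    then show "fV P (v' w) = fV Q w" using \<open>v' w \<in> Ver E\<close> on_base(3)[of "v' w"] by simp
  qed
  have o'_eqI: "o' y = x" if "x \<in> Ob E" "fO F x = y" for x y
    using that bO unfolding o'_def bij_betw_def by (auto intro: inv_into_f_f)
  have v'_eqI: "v' w = u" if "u \<in> Ver E" "fV F u = w" for u w
    using that bV unfolding v'_def bij_betw_def by (auto intro: inv_into_f_f)
  define G where "G = \<lparr>dsrc = E', dtgt = E, fO = (\<lambda>y\<in>Ob E'. o' y),
    fH = (\<lambda>h\<in>Hor E'. hlift P (fH Q h) (o' (Cod (HCat E') h))), fV = (\<lambda>w\<in>Ver E'. v' w),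
    fS = (\<lambda>\<sigma>\<in>Sq E'. slift P (fS Q \<sigma>) (v' (rgt E' \<sigma>)))\<rparr>"
  have vD: "Dom (VCat E) (v' w) = o' (Dom (VCat E') w)" "Cod (VCat E) (v' w) = o' (Cod (VCat E') w)"
    if "w \<in> Ver E'" for w
    using that F.on_bounds(3,4)[of "v' w"] by (auto intro!: o'_eqI[symmetric])
  have Fh: "fH F (hlift P (fH Q h) (o' (Cod (HCat E') h))) = h" if "h \<in> Hor E'" for h
    by (rule Q.hor_eqI) (use that in simp_all)
  have Fs: "fS F (slift P (fS Q \<sigma>) (v' (rgt E' \<sigma>))) = \<sigma>" if "\<sigma> \<in> Sq E'" for \<sigma>
    by (rule Q.sq_eqI) (use that in simp_all)
  have G: "over Q E' C G P E"
  proof (rule overI[OF Q.fibration_axioms P.fibration_axioms], goal_cases)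
    case (9 u) then show ?case by (simp add: G_def vD)
  next
    case (11 x) then show ?case by (simp add: G_def) (rule v'_eqI, simp_all)
  next
    case (12 w u) then show ?case by (simp add: G_def) (rule v'_eqI, simp_all add: vD)
  next
    case (13 h)
    then have "o' (Dom (HCat E') h) = Dom (HCat E) (hlift P (fH Q h) (o' (Cod (HCat E') h)))"
      using arg_cong[OF Fh[OF 13], of "Dom (HCat E')"] by (intro o'_eqI) simp_all
    then show ?case using 13 by (simp add: G_def)
  next
    case (15 \<sigma>)
    then have "v' (lft E' \<sigma>) = lft E (slift P (fS Q \<sigma>) (v' (rgt E' \<sigma>)))"
      using arg_cong[OF Fs[OF 15], of "lft E'"] by (intro v'_eqI) simp_all
    then show ?case using 15 by (simp add: G_def)
  qed (simp_all add: G_def)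
  have "dfun_comp G F = dfun_id E"
    by (rule over_eqI[OF over_comp[OF assms(1) G] over_id[OF P.fibration_axioms]])
      (simp_all add: G_def o'_eqI v'_eqI)
  moreover have "dfun_comp F G = dfun_id E'"
    by (rule over_eqI[OF over_comp[OF G assms(1)] over_id[OF Q.fibration_axioms]])
      (simp_all add: G_def o'_eqI v'_eqI)
  ultimately show ?thesis
    unfolding iso_arr_def using assms(1) G by (intro conjI bexI[of _ "(Q, G, P)"]) simp_all
qed

text \<open>Cells of a slice are triples of source, cell and target.\<close>

definition mid :: "'a \<times> 'b \<times> 'c \<Rightarrow> 'b" where "mid t = fst (snd t)"

lemma mid [simp]: "mid (p, f, q) = f" by (simp add: mid_def)

lemma is_functor_simps:
  assumes "is_functor A B Fo Fa"
  shows "a \<in> Obj A \<Longrightarrow> Fo a \<in> Obj B" "m \<in> Arr A \<Longrightarrow> Fa m \<in> Arr B"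
    "m \<in> Arr A \<Longrightarrow> Dom B (Fa m) = Fo (Dom A m)" "m \<in> Arr A \<Longrightarrow> Cod B (Fa m) = Fo (Cod A m)"
    "a \<in> Obj A \<Longrightarrow> Fa (Ident A a) = Ident B (Fo a)"
    "\<lbrakk>n \<in> Arr A; m \<in> Arr A; Cod A m = Dom A n\<rbrakk> \<Longrightarrow> Fa (Cmp A n m) = Cmp B (Fa n) (Fa m)"
  using assms by (auto simp: is_functor_def)

text \<open>
  Since equations between cells over the base can be tested on objects and vertical morphisms,
  the functor laws for a 2-functor into discrete double fibrations become pointwise conditions.
\<close>

lemma twofunctor_into_DFibI:
  fixes K :: "('o, 'm, 't) twocat"
  assumes K: "twocategory K"
    and F: "\<And>f. f \<in> Cells1 K \<Longrightarrow> on1 T f = (on0 T (Dom (One K) f), m f, on0 T (Cod (One K) f))"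
      "\<And>\<sigma>. \<sigma> \<in> Cells2 K \<Longrightarrow> on2 T \<sigma> = (on0 T (Dom (Horiz K) \<sigma>), c \<sigma>, on0 T (Cod (Horiz K) \<sigma>))"
    and o: "\<And>x. x \<in> Cells0 K \<Longrightarrow> fibration (on0 T x) (E x) C"
    and m: "\<And>f. f \<in> Cells1 K \<Longrightarrow>
      over (on0 T (Dom (One K) f)) (E (Dom (One K) f)) C (m f) (on0 T (Cod (One K) f)) (E (Cod (One K) f))"
      "\<And>x a. \<lbrakk>x \<in> Cells0 K; a \<in> Ob (E x)\<rbrakk> \<Longrightarrow> fO (m (Ident (One K) x)) a = a"
      "\<And>x u. \<lbrakk>x \<in> Cells0 K; u \<in> Ver (E x)\<rbrakk> \<Longrightarrow> fV (m (Ident (One K) x)) u = u"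
      "\<And>g f a. \<lbrakk>g \<in> Cells1 K; f \<in> Cells1 K; Cod (One K) f = Dom (One K) g; a \<in> Ob (E (Dom (One K) f))\<rbrakk> \<Longrightarrow>
        fO (m (Cmp (One K) g f)) a = fO (m g) (fO (m f) a)"
      "\<And>g f u. \<lbrakk>g \<in> Cells1 K; f \<in> Cells1 K; Cod (One K) f = Dom (One K) g; u \<in> Ver (E (Dom (One K) f))\<rbrakk> \<Longrightarrow>
        fV (m (Cmp (One K) g f)) u = fV (m g) (fV (m f) u)"
    and c: "\<And>\<sigma>. \<sigma> \<in> Cells2 K \<Longrightarrow>
      over_cell (on0 T (Dom (Horiz K) \<sigma>)) (E (Dom (Horiz K) \<sigma>)) C (m (Dom (Vert K) \<sigma>)) (m (Cod (Vert K) \<sigma>))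
        (c \<sigma>) (on0 T (Cod (Horiz K) \<sigma>)) (E (Cod (Horiz K) \<sigma>))"
      "\<And>f a. \<lbrakk>f \<in> Cells1 K; a \<in> Ob (E (Dom (One K) f))\<rbrakk> \<Longrightarrow>
        vO (c (Ident (Vert K) f)) a = Ident (VCat (E (Cod (One K) f))) (fO (m f) a)"
      "\<And>\<tau> \<sigma> a. \<lbrakk>\<tau> \<in> Cells2 K; \<sigma> \<in> Cells2 K; Cod (Vert K) \<sigma> = Dom (Vert K) \<tau>; a \<in> Ob (E (Dom (Horiz K) \<sigma>))\<rbrakk> \<Longrightarrow>
        vO (c (Cmp (Vert K) \<tau> \<sigma>)) a = Cmp (VCat (E (Cod (Horiz K) \<sigma>))) (vO (c \<tau>) a) (vO (c \<sigma>) a)"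
      "\<And>\<tau> \<sigma> a. \<lbrakk>\<tau> \<in> Cells2 K; \<sigma> \<in> Cells2 K; Cod (Horiz K) \<sigma> = Dom (Horiz K) \<tau>; a \<in> Ob (E (Dom (Horiz K) \<sigma>))\<rbrakk> \<Longrightarrow>
        vO (c (Cmp (Horiz K) \<tau> \<sigma>)) a = Cmp (VCat (E (Cod (Horiz K) \<tau>)))
          (vO (c \<tau>) (fO (m (Cod (Vert K) \<sigma>)) a)) (fV (m (Dom (Vert K) \<tau>)) (vO (c \<sigma>) a))"
  shows "twofunctor K (DFib C) T"
proof -
  interpret twocategory K by (rule K)
  have E: "dsrc (on0 T x) = E x" if "x \<in> Cells0 K" for x
    using o[OF that] by (simp add: fibration_iff)
  have ids [simp]: "dsrc (m f) = E (Dom (One K) f)" "dtgt (m f) = E (Cod (One K) f)" if "f \<in> Cells1 K" for f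
    using over_ids[OF m(1)[OF that]] by simp_all
  have cs [simp]: "vsrc (c \<sigma>) = m (Dom (Vert K) \<sigma>)" "vtgt (c \<sigma>) = m (Cod (Vert K) \<sigma>)" if "\<sigma> \<in> Cells2 K" for \<sigma>
    using over_cell_ids[OF c(1)[OF that]] by simp_all
  have mI: "m (Ident (One K) x) = dfun_id (E x)" if x: "x \<in> Cells0 K" for x
  proof -
    have "over (on0 T x) (E x) C (m (Ident (One K) x)) (on0 T x) (E x)"
      using m(1)[of "Ident (One K) x"] x by simp
    from over_eqI[OF this over_id[OF o[OF x]]] show ?thesis using x by (simp add: m(2,3))
  qed
  have mC: "m (Cmp (One K) g f) = dfun_comp (m g) (m f)"
    if g: "g \<in> Cells1 K" "f \<in> Cells1 K" "Cod (One K) f = Dom (One K) g" for g f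
  proof -
    have "over (on0 T (Dom (One K) f)) (E (Dom (One K) f)) C (m (Cmp (One K) g f))
        (on0 T (Cod (One K) g)) (E (Cod (One K) g))"
      using m(1)[of "Cmp (One K) g f"] g by simp
    from over_eqI[OF this over_comp[OF m(1)[OF g(2)] m(1)[OF g(1), folded g(3)]]]
    show ?thesis using g by (simp add: m(4,5))
  qed
  have cI: "c (Ident (Vert K) f) = vtrans_id (m f)" if f: "f \<in> Cells1 K" for f
    by (rule over_cell_eqI[of "on0 T (Dom (One K) f)" "E (Dom (One K) f)" C "m f" "m f" _
          "on0 T (Cod (One K) f)" "E (Cod (One K) f)"])
      (use f c(1)[of "Ident (Vert K) f"] over_cell_id[OF m(1)[OF f]] in \<open>simp_all add: c(2)\<close>)
  have cV: "c (Cmp (Vert K) \<tau> \<sigma>) = vtrans_vcomp (c \<tau>) (c \<sigma>)"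
    if t: "\<tau> \<in> Cells2 K" "\<sigma> \<in> Cells2 K" "Cod (Vert K) \<sigma> = Dom (Vert K) \<tau>" for \<tau> \<sigma>
  proof -
    note par = vert_parallel[OF t]
    note A = c(1)[OF t(2)] and B = c(1)[OF t(1), unfolded par, folded t(3)]
    show ?thesis
      using over_cell_eqI[OF _ over_cell_vcomp[OF A B], of "c (Cmp (Vert K) \<tau> \<sigma>)"]
        c(1)[of "Cmp (Vert K) \<tau> \<sigma>"] t by (simp add: c(3))
  qed
  have cH: "c (Cmp (Horiz K) \<tau> \<sigma>) = vtrans_hcomp (c \<tau>) (c \<sigma>)"
    if t: "\<tau> \<in> Cells2 K" "\<sigma> \<in> Cells2 K" "Cod (Horiz K) \<sigma> = Dom (Horiz K) \<tau>" for \<tau> \<sigma>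
  proof -
    have D: "Cod (One K) (Dom (Vert K) \<sigma>) = Dom (One K) (Dom (Vert K) \<tau>)"
      "Cod (One K) (Cod (Vert K) \<sigma>) = Dom (One K) (Cod (Vert K) \<tau>)" using t by simp_all
    note A = c(1)[OF t(2)] and B = c(1)[OF t(1), folded t(3)]
    have "over_cell (on0 T (Dom (Horiz K) \<sigma>)) (E (Dom (Horiz K) \<sigma>)) C
        (dfun_comp (m (Dom (Vert K) \<tau>)) (m (Dom (Vert K) \<sigma>))) (dfun_comp (m (Cod (Vert K) \<tau>)) (m (Cod (Vert K) \<sigma>)))
        (c (Cmp (Horiz K) \<tau> \<sigma>)) (on0 T (Cod (Horiz K) \<tau>)) (E (Cod (Horiz K) \<tau>))"
      using c(1)[of "Cmp (Horiz K) \<tau> \<sigma>"] t D by (simp add: mC)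
    from over_cell_eqI[OF this over_cell_hcomp[OF A B]] show ?thesis using t D by (simp add: c(4))
  qed
  show ?thesis
    unfolding twofunctor_def is_functor_def
    by (auto simp: F o E m(1) c(1) mI mC cI cV cH vert_parallel Ident_Horiz)
qed

text \<open>
  The naturality conditions are equations between cells over the base and are tested pointwise
  in the same way.
\<close>

lemma two_natural_into_DFibI:
  fixes K :: "('o, 'm, 't) twocat"
  assumes K: "twocategory K" and S: "twofunctor K (DFib C) S" and T: "twofunctor K (DFib C) T"
    and ES: "\<And>x. x \<in> Cells0 K \<Longrightarrow> dsrc (on0 S x) = ES x" and ET: "\<And>x. x \<in> Cells0 K \<Longrightarrow> dsrc (on0 T x) = ET x"
    and \<eta>: "\<And>x. x \<in> Cells0 K \<Longrightarrow> \<eta> x = (on0 S x, n x, on0 T x)"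
    and n: "\<And>x. x \<in> Cells0 K \<Longrightarrow> over (on0 S x) (ES x) C (n x) (on0 T x) (ET x)"
    and nat1: "\<And>f a. \<lbrakk>f \<in> Cells1 K; a \<in> Ob (ES (Dom (One K) f))\<rbrakk> \<Longrightarrow>
        fO (mid (on1 T f)) (fO (n (Dom (One K) f)) a) = fO (n (Cod (One K) f)) (fO (mid (on1 S f)) a)"
      "\<And>f u. \<lbrakk>f \<in> Cells1 K; u \<in> Ver (ES (Dom (One K) f))\<rbrakk> \<Longrightarrow>
        fV (mid (on1 T f)) (fV (n (Dom (One K) f)) u) = fV (n (Cod (One K) f)) (fV (mid (on1 S f)) u)"
    and nat2: "\<And>\<sigma> a. \<lbrakk>\<sigma> \<in> Cells2 K; a \<in> Ob (ES (Dom (Horiz K) \<sigma>))\<rbrakk> \<Longrightarrow>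
        vO (mid (on2 T \<sigma>)) (fO (n (Dom (Horiz K) \<sigma>)) a) = fV (n (Cod (Horiz K) \<sigma>)) (vO (mid (on2 S \<sigma>)) a)"
  shows "two_natural K (DFib C) S T \<eta>"
proof -
  interpret twocategory K by (rule K)
  have one: "on1 R f = (on0 R (Dom (One K) f), mid (on1 R f), on0 R (Cod (One K) f)) \<and>
      over (on0 R (Dom (One K) f)) (E (Dom (One K) f)) C (mid (on1 R f)) (on0 R (Cod (One K) f))
        (E (Cod (One K) f))"
    if "twofunctor K (DFib C) R" "f \<in> Cells1 K" "\<And>x. x \<in> Cells0 K \<Longrightarrow> dsrc (on0 R x) = E x" for R f E
  proof -
    obtain p g q where e: "on1 R f = (p, g, q)" by (cases "on1 R f")
    show ?thesis
      using is_functor_simps(2-4)[OF that(1)[unfolded twofunctor_def, THEN conjunct1] that(2)] using that(2,3) by (auto simp: e)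
  qed
  have two: "on2 R \<sigma> = (on0 R (Dom (Horiz K) \<sigma>), mid (on2 R \<sigma>), on0 R (Cod (Horiz K) \<sigma>)) \<and>
      over_cell (on0 R (Dom (Horiz K) \<sigma>)) (E (Dom (Horiz K) \<sigma>)) C (mid (on1 R (Dom (Vert K) \<sigma>)))
        (mid (on1 R (Cod (Vert K) \<sigma>))) (mid (on2 R \<sigma>)) (on0 R (Cod (Horiz K) \<sigma>)) (E (Cod (Horiz K) \<sigma>))"
    if R: "twofunctor K (DFib C) R" and s: "\<sigma> \<in> Cells2 K" and E: "\<And>x. x \<in> Cells0 K \<Longrightarrow> dsrc (on0 R x) = E x" for R \<sigma> E
  proof -
    obtain p g q where e: "on2 R \<sigma> = (p, g, q)" by (cases "on2 R \<sigma>")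
    note f = is_functor_simps(2-4)[OF R[unfolded twofunctor_def, THEN conjunct2, THEN conjunct1]]
      is_functor_simps(3,4)[OF R[unfolded twofunctor_def, THEN conjunct2, THEN conjunct2]]
    show ?thesis
      using f[of \<sigma>] s by (auto simp: e E) (metis mid)
  qed
  have n1: "dfun_comp (mid (on1 T f)) (n (Dom (One K) f)) = dfun_comp (n (Cod (One K) f)) (mid (on1 S f))"
    if f: "f \<in> Cells1 K" for f
    by (rule over_eqI[OF over_comp[OF n[of "Dom (One K) f"] one[OF T f ET, THEN conjunct2]]
          over_comp[OF one[OF S f ES, THEN conjunct2] n[of "Cod (One K) f"]]])
      (use f nat1[OF f] over_ids[OF n] over_ids[OF one[OF S f ES, THEN conjunct2]] in simp_all)
  have n2: "vtrans_hcomp (mid (on2 T \<sigma>)) (vtrans_id (n (Dom (Horiz K) \<sigma>))) =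
      vtrans_hcomp (vtrans_id (n (Cod (Horiz K) \<sigma>))) (mid (on2 S \<sigma>))" if s: "\<sigma> \<in> Cells2 K" for \<sigma>
  proof -
    have d: "Dom (Vert K) \<sigma> \<in> Cells1 K" "Cod (Vert K) \<sigma> \<in> Cells1 K" using s by simp_all
    note N = n[OF H2_cat(1)[OF s]] n[OF H2_cat(2)[OF s]]
    note t = two[OF T s ET, THEN conjunct2] and u = two[OF S s ES, THEN conjunct2]
    interpret nd: over "on0 S (Dom (Horiz K) \<sigma>)" "ES (Dom (Horiz K) \<sigma>)" C "n (Dom (Horiz K) \<sigma>)"
      "on0 T (Dom (Horiz K) \<sigma>)" "ET (Dom (Horiz K) \<sigma>)" by (rule N(1))
    interpret nc: over "on0 S (Cod (Horiz K) \<sigma>)" "ES (Cod (Horiz K) \<sigma>)" C "n (Cod (Horiz K) \<sigma>)"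
      "on0 T (Cod (Horiz K) \<sigma>)" "ET (Cod (Horiz K) \<sigma>)" by (rule N(2))
    interpret t: over_cell "on0 T (Dom (Horiz K) \<sigma>)" "ET (Dom (Horiz K) \<sigma>)" C
      "mid (on1 T (Dom (Vert K) \<sigma>))" "mid (on1 T (Cod (Vert K) \<sigma>))" "mid (on2 T \<sigma>)"
      "on0 T (Cod (Horiz K) \<sigma>)" "ET (Cod (Horiz K) \<sigma>)" by (rule t)
    interpret u: over_cell "on0 S (Dom (Horiz K) \<sigma>)" "ES (Dom (Horiz K) \<sigma>)" C
      "mid (on1 S (Dom (Vert K) \<sigma>))" "mid (on1 S (Cod (Vert K) \<sigma>))" "mid (on2 S \<sigma>)"
      "on0 S (Cod (Horiz K) \<sigma>)" "ES (Cod (Horiz K) \<sigma>)" by (rule u)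
    show ?thesis
      by (rule over_cell_eqI[OF over_cell_hcomp[OF over_cell_id[OF N(1)] t]
            over_cell_hcomp[OF u over_cell_id[OF N(2)], folded n1[OF d(1), simplified bounds[OF s]]
              n1[OF d(2), simplified bounds[OF s]]]])
        (use nat2[OF s] nat1(1)[OF d(1)] s in \<open>simp_all add: t.A.vsrc t.A.vtgt u.A.vsrc u.A.vtgt\<close>)
  qed
  show ?thesis
    unfolding two_natural_def
  proof (intro conjI ballI)
    fix x assume "x \<in> Cells0 K"
    then show "\<eta> x \<in> Hom (One (DFib C)) (on0 S x) (on0 T x)" using n[of x] by (simp add: \<eta> ES ET)
  next
    fix f assume f: "f \<in> Cells1 K"
    obtain g h where "on1 T f = (on0 T (Dom (One K) f), g, on0 T (Cod (One K) f))"
      "on1 S f = (on0 S (Dom (One K) f), h, on0 S (Cod (One K) f))"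
      using one[OF T f ET] one[OF S f ES] by blast
    then show "Cmp (One (DFib C)) (on1 T f) (\<eta> (Dom (One K) f)) = Cmp (One (DFib C)) (\<eta> (Cod (One K) f)) (on1 S f)"
      using f n1[OF f] by (simp add: \<eta>)
  next
    fix \<sigma> assume s: "\<sigma> \<in> Cells2 K"
    obtain g h where "on2 T \<sigma> = (on0 T (Dom (Horiz K) \<sigma>), g, on0 T (Cod (Horiz K) \<sigma>))"
      "on2 S \<sigma> = (on0 S (Dom (Horiz K) \<sigma>), h, on0 S (Cod (Horiz K) \<sigma>))"
      using two[OF T s ET] two[OF S s ES] by blast
    then show "Cmp (Horiz (DFib C)) (on2 T \<sigma>) (Ident (Vert (DFib C)) (\<eta> (Dom (Horiz K) \<sigma>))) =
        Cmp (Horiz (DFib C)) (Ident (Vert (DFib C)) (\<eta> (Cod (Horiz K) \<sigma>))) (on2 S \<sigma>)"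
      using s n2[OF s] by (simp add: \<eta>)
  qed
qed

section \<open>The 2-category of lax double presheaves\<close>

text \<open>
  The comparison maps are used through representatives only: in this form they are a partial
  multiplication of elements, and the laws of a presheaf say that it is natural, associative and
  unital, without mention of coends.
\<close>

definition vmul :: "'u dblcat \<Rightarrow> 'u psh \<Rightarrow> 'u \<Rightarrow> 'u \<Rightarrow> 'u \<Rightarrow> 'u \<Rightarrow> 'u \<Rightarrow> 'u \<Rightarrow> 'u \<Rightarrow> 'u" where
  "vmul C X u u' a a' a'' s' s = pmu X u u' a a'' (psh_comp_class C X u u' a a' a'' s' s)"

context lax_double_presheaf
begin

sublocale C: double_category C by (rule base)

lemma fib_category: "x \<in> Ob C \<Longrightarrow> category (pcat X x)"
  using pcat small_category.axioms(1) by blast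

lemmas fib [simp] = category.cat[OF fib_category]
lemmas fib_assoc = category.Cmp_assoc[OF fib_category]

lemma pfun_functor: "f \<in> Hor C \<Longrightarrow> small_functor (pcat X (Cod (HCat C) f)) (pcat X (Dom (HCat C) f)) (pfun X f)"
  using pfun[of f] by simp

lemma pfun_simps [simp]:
  "\<lbrakk>f \<in> Hor C; Dom (HCat C) f = x; b \<in> Obj (pcat X (Cod (HCat C) f))\<rbrakk> \<Longrightarrow> fo (pfun X f) b \<in> Obj (pcat X x)"
  "\<lbrakk>f \<in> Hor C; Dom (HCat C) f = x; m \<in> Arr (pcat X (Cod (HCat C) f))\<rbrakk> \<Longrightarrow> fa (pfun X f) m \<in> Arr (pcat X x)"
  "\<lbrakk>f \<in> Hor C; Dom (HCat C) f = x; m \<in> Arr (pcat X (Cod (HCat C) f))\<rbrakk> \<Longrightarrow>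
    Dom (pcat X x) (fa (pfun X f) m) = fo (pfun X f) (Dom (pcat X (Cod (HCat C) f)) m)"
  "\<lbrakk>f \<in> Hor C; Dom (HCat C) f = x; m \<in> Arr (pcat X (Cod (HCat C) f))\<rbrakk> \<Longrightarrow>
    Cod (pcat X x) (fa (pfun X f) m) = fo (pfun X f) (Cod (pcat X (Cod (HCat C) f)) m)"
  "\<lbrakk>f \<in> Hor C; Cod (HCat C) f = y; b \<in> Obj (pcat X y)\<rbrakk> \<Longrightarrow>
    fa (pfun X f) (Ident (pcat X y) b) = Ident (pcat X (Dom (HCat C) f)) (fo (pfun X f) b)"
  "\<lbrakk>f \<in> Hor C; Cod (HCat C) f = y; n \<in> Arr (pcat X y); m \<in> Arr (pcat X y); Cod (pcat X y) m = Dom (pcat X y) n\<rbrakk> \<Longrightarrow>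
    fa (pfun X f) (Cmp (pcat X y) n m) = Cmp (pcat X (Dom (HCat C) f)) (fa (pfun X f) n) (fa (pfun X f) m)"
  using pfun_functor[of f] by (auto simp: small_functor_def is_functor_def)

lemma pfun_comp [simp]:
  "\<lbrakk>g \<in> Hor C; f \<in> Hor C; Cod (HCat C) f = Dom (HCat C) g; b \<in> Obj (pcat X (Cod (HCat C) g))\<rbrakk> \<Longrightarrow>
    fo (pfun X (Cmp (HCat C) g f)) b = fo (pfun X f) (fo (pfun X g) b)"
  "\<lbrakk>x \<in> Ob C; a \<in> Obj (pcat X x)\<rbrakk> \<Longrightarrow> fo (pfun X (Ident (HCat C) x)) a = a"
  "\<lbrakk>x \<in> Ob C; m \<in> Arr (pcat X x)\<rbrakk> \<Longrightarrow> fa (pfun X (Ident (HCat C) x)) m = m"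
  using pfun_Cmp[of f _ "Dom (HCat C) g" g] pfun_Ident[of x] by (auto simp: fctr_comp_def fctr_id_def)

lemma pprof_prof: "u \<in> Ver C \<Longrightarrow>
    small_profunctor (pcat X (Dom (VCat C) u)) (pcat X (Cod (VCat C) u)) (pprof X u)"
  using pprof[of u] by simp

lemma pact_in [simp]:
  "\<lbrakk>u \<in> Ver C; m \<in> Arr (pcat X (Dom (VCat C) u)); n \<in> Arr (pcat X (Cod (VCat C) u));
    Dom (pcat X (Dom (VCat C) u)) m = a; Cod (pcat X (Cod (VCat C) u)) n = b;
    s \<in> pel (pprof X u) (Cod (pcat X (Dom (VCat C) u)) m) (Dom (pcat X (Cod (VCat C) u)) n)\<rbrakk> \<Longrightarrow>
    pact (pprof X u) m n s \<in> pel (pprof X u) a b"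
  using pprof_prof[of u] by (auto simp: small_profunctor_def profunctor_def PiE_def Pi_def)

lemma pact_Ident [simp]:
  "\<lbrakk>u \<in> Ver C; Dom (VCat C) u = x; Cod (VCat C) u = x'; a \<in> Obj (pcat X x); a' \<in> Obj (pcat X x');
    s \<in> pel (pprof X u) a a'\<rbrakk> \<Longrightarrow> pact (pprof X u) (Ident (pcat X x) a) (Ident (pcat X x') a') s = s"
  using pprof_prof[of u] by (auto simp: small_profunctor_def profunctor_def)

lemma pact_Cmp:
  "\<lbrakk>u \<in> Ver C; Dom (VCat C) u = x; Cod (VCat C) u = x'; m \<in> Arr (pcat X x); k \<in> Arr (pcat X x);
    n \<in> Arr (pcat X x'); l \<in> Arr (pcat X x'); Cod (pcat X x) m = Dom (pcat X x) k;
    Cod (pcat X x') n = Dom (pcat X x') l; s \<in> pel (pprof X u) (Cod (pcat X x) k) (Dom (pcat X x') n)\<rbrakk> \<Longrightarrow>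
    pact (pprof X u) m l (pact (pprof X u) k n s) = pact (pprof X u) (Cmp (pcat X x) k m) (Cmp (pcat X x') l n) s"
  using pprof_prof[of u] by (auto simp: small_profunctor_def profunctor_def)

lemma psq_in [simp]:
  "\<lbrakk>\<alpha> \<in> Sq C; lft C \<alpha> = u; upper C \<alpha> = f; lower C \<alpha> = f'; a \<in> Obj (pcat X (Dom (VCat C) (rgt C \<alpha>)));
    a' \<in> Obj (pcat X (Cod (VCat C) (rgt C \<alpha>))); s \<in> pel (pprof X (rgt C \<alpha>)) a a'\<rbrakk> \<Longrightarrow>
    psq X \<alpha> a a' s \<in> pel (pprof X u) (fo (pfun X f) a) (fo (pfun X f') a')"
  using psq[of \<alpha> u "rgt C \<alpha>"] by (auto simp: prof_nat_def prof_restrict_def PiE_def Pi_def)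

lemma psq_comp [simp]:
  "\<lbrakk>\<alpha> \<in> Sq C; \<beta> \<in> Sq C; rgt C \<alpha> = lft C \<beta>; a \<in> Obj (pcat X (Dom (VCat C) (rgt C \<beta>)));
    a' \<in> Obj (pcat X (Cod (VCat C) (rgt C \<beta>))); s \<in> pel (pprof X (rgt C \<beta>)) a a'\<rbrakk> \<Longrightarrow>
    psq X (Cmp (SHCat C) \<beta> \<alpha>) a a' s =
      psq X \<alpha> (fo (pfun X (upper C \<beta>)) a) (fo (pfun X (lower C \<beta>)) a') (psq X \<beta> a a' s)"
  "\<lbrakk>u \<in> Ver C; a \<in> Obj (pcat X (Dom (VCat C) u)); a' \<in> Obj (pcat X (Cod (VCat C) u)); s \<in> pel (pprof X u) a a'\<rbrakk> \<Longrightarrow>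
    psq X (Ident (SHCat C) u) a a' s = s"
  using psq_Cmp[of \<alpha> "lft C \<alpha>" "lft C \<beta>" \<beta> "rgt C \<beta>"] psq_Ident[of u] by auto

lemma hom_pprof [simp]:
  "\<lbrakk>x \<in> Ob C; a \<in> Obj (pcat X x); b \<in> Obj (pcat X x)\<rbrakk> \<Longrightarrow> pel (pprof X (Ident (VCat C) x)) a b = Hom (pcat X x) a b"
  "\<lbrakk>x \<in> Ob C; m \<in> Arr (pcat X x); n \<in> Arr (pcat X x); s \<in> Hom (pcat X x) (Cod (pcat X x) m) (Dom (pcat X x) n)\<rbrakk> \<Longrightarrow>
    pact (pprof X (Ident (VCat C) x)) m n s = Cmp (pcat X x) n (Cmp (pcat X x) s m)"
  by (simp_all add: normal_pprof hom_prof_def)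

lemma psq_Ident_vert [simp]:
  "\<lbrakk>f \<in> Hor C; a = Dom (pcat X (Cod (HCat C) f)) m; b = Cod (pcat X (Cod (HCat C) f)) m; m \<in> Arr (pcat X (Cod (HCat C) f))\<rbrakk> \<Longrightarrow>
    psq X (Ident (SVCat C) f) a b m = fa (pfun X f) m"
  using normal_psq[of f _ "Cod (HCat C) f"] by simp

lemma comp_class_in:
  assumes "u \<in> Ver C" "u' \<in> Ver C" "Cod (VCat C) u = Dom (VCat C) u'"
    "a \<in> Obj (pcat X (Dom (VCat C) u))" "a' \<in> Obj (pcat X (Dom (VCat C) u'))" "a'' \<in> Obj (pcat X (Cod (VCat C) u'))"
    "s \<in> pel (pprof X u) a a'" "s' \<in> pel (pprof X u') a' a''"
  shows "psh_comp_class C X u u' a a' a'' s' s \<in> pel (prof_comp (pcat X (Dom (VCat C) u)) (pcat X (Dom (VCat C) u'))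
    (pcat X (Cod (VCat C) u')) (pprof X u') (pprof X u)) a a''"
  using assms by (auto simp: prof_comp_def coend_class_def coend_pairs_def intro!: quotientI)

lemma vmul_in [simp]:
  assumes "u \<in> Ver C" "u' \<in> Ver C" "Cod (VCat C) u = Dom (VCat C) u'" "Cmp (VCat C) u' u = w"
    "a \<in> Obj (pcat X (Dom (VCat C) u))" "a' \<in> Obj (pcat X (Dom (VCat C) u'))" "a'' \<in> Obj (pcat X (Cod (VCat C) u'))"
    "s \<in> pel (pprof X u) a a'" "s' \<in> pel (pprof X u') a' a''"
  shows "vmul C X u u' a a' a'' s' s \<in> pel (pprof X w) a a''"
proof -
  have "prof_nat (pcat X (Dom (VCat C) u)) (pcat X (Cod (VCat C) u'))
        (prof_comp (pcat X (Dom (VCat C) u)) (pcat X (Dom (VCat C) u')) (pcat X (Cod (VCat C) u')) (pprof X u') (pprof X u))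
        (pprof X w) (pmu X u u')"
    using pmu[of u "Dom (VCat C) u" "Dom (VCat C) u'" u' "Cod (VCat C) u'"] assms(1-4) by simp
  then show ?thesis
    using comp_class_in[OF assms(1-3,5-9)] assms(5,7)
    unfolding prof_nat_def vmul_def by (auto simp: PiE_def Pi_def)
qed

lemma vmul_natural:
  assumes "\<alpha> \<in> Sq C" "\<alpha>' \<in> Sq C" "lower C \<alpha> = upper C \<alpha>'"
    "a \<in> Obj (pcat X (Dom (VCat C) (rgt C \<alpha>)))" "a' \<in> Obj (pcat X (Dom (VCat C) (rgt C \<alpha>')))"
    "a'' \<in> Obj (pcat X (Cod (VCat C) (rgt C \<alpha>')))"
    "s \<in> pel (pprof X (rgt C \<alpha>)) a a'" "s' \<in> pel (pprof X (rgt C \<alpha>')) a' a''"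
  shows "psq X (Cmp (SVCat C) \<alpha>' \<alpha>) a a'' (vmul C X (rgt C \<alpha>) (rgt C \<alpha>') a a' a'' s' s) =
    vmul C X (lft C \<alpha>) (lft C \<alpha>') (fo (pfun X (upper C \<alpha>)) a) (fo (pfun X (upper C \<alpha>')) a')
      (fo (pfun X (lower C \<alpha>')) a'') (psq X \<alpha>' a' a'' s') (psq X \<alpha> a a' s)"
  unfolding vmul_def
  by (rule pmu_natural[of \<alpha> "lft C \<alpha>" "rgt C \<alpha>" \<alpha>' "lft C \<alpha>'" "rgt C \<alpha>'" "Dom (VCat C) (rgt C \<alpha>)"
        "Dom (VCat C) (rgt C \<alpha>')" "Cod (VCat C) (rgt C \<alpha>')", unfolded assms(3)])
    (use assms C.vert_composable[of \<alpha> \<alpha>'] in simp_all)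

lemma vmul_assoc:
  assumes "u \<in> Ver C" "u' \<in> Ver C" "u'' \<in> Ver C" "Cod (VCat C) u = Dom (VCat C) u'" "Cod (VCat C) u' = Dom (VCat C) u''"
    "a \<in> Obj (pcat X (Dom (VCat C) u))" "a' \<in> Obj (pcat X (Dom (VCat C) u'))" "a'' \<in> Obj (pcat X (Dom (VCat C) u''))"
    "b \<in> Obj (pcat X (Cod (VCat C) u''))"
    "s \<in> pel (pprof X u) a a'" "s' \<in> pel (pprof X u') a' a''" "s'' \<in> pel (pprof X u'') a'' b"
  shows "vmul C X u (Cmp (VCat C) u'' u') a a' b (vmul C X u' u'' a' a'' b s'' s') s =
    vmul C X (Cmp (VCat C) u' u) u'' a a'' b s'' (vmul C X u u' a a' a'' s' s)"
  unfolding vmul_def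
  by (rule pmu_assoc[of u "Dom (VCat C) u" "Dom (VCat C) u'" u' "Dom (VCat C) u''" u'' "Cod (VCat C) u''"])
    (use assms in simp_all)

lemma vmul_left:
  "\<lbrakk>u \<in> Ver C; Dom (VCat C) u = x; m \<in> Hom (pcat X x) a b; a' \<in> Obj (pcat X (Cod (VCat C) u)); s \<in> pel (pprof X u) b a'\<rbrakk> \<Longrightarrow>
    vmul C X (Ident (VCat C) x) u a b a' s m = pact (pprof X u) m (Ident (pcat X (Cod (VCat C) u)) a') s"
  unfolding vmul_def by (rule normal_pmu_left) auto

lemma vmul_right:
  "\<lbrakk>u \<in> Ver C; Cod (VCat C) u = x'; m \<in> Hom (pcat X x') a' b'; a \<in> Obj (pcat X (Dom (VCat C) u)); s \<in> pel (pprof X u) a a'\<rbrakk> \<Longrightarrow>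
    vmul C X u (Ident (VCat C) x') a a' b' m s = pact (pprof X u) (Ident (pcat X (Dom (VCat C) u)) a) m s"
  unfolding vmul_def by (rule normal_pmu_right) auto

lemma vmul_unit [simp]:
  "\<lbrakk>u \<in> Ver C; Dom (VCat C) u = x; a \<in> Obj (pcat X x); a' \<in> Obj (pcat X (Cod (VCat C) u)); s \<in> pel (pprof X u) a a'\<rbrakk> \<Longrightarrow>
    vmul C X (Ident (VCat C) x) u a a a' s (Ident (pcat X x) a) = s"
  "\<lbrakk>u \<in> Ver C; Cod (VCat C) u = x'; a \<in> Obj (pcat X (Dom (VCat C) u)); a' \<in> Obj (pcat X x'); s \<in> pel (pprof X u) a a'\<rbrakk> \<Longrightarrow>
    vmul C X u (Ident (VCat C) x') a a' a' (Ident (pcat X x') a') s = s"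
  using vmul_left[of u x "Ident (pcat X x) a" a a a' s] vmul_right[of u x' "Ident (pcat X x') a'" a' a' a s] by auto

lemma vmul_hom:
  assumes "x \<in> Ob C" "m \<in> Hom (pcat X x) a b" "n \<in> Hom (pcat X x) b c"
  shows "vmul C X (Ident (VCat C) x) (Ident (VCat C) x) a b c n m = Cmp (pcat X x) n m"
  using vmul_left[of "Ident (VCat C) x" x m a b c n] assms
  by (auto simp: fib_assoc[symmetric])

lemma pact_split:
  assumes "u \<in> Ver C" "Dom (VCat C) u = x" "Cod (VCat C) u = x'" "m \<in> Hom (pcat X x) a b" "n \<in> Hom (pcat X x') b' a'"
    "s \<in> pel (pprof X u) b b'"
  shows "pact (pprof X u) m n s = pact (pprof X u) (Ident (pcat X x) a) n (pact (pprof X u) m (Ident (pcat X x') b') s)"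
    "pact (pprof X u) m n s = pact (pprof X u) m (Ident (pcat X x') a') (pact (pprof X u) (Ident (pcat X x) b) n s)"
  using assms by (auto simp: pact_Cmp)

end

locale ptransf =
  fixes C :: "'u::universe dblcat" and F :: "'u ptrans" and X Y :: "'u psh"
  assumes F: "presheaf_transformation C F" and psrc: "psrc F = X" and ptgt: "ptgt F = Y"
begin

sublocale X: lax_double_presheaf C X using presheaf_transformation.src[OF F] by (simp add: psrc)
sublocale Y: lax_double_presheaf C Y using presheaf_transformation.tgt[OF F] by (simp add: ptgt)

lemma ext: "tfun F \<in> extensional (Ob C)" "tprof F \<in> extensional (Ver C)"
  by (rule presheaf_transformation.tfun_ext[OF F] presheaf_transformation.tprof_ext[OF F])+

lemma tfun_functor: "x \<in> Ob C \<Longrightarrow> small_functor (pcat X x) (pcat Y x) (tfun F x)"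
  by (rule presheaf_transformation.tfun[OF F, unfolded psrc ptgt])

lemma tfun_simps [simp]:
  "\<lbrakk>x \<in> Ob C; a \<in> Obj (pcat X x)\<rbrakk> \<Longrightarrow> fo (tfun F x) a \<in> Obj (pcat Y x)"
  "\<lbrakk>x \<in> Ob C; m \<in> Arr (pcat X x)\<rbrakk> \<Longrightarrow> fa (tfun F x) m \<in> Arr (pcat Y x)"
  "\<lbrakk>x \<in> Ob C; m \<in> Arr (pcat X x)\<rbrakk> \<Longrightarrow> Dom (pcat Y x) (fa (tfun F x) m) = fo (tfun F x) (Dom (pcat X x) m)"
  "\<lbrakk>x \<in> Ob C; m \<in> Arr (pcat X x)\<rbrakk> \<Longrightarrow> Cod (pcat Y x) (fa (tfun F x) m) = fo (tfun F x) (Cod (pcat X x) m)"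
  "\<lbrakk>x \<in> Ob C; a \<in> Obj (pcat X x)\<rbrakk> \<Longrightarrow> fa (tfun F x) (Ident (pcat X x) a) = Ident (pcat Y x) (fo (tfun F x) a)"
  "\<lbrakk>x \<in> Ob C; n \<in> Arr (pcat X x); m \<in> Arr (pcat X x); Cod (pcat X x) m = Dom (pcat X x) n\<rbrakk> \<Longrightarrow>
    fa (tfun F x) (Cmp (pcat X x) n m) = Cmp (pcat Y x) (fa (tfun F x) n) (fa (tfun F x) m)"
  using tfun_functor[of x] by (auto simp: small_functor_def is_functor_def)

lemma tprof_nat: "u \<in> Ver C \<Longrightarrow> prof_nat (pcat X (Dom (VCat C) u)) (pcat X (Cod (VCat C) u)) (pprof X u)
   (prof_restrict (pprof Y u) (tfun F (Dom (VCat C) u)) (tfun F (Cod (VCat C) u))) (tprof F u)"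
  by (rule presheaf_transformation.tprof[OF F, unfolded psrc ptgt]) simp

lemma tprof_in [simp]:
  "\<lbrakk>u \<in> Ver C; Dom (VCat C) u = x; Cod (VCat C) u = x'; a \<in> Obj (pcat X x); a' \<in> Obj (pcat X x'); s \<in> pel (pprof X u) a a'\<rbrakk>
    \<Longrightarrow> tprof F u a a' s \<in> pel (pprof Y u) (fo (tfun F x) a) (fo (tfun F x') a')"
  using tprof_nat[of u] by (auto simp: prof_nat_def prof_restrict_def PiE_def Pi_def)

lemma tprof_pact:
  "\<lbrakk>u \<in> Ver C; Dom (VCat C) u = x; Cod (VCat C) u = x'; m \<in> Hom (pcat X x) a b; n \<in> Hom (pcat X x') b' a';
     s \<in> pel (pprof X u) b b'\<rbrakk>
    \<Longrightarrow> tprof F u a a' (pact (pprof X u) m n s) =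
      pact (pprof Y u) (fa (tfun F x) m) (fa (tfun F x') n) (tprof F u b b' s)"
  using tprof_nat[of u] by (auto simp: prof_nat_def prof_restrict_def)

lemma tfun_hor:
  assumes "f \<in> Hor C"
  shows "b \<in> Obj (pcat X (Cod (HCat C) f)) \<Longrightarrow>
      fo (tfun F (Dom (HCat C) f)) (fo (pfun X f) b) = fo (pfun Y f) (fo (tfun F (Cod (HCat C) f)) b)"
    "m \<in> Arr (pcat X (Cod (HCat C) f)) \<Longrightarrow>
      fa (tfun F (Dom (HCat C) f)) (fa (pfun X f) m) = fa (pfun Y f) (fa (tfun F (Cod (HCat C) f)) m)"
proof -
  let ?A = "pcat X (Cod (HCat C) f)"
  have "fctr_comp ?A (tfun F (Dom (HCat C) f)) (pfun X f) = fctr_comp ?A (pfun Y f) (tfun F (Cod (HCat C) f))"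
    by (rule presheaf_transformation.tfun_natural[OF F, unfolded psrc ptgt]) (simp add: assms)
  note e = arg_cong[OF this, of fo, THEN fun_cong, of b] arg_cong[OF this, of fa, THEN fun_cong, of m]
  show "b \<in> Obj ?A \<Longrightarrow> fo (tfun F (Dom (HCat C) f)) (fo (pfun X f) b) = fo (pfun Y f) (fo (tfun F (Cod (HCat C) f)) b)"
    using e(1) by (simp add: fctr_comp_def)
  show "m \<in> Arr ?A \<Longrightarrow> fa (tfun F (Dom (HCat C) f)) (fa (pfun X f) m) = fa (pfun Y f) (fa (tfun F (Cod (HCat C) f)) m)"
    using e(2) by (simp add: fctr_comp_def)
qed

lemma tprof_psq:
  assumes "\<alpha> \<in> Sq C" "a \<in> Obj (pcat X (Dom (VCat C) (rgt C \<alpha>)))" "a' \<in> Obj (pcat X (Cod (VCat C) (rgt C \<alpha>)))"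
    "s \<in> pel (pprof X (rgt C \<alpha>)) a a'"
  shows "tprof F (lft C \<alpha>) (fo (pfun X (upper C \<alpha>)) a) (fo (pfun X (lower C \<alpha>)) a') (psq X \<alpha> a a' s) =
      psq Y \<alpha> (fo (tfun F (Dom (VCat C) (rgt C \<alpha>))) a) (fo (tfun F (Cod (VCat C) (rgt C \<alpha>))) a') (tprof F (rgt C \<alpha>) a a' s)"
  by (rule presheaf_transformation.tprof_natural[OF F, unfolded psrc ptgt]) (use assms in simp_all)

lemma tprof_vmul:
  assumes "u \<in> Ver C" "u' \<in> Ver C" "Cod (VCat C) u = Dom (VCat C) u'"
    "a \<in> Obj (pcat X (Dom (VCat C) u))" "a' \<in> Obj (pcat X (Dom (VCat C) u'))" "a'' \<in> Obj (pcat X (Cod (VCat C) u'))"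
    "s \<in> pel (pprof X u) a a'" "s' \<in> pel (pprof X u') a' a''"
  shows "tprof F (Cmp (VCat C) u' u) a a'' (vmul C X u u' a a' a'' s' s) =
      vmul C Y u u' (fo (tfun F (Dom (VCat C) u)) a) (fo (tfun F (Dom (VCat C) u')) a') (fo (tfun F (Cod (VCat C) u')) a'')
        (tprof F u' a' a'' s') (tprof F u a a' s)"
  unfolding vmul_def
  by (rule presheaf_transformation.tprof_pmu[OF F, unfolded psrc ptgt]) (use assms in simp_all)

lemma tprof_Ident [simp]:
  "\<lbrakk>x \<in> Ob C; a = Dom (pcat X x) m; b = Cod (pcat X x) m; m \<in> Arr (pcat X x)\<rbrakk> \<Longrightarrow>
    tprof F (Ident (VCat C) x) a b m = fa (tfun F x) m"
  using presheaf_transformation.tprof_Ident[OF F, unfolded psrc ptgt, of x] by simp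

end

text \<open>
  By normality the action of an arrow of a fibre is multiplication with an element of an
  identity profunctor, so naturality of the maps of elements follows from compatibility with
  multiplication.
\<close>

lemma ptransfI:
  assumes X: "lax_double_presheaf C X" and Y: "lax_double_presheaf C Y" and st: "psrc F = X" "ptgt F = Y"
    and ext: "tfun F \<in> extensional (Ob C)" "tprof F \<in> extensional (Ver C)"
    and fn: "\<And>x. x \<in> Ob C \<Longrightarrow> small_functor (pcat X x) (pcat Y x) (tfun F x)"
    and p: "\<And>u. u \<in> Ver C \<Longrightarrow> tprof F u \<in> (\<Pi>\<^sub>E a\<in>Obj (pcat X (Dom (VCat C) u)). \<Pi>\<^sub>E a'\<in>Obj (pcat X (Cod (VCat C) u)).
      pel (pprof X u) a a' \<rightarrow>\<^sub>E pel (pprof Y u) (fo (tfun F (Dom (VCat C) u)) a) (fo (tfun F (Cod (VCat C) u)) a'))"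
    and hor: "\<And>f b. \<lbrakk>f \<in> Hor C; b \<in> Obj (pcat X (Cod (HCat C) f))\<rbrakk> \<Longrightarrow>
        fo (tfun F (Dom (HCat C) f)) (fo (pfun X f) b) = fo (pfun Y f) (fo (tfun F (Cod (HCat C) f)) b)"
      "\<And>f m. \<lbrakk>f \<in> Hor C; m \<in> Arr (pcat X (Cod (HCat C) f))\<rbrakk> \<Longrightarrow>
        fa (tfun F (Dom (HCat C) f)) (fa (pfun X f) m) = fa (pfun Y f) (fa (tfun F (Cod (HCat C) f)) m)"
    and sq: "\<And>\<alpha> a a' s. \<lbrakk>\<alpha> \<in> Sq C; a \<in> Obj (pcat X (Dom (VCat C) (rgt C \<alpha>)));
        a' \<in> Obj (pcat X (Cod (VCat C) (rgt C \<alpha>))); s \<in> pel (pprof X (rgt C \<alpha>)) a a'\<rbrakk> \<Longrightarrow>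
      tprof F (lft C \<alpha>) (fo (pfun X (upper C \<alpha>)) a) (fo (pfun X (lower C \<alpha>)) a') (psq X \<alpha> a a' s) =
      psq Y \<alpha> (fo (tfun F (Dom (VCat C) (rgt C \<alpha>))) a) (fo (tfun F (Cod (VCat C) (rgt C \<alpha>))) a') (tprof F (rgt C \<alpha>) a a' s)"
    and mul: "\<And>u u' a a' a'' s s'. \<lbrakk>u \<in> Ver C; u' \<in> Ver C; Cod (VCat C) u = Dom (VCat C) u';
        a \<in> Obj (pcat X (Dom (VCat C) u)); a' \<in> Obj (pcat X (Dom (VCat C) u')); a'' \<in> Obj (pcat X (Cod (VCat C) u'));
        s \<in> pel (pprof X u) a a'; s' \<in> pel (pprof X u') a' a''\<rbrakk> \<Longrightarrow>
      tprof F (Cmp (VCat C) u' u) a a'' (vmul C X u u' a a' a'' s' s) =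
      vmul C Y u u' (fo (tfun F (Dom (VCat C) u)) a) (fo (tfun F (Dom (VCat C) u')) a') (fo (tfun F (Cod (VCat C) u')) a'')
        (tprof F u' a' a'' s') (tprof F u a a' s)"
    and idn: "\<And>x a b m. \<lbrakk>x \<in> Ob C; m \<in> Hom (pcat X x) a b\<rbrakk> \<Longrightarrow> tprof F (Ident (VCat C) x) a b m = fa (tfun F x) m"
  shows "ptransf C F X Y"
proof -
  interpret X: lax_double_presheaf C X by (rule X)
  interpret Y: lax_double_presheaf C Y by (rule Y)
  have f [simp]: "\<lbrakk>x \<in> Ob C; a \<in> Obj (pcat X x)\<rbrakk> \<Longrightarrow> fo (tfun F x) a \<in> Obj (pcat Y x)"
    "\<lbrakk>x \<in> Ob C; m \<in> Arr (pcat X x)\<rbrakk> \<Longrightarrow> fa (tfun F x) m \<in> Arr (pcat Y x)"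
    "\<lbrakk>x \<in> Ob C; m \<in> Arr (pcat X x)\<rbrakk> \<Longrightarrow> Dom (pcat Y x) (fa (tfun F x) m) = fo (tfun F x) (Dom (pcat X x) m)"
    "\<lbrakk>x \<in> Ob C; m \<in> Arr (pcat X x)\<rbrakk> \<Longrightarrow> Cod (pcat Y x) (fa (tfun F x) m) = fo (tfun F x) (Cod (pcat X x) m)"
    "\<lbrakk>x \<in> Ob C; a \<in> Obj (pcat X x)\<rbrakk> \<Longrightarrow> fa (tfun F x) (Ident (pcat X x) a) = Ident (pcat Y x) (fo (tfun F x) a)" for x a m
    using fn[of x] by (auto simp: small_functor_def is_functor_def)
  have p_in: "tprof F u a a' s \<in> pel (pprof Y u) (fo (tfun F (Dom (VCat C) u)) a) (fo (tfun F (Cod (VCat C) u)) a')"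
    if "u \<in> Ver C" "a \<in> Obj (pcat X (Dom (VCat C) u))" "a' \<in> Obj (pcat X (Cod (VCat C) u))" "s \<in> pel (pprof X u) a a'" for u a a' s
    using p[OF that(1)] that(2-) by (auto simp: PiE_def Pi_def)
  \<comment> \<open>The two-sided action is split, and each half is a multiplication by an arrow.\<close>
  have act: "tprof F u a a' (pact (pprof X u) m n s) =
      pact (pprof Y u) (fa (tfun F (Dom (VCat C) u)) m) (fa (tfun F (Cod (VCat C) u)) n) (tprof F u b b' s)"
    if h: "u \<in> Ver C" "m \<in> Hom (pcat X (Dom (VCat C) u)) a b" "n \<in> Hom (pcat X (Cod (VCat C) u)) b' a'" "s \<in> pel (pprof X u) b b'"
    for u m n s a a' b b'
  proof -
    let ?x = "Dom (VCat C) u" and ?x' = "Cod (VCat C) u"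
    have o: "a \<in> Obj (pcat X ?x)" "b \<in> Obj (pcat X ?x)" "a' \<in> Obj (pcat X ?x')" "b' \<in> Obj (pcat X ?x')" using h by auto
    have left: "tprof F u a b' (pact (pprof X u) m (Ident (pcat X ?x') b') s) =
        pact (pprof Y u) (fa (tfun F ?x) m) (Ident (pcat Y ?x') (fo (tfun F ?x') b')) (tprof F u b b' s)"
      using mul[of "Ident (VCat C) ?x" u a b b' m s] h o
      by (simp add: X.vmul_left Y.vmul_left idn p_in)
    have "pact (pprof X u) m (Ident (pcat X ?x') b') s \<in> pel (pprof X u) a b'" using h o by simp
    then have right: "tprof F u a a' (pact (pprof X u) (Ident (pcat X ?x) a) n (pact (pprof X u) m (Ident (pcat X ?x') b') s)) =
        pact (pprof Y u) (Ident (pcat Y ?x) (fo (tfun F ?x) a)) (fa (tfun F ?x') n)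
          (tprof F u a b' (pact (pprof X u) m (Ident (pcat X ?x') b') s))"
      using mul[of u "Ident (VCat C) ?x'" a b' a' "pact (pprof X u) m (Ident (pcat X ?x') b') s" n] h o
      by (simp add: X.vmul_right Y.vmul_right idn p_in)
    have sp: "pact (pprof X u) m n s = pact (pprof X u) (Ident (pcat X ?x) a) n (pact (pprof X u) m (Ident (pcat X ?x') b') s)"
      by (rule X.pact_split(1)) (use h in simp_all)
    have sp': "pact (pprof Y u) (fa (tfun F ?x) m) (fa (tfun F ?x') n) (tprof F u b b' s) =
        pact (pprof Y u) (Ident (pcat Y ?x) (fo (tfun F ?x) a)) (fa (tfun F ?x') n)
          (pact (pprof Y u) (fa (tfun F ?x) m) (Ident (pcat Y ?x') (fo (tfun F ?x') b')) (tprof F u b b' s))"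
      by (rule Y.pact_split(1)[where b = "fo (tfun F ?x) b"]) (use h o p_in[of u b b' s] in simp_all)
    show ?thesis by (simp only: sp right left sp')
  qed
  have "presheaf_transformation C F"
  proof (rule presheaf_transformation.intro, unfold st, goal_cases)
    case (6 u x x')
    then show ?case using p[of u] by (auto simp: prof_nat_def prof_restrict_def act)
  next
    case (7 f x y)
    then show ?case using hor by (auto simp: fctr_comp_def intro!: restrict_ext)
  next
    case (8 \<alpha> u v y y' a a' s)
    then show ?case using sq[of \<alpha> a a' s] by auto
  next
    case (9 u x x' u' x'' a a' a'' s s')
    then show ?case using mul[of u u' a a' a'' s s'] by (auto simp: vmul_def)
  qed (use X Y ext fn idn in auto)
  then show ?thesis by (simp add: ptransf_def st)
qed

lemma ptrans_eqI:
  assumes "ptransf C F X Y" "ptransf C G X Y"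
    and o: "\<And>x a. \<lbrakk>x \<in> Ob C; a \<in> Obj (pcat X x)\<rbrakk> \<Longrightarrow> fo (tfun F x) a = fo (tfun G x) a"
    and p: "\<And>u a a' s. \<lbrakk>u \<in> Ver C; a \<in> Obj (pcat X (Dom (VCat C) u)); a' \<in> Obj (pcat X (Cod (VCat C) u));
      s \<in> pel (pprof X u) a a'\<rbrakk> \<Longrightarrow> tprof F u a a' s = tprof G u a a' s"
  shows "F = G"
proof -
  interpret F: ptransf C F X Y by (rule assms(1))
  interpret G: ptransf C G X Y by (rule assms(2))
  have "tfun F x = tfun G x" if x: "x \<in> Ob C" for x
  proof -
    have "fo (tfun F x) = fo (tfun G x)"
      using F.tfun_functor[OF x] G.tfun_functor[OF x] o[OF x]
      by (auto simp: small_functor_def intro: extensionalityI)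
    moreover have "fa (tfun F x) m = fa (tfun G x) m" if m: "m \<in> Arr (pcat X x)" for m
      using p[of "Ident (VCat C) x" "Dom (pcat X x) m" "Cod (pcat X x) m" m] x m by simp
    then have "fa (tfun F x) = fa (tfun G x)"
      using F.tfun_functor[OF x] G.tfun_functor[OF x]
      by (auto simp: small_functor_def intro: extensionalityI)
    ultimately show ?thesis by simp
  qed
  then have t: "tfun F = tfun G" using F.ext G.ext by (auto intro: extensionalityI)
  have "tprof F u = tprof G u" if u: "u \<in> Ver C" for u
  proof -
    have e: "tprof F u \<in> extensional (Obj (pcat X (Dom (VCat C) u)))" "tprof G u \<in> extensional (Obj (pcat X (Dom (VCat C) u)))"
      using F.tprof_nat[OF u] G.tprof_nat[OF u] by (auto simp: prof_nat_def PiE_def)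
    have e': "tprof H u a \<in> extensional (Obj (pcat X (Cod (VCat C) u)))"
      "tprof H u a a' \<in> extensional (pel (pprof X u) a a')"
      if "H = F \<or> H = G" "a \<in> Obj (pcat X (Dom (VCat C) u))" "a' \<in> Obj (pcat X (Cod (VCat C) u))" for H a a'
      using F.tprof_nat[OF u] G.tprof_nat[OF u] that by (auto simp: prof_nat_def PiE_def Pi_def)
    have e'': "tprof H u a \<in> extensional (Obj (pcat X (Cod (VCat C) u)))"
      if "H = F \<or> H = G" "a \<in> Obj (pcat X (Dom (VCat C) u))" for H a
      using F.tprof_nat[OF u] G.tprof_nat[OF u] that by (auto simp: prof_nat_def PiE_def Pi_def)
    have 1: "tprof F u a a' = tprof G u a a'"
      if "a \<in> Obj (pcat X (Dom (VCat C) u))" "a' \<in> Obj (pcat X (Cod (VCat C) u))" for a a'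
      by (rule extensionalityI[of _ "pel (pprof X u) a a'"]) (use that e' p u in auto)
    have 2: "tprof F u a = tprof G u a" if "a \<in> Obj (pcat X (Dom (VCat C) u))" for a
      by (rule extensionalityI[of _ "Obj (pcat X (Cod (VCat C) u))"]) (use that e'' 1 in auto)
    show ?thesis by (rule extensionalityI[OF e]) (use 2 in auto)
  qed
  then have "tprof F = tprof G" using F.ext G.ext by (auto intro: extensionalityI)
  with t show ?thesis using F.psrc G.psrc F.ptgt G.ptgt by simp
qed

lemma ptransf_iff: "ptransf C F X Y \<longleftrightarrow> presheaf_transformation C F \<and> psrc F = X \<and> ptgt F = Y"
  by (auto simp: ptransf_def)

lemma presheaf_transformation_ptransf: "presheaf_transformation C F \<Longrightarrow> ptransf C F (psrc F) (ptgt F)"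
  by (simp add: ptransf_def)

lemma (in ptransf) tfun_hor_at:
  "\<lbrakk>f \<in> Hor C; Dom (HCat C) f = x; b \<in> Obj (pcat X (Cod (HCat C) f))\<rbrakk> \<Longrightarrow>
    fo (tfun F x) (fo (pfun X f) b) = fo (pfun Y f) (fo (tfun F (Cod (HCat C) f)) b)"
  using tfun_hor(1) by blast

lemma fctr_sel [simp]: "a \<in> Obj A \<Longrightarrow> fo (fctr_id A) a = a" "m \<in> Arr A \<Longrightarrow> fa (fctr_id A) m = m"
  "a \<in> Obj A \<Longrightarrow> fo (fctr_comp A G F) a = fo G (fo F a)" "m \<in> Arr A \<Longrightarrow> fa (fctr_comp A G F) m = fa G (fa F m)"
  by (simp_all add: fctr_id_def fctr_comp_def)

lemma ptrans_sel [simp]: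
  "psrc (ptrans_id C X) = X" "ptgt (ptrans_id C X) = X"
  "psrc (ptrans_comp C G F) = psrc F" "ptgt (ptrans_comp C G F) = ptgt G"
  "x \<in> Ob C \<Longrightarrow> tfun (ptrans_id C X) x = fctr_id (pcat X x)"
  "x \<in> Ob C \<Longrightarrow> tfun (ptrans_comp C G F) x = fctr_comp (pcat (psrc F) x) (tfun G x) (tfun F x)"
  "\<lbrakk>u \<in> Ver C; a \<in> Obj (pcat X (Dom (VCat C) u)); a' \<in> Obj (pcat X (Cod (VCat C) u)); s \<in> pel (pprof X u) a a'\<rbrakk>
    \<Longrightarrow> tprof (ptrans_id C X) u a a' s = s"
  "\<lbrakk>u \<in> Ver C; Dom (VCat C) u = x; Cod (VCat C) u = x'; a \<in> Obj (pcat (psrc F) x); a' \<in> Obj (pcat (psrc F) x');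
     s \<in> pel (pprof (psrc F) u) a a'\<rbrakk>
    \<Longrightarrow> tprof (ptrans_comp C G F) u a a' s = tprof G u (fo (tfun F x) a) (fo (tfun F x') a') (tprof F u a a' s)"
  by (auto simp: ptrans_id_def ptrans_comp_def Let_def)

lemma small_functor_id: "category A \<Longrightarrow> small_functor A A (fctr_id A)"
proof -
  assume "category A"
  then interpret category A .
  show ?thesis by (auto simp: small_functor_def is_functor_def fctr_id_def)
qed

lemma small_functor_comp:
  assumes "category A" "small_functor B D G" "small_functor A B F" shows "small_functor A D (fctr_comp A G F)"
proof -
  interpret category A by fact
  have "fo F a \<in> Obj B" if "a \<in> Obj A" for a using assms(3) that by (auto simp: small_functor_def is_functor_def)
  moreover have "fa F m \<in> Arr B" if "m \<in> Arr A" for m using assms(3) that by (auto simp: small_functor_def is_functor_def)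
  ultimately show ?thesis using assms(2,3) by (auto simp: small_functor_def is_functor_def fctr_comp_def)
qed

lemma ptransf_id:
  assumes "lax_double_presheaf C X" shows "ptransf C (ptrans_id C X) X X"
proof -
  interpret lax_double_presheaf C X by (rule assms)
  show ?thesis
  proof (rule ptransfI[OF assms assms], goal_cases)
    case (6 u) then show ?case by (auto simp: ptrans_id_def)
  qed (simp_all add: small_functor_id fib_category, simp_all add: ptrans_id_def)
qed

lemma ptransf_comp:
  assumes "ptransf C G Y Z" "ptransf C F X Y" shows "ptransf C (ptrans_comp C G F) X Z"
proof -
  interpret G: ptransf C G Y Z by (rule assms(1))
  interpret F: ptransf C F X Y by (rule assms(2))
  show ?thesis
  proof (rule ptransfI[OF F.X.lax_double_presheaf_axioms G.Y.lax_double_presheaf_axioms], goal_cases)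
    case (5 x)
    then show ?case
      by (simp add: F.psrc small_functor_comp[OF F.X.fib_category G.tfun_functor F.tfun_functor])
  next
    case (6 u)
    then show ?case by (auto simp: ptrans_comp_def Let_def F.psrc)
  next
    case (9 \<alpha> a a' s)
    then show ?case by (simp add: F.psrc F.tprof_psq G.tprof_psq[symmetric] F.tfun_hor_at)
  next
    case (10 u u' a a' a'' s s')
    then show ?case by (simp add: F.psrc F.tprof_vmul G.tprof_vmul)
  qed (simp_all add: F.psrc F.ptgt G.psrc G.ptgt F.tfun_hor G.tfun_hor, simp_all add: ptrans_comp_def Let_def)
qed

lemma ptransf_presheaves: "ptransf C F X Y \<Longrightarrow> lax_double_presheaf C X" "ptransf C F X Y \<Longrightarrow> lax_double_presheaf C Y"
proof -
  assume "ptransf C F X Y"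
  then interpret ptransf C F X Y .
  show "lax_double_presheaf C X" "lax_double_presheaf C Y" by unfold_locales
qed

lemma ptrans_comp_id:
  assumes "ptransf C F X Y"
  shows "ptrans_comp C F (ptrans_id C X) = F" "ptrans_comp C (ptrans_id C Y) F = F"
proof -
  interpret F: ptransf C F X Y by (rule assms)
  note I = ptransf_id[OF F.X.lax_double_presheaf_axioms] ptransf_id[OF F.Y.lax_double_presheaf_axioms]
  show "ptrans_comp C F (ptrans_id C X) = F"
    by (rule ptrans_eqI[OF ptransf_comp[OF assms I(1)] assms]) simp_all
  show "ptrans_comp C (ptrans_id C Y) F = F"
    by (rule ptrans_eqI[OF ptransf_comp[OF I(2) assms] assms]) (simp_all add: F.psrc)
qed

lemma ptrans_comp_assoc:
  assumes "ptransf C H Z W" "ptransf C G Y Z" "ptransf C F X Y"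
  shows "ptrans_comp C H (ptrans_comp C G F) = ptrans_comp C (ptrans_comp C H G) F"
proof -
  interpret H: ptransf C H Z W by (rule assms(1))
  interpret G: ptransf C G Y Z by (rule assms(2))
  interpret F: ptransf C F X Y by (rule assms(3))
  show ?thesis
    by (rule ptrans_eqI[OF ptransf_comp[OF assms(1) ptransf_comp[OF assms(2,3)]]
          ptransf_comp[OF ptransf_comp[OF assms(1,2)] assms(3)]]) (simp_all add: F.psrc G.psrc)
qed

locale pmodf =
  fixes C :: "'u::universe dblcat" and A :: "'u pmod" and F F' :: "'u ptrans" and X Y :: "'u psh"
  assumes A: "globular_modification C A" and msrc: "msrc A = F" and mtgt: "mtgt A = F'"
    and psrc: "psrc F = X" and ptgt: "ptgt F = Y"
begin

sublocale F: ptransf C F X Y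
  using globular_modification.src[OF A] by (simp add: ptransf_def msrc psrc ptgt)

sublocale F': ptransf C F' X Y
  using globular_modification.tgt[OF A] globular_modification.parallel[OF A]
  by (simp add: ptransf_def mtgt msrc psrc ptgt)

lemma mcomp_in: "mcomp A \<in> (\<Pi>\<^sub>E x\<in>Ob C. \<Pi>\<^sub>E a\<in>Obj (pcat X x). Hom (pcat Y x) (fo (tfun F x) a) (fo (tfun F' x) a))"
  using globular_modification.mcomp_in[OF A] by (simp add: mtgt msrc psrc ptgt)

lemma mcomp_simps [simp]:
  "\<lbrakk>x \<in> Ob C; a \<in> Obj (pcat X x)\<rbrakk> \<Longrightarrow> mcomp A x a \<in> Arr (pcat Y x)"
  "\<lbrakk>x \<in> Ob C; a \<in> Obj (pcat X x)\<rbrakk> \<Longrightarrow> Dom (pcat Y x) (mcomp A x a) = fo (tfun F x) a"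
  "\<lbrakk>x \<in> Ob C; a \<in> Obj (pcat X x)\<rbrakk> \<Longrightarrow> Cod (pcat Y x) (mcomp A x a) = fo (tfun F' x) a"
  using mcomp_in by (auto simp: PiE_def Pi_def)

lemma mcomp_natural: "\<lbrakk>x \<in> Ob C; m \<in> Hom (pcat X x) a b\<rbrakk> \<Longrightarrow>
    Cmp (pcat Y x) (fa (tfun F' x) m) (mcomp A x a) = Cmp (pcat Y x) (mcomp A x b) (fa (tfun F x) m)"
  by (rule globular_modification.mcomp_natural[OF A, unfolded mtgt msrc psrc ptgt])

lemma mcomp_hor: "\<lbrakk>f \<in> Hor C; Dom (HCat C) f = x; Cod (HCat C) f = y; b \<in> Obj (pcat X y)\<rbrakk> \<Longrightarrow>
    fa (pfun Y f) (mcomp A y b) = mcomp A x (fo (pfun X f) b)"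
  by (rule globular_modification.mcomp_Hor[OF A, unfolded mtgt msrc psrc ptgt]) simp_all

lemma mcomp_ver:
  assumes "u \<in> Ver C" "Dom (VCat C) u = x" "Cod (VCat C) u = x'" "a \<in> Obj (pcat X x)" "a' \<in> Obj (pcat X x')" "s \<in> pel (pprof X u) a a'"
  shows "pact (pprof Y u) (Ident (pcat Y x) (fo (tfun F x) a)) (mcomp A x' a') (tprof F u a a' s) =
      pact (pprof Y u) (mcomp A x a) (Ident (pcat Y x') (fo (tfun F' x') a')) (tprof F' u a a' s)"
  by (rule globular_modification.mcomp_Ver[OF A, unfolded mtgt msrc psrc ptgt]) (use assms in simp_all)

end

text \<open>Naturality in the arrows of the fibres is compatibility with the elements of identity profunctors.\<close>

lemma pmodfI:
  assumes F: "ptransf C F X Y" and F': "ptransf C F' X Y" and st: "msrc A = F" "mtgt A = F'"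
    and i: "mcomp A \<in> (\<Pi>\<^sub>E x\<in>Ob C. \<Pi>\<^sub>E a\<in>Obj (pcat X x). Hom (pcat Y x) (fo (tfun F x) a) (fo (tfun F' x) a))"
    and h: "\<And>f b. \<lbrakk>f \<in> Hor C; b \<in> Obj (pcat X (Cod (HCat C) f))\<rbrakk> \<Longrightarrow>
        fa (pfun Y f) (mcomp A (Cod (HCat C) f) b) = mcomp A (Dom (HCat C) f) (fo (pfun X f) b)"
    and v: "\<And>u a a' s. \<lbrakk>u \<in> Ver C; a \<in> Obj (pcat X (Dom (VCat C) u)); a' \<in> Obj (pcat X (Cod (VCat C) u)); s \<in> pel (pprof X u) a a'\<rbrakk> \<Longrightarrow>
        pact (pprof Y u) (Ident (pcat Y (Dom (VCat C) u)) (fo (tfun F (Dom (VCat C) u)) a)) (mcomp A (Cod (VCat C) u) a') (tprof F u a a' s) =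
        pact (pprof Y u) (mcomp A (Dom (VCat C) u) a) (Ident (pcat Y (Cod (VCat C) u)) (fo (tfun F' (Cod (VCat C) u)) a')) (tprof F' u a a' s)"
  shows "pmodf C A F F' X Y"
proof -
  interpret F: ptransf C F X Y by (rule F)
  interpret F': ptransf C F' X Y by (rule F')
  have m [simp]: "\<lbrakk>x \<in> Ob C; a \<in> Obj (pcat X x)\<rbrakk> \<Longrightarrow> mcomp A x a \<in> Arr (pcat Y x)"
    "\<lbrakk>x \<in> Ob C; a \<in> Obj (pcat X x)\<rbrakk> \<Longrightarrow> Dom (pcat Y x) (mcomp A x a) = fo (tfun F x) a"
    "\<lbrakk>x \<in> Ob C; a \<in> Obj (pcat X x)\<rbrakk> \<Longrightarrow> Cod (pcat Y x) (mcomp A x a) = fo (tfun F' x) a" for x a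
    using i by (auto simp: PiE_def Pi_def)
  have "globular_modification C A"
  proof (rule globular_modification.intro, unfold st F.psrc F.ptgt, goal_cases)
    case (6 x m a b)
    then show ?case
      using v[of "Ident (VCat C) x" a b m] by auto
  qed (use F.F F'.F F'.psrc F'.ptgt i h v in auto)
  then show ?thesis by (simp add: pmodf_def st F.psrc F.ptgt)
qed

lemma pmod_eqI:
  assumes "pmodf C A F F' X Y" "pmodf C B F F' X Y"
    and e: "\<And>x a. \<lbrakk>x \<in> Ob C; a \<in> Obj (pcat X x)\<rbrakk> \<Longrightarrow> mcomp A x a = mcomp B x a"
  shows "A = B"
proof -
  interpret A: pmodf C A F F' X Y by (rule assms(1))
  interpret B: pmodf C B F F' X Y by (rule assms(2))
  have "mcomp A = mcomp B"
    by (rule PiE_ext[OF A.mcomp_in B.mcomp_in], rule PiE_ext[OF PiE_mem[OF A.mcomp_in] PiE_mem[OF B.mcomp_in]])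
      (simp_all add: e)
  then show ?thesis using A.msrc B.msrc A.mtgt B.mtgt by simp
qed

lemma pmodf_iff: "pmodf C A F F' X Y \<longleftrightarrow> globular_modification C A \<and> msrc A = F \<and> mtgt A = F' \<and> psrc F = X \<and> ptgt F = Y"
  by (auto simp: pmodf_def)

lemma pmod_sel [simp]:
  "msrc (pmod_id C F) = F" "mtgt (pmod_id C F) = F"
  "msrc (pmod_vcomp C B A) = msrc A" "mtgt (pmod_vcomp C B A) = mtgt B"
  "msrc (pmod_hcomp C B A) = ptrans_comp C (msrc B) (msrc A)" "mtgt (pmod_hcomp C B A) = ptrans_comp C (mtgt B) (mtgt A)"
  "\<lbrakk>x \<in> Ob C; a \<in> Obj (pcat (psrc F) x)\<rbrakk> \<Longrightarrow> mcomp (pmod_id C F) x a = Ident (pcat (ptgt F) x) (fo (tfun F x) a)"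
  "\<lbrakk>x \<in> Ob C; a \<in> Obj (pcat (psrc (msrc A)) x)\<rbrakk> \<Longrightarrow>
    mcomp (pmod_vcomp C B A) x a = Cmp (pcat (ptgt (msrc A)) x) (mcomp B x a) (mcomp A x a)"
  "\<lbrakk>x \<in> Ob C; a \<in> Obj (pcat (psrc (msrc A)) x)\<rbrakk> \<Longrightarrow>
    mcomp (pmod_hcomp C B A) x a = Cmp (pcat (ptgt (msrc B)) x) (mcomp B x (fo (tfun (mtgt A) x) a)) (fa (tfun (msrc B) x) (mcomp A x a))"
  by (simp_all add: pmod_id_def pmod_vcomp_def pmod_hcomp_def)

lemma pmodf_id:
  assumes "ptransf C F X Y" shows "pmodf C (pmod_id C F) F F X Y"
proof -
  interpret F: ptransf C F X Y by (rule assms)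
  show ?thesis
    by (rule pmodfI[OF assms assms]) (auto simp: F.psrc F.ptgt F.tfun_hor pmod_id_def)
qed

lemma pmodf_vcomp:
  assumes "pmodf C B F' F'' X Y" "pmodf C A F F' X Y" shows "pmodf C (pmod_vcomp C B A) F F'' X Y"
proof -
  interpret B: pmodf C B F' F'' X Y by (rule assms(1))
  interpret A: pmodf C A F F' X Y by (rule assms(2))
  show ?thesis
  proof (rule pmodfI[OF A.F.ptransf_axioms B.F'.ptransf_axioms], goal_cases)
    case 3 then show ?case by (auto simp: pmod_vcomp_def A.msrc A.F.psrc A.F.ptgt)
  next
    case (5 u a a' s)
    let ?x = "Dom (VCat C) u" and ?x' = "Cod (VCat C) u"
    let ?p = "pact (pprof Y u)" and ?I = "\<lambda>x G a. Ident (pcat Y x) (fo (tfun G x) a)"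
    note h = 5
    have "?p (?I ?x F a) (Cmp (pcat Y ?x') (mcomp B ?x' a') (mcomp A ?x' a')) (tprof F u a a' s) =
        ?p (?I ?x F a) (mcomp B ?x' a') (?p (?I ?x F a) (mcomp A ?x' a') (tprof F u a a' s))"
      using h by (simp add: B.F.Y.pact_Cmp)
    also have "\<dots> = ?p (?I ?x F a) (mcomp B ?x' a') (?p (mcomp A ?x a) (?I ?x' F' a') (tprof F' u a a' s))"
      using A.mcomp_ver[of u ?x ?x' a a' s] h by simp
    also have "\<dots> = ?p (mcomp A ?x a) (mcomp B ?x' a') (tprof F' u a a' s)"
      using h by (simp add: B.F.Y.pact_Cmp)
    also have "\<dots> = ?p (mcomp A ?x a) (?I ?x' F'' a') (?p (?I ?x F' a) (mcomp B ?x' a') (tprof F' u a a' s))"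
      using h by (simp add: B.F.Y.pact_Cmp)
    also have "\<dots> = ?p (mcomp A ?x a) (?I ?x' F'' a') (?p (mcomp B ?x a) (?I ?x' F'' a') (tprof F'' u a a' s))"
      using B.mcomp_ver[of u ?x ?x' a a' s] h by simp
    also have "\<dots> = ?p (Cmp (pcat Y ?x) (mcomp B ?x a) (mcomp A ?x a)) (?I ?x' F'' a') (tprof F'' u a a' s)"
      using h by (simp add: B.F.Y.pact_Cmp)
    finally show ?case using h by (simp add: A.msrc A.F.psrc A.F.ptgt)
  qed (simp_all add: A.msrc B.mtgt A.F.psrc A.F.ptgt A.mcomp_hor B.mcomp_hor)
qed

lemma pmodf_hcomp:
  assumes "pmodf C B G G' Y Z" "pmodf C A F F' X Y"
  shows "pmodf C (pmod_hcomp C B A) (ptrans_comp C G F) (ptrans_comp C G' F') X Z"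
proof -
  interpret B: pmodf C B G G' Y Z by (rule assms(1))
  interpret A: pmodf C A F F' X Y by (rule assms(2))
  show ?thesis
  proof (rule pmodfI[OF ptransf_comp[OF B.F.ptransf_axioms A.F.ptransf_axioms]
        ptransf_comp[OF B.F'.ptransf_axioms A.F'.ptransf_axioms]], goal_cases)
    case 3 then show ?case by (auto simp: pmod_hcomp_def A.msrc A.mtgt B.msrc A.F.psrc A.F'.psrc B.F.ptgt)
  next
    case (4 f b)
    then show ?case
      using B.F.tfun_hor(2)[of f "mcomp A (Cod (HCat C) f) b"]
      by (simp add: A.msrc A.mtgt B.msrc A.F.psrc B.F.ptgt A.mcomp_hor B.mcomp_hor A.F'.tfun_hor)
  next
    case (5 u a a' s)
    let ?x = "Dom (VCat C) u" and ?x' = "Cod (VCat C) u"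
    let ?p = "pact (pprof Z u)" and ?I = "\<lambda>x b. Ident (pcat Z x) b"
    let ?G = "\<lambda>x. fo (tfun G x)" and ?Ga = "\<lambda>x. fa (tfun G x)" and ?G' = "\<lambda>x. fo (tfun G' x)"
    let ?F = "\<lambda>x. fo (tfun F x)" and ?F' = "\<lambda>x. fo (tfun F' x)"
    let ?s = "tprof F u a a' s" and ?s' = "tprof F' u a a' s"
    note h = 5
    have "?p (?I ?x (?G ?x (?F ?x a))) (Cmp (pcat Z ?x') (mcomp B ?x' (?F' ?x' a')) (?Ga ?x' (mcomp A ?x' a')))
          (tprof G u (?F ?x a) (?F ?x' a') ?s) =
        ?p (?I ?x (?G ?x (?F ?x a))) (mcomp B ?x' (?F' ?x' a'))
          (?p (?I ?x (?G ?x (?F ?x a))) (?Ga ?x' (mcomp A ?x' a')) (tprof G u (?F ?x a) (?F ?x' a') ?s))"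
      using h by (simp add: B.F.Y.pact_Cmp)
    also have "?p (?I ?x (?G ?x (?F ?x a))) (?Ga ?x' (mcomp A ?x' a')) (tprof G u (?F ?x a) (?F ?x' a') ?s) =
        tprof G u (?F ?x a) (?F' ?x' a') (pact (pprof Y u) (Ident (pcat Y ?x) (?F ?x a)) (mcomp A ?x' a') ?s)"
      using h B.F.tprof_pact[of u ?x ?x' "Ident (pcat Y ?x) (?F ?x a)" "?F ?x a" "?F ?x a" "mcomp A ?x' a'" "?F ?x' a'" "?F' ?x' a'" ?s]
      by simp
    also have "\<dots> = tprof G u (?F ?x a) (?F' ?x' a') (pact (pprof Y u) (mcomp A ?x a) (Ident (pcat Y ?x') (?F' ?x' a')) ?s')"
      using A.mcomp_ver[of u ?x ?x' a a' s] h by simp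
    also have "\<dots> = ?p (?Ga ?x (mcomp A ?x a)) (?I ?x' (?G ?x' (?F' ?x' a'))) (tprof G u (?F' ?x a) (?F' ?x' a') ?s')"
      using h B.F.tprof_pact[of u ?x ?x' "mcomp A ?x a" "?F ?x a" "?F' ?x a" "Ident (pcat Y ?x') (?F' ?x' a')" "?F' ?x' a'" "?F' ?x' a'" ?s']
      by simp
    also have "?p (?I ?x (?G ?x (?F ?x a))) (mcomp B ?x' (?F' ?x' a')) \<dots> =
        ?p (?Ga ?x (mcomp A ?x a)) (mcomp B ?x' (?F' ?x' a')) (tprof G u (?F' ?x a) (?F' ?x' a') ?s')"
      using h by (simp add: B.F.Y.pact_Cmp)
    also have "\<dots> = ?p (?Ga ?x (mcomp A ?x a)) (?I ?x' (?G' ?x' (?F' ?x' a')))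
        (?p (?I ?x (?G ?x (?F' ?x a))) (mcomp B ?x' (?F' ?x' a')) (tprof G u (?F' ?x a) (?F' ?x' a') ?s'))"
      using h by (simp add: B.F.Y.pact_Cmp)
    also have "\<dots> = ?p (?Ga ?x (mcomp A ?x a)) (?I ?x' (?G' ?x' (?F' ?x' a')))
        (?p (mcomp B ?x (?F' ?x a)) (?I ?x' (?G' ?x' (?F' ?x' a'))) (tprof G' u (?F' ?x a) (?F' ?x' a') ?s'))"
      using B.mcomp_ver[of u ?x ?x' "?F' ?x a" "?F' ?x' a'" ?s'] h by simp
    also have "\<dots> = ?p (Cmp (pcat Z ?x) (mcomp B ?x (?F' ?x a)) (?Ga ?x (mcomp A ?x a))) (?I ?x' (?G' ?x' (?F' ?x' a')))
        (tprof G' u (?F' ?x a) (?F' ?x' a') ?s')"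
      using h by (simp add: B.F.Y.pact_Cmp)
    finally show ?case using h by (simp add: A.msrc A.mtgt B.msrc A.F.psrc A.F'.psrc B.F.ptgt)
  qed (simp_all add: A.msrc A.mtgt B.msrc B.mtgt)
qed

lemma pmod_vcomp_id:
  assumes "pmodf C A F F' X Y"
  shows "pmod_vcomp C A (pmod_id C F) = A" "pmod_vcomp C (pmod_id C F') A = A"
proof -
  interpret A: pmodf C A F F' X Y by (rule assms)
  show "pmod_vcomp C A (pmod_id C F) = A"
    by (rule pmod_eqI[OF pmodf_vcomp[OF assms pmodf_id[OF A.F.ptransf_axioms]] assms])
      (simp_all add: A.F.psrc A.F.ptgt)
  show "pmod_vcomp C (pmod_id C F') A = A"
    by (rule pmod_eqI[OF pmodf_vcomp[OF pmodf_id[OF A.F'.ptransf_axioms] assms] assms])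
      (simp_all add: A.F.psrc A.F.ptgt A.F'.psrc A.F'.ptgt A.msrc)
qed

lemma pmod_vcomp_assoc:
  assumes "pmodf C D F'' F3 X Y" "pmodf C B F' F'' X Y" "pmodf C A F F' X Y"
  shows "pmod_vcomp C D (pmod_vcomp C B A) = pmod_vcomp C (pmod_vcomp C D B) A"
proof -
  interpret D: pmodf C D F'' F3 X Y by (rule assms(1))
  interpret B: pmodf C B F' F'' X Y by (rule assms(2))
  interpret A: pmodf C A F F' X Y by (rule assms(3))
  show ?thesis
    by (rule pmod_eqI[OF pmodf_vcomp[OF assms(1) pmodf_vcomp[OF assms(2,3)]] pmodf_vcomp[OF pmodf_vcomp[OF assms(1,2)] assms(3)]])
      (simp_all add: A.F.psrc A.F.ptgt B.F.psrc B.F.ptgt A.msrc B.msrc D.F.Y.fib_assoc)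
qed

lemma pmod_hcomp_id:
  assumes "pmodf C A F F' X Y"
  shows "pmod_hcomp C A (pmod_id C (ptrans_id C X)) = A" "pmod_hcomp C (pmod_id C (ptrans_id C Y)) A = A"
proof -
  interpret A: pmodf C A F F' X Y by (rule assms)
  note I = ptransf_id[OF A.F.X.lax_double_presheaf_axioms] ptransf_id[OF A.F.Y.lax_double_presheaf_axioms]
  have "pmodf C (pmod_hcomp C A (pmod_id C (ptrans_id C X))) F F' X Y"
    using pmodf_hcomp[OF assms pmodf_id[OF I(1)]]
    by (simp add: ptrans_comp_id[OF A.F.ptransf_axioms] ptrans_comp_id[OF A.F'.ptransf_axioms])
  from pmod_eqI[OF this assms] show "pmod_hcomp C A (pmod_id C (ptrans_id C X)) = A"
    by (simp add: A.msrc A.F.ptgt)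
  have "pmodf C (pmod_hcomp C (pmod_id C (ptrans_id C Y)) A) F F' X Y"
    using pmodf_hcomp[OF pmodf_id[OF I(2)] assms]
    by (simp add: ptrans_comp_id[OF A.F.ptransf_axioms] ptrans_comp_id[OF A.F'.ptransf_axioms])
  from pmod_eqI[OF this assms] show "pmod_hcomp C (pmod_id C (ptrans_id C Y)) A = A"
    by (simp add: A.msrc A.mtgt A.F.psrc)
qed

lemma pmod_hcomp_assoc:
  assumes "pmodf C D H H' Z W" "pmodf C B G G' Y Z" "pmodf C A F F' X Y"
  shows "pmod_hcomp C D (pmod_hcomp C B A) = pmod_hcomp C (pmod_hcomp C D B) A"
proof -
  interpret D: pmodf C D H H' Z W by (rule assms(1))
  interpret B: pmodf C B G G' Y Z by (rule assms(2))
  interpret A: pmodf C A F F' X Y by (rule assms(3))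
  note eqs = ptrans_comp_assoc[OF D.F.ptransf_axioms B.F.ptransf_axioms A.F.ptransf_axioms]
    ptrans_comp_assoc[OF D.F'.ptransf_axioms B.F'.ptransf_axioms A.F'.ptransf_axioms]
  show ?thesis
    by (rule pmod_eqI[OF pmodf_hcomp[OF assms(1) pmodf_hcomp[OF assms(2,3)]]
          pmodf_hcomp[OF pmodf_hcomp[OF assms(1,2)] assms(3), folded eqs]])
      (simp_all add: A.F.psrc A.F'.psrc B.F.psrc D.F.ptgt B.F.ptgt A.msrc A.mtgt B.msrc B.mtgt D.msrc D.F.Y.fib_assoc)
qed

lemma pmod_hcomp_of_ids:
  assumes "ptransf C G Y Z" "ptransf C F X Y"
  shows "pmod_hcomp C (pmod_id C G) (pmod_id C F) = pmod_id C (ptrans_comp C G F)"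
proof -
  interpret G: ptransf C G Y Z by (rule assms(1))
  interpret F: ptransf C F X Y by (rule assms(2))
  show ?thesis
    by (rule pmod_eqI[OF pmodf_hcomp[OF pmodf_id[OF assms(1)] pmodf_id[OF assms(2)]] pmodf_id[OF ptransf_comp[OF assms]]])
      (simp_all add: F.psrc F.ptgt G.psrc G.ptgt)
qed

lemma pmod_interchange:
  assumes "pmodf C \<sigma> F F' X Y" "pmodf C \<sigma>' F' F'' X Y" "pmodf C \<tau> G G' Y Z" "pmodf C \<tau>' G' G'' Y Z"
  shows "pmod_hcomp C (pmod_vcomp C \<tau>' \<tau>) (pmod_vcomp C \<sigma>' \<sigma>) =
    pmod_vcomp C (pmod_hcomp C \<tau>' \<sigma>') (pmod_hcomp C \<tau> \<sigma>)"
proof -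
  interpret s: pmodf C \<sigma> F F' X Y by (rule assms(1))
  interpret s': pmodf C \<sigma>' F' F'' X Y by (rule assms(2))
  interpret t: pmodf C \<tau> G G' Y Z by (rule assms(3))
  interpret t': pmodf C \<tau>' G' G'' Y Z by (rule assms(4))
  show ?thesis
  proof (rule pmod_eqI[OF pmodf_hcomp[OF pmodf_vcomp[OF assms(4,3)] pmodf_vcomp[OF assms(2,1)]]
        pmodf_vcomp[OF pmodf_hcomp[OF assms(4,2)] pmodf_hcomp[OF assms(3,1)]]], goal_cases)
    case (1 x a)
    let ?c = "Cmp (pcat Z x)"
    have "?c (mcomp \<tau> x (fo (tfun F'' x) a)) (?c (fa (tfun G x) (mcomp \<sigma>' x a)) (fa (tfun G x) (mcomp \<sigma> x a))) =
        ?c (?c (fa (tfun G' x) (mcomp \<sigma>' x a)) (mcomp \<tau> x (fo (tfun F' x) a))) (fa (tfun G x) (mcomp \<sigma> x a))"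
      using 1 t.mcomp_natural[of x "mcomp \<sigma>' x a"] by (simp add: t.F.Y.fib_assoc)
    then show ?case using 1
      by (simp add: t.F.Y.fib_assoc[symmetric] s.msrc s.mtgt s'.msrc s'.mtgt t.msrc t'.msrc s.F.psrc s.F.ptgt
          s.F'.psrc t.F.psrc t.F.ptgt t.F'.ptgt)
  qed
qed

lemma Psh_simps [simp]:
  "Obj (One (Psh C)) = Collect (lax_double_presheaf C)" "Arr (One (Psh C)) = Collect (presheaf_transformation C)"
  "Dom (One (Psh C)) = psrc" "Cod (One (Psh C)) = ptgt" "Ident (One (Psh C)) = ptrans_id C" "Cmp (One (Psh C)) = ptrans_comp C"
  "Obj (Vert (Psh C)) = Collect (presheaf_transformation C)" "Arr (Vert (Psh C)) = Collect (globular_modification C)"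
  "Dom (Vert (Psh C)) = msrc" "Cod (Vert (Psh C)) = mtgt" "Ident (Vert (Psh C)) = pmod_id C" "Cmp (Vert (Psh C)) = pmod_vcomp C"
  "Obj (Horiz (Psh C)) = Collect (lax_double_presheaf C)" "Arr (Horiz (Psh C)) = Collect (globular_modification C)"
  "Dom (Horiz (Psh C)) A = psrc (msrc A)" "Cod (Horiz (Psh C)) A = ptgt (msrc A)"
  "Ident (Horiz (Psh C)) X = pmod_id C (ptrans_id C X)" "Cmp (Horiz (Psh C)) = pmod_hcomp C"
  by (simp_all add: Psh_def)

lemma globular_modification_parallel:
  assumes "globular_modification C A"
  shows "psrc (mtgt A) = psrc (msrc A)" "ptgt (mtgt A) = ptgt (msrc A)"
    "presheaf_transformation C (msrc A)" "presheaf_transformation C (mtgt A)"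
  using globular_modification.parallel[OF assms] globular_modification.src[OF assms] globular_modification.tgt[OF assms]
  by auto

lemma twocategory_Psh: "twocategory (Psh C)"
proof -
  note mt = pmodf_iff[THEN iffD2]
  note par = globular_modification_parallel
  have gm: "pmodf C A (msrc A) (mtgt A) (psrc (msrc A)) (ptgt (msrc A))" if "globular_modification C A" for A
    using that by (simp add: pmodf_iff)
  note pt = presheaf_transformation_ptransf
  show ?thesis
  proof (rule twocategory.intro)
    show "category (One (Psh C))"
    proof (rule category.intro, goal_cases)
      case (1 m) then show ?case using ptransf_presheaves[OF pt] by simp
    next
      case (2 m) then show ?case using ptransf_presheaves[OF pt] by simp
    next
      case (3 a) then show ?case using ptransf_id[of C a] by (simp add: ptransf_iff)
    next
      case (6 n m) then show ?case using ptransf_comp[of C n "psrc n" "ptgt n" m "psrc m"] by (simp add: ptransf_iff)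
    next
      case (9 m) then show ?case using ptrans_comp_id(1)[OF pt] by simp
    next
      case (10 m) then show ?case using ptrans_comp_id(2)[OF pt] by simp
    next
      case (11 k n m)
      then show ?case using ptrans_comp_assoc[of C k "psrc k" "ptgt k" n "psrc n" m "psrc m"] by (simp add: ptransf_iff)
    qed simp_all
    show "category (Vert (Psh C))"
    proof (rule category.intro, goal_cases)
      case (3 F) then show ?case using pmodf_id[OF pt] by (simp add: pmodf_iff)
    next
      case (6 n m)
      then show ?case using pmodf_vcomp[of C n "msrc n" "mtgt n" "psrc (msrc m)" "ptgt (msrc m)" m "msrc m"] par[of C m] par[of C n]
        by (simp add: pmodf_iff)
    next
      case (9 m) then show ?case using pmod_vcomp_id(1)[OF gm] by simp
    next
      case (10 m) then show ?case using pmod_vcomp_id(2)[OF gm] by simp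
    next
      case (11 k n m)
      then show ?case
        using pmod_vcomp_assoc[of C k "msrc k" "mtgt k" "psrc (msrc m)" "ptgt (msrc m)" n "msrc n" m "msrc m"] par[of C m] par[of C n]
        by (simp add: pmodf_iff)
    qed (auto simp: par)
    show "category (Horiz (Psh C))"
    proof (rule category.intro, goal_cases)
      case (1 m) then show ?case using ptransf_presheaves(1)[OF pt[OF par(3)]] by simp
    next
      case (2 m) then show ?case using ptransf_presheaves(2)[OF pt[OF par(3)]] by simp
    next
      case (3 X) then show ?case using pmodf_id[OF ptransf_id] by (simp add: pmodf_iff)
    next
      case (6 n m)
      then show ?case
        using pmodf_hcomp[of C n "msrc n" "mtgt n" "psrc (msrc n)" "ptgt (msrc n)" m "msrc m" "mtgt m" "psrc (msrc m)"]
        by (simp add: pmodf_iff)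
    next
      case (9 m) then show ?case using pmod_hcomp_id(1)[OF gm] by simp
    next
      case (10 m) then show ?case using pmod_hcomp_id(2)[OF gm] by simp
    next
      case (11 k n m)
      then show ?case
        using pmod_hcomp_assoc[of C k "msrc k" "mtgt k" "psrc (msrc k)" "ptgt (msrc k)" n "msrc n" "mtgt n" "psrc (msrc n)"
            m "msrc m" "mtgt m" "psrc (msrc m)"]
        by (simp add: pmodf_iff)
    qed (auto simp: par)
  next
    fix g f
    assume "g \<in> Cells1 (Psh C)" "f \<in> Cells1 (Psh C)" "Cod (One (Psh C)) f = Dom (One (Psh C)) g"
    then show "Cmp (Horiz (Psh C)) (Ident (Vert (Psh C)) g) (Ident (Vert (Psh C)) f) = Ident (Vert (Psh C)) (Cmp (One (Psh C)) g f)"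
      using pmod_hcomp_of_ids[of C g "psrc g" "ptgt g" f "psrc f"] by (simp add: ptransf_iff)
  next
    fix \<sigma> \<sigma>' \<tau> \<tau>'
    assume "\<sigma> \<in> Cells2 (Psh C)" "\<sigma>' \<in> Cells2 (Psh C)" "\<tau> \<in> Cells2 (Psh C)" "\<tau>' \<in> Cells2 (Psh C)"
      "Cod (Vert (Psh C)) \<sigma> = Dom (Vert (Psh C)) \<sigma>'" "Cod (Vert (Psh C)) \<tau> = Dom (Vert (Psh C)) \<tau>'"
      "Cod (Horiz (Psh C)) \<sigma> = Dom (Horiz (Psh C)) \<tau>"
    then show "Cmp (Horiz (Psh C)) (Cmp (Vert (Psh C)) \<tau>' \<tau>) (Cmp (Vert (Psh C)) \<sigma>' \<sigma>) =
        Cmp (Vert (Psh C)) (Cmp (Horiz (Psh C)) \<tau>' \<sigma>') (Cmp (Horiz (Psh C)) \<tau> \<sigma>)"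
      using pmod_interchange[of C \<sigma> "msrc \<sigma>" "mtgt \<sigma>" "psrc (msrc \<sigma>)" "ptgt (msrc \<sigma>)" \<sigma>' "mtgt \<sigma>'"
          \<tau> "msrc \<tau>" "mtgt \<tau>" "ptgt (msrc \<tau>)" \<tau>' "mtgt \<tau>'"] par[of C \<sigma>] par[of C \<tau>]
      by (simp add: pmodf_iff)
  qed (auto simp: par)
qed

section \<open>The Grothendieck construction\<close>

lemma upair_eq [simp]: "upair a b = upair c d \<longleftrightarrow> a = c \<and> b = d"
  using upair_inject by blast

lemma vcode_sel [simp]: "vbase (vcode u a a' s) = u" "vdomc (vcode u a a' s) = a" "vcodc (vcode u a a' s) = a'"
  "velem (vcode u a a' s) = s"
  by (simp_all add: vcode_def vbase_def vdomc_def vcodc_def velem_def)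

lemma vcode_eq [simp]: "vcode u a a' s = vcode v b b' t \<longleftrightarrow> u = v \<and> a = b \<and> a' = b' \<and> s = t"
  by (auto simp: vcode_def)

lemma groth_mem [simp]:
  "upair x a \<in> groth_Ob C X \<longleftrightarrow> x \<in> Ob C \<and> a \<in> Obj (pcat X x)"
  "upair f b \<in> groth_Hor C X \<longleftrightarrow> f \<in> Hor C \<and> b \<in> Obj (pcat X (Cod (HCat C) f))"
  "vcode u a a' s \<in> groth_Ver C X \<longleftrightarrow> u \<in> Ver C \<and> a \<in> Obj (pcat X (Dom (VCat C) u)) \<and>
     a' \<in> Obj (pcat X (Cod (VCat C) u)) \<and> s \<in> pel (pprof X u) a a'"
  by (auto simp: groth_Ob_def groth_Hor_def groth_Ver_def)

lemma groth_Sq_mem [simp]: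
  "vcode \<alpha> b b' t \<in> groth_Sq C X \<longleftrightarrow> \<alpha> \<in> Sq C \<and> b \<in> Obj (pcat X (Dom (VCat C) (rgt C \<alpha>))) \<and>
     b' \<in> Obj (pcat X (Cod (VCat C) (rgt C \<alpha>))) \<and> t \<in> pel (pprof X (rgt C \<alpha>)) b b' \<and> rgt C \<alpha> \<in> Ver C"
  by (auto simp: groth_Sq_def)

lemma groth_ObE: "p \<in> groth_Ob C X \<Longrightarrow> (\<And>x a. p = upair x a \<Longrightarrow> x \<in> Ob C \<Longrightarrow> a \<in> Obj (pcat X x) \<Longrightarrow> thesis) \<Longrightarrow> thesis"
  by (auto simp: groth_Ob_def)

lemma groth_HorE: "h \<in> groth_Hor C X \<Longrightarrow>
    (\<And>f b. h = upair f b \<Longrightarrow> f \<in> Hor C \<Longrightarrow> b \<in> Obj (pcat X (Cod (HCat C) f)) \<Longrightarrow> thesis) \<Longrightarrow> thesis"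
  by (auto simp: groth_Hor_def)

lemma groth_VerE: "w \<in> groth_Ver C X \<Longrightarrow>
    (\<And>u a a' s. w = vcode u a a' s \<Longrightarrow> u \<in> Ver C \<Longrightarrow> a \<in> Obj (pcat X (Dom (VCat C) u)) \<Longrightarrow>
     a' \<in> Obj (pcat X (Cod (VCat C) u)) \<Longrightarrow> s \<in> pel (pprof X u) a a' \<Longrightarrow> thesis) \<Longrightarrow> thesis"
  by (auto simp: groth_Ver_def)

lemma groth_SqE: "\<sigma> \<in> groth_Sq C X \<Longrightarrow>
    (\<And>\<alpha> b b' t. \<sigma> = vcode \<alpha> b b' t \<Longrightarrow> \<alpha> \<in> Sq C \<Longrightarrow> rgt C \<alpha> \<in> Ver C \<Longrightarrow> b \<in> Obj (pcat X (Dom (VCat C) (rgt C \<alpha>))) \<Longrightarrow>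
     b' \<in> Obj (pcat X (Cod (VCat C) (rgt C \<alpha>))) \<Longrightarrow> t \<in> pel (pprof X (rgt C \<alpha>)) b b' \<Longrightarrow> thesis) \<Longrightarrow> thesis"
  by (auto simp: groth_Sq_def)

lemmas grothE = groth_ObE groth_HorE groth_VerE groth_SqE

lemma groth_sets [simp]:
  "Obj (HCat (groth C X)) = groth_Ob C X" "Arr (HCat (groth C X)) = groth_Hor C X"
  "Obj (VCat (groth C X)) = groth_Ob C X" "Arr (VCat (groth C X)) = groth_Ver C X"
  "Obj (SHCat (groth C X)) = groth_Ver C X" "Arr (SHCat (groth C X)) = groth_Sq C X"
  "Obj (SVCat (groth C X)) = groth_Hor C X" "Arr (SVCat (groth C X)) = groth_Sq C X"
  by (simp_all add: groth_def Let_def)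

lemma groth_bounds [simp]:
  "upair f b \<in> groth_Hor C X \<Longrightarrow> Dom (HCat (groth C X)) (upair f b) = upair (Dom (HCat C) f) (fo (pfun X f) b)"
  "upair f b \<in> groth_Hor C X \<Longrightarrow> Cod (HCat (groth C X)) (upair f b) = upair (Cod (HCat C) f) b"
  "vcode u a a' s \<in> groth_Ver C X \<Longrightarrow> Dom (VCat (groth C X)) (vcode u a a' s) = upair (Dom (VCat C) u) a"
  "vcode u a a' s \<in> groth_Ver C X \<Longrightarrow> Cod (VCat (groth C X)) (vcode u a a' s) = upair (Cod (VCat C) u) a'"
  "vcode \<alpha> a a' s \<in> groth_Sq C X \<Longrightarrow> lft (groth C X) (vcode \<alpha> a a' s) =
    vcode (lft C \<alpha>) (fo (pfun X (upper C \<alpha>)) a) (fo (pfun X (lower C \<alpha>)) a') (psq X \<alpha> a a' s)"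
  "vcode \<alpha> a a' s \<in> groth_Sq C X \<Longrightarrow> rgt (groth C X) (vcode \<alpha> a a' s) = vcode (rgt C \<alpha>) a a' s"
  "vcode \<alpha> a a' s \<in> groth_Sq C X \<Longrightarrow> upper (groth C X) (vcode \<alpha> a a' s) = upair (upper C \<alpha>) a"
  "vcode \<alpha> a a' s \<in> groth_Sq C X \<Longrightarrow> lower (groth C X) (vcode \<alpha> a a' s) = upair (lower C \<alpha>) a'"
  by (simp_all add: groth_def Let_def del: groth_mem groth_Sq_mem)

lemma groth_Ident [simp]:
  "upair x a \<in> groth_Ob C X \<Longrightarrow> Ident (HCat (groth C X)) (upair x a) = upair (Ident (HCat C) x) a"
  "upair x a \<in> groth_Ob C X \<Longrightarrow> Ident (VCat (groth C X)) (upair x a) = vcode (Ident (VCat C) x) a a (Ident (pcat X x) a)"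
  "vcode u a a' s \<in> groth_Ver C X \<Longrightarrow> Ident (SHCat (groth C X)) (vcode u a a' s) = vcode (Ident (SHCat C) u) a a' s"
  "upair f b \<in> groth_Hor C X \<Longrightarrow> Ident (SVCat (groth C X)) (upair f b) =
    vcode (Ident (SVCat C) f) b b (Ident (pcat X (Cod (HCat C) f)) b)"
  by (simp_all add: groth_def Let_def del: groth_mem groth_Sq_mem)

lemma groth_Cmp [simp]:
  "\<lbrakk>upair g c \<in> groth_Hor C X; upair f b \<in> groth_Hor C X; Cod (HCat C) f = Dom (HCat C) g; b = fo (pfun X g) c\<rbrakk> \<Longrightarrow>
    Cmp (HCat (groth C X)) (upair g c) (upair f b) = upair (Cmp (HCat C) g f) c"
  "\<lbrakk>vcode u' b a'' s' \<in> groth_Ver C X; vcode u a a' s \<in> groth_Ver C X; Cod (VCat C) u = Dom (VCat C) u'; a' = b\<rbrakk> \<Longrightarrow>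
    Cmp (VCat (groth C X)) (vcode u' b a'' s') (vcode u a a' s) = vcode (Cmp (VCat C) u' u) a a'' (vmul C X u u' a a' a'' s' s)"
  "\<lbrakk>vcode \<beta> c c' t \<in> groth_Sq C X; vcode \<alpha> b b' s \<in> groth_Sq C X; rgt C \<alpha> = lft C \<beta>; b = fo (pfun X (upper C \<beta>)) c;
     b' = fo (pfun X (lower C \<beta>)) c'; s = psq X \<beta> c c' t\<rbrakk> \<Longrightarrow>
    Cmp (SHCat (groth C X)) (vcode \<beta> c c' t) (vcode \<alpha> b b' s) = vcode (Cmp (SHCat C) \<beta> \<alpha>) c c' t"
  "\<lbrakk>vcode \<beta> c c' t \<in> groth_Sq C X; vcode \<alpha> b b' s \<in> groth_Sq C X; lower C \<alpha> = upper C \<beta>; b' = c\<rbrakk> \<Longrightarrow>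
    Cmp (SVCat (groth C X)) (vcode \<beta> c c' t) (vcode \<alpha> b b' s) =
      vcode (Cmp (SVCat C) \<beta> \<alpha>) b c' (vmul C X (rgt C \<alpha>) (rgt C \<beta>) b b' c' t s)"
  by (simp_all add: groth_def Let_def vmul_def del: groth_mem groth_Sq_mem)

lemma groth_ext:
  "Dom (HCat (groth C X)) \<in> extensional (groth_Hor C X)" "Cod (HCat (groth C X)) \<in> extensional (groth_Hor C X)"
  "Ident (HCat (groth C X)) \<in> extensional (groth_Ob C X)" "Cmp (HCat (groth C X)) \<in> extensional (groth_Hor C X)"
  "h \<in> groth_Hor C X \<Longrightarrow> Cmp (HCat (groth C X)) h \<in> extensional (Into (HCat (groth C X)) (Dom (HCat (groth C X)) h))"
  "Dom (VCat (groth C X)) \<in> extensional (groth_Ver C X)" "Cod (VCat (groth C X)) \<in> extensional (groth_Ver C X)"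
  "Ident (VCat (groth C X)) \<in> extensional (groth_Ob C X)" "Cmp (VCat (groth C X)) \<in> extensional (groth_Ver C X)"
  "w \<in> groth_Ver C X \<Longrightarrow> Cmp (VCat (groth C X)) w \<in> extensional (Into (VCat (groth C X)) (Dom (VCat (groth C X)) w))"
  "Dom (SHCat (groth C X)) \<in> extensional (groth_Sq C X)" "Cod (SHCat (groth C X)) \<in> extensional (groth_Sq C X)"
  "Ident (SHCat (groth C X)) \<in> extensional (groth_Ver C X)" "Cmp (SHCat (groth C X)) \<in> extensional (groth_Sq C X)"
  "\<sigma> \<in> groth_Sq C X \<Longrightarrow> Cmp (SHCat (groth C X)) \<sigma> \<in> extensional (Into (SHCat (groth C X)) (Dom (SHCat (groth C X)) \<sigma>))"
  "Dom (SVCat (groth C X)) \<in> extensional (groth_Sq C X)" "Cod (SVCat (groth C X)) \<in> extensional (groth_Sq C X)"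
  "Ident (SVCat (groth C X)) \<in> extensional (groth_Hor C X)" "Cmp (SVCat (groth C X)) \<in> extensional (groth_Sq C X)"
  "\<sigma> \<in> groth_Sq C X \<Longrightarrow> Cmp (SVCat (groth C X)) \<sigma> \<in> extensional (Into (SVCat (groth C X)) (Dom (SVCat (groth C X)) \<sigma>))"
  by (simp_all add: groth_def Let_def Into_def)

lemma small_image: "small A \<Longrightarrow> small (f ` A)" for f :: "'a::universe \<Rightarrow> 'a"
  using small_UN[of A "\<lambda>x. {f x}", OF _ small_insert[OF small_empty]] by (simp add: UNION_singleton_eq_range)

context lax_double_presheaf
begin

lemma small_groth: "small (groth_Ob C X)" "small (groth_Hor C X)" "small (groth_Ver C X)" "small (groth_Sq C X)"
proof -
  have o: "small (Obj (pcat X x))" if "x \<in> Ob C" for x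
    using pcat[OF that] by (rule small_category.small_Obj)
  have p: "small (pel (pprof X u) a a')"
    if "u \<in> Ver C" "a \<in> Obj (pcat X (Dom (VCat C) u))" "a' \<in> Obj (pcat X (Cod (VCat C) u))" for u a a'
    using pprof_prof[OF that(1)] that(2,3) by (simp add: small_profunctor_def)
  have "groth_Ob C X = (\<Union>x\<in>Ob C. (\<lambda>a. upair x a) ` Obj (pcat X x))" by (auto simp: groth_Ob_def)
  then show "small (groth_Ob C X)"
    using o by (simp add: small_UN[OF C.H.small_Obj] small_image)
  have "groth_Hor C X = (\<Union>f\<in>Hor C. (\<lambda>b. upair f b) ` Obj (pcat X (Cod (HCat C) f)))" by (auto simp: groth_Hor_def)
  then show "small (groth_Hor C X)"
    using o by (simp add: small_UN[OF C.H.small_Arr] small_image)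
  have "groth_Ver C X = (\<Union>u\<in>Ver C. \<Union>a\<in>Obj (pcat X (Dom (VCat C) u)). \<Union>a'\<in>Obj (pcat X (Cod (VCat C) u)).
      (\<lambda>s. vcode u a a' s) ` pel (pprof X u) a a')" by (auto simp: groth_Ver_def)
  then show "small (groth_Ver C X)"
    by (simp only:) (intro small_UN[OF C.V.small_Arr] small_UN[OF o] small_image p, simp_all)
  have "groth_Sq C X = (\<Union>\<alpha>\<in>Sq C. \<Union>a\<in>Obj (pcat X (Dom (VCat C) (rgt C \<alpha>))). \<Union>a'\<in>Obj (pcat X (Cod (VCat C) (rgt C \<alpha>))).
      (\<lambda>s. vcode \<alpha> a a' s) ` pel (pprof X (rgt C \<alpha>)) a a')" by (auto simp: groth_Sq_def)
  then show "small (groth_Sq C X)"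
    by (simp only:) (intro small_UN[OF C.SH.small_Arr] small_UN[OF o] small_image p, simp_all)
qed

lemma groth_HCat: "small_category (HCat (groth C X))"
  by (intro small_category.intro category.intro small_category_axioms.intro)
    (auto elim!: grothE simp: small_groth groth_ext C.H.Cmp_assoc)

lemma groth_VCat: "small_category (VCat (groth C X))"
  by (intro small_category.intro category.intro small_category_axioms.intro)
    (auto elim!: grothE simp: small_groth groth_ext C.V.Cmp_assoc vmul_assoc)

lemma groth_SHCat: "small_category (SHCat (groth C X))"
  by (intro small_category.intro category.intro small_category_axioms.intro)
    (auto elim!: grothE simp: small_groth groth_ext C.SH.Cmp_assoc)

lemma groth_SVCat: "small_category (SVCat (groth C X))"
  by (intro small_category.intro category.intro small_category_axioms.intro)
    (auto elim!: grothE simp: small_groth groth_ext C.SV_assoc vmul_assoc C.vert_composable)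

lemma groth_double_category: "double_category (groth C X)"
  by (rule double_category.intro)
    (auto elim!: grothE simp: groth_HCat groth_VCat groth_SHCat groth_SVCat vmul_natural C.vert_composable
      C.interchange C.Cmp_vert_Ident C.Cmp_hor_Ident C.Ident_Ident vmul_hom)

lemma groth_proj_sel [simp]:
  "dsrc (groth_proj C X) = groth C X" "dtgt (groth_proj C X) = C"
  "upair x a \<in> groth_Ob C X \<Longrightarrow> fO (groth_proj C X) (upair x a) = x"
  "upair f b \<in> groth_Hor C X \<Longrightarrow> fH (groth_proj C X) (upair f b) = f"
  "vcode u a a' s \<in> groth_Ver C X \<Longrightarrow> fV (groth_proj C X) (vcode u a a' s) = u"
  "vcode \<alpha> a a' s \<in> groth_Sq C X \<Longrightarrow> fS (groth_proj C X) (vcode \<alpha> a a' s) = \<alpha>"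
  by (simp_all add: groth_proj_def del: groth_mem groth_Sq_mem)

lemma groth_proj_dfunctor: "dfunctor (groth_proj C X) (groth C X) C"
  by (rule dfunctorI[OF groth_double_category base])
    (auto elim!: grothE simp: C.vert_composable, auto simp: groth_proj_def)

lemma groth_fibration: "fibration (groth_proj C X) (groth C X) C"
proof (rule fibrationI[OF groth_proj_dfunctor], goal_cases)
  case (1 e f)
  then obtain y b where e: "e = upair y b" "y \<in> Ob C" "b \<in> Obj (pcat X y)" by (auto elim!: grothE)
  show ?case
    by (rule ex1I[of _ "upair f b"]) (use 1 in \<open>auto elim!: grothE simp: e\<close>)
next
  case (2 v \<alpha>)
  then obtain u b b' t where v: "v = vcode u b b' t" "u \<in> Ver C" "b \<in> Obj (pcat X (Dom (VCat C) u))"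
    "b' \<in> Obj (pcat X (Cod (VCat C) u))" "t \<in> pel (pprof X u) b b'" by (auto elim!: grothE)
  show ?case
    by (rule ex1I[of _ "vcode \<alpha> b b' t"]) (use 2 in \<open>auto elim!: grothE simp: v\<close>)
qed

end

subsection \<open>Action on transformations and modifications\<close>

context ptransf
begin

lemma groth_map_sel [simp]:
  "dsrc (groth_map C F) = groth C X" "dtgt (groth_map C F) = groth C Y"
  "upair x a \<in> groth_Ob C X \<Longrightarrow> fO (groth_map C F) (upair x a) = upair x (fo (tfun F x) a)"
  "upair f b \<in> groth_Hor C X \<Longrightarrow> fH (groth_map C F) (upair f b) = upair f (fo (tfun F (Cod (HCat C) f)) b)"
  "vcode u a a' s \<in> groth_Ver C X \<Longrightarrow> fV (groth_map C F) (vcode u a a' s) =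
    vcode u (fo (tfun F (Dom (VCat C) u)) a) (fo (tfun F (Cod (VCat C) u)) a') (tprof F u a a' s)"
  "vcode \<alpha> a a' s \<in> groth_Sq C X \<Longrightarrow> fS (groth_map C F) (vcode \<alpha> a a' s) =
    vcode \<alpha> (fo (tfun F (Dom (VCat C) (rgt C \<alpha>))) a) (fo (tfun F (Cod (VCat C) (rgt C \<alpha>))) a') (tprof F (rgt C \<alpha>) a a' s)"
  by (simp_all add: groth_map_def Let_def psrc ptgt del: groth_mem groth_Sq_mem)

lemma groth_map_over: "over (groth_proj C X) (groth C X) C (groth_map C F) (groth_proj C Y) (groth C Y)"
proof (rule overI[OF X.groth_fibration Y.groth_fibration], goal_cases)
  case (12 w u)
  then show ?case by (auto elim!: grothE simp: tprof_vmul)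
next
  case (13 h)
  then show ?case by (auto elim!: grothE simp: tfun_hor_at)
next
  case (15 \<sigma>)
  then show ?case by (auto elim!: grothE simp: tfun_hor_at tprof_psq)
qed (auto elim!: grothE, auto simp: groth_map_def Let_def psrc)

end

context pmodf
begin

lemma groth_mod_sel [simp]:
  "vsrc (groth_mod C A) = groth_map C F" "vtgt (groth_mod C A) = groth_map C F'"
  "upair x a \<in> groth_Ob C X \<Longrightarrow> vO (groth_mod C A) (upair x a) =
    vcode (Ident (VCat C) x) (fo (tfun F x) a) (fo (tfun F' x) a) (mcomp A x a)"
  "upair f b \<in> groth_Hor C X \<Longrightarrow> vH (groth_mod C A) (upair f b) =
    vcode (Ident (SVCat C) f) (fo (tfun F (Cod (HCat C) f)) b) (fo (tfun F' (Cod (HCat C) f)) b) (mcomp A (Cod (HCat C) f) b)"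
  by (simp_all add: groth_mod_def Let_def msrc mtgt psrc del: groth_mem groth_Sq_mem)

lemma groth_mod_over: "over_cell (groth_proj C X) (groth C X) C (groth_map C F) (groth_map C F') (groth_mod C A)
    (groth_proj C Y) (groth C Y)"
proof (rule over_cellI[OF F.groth_map_over F'.groth_map_over], goal_cases)
  case (7 w)
  then show ?case by (auto elim!: grothE simp: F.Y.vmul_left F.Y.vmul_right mcomp_ver)
next
  case (8 h)
  then show ?case by (auto elim!: grothE simp: F.tfun_hor_at F'.tfun_hor_at mcomp_hor)
qed (auto elim!: grothE, auto simp: groth_mod_def Let_def msrc psrc)

end

lemma Groth_sel [simp]: "on0 (Groth C) = groth_proj C"
  "on1 (Groth C) F = (groth_proj C (psrc F), groth_map C F, groth_proj C (ptgt F))"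
  "on2 (Groth C) A = (groth_proj C (psrc (msrc A)), groth_mod C A, groth_proj C (ptgt (msrc A)))"
  by (simp_all add: Groth_def)

lemma twofunctor_Groth: "twofunctor (Psh C) (DFib C) (Groth C)"
proof (rule twofunctor_into_DFibI[OF twocategory_Psh, where m = "groth_map C" and c = "groth_mod C" and E = "groth C"], goal_cases)
  case (3 X)
  then show ?case using lax_double_presheaf.groth_fibration[of C X] by simp
next
  case (4 F)
  then show ?case using ptransf.groth_map_over[OF presheaf_transformation_ptransf] by simp
next
  case (5 X a)
  then interpret I: ptransf C "ptrans_id C X" X X by (simp add: ptransf_id)
  show ?case using 5 by (auto elim!: grothE)
next
  case (6 X u)
  then interpret I: ptransf C "ptrans_id C X" X X by (simp add: ptransf_id)
  show ?case using 6 by (auto elim!: grothE)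
next
  case (7 G F a)
  obtain X Y Z where st: "psrc F = X" "ptgt F = Y" "psrc G = Y" "ptgt G = Z" using 7(3) by simp
  interpret F: ptransf C F X Y using 7 st by (simp add: ptransf_iff)
  interpret G: ptransf C G Y Z using 7 st by (simp add: ptransf_iff)
  interpret GF: ptransf C "ptrans_comp C G F" X Z by (rule ptransf_comp[OF G.ptransf_axioms F.ptransf_axioms])
  show ?case using 7 by (auto elim!: grothE simp: st)
next
  case (8 G F u)
  obtain X Y Z where st: "psrc F = X" "ptgt F = Y" "psrc G = Y" "ptgt G = Z" using 8(3) by simp
  interpret F: ptransf C F X Y using 8 st by (simp add: ptransf_iff)
  interpret G: ptransf C G Y Z using 8 st by (simp add: ptransf_iff)
  interpret GF: ptransf C "ptrans_comp C G F" X Z by (rule ptransf_comp[OF G.ptransf_axioms F.ptransf_axioms])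
  show ?case using 8 by (auto elim!: grothE simp: st)
next
  case (9 A)
  then show ?case
    using pmodf.groth_mod_over[of C A "msrc A" "mtgt A" "psrc (msrc A)" "ptgt (msrc A)"]
    by (simp add: pmodf_iff)
next
  case (10 F a)
  obtain X Y where st: "psrc F = X" "ptgt F = Y" by simp
  interpret F: ptransf C F X Y using 10 st by (simp add: ptransf_iff)
  interpret I: pmodf C "pmod_id C F" F F X Y by (rule pmodf_id[OF F.ptransf_axioms])
  show ?case using 10 by (auto elim!: grothE simp: st)
next
  case (11 B A a)
  obtain X Y F F' F'' where st: "msrc A = F" "mtgt A = F'" "msrc B = F'" "mtgt B = F''" "psrc F = X" "ptgt F = Y"
    using 11(3) by simp
  interpret A: pmodf C A F F' X Y using 11 st by (simp add: pmodf_iff)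
  interpret B: pmodf C B F' F'' X Y using 11 st A.F'.psrc A.F'.ptgt by (simp add: pmodf_iff)
  interpret BA: pmodf C "pmod_vcomp C B A" F F'' X Y by (rule pmodf_vcomp[OF B.pmodf_axioms A.pmodf_axioms])
  show ?case using 11 by (auto elim!: grothE simp: st A.F.X.vmul_hom A.F.Y.vmul_hom)
next
  case (12 B A a)
  obtain X Y Z F F' G G' where st: "msrc A = F" "mtgt A = F'" "msrc B = G" "mtgt B = G'" "psrc F = X" "ptgt F = Y"
    "psrc G = Y" "ptgt G = Z" using 12(3) by simp
  interpret A: pmodf C A F F' X Y using 12 st by (simp add: pmodf_iff)
  interpret B: pmodf C B G G' Y Z using 12 st by (simp add: pmodf_iff)
  interpret BA: pmodf C "pmod_hcomp C B A" "ptrans_comp C G F" "ptrans_comp C G' F'" X Z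
    by (rule pmodf_hcomp[OF B.pmodf_axioms A.pmodf_axioms])
  show ?case using 12 by (auto elim!: grothE simp: st B.F.Y.vmul_hom A.F.psrc A.F'.psrc)
qed (auto simp: globular_modification_parallel)

subsection \<open>The Grothendieck construction is fully faithful\<close>

text \<open>
  A double functor over the base keeps the base components of codes, so its content is a map
  \<open>ob\<close> on the objects of the fibres and a map \<open>el\<close> on the elements of
  the profunctors. Arrows of a fibre are elements at a vertical identity, hence
  \<open>el\<close> also provides the action on arrows, and functoriality is compatibility with
  vertical composition.
\<close>

locale groth_over = X: lax_double_presheaf C X + Y: lax_double_presheaf C Y +
  H: over "groth_proj C X" "groth C X" C H "groth_proj C Y" "groth C Y"
  for C X Y H
begin

definition ob where "ob x a = usnd (fO H (upair x a))"
definition el where "el u a a' s = velem (fV H (vcode u a a' s))"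

lemma fO_H: "\<lbrakk>x \<in> Ob C; a \<in> Obj (pcat X x)\<rbrakk> \<Longrightarrow> fO H (upair x a) = upair x (ob x a) \<and> ob x a \<in> Obj (pcat Y x)"
  using H.F.on_cells(1)[of "upair x a"] H.on_base(1)[of "upair x a"] by (auto elim!: grothE simp: ob_def simp del: H.on_base H.F.on_cells)

lemma fH_H: "\<lbrakk>f \<in> Hor C; b \<in> Obj (pcat X (Cod (HCat C) f))\<rbrakk> \<Longrightarrow> fH H (upair f b) = upair f (ob (Cod (HCat C) f) b)"
  using H.F.on_cells(2)[of "upair f b"] H.on_base(2)[of "upair f b"] H.F.on_bounds(2)[of "upair f b"]
    fO_H[of "Cod (HCat C) f" b]
  by (auto elim!: grothE simp del: H.on_base H.F.on_bounds H.F.on_cells)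

lemma fV_H: "\<lbrakk>u \<in> Ver C; a \<in> Obj (pcat X (Dom (VCat C) u)); a' \<in> Obj (pcat X (Cod (VCat C) u)); s \<in> pel (pprof X u) a a'\<rbrakk> \<Longrightarrow>
    fV H (vcode u a a' s) = vcode u (ob (Dom (VCat C) u) a) (ob (Cod (VCat C) u) a') (el u a a' s) \<and>
    el u a a' s \<in> pel (pprof Y u) (ob (Dom (VCat C) u) a) (ob (Cod (VCat C) u) a')"
  using H.F.on_cells(3)[of "vcode u a a' s"] H.on_base(3)[of "vcode u a a' s"] H.F.on_bounds(3,4)[of "vcode u a a' s"]
    fO_H[of "Dom (VCat C) u" a] fO_H[of "Cod (VCat C) u" a']
  by (auto elim!: grothE simp: el_def simp del: H.on_base H.F.on_bounds H.F.on_cells)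

lemma fS_H: "\<lbrakk>\<alpha> \<in> Sq C; a \<in> Obj (pcat X (Dom (VCat C) (rgt C \<alpha>))); a' \<in> Obj (pcat X (Cod (VCat C) (rgt C \<alpha>)));
     s \<in> pel (pprof X (rgt C \<alpha>)) a a'\<rbrakk> \<Longrightarrow>
    fS H (vcode \<alpha> a a' s) = vcode \<alpha> (ob (Dom (VCat C) (rgt C \<alpha>)) a) (ob (Cod (VCat C) (rgt C \<alpha>)) a') (el (rgt C \<alpha>) a a' s)"
  using H.F.on_cells(4)[of "vcode \<alpha> a a' s"] H.on_base(4)[of "vcode \<alpha> a a' s"] H.F.on_bounds(6)[of "vcode \<alpha> a a' s"]
    fV_H[of "rgt C \<alpha>" a a' s]
  by (auto elim!: grothE simp del: H.on_base H.F.on_bounds H.F.on_cells)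

lemma o_in [simp]: "\<lbrakk>x \<in> Ob C; a \<in> Obj (pcat X x)\<rbrakk> \<Longrightarrow> ob x a \<in> Obj (pcat Y x)"
  using fO_H by blast

lemma p_in [simp]: "\<lbrakk>u \<in> Ver C; Dom (VCat C) u = x; Cod (VCat C) u = x'; a \<in> Obj (pcat X x); a' \<in> Obj (pcat X x'); s \<in> pel (pprof X u) a a'\<rbrakk> \<Longrightarrow>
    el u a a' s \<in> pel (pprof Y u) (ob x a) (ob x' a')"
  using fV_H by blast

lemma o_hor: "\<lbrakk>f \<in> Hor C; Dom (HCat C) f = x; b \<in> Obj (pcat X (Cod (HCat C) f))\<rbrakk> \<Longrightarrow>
    ob x (fo (pfun X f) b) = fo (pfun Y f) (ob (Cod (HCat C) f) b)"
  using H.F.on_bounds(1)[of "upair f b"] fH_H[of f b] fO_H[of x "fo (pfun X f) b"] by auto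

lemma p_sq: "\<lbrakk>\<alpha> \<in> Sq C; a \<in> Obj (pcat X (Dom (VCat C) (rgt C \<alpha>))); a' \<in> Obj (pcat X (Cod (VCat C) (rgt C \<alpha>)));
     s \<in> pel (pprof X (rgt C \<alpha>)) a a'\<rbrakk> \<Longrightarrow>
    el (lft C \<alpha>) (fo (pfun X (upper C \<alpha>)) a) (fo (pfun X (lower C \<alpha>)) a') (psq X \<alpha> a a' s) =
    psq Y \<alpha> (ob (Dom (VCat C) (rgt C \<alpha>)) a) (ob (Cod (VCat C) (rgt C \<alpha>)) a') (el (rgt C \<alpha>) a a' s)"
  using H.F.on_bounds(5)[of "vcode \<alpha> a a' s"] fS_H[of \<alpha> a a' s]
    fV_H[of "lft C \<alpha>" "fo (pfun X (upper C \<alpha>)) a" "fo (pfun X (lower C \<alpha>)) a'" "psq X \<alpha> a a' s"] by simp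

lemma p_vmul:
  "\<lbrakk>u \<in> Ver C; u' \<in> Ver C; Cod (VCat C) u = Dom (VCat C) u';
    a \<in> Obj (pcat X (Dom (VCat C) u)); a' \<in> Obj (pcat X (Dom (VCat C) u')); a'' \<in> Obj (pcat X (Cod (VCat C) u'));
    s \<in> pel (pprof X u) a a'; s' \<in> pel (pprof X u') a' a''\<rbrakk> \<Longrightarrow>
  el (Cmp (VCat C) u' u) a a'' (vmul C X u u' a a' a'' s' s) =
    vmul C Y u u' (ob (Dom (VCat C) u) a) (ob (Dom (VCat C) u') a') (ob (Cod (VCat C) u') a'') (el u' a' a'' s') (el u a a' s)"
  using H.F.on_Cmp(2)[of "vcode u' a' a'' s'" "vcode u a a' s"]
    fV_H[of u a a' s] fV_H[of u' a' a'' s'] fV_H[of "Cmp (VCat C) u' u" a a'' "vmul C X u u' a a' a'' s' s"]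
  by simp

lemma p_Ident: "\<lbrakk>x \<in> Ob C; a \<in> Obj (pcat X x)\<rbrakk> \<Longrightarrow> el (Ident (VCat C) x) a a (Ident (pcat X x) a) = Ident (pcat Y x) (ob x a)"
  using H.F.on_Ident(2)[of "upair x a"] fO_H[of x a] fV_H[of "Ident (VCat C) x" a a "Ident (pcat X x) a"] by simp

definition trans :: "'a ptrans" where
  "trans = \<lparr>psrc = X, ptgt = Y,
     tfun = (\<lambda>x\<in>Ob C. \<lparr>fo = (\<lambda>a\<in>Obj (pcat X x). ob x a),
       fa = (\<lambda>m\<in>Arr (pcat X x). el (Ident (VCat C) x) (Dom (pcat X x) m) (Cod (pcat X x) m) m)\<rparr>),
     tprof = (\<lambda>u\<in>Ver C. \<lambda>a\<in>Obj (pcat X (Dom (VCat C) u)). \<lambda>a'\<in>Obj (pcat X (Cod (VCat C) u)).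
       \<lambda>s\<in>pel (pprof X u) a a'. el u a a' s)\<rparr>"

lemma trans_sel [simp]:
  "x \<in> Ob C \<Longrightarrow> a \<in> Obj (pcat X x) \<Longrightarrow> fo (tfun trans x) a = ob x a"
  "x \<in> Ob C \<Longrightarrow> m \<in> Arr (pcat X x) \<Longrightarrow> fa (tfun trans x) m = el (Ident (VCat C) x) (Dom (pcat X x) m) (Cod (pcat X x) m) m"
  "\<lbrakk>u \<in> Ver C; a \<in> Obj (pcat X (Dom (VCat C) u)); a' \<in> Obj (pcat X (Cod (VCat C) u)); s \<in> pel (pprof X u) a a'\<rbrakk> \<Longrightarrow>
    tprof trans u a a' s = el u a a' s"
  by (simp_all add: trans_def)

lemma p_hom [simp]:
  assumes "x \<in> Ob C" "a = Dom (pcat X x) m" "b = Cod (pcat X x) m" "m \<in> Arr (pcat X x)"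
  shows "el (Ident (VCat C) x) a b m \<in> Arr (pcat Y x)" "Dom (pcat Y x) (el (Ident (VCat C) x) a b m) = ob x a"
    "Cod (pcat Y x) (el (Ident (VCat C) x) a b m) = ob x b"
  using p_in[of "Ident (VCat C) x" x x a b m] assms by simp_all

lemma trans: "ptransf C trans X Y"
proof (rule ptransfI[OF X.lax_double_presheaf_axioms Y.lax_double_presheaf_axioms], goal_cases)
  case (5 x)
  have "el (Ident (VCat C) x) (Dom (pcat X x) m) (Cod (pcat X x) n) (Cmp (pcat X x) n m) =
      Cmp (pcat Y x) (el (Ident (VCat C) x) (Dom (pcat X x) n) (Cod (pcat X x) n) n)
        (el (Ident (VCat C) x) (Dom (pcat X x) m) (Cod (pcat X x) m) m)"
    if "n \<in> Arr (pcat X x)" "m \<in> Arr (pcat X x)" "Cod (pcat X x) m = Dom (pcat X x) n" for n m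
    using p_vmul[of "Ident (VCat C) x" "Ident (VCat C) x" "Dom (pcat X x) m" "Dom (pcat X x) n" "Cod (pcat X x) n" m n] 5 that
    by (simp add: X.vmul_hom Y.vmul_hom)
  then show ?case
    using 5 by (auto simp: trans_def small_functor_def is_functor_def p_Ident)
next
  case (6 u)
  then show ?case by (auto simp: trans_def)
next
  case (8 f m)
  then show ?case using p_sq[of "Ident (SVCat C) f" "Dom (pcat X (Cod (HCat C) f)) m" "Cod (pcat X (Cod (HCat C) f)) m" m] by simp
next
  case (9 \<alpha> a a' s)
  then show ?case by (simp add: p_sq)
next
  case (10 u u' a a' a'' s s')
  then show ?case by (simp add: p_vmul)
qed (simp_all add: o_hor, simp_all add: trans_def)

lemma groth_map_trans: "groth_map C trans = H"
proof -
  interpret T: ptransf C trans X Y by (rule trans)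
  show ?thesis
    by (rule over_eqI[OF T.groth_map_over H.over_axioms]) (auto elim!: grothE simp: fO_H fV_H)
qed

end

lemma groth_map_inject:
  assumes "ptransf C F X Y" "ptransf C G X Y" "groth_map C F = groth_map C G" shows "F = G"
proof -
  interpret F: ptransf C F X Y by (rule assms(1))
  interpret G: ptransf C G X Y by (rule assms(2))
  show ?thesis
  proof (rule ptrans_eqI[OF assms(1,2)], goal_cases)
    case (1 x a)
    then show ?case using F.groth_map_sel(3)[of x a] G.groth_map_sel(3)[of x a] assms(3) by simp
  next
    case (2 u a a' s)
    then show ?case using F.groth_map_sel(5)[of u a a' s] G.groth_map_sel(5)[of u a a' s] assms(3) by simp
  qed
qed

lemma groth_mod_inject:
  assumes "pmodf C A F F' X Y" "pmodf C B F F' X Y" "groth_mod C A = groth_mod C B" shows "A = B"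
proof -
  interpret A: pmodf C A F F' X Y by (rule assms(1))
  interpret B: pmodf C B F F' X Y by (rule assms(2))
  show ?thesis
  proof (rule pmod_eqI[OF assms(1,2)], goal_cases)
    case (1 x a)
    then show ?case using A.groth_mod_sel(3)[of x a] B.groth_mod_sel(3)[of x a] assms(3) by simp
  qed
qed

text \<open>
  A component over a vertical identity is coded by an arrow of a fibre, and the family of these
  arrows is the modification.
\<close>

lemma groth_mod_surj:
  assumes "ptransf C F X Y" "ptransf C F' X Y"
    and "over_cell (groth_proj C X) (groth C X) C (groth_map C F) (groth_map C F') A (groth_proj C Y) (groth C Y)"
  shows "\<exists>B. pmodf C B F F' X Y \<and> groth_mod C B = A"
proof -
  interpret F: ptransf C F X Y by (rule assms(1))
  interpret F': ptransf C F' X Y by (rule assms(2))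
  interpret A: over_cell "groth_proj C X" "groth C X" C "groth_map C F" "groth_map C F'" A "groth_proj C Y" "groth C Y"
    by (rule assms(3))
  define m where "m x a = velem (vO A (upair x a))" for x a
  have O: "vO A (upair x a) = vcode (Ident (VCat C) x) (fo (tfun F x) a) (fo (tfun F' x) a) (m x a) \<and>
      m x a \<in> Arr (pcat Y x) \<and> Dom (pcat Y x) (m x a) = fo (tfun F x) a \<and> Cod (pcat Y x) (m x a) = fo (tfun F' x) a"
    if "x \<in> Ob C" "a \<in> Obj (pcat X x)" for x a
    using A.A.on_cells(1-3)[of "upair x a"] A.vO_base[of "upair x a"] that by (auto elim!: grothE simp: m_def simp del: A.vO_base A.A.on_cells)
  have H: "vH A (upair f b) = vcode (Ident (SVCat C) f) (fo (tfun F (Cod (HCat C) f)) b) (fo (tfun F' (Cod (HCat C) f)) b)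
      (m (Cod (HCat C) f) b)"
    if "f \<in> Hor C" "b \<in> Obj (pcat X (Cod (HCat C) f))" for f b
    using A.A.on_cells(4,8)[of "upair f b"] A.vH_base[of "upair f b"] that O[of "Cod (HCat C) f" b] by (auto elim!: grothE simp del: A.vH_base A.A.on_cells)
  define B where "B = \<lparr>msrc = F, mtgt = F', mcomp = (\<lambda>x\<in>Ob C. \<lambda>a\<in>Obj (pcat X x). m x a)\<rparr>"
  have B: "pmodf C B F F' X Y"
  proof (rule pmodfI[OF assms(1,2)], goal_cases)
    case (4 f b)
    then show ?case
      using A.A.on_cells(7)[of "upair f b"] H[of f b] O[of "Dom (HCat C) f" "fo (pfun X f) b"] O[of "Cod (HCat C) f" b]
      by (simp add: B_def)
  next
    case (5 u a a' s)
    then show ?case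
      using A.A.natural_Ver[of "vcode u a a' s"] O[of "Dom (VCat C) u" a] O[of "Cod (VCat C) u" a']
      by (simp add: B_def F.Y.vmul_left F.Y.vmul_right)
  qed (auto simp: B_def O)
  then interpret B: pmodf C B F F' X Y .
  have "groth_mod C B = A"
    by (rule over_cell_eqI[OF B.groth_mod_over A.over_cell_axioms]) (auto elim!: grothE simp: O, simp add: B_def)
  with B show ?thesis by blast
qed

section \<open>The lax double presheaf of fibres\<close>

subsection \<open>Action of arrows on composites of profunctors\<close>

lemma coend_rel_equiv: "(t, t') \<in> coend_rel A A' A'' U' U a a'' \<Longrightarrow>
    coend_rel A A' A'' U' U a a'' `` {t} = coend_rel A A' A'' U' U a a'' `` {t'}"
proof -
  let ?R = "coend_rel A A' A'' U' U a a''"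
  have sym: "sym ?R" unfolding coend_rel_def by (intro sym_rtrancl sym_Un_converse)
  have tr: "trans ?R" unfolding coend_rel_def by (rule trans_rtrancl)
  assume "(t, t') \<in> ?R"
  then show ?thesis using symD[OF sym] transD[OF tr] by blast
qed

lemma coend_class_self: "(a', s', s) \<in> coend_class A A' A'' U' U a a' a'' s' s"
  by (simp add: coend_class_def coend_rel_def)

text \<open>
  A function out of a coend is a function on triples that is invariant under the generating
  steps.
\<close>

lemma coend_invariant:
  assumes "(t, t') \<in> coend_rel A A' A'' U' U a a''"
    and "\<And>t t'. (t, t') \<in> coend_step A A' A'' U' U a a'' \<Longrightarrow> f t = f t'"
  shows "f t = f t'"
  using assms(1) unfolding coend_rel_def by (induction rule: rtrancl_induct) (auto dest: assms(2))

text \<open>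
  The action on a composite of profunctors is the union over all representatives of a class.
  Acting on representatives carries generating steps to generating steps, so all members of this
  union coincide and the action can be computed on any representative.
\<close>

lemma pact_prof_comp:
  assumes cat: "category A" "category A'" "category A''" and U: "profunctor A A' U" and U': "profunctor A' A'' U'"
    and k: "k \<in> Arr A" and l: "l \<in> Arr A''" and a': "a' \<in> Obj A'"
    and s: "s \<in> pel U (Cod A k) a'" and s': "s' \<in> pel U' a' (Dom A'' l)"
  shows "pact (prof_comp A A' A'' U' U) k l (coend_class A A' A'' U' U (Cod A k) a' (Dom A'' l) s' s) =
    coend_class A A' A'' U' U (Dom A k) a' (Cod A'' l) (pact U' (Ident A' a') l s') (pact U k (Ident A' a') s)"
proof -
  interpret A: category A by (rule cat(1))
  interpret A': category A' by (rule cat(2))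
  interpret A'': category A'' by (rule cat(3))
  let ?S = "coend_step A A' A'' U' U" and ?R = "coend_rel A A' A'' U' U"
  have in1: "pact V m n x \<in> pel V (Dom B m) (Cod B' n)"
    if "profunctor B B' V" "m \<in> Arr B" "n \<in> Arr B'" "x \<in> pel V (Cod B m) (Dom B' n)" for B B' and V :: "('a, 'z) prof" and m n x
    using that by (auto simp: profunctor_def PiE_def Pi_def)
  have comp: "pact V m n (pact V k l x) = pact V (Cmp B k m) (Cmp B' n l) x"
    if "profunctor B B' V" "m \<in> Arr B" "k \<in> Arr B" "n \<in> Arr B'" "l \<in> Arr B'" "Cod B m = Dom B k" "Cod B' l = Dom B' n"
      "x \<in> pel V (Cod B k) (Dom B' l)" for B B' and V :: "('a, 'z) prof" and m n k l x
    using that by (auto simp: profunctor_def)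
  define act where "act = (\<lambda>(b', t', t). (b', pact U' (Ident A' b') l t', pact U k (Ident A' b') t))"
  have step: "(act p, act q) \<in> ?S (Dom A k) (Cod A'' l)" if pq: "(p, q) \<in> ?S (Cod A k) (Dom A'' l)" for p q
  proof -
    obtain m t' t where m: "m \<in> Arr A'" "t' \<in> pel U' (Cod A' m) (Dom A'' l)" "t \<in> pel U (Cod A k) (Dom A' m)"
      and p: "p = (Cod A' m, t', pact U (Ident A (Cod A k)) m t)"
      and q: "q = (Dom A' m, pact U' m (Ident A'' (Dom A'' l)) t', t)"
      using pq unfolding coend_step_def by blast
    let ?t' = "pact U' (Ident A' (Cod A' m)) l t'" and ?t = "pact U k (Ident A' (Dom A' m)) t"
    have "pact U k (Ident A' (Cod A' m)) (pact U (Ident A (Cod A k)) m t) = pact U (Ident A (Dom A k)) m ?t"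
      using m k comp[OF U] by simp
    moreover have "pact U' (Ident A' (Dom A' m)) l (pact U' m (Ident A'' (Dom A'' l)) t') = pact U' m (Ident A'' (Cod A'' l)) ?t'"
      using m l comp[OF U'] by simp
    moreover have "?t' \<in> pel U' (Cod A' m) (Cod A'' l)" "?t \<in> pel U (Dom A k) (Dom A' m)"
      using in1[OF U', of "Ident A' (Cod A' m)" l t'] in1[OF U, of k "Ident A' (Dom A' m)" t] m k l by simp_all
    ultimately have "act p = (Cod A' m, ?t', pact U (Ident A (Dom A k)) m ?t)"
      "act q = (Dom A' m, pact U' m (Ident A'' (Cod A'' l)) ?t', ?t)"
      "?t' \<in> pel U' (Cod A' m) (Cod A'' l)" "?t \<in> pel U (Dom A k) (Dom A' m)"
      by (simp_all add: act_def p q)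
    then show ?thesis using m(1) unfolding coend_step_def by blast
  qed
  let ?c = "coend_class A A' A'' U' U (Cod A k) a' (Dom A'' l) s' s"
  have cls: "(case p of (b', t', t) \<Rightarrow> coend_class A A' A'' U' U (Dom A k) b' (Cod A'' l)
      (pact U' (Ident A' b') l t') (pact U k (Ident A' b') t)) = ?R (Dom A k) (Cod A'' l) `` {act p}" for p
    by (cases p) (simp add: coend_class_def act_def)
  have all: "?R (Dom A k) (Cod A'' l) `` {act p} = ?R (Dom A k) (Cod A'' l) `` {act (a', s', s)}" if "p \<in> ?c" for p
  proof -
    have "((a', s', s), p) \<in> ?R (Cod A k) (Dom A'' l)" using that by (simp add: coend_class_def)
    moreover have "?R (Dom A k) (Cod A'' l) `` {act t} = ?R (Dom A k) (Cod A'' l) `` {act t'}"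
      if "(t, t') \<in> ?S (Cod A k) (Dom A'' l)" for t t'
      by (rule coend_rel_equiv, unfold coend_rel_def) (intro r_into_rtrancl UnI1 step that)
    ultimately show ?thesis
      by (rule coend_invariant[where f = "\<lambda>p. ?R (Dom A k) (Cod A'' l) `` {act p}", symmetric])
  qed
  have c: "?c \<in> coend_pairs A' U' U (Cod A k) (Dom A'' l) // ?R (Cod A k) (Dom A'' l)"
    using a' s s' by (auto simp: coend_class_def coend_pairs_def intro!: quotientI)
  have "pact (prof_comp A A' A'' U' U) k l ?c = (\<Union>p\<in>?c. ?R (Dom A k) (Cod A'' l) `` {act p})"
    using k l c by (simp add: prof_comp_def cls)
  also have "\<dots> = (\<Union>p\<in>?c. ?R (Dom A k) (Cod A'' l) `` {act (a', s', s)})"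
    by (rule SUP_cong[OF refl all])
  also have "\<dots> = ?R (Dom A k) (Cod A'' l) `` {act (a', s', s)}"
  proof -
    have "?c \<noteq> {}" using coend_class_self by (metis empty_iff)
    then show ?thesis by (rule cSUP_const)
  qed
  finally show ?thesis by (simp add: coend_class_def act_def)
qed

subsection \<open>Reindexing along a fibration\<close>

context fibration
begin

text \<open>
  Reindexing of objects along a horizontal morphism and of vertical morphisms along a square.
\<close>

definition reO where "reO f e = Dom (HCat E) (hlift P f e)"
definition reV where "reV \<alpha> w = lft E (slift P \<alpha> w)"

lemma reO_in [simp]:
  "\<lbrakk>e \<in> Ob E; f \<in> Hor C; Cod (HCat C) f = fO P e\<rbrakk> \<Longrightarrow> reO f e \<in> Ob E"
  "\<lbrakk>e \<in> Ob E; f \<in> Hor C; Cod (HCat C) f = fO P e\<rbrakk> \<Longrightarrow> fO P (reO f e) = Dom (HCat C) f"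
  by (simp_all add: reO_def flip: on_bounds(1))

lemma reO_id [simp]: "e \<in> Ob E \<Longrightarrow> fO P e = x \<Longrightarrow> reO (Ident (HCat C) x) e = e"
  unfolding reO_def by (subst hlift_eqI[of "Ident (HCat E) e"]) auto

lemma hlift_comp:
  "\<lbrakk>e \<in> Ob E; g \<in> Hor C; f \<in> Hor C; Cod (HCat C) g = fO P e; Cod (HCat C) f = Dom (HCat C) g\<rbrakk> \<Longrightarrow>
    hlift P (Cmp (HCat C) g f) e = Cmp (HCat E) (hlift P g e) (hlift P f (reO g e))"
  by (rule hlift_eqI) (simp_all add: reO_def[symmetric])

lemma reO_comp [simp]:
  "\<lbrakk>e \<in> Ob E; g \<in> Hor C; f \<in> Hor C; Cod (HCat C) g = fO P e; Cod (HCat C) f = Dom (HCat C) g\<rbrakk> \<Longrightarrow>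
    reO (Cmp (HCat C) g f) e = reO f (reO g e)"
  by (simp add: reO_def[of "Cmp (HCat C) g f"] reO_def[of f] hlift_comp)  (simp add: reO_def[symmetric])

lemma reV_in [simp]:
  assumes "w \<in> Ver E" "\<alpha> \<in> Sq C" "rgt C \<alpha> = fV P w"
  shows "reV \<alpha> w \<in> Ver E" "fV P (reV \<alpha> w) = lft C \<alpha>" "Dom (VCat E) (reV \<alpha> w) = reO (upper C \<alpha>) (Dom (VCat E) w)"
    "Cod (VCat E) (reV \<alpha> w) = reO (lower C \<alpha>) (Cod (VCat E) w)"
  using assms by (simp_all add: reV_def reO_def flip: on_bounds(5) E.corner_upper_left E.corner_lower_left)
    (simp_all add: lft_slift_bounds)

lemma reV_id [simp]: "w \<in> Ver E \<Longrightarrow> fV P w = u \<Longrightarrow> reV (Ident (SHCat C) u) w = w"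
  unfolding reV_def by (subst slift_eqI[of "Ident (SHCat E) w"]) auto

lemma slift_comp:
  "\<lbrakk>w \<in> Ver E; \<beta> \<in> Sq C; \<alpha> \<in> Sq C; rgt C \<beta> = fV P w; rgt C \<alpha> = lft C \<beta>\<rbrakk> \<Longrightarrow>
    slift P (Cmp (SHCat C) \<beta> \<alpha>) w = Cmp (SHCat E) (slift P \<beta> w) (slift P \<alpha> (reV \<beta> w))"
  by (rule slift_eqI) (simp_all add: reV_def[symmetric])

lemma reV_comp [simp]:
  "\<lbrakk>w \<in> Ver E; \<beta> \<in> Sq C; \<alpha> \<in> Sq C; rgt C \<beta> = fV P w; rgt C \<alpha> = lft C \<beta>\<rbrakk> \<Longrightarrow>
    reV (Cmp (SHCat C) \<beta> \<alpha>) w = reV \<alpha> (reV \<beta> w)"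
  by (simp add: reV_def[of "Cmp (SHCat C) \<beta> \<alpha>"] reV_def[of \<alpha>] slift_comp) (simp add: reV_def[symmetric])

text \<open>
  A vertical composite of lifts is a lift, which makes reindexing compatible with vertical
  composition; the reindexing functors and the naturality of the comparison maps depend on it.
\<close>

lemma slift_vcomp:
  assumes "w \<in> Ver E" "w' \<in> Ver E" "Cod (VCat E) w = Dom (VCat E) w'" "\<alpha> \<in> Sq C" "\<alpha>' \<in> Sq C" "rgt C \<alpha> = fV P w"
    "rgt C \<alpha>' = fV P w'" "lower C \<alpha> = upper C \<alpha>'"
  shows "slift P (Cmp (SVCat C) \<alpha>' \<alpha>) (Cmp (VCat E) w' w) = Cmp (SVCat E) (slift P \<alpha>' w') (slift P \<alpha> w)"
    "lower E (slift P \<alpha> w) = upper E (slift P \<alpha>' w')"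
  using assms by (auto intro!: slift_eqI simp: lft_slift_bounds)

lemma reV_vcomp:
  assumes "w \<in> Ver E" "w' \<in> Ver E" "Cod (VCat E) w = Dom (VCat E) w'" "\<alpha> \<in> Sq C" "\<alpha>' \<in> Sq C" "rgt C \<alpha> = fV P w"
    "rgt C \<alpha>' = fV P w'" "lower C \<alpha> = upper C \<alpha>'"
  shows "reV (Cmp (SVCat C) \<alpha>' \<alpha>) (Cmp (VCat E) w' w) = Cmp (VCat E) (reV \<alpha>' w') (reV \<alpha> w)"
  using slift_vcomp[OF assms] assms by (simp add: reV_def)

lemma reV_vid: "\<lbrakk>e \<in> Ob E; f \<in> Hor C; Cod (HCat C) f = fO P e\<rbrakk> \<Longrightarrow>
    reV (Ident (SVCat C) f) (Ident (VCat E) e) = Ident (VCat E) (reO f e)"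
  unfolding reV_def reO_def by (subst slift_eqI[of "Ident (SVCat E) (hlift P f e)"]) auto

end

subsection \<open>Fibres\<close>

context fibration
begin

definition fibre_cat where
  "fibre_cat x = (let A = {w \<in> Ver E. fV P w = Ident (VCat C) x} in
     \<lparr>Obj = {e \<in> Ob E. fO P e = x}, Arr = A, Dom = (\<lambda>w\<in>A. Dom (VCat E) w), Cod = (\<lambda>w\<in>A. Cod (VCat E) w),
       Ident = (\<lambda>e\<in>{e \<in> Ob E. fO P e = x}. Ident (VCat E) e),
       Cmp = (\<lambda>n\<in>A. \<lambda>m\<in>{m \<in> A. Cod (VCat E) m = Dom (VCat E) n}. Cmp (VCat E) n m)\<rparr>)"

definition fibre_prof where
  "fibre_prof u = (let A = fibre_cat (Dom (VCat C) u); A' = fibre_cat (Cod (VCat C) u);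
       el = (\<lambda>a a'. {w \<in> Ver E. fV P w = u \<and> Dom (VCat E) w = a \<and> Cod (VCat E) w = a'}) in
     \<lparr>pel = (\<lambda>a\<in>Obj A. \<lambda>a'\<in>Obj A'. el a a'),
       pact = (\<lambda>m\<in>Arr A. \<lambda>n\<in>Arr A'. \<lambda>s\<in>el (Cod A m) (Dom A' n). Cmp (VCat E) n (Cmp (VCat E) s m))\<rparr>)"

definition fibre_fun where
  "fibre_fun f = \<lparr>fo = (\<lambda>e\<in>Obj (fibre_cat (Cod (HCat C) f)). reO f e),
     fa = (\<lambda>m\<in>Arr (fibre_cat (Cod (HCat C) f)). reV (Ident (SVCat C) f) m)\<rparr>"

definition fibre_sq where
  "fibre_sq \<alpha> = (\<lambda>a\<in>Obj (fibre_cat (Dom (VCat C) (rgt C \<alpha>))). \<lambda>a'\<in>Obj (fibre_cat (Cod (VCat C) (rgt C \<alpha>))).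
     \<lambda>s\<in>pel (fibre_prof (rgt C \<alpha>)) a a'. reV \<alpha> s)"

abbreviation fibre_comp where
  "fibre_comp u u' \<equiv> prof_comp (fibre_cat (Dom (VCat C) u)) (fibre_cat (Dom (VCat C) u')) (fibre_cat (Cod (VCat C) u'))
     (fibre_prof u') (fibre_prof u)"

abbreviation fibre_class where
  "fibre_class u u' \<equiv> coend_class (fibre_cat (Dom (VCat C) u)) (fibre_cat (Dom (VCat C) u')) (fibre_cat (Cod (VCat C) u'))
     (fibre_prof u') (fibre_prof u)"

text \<open>
  Sliding a vertical morphism over an identity from one factor to the other does not change the
  composite, so the choice of a representative is harmless.
\<close>

definition fibre_mu where
  "fibre_mu u u' = (\<lambda>a\<in>Obj (fibre_cat (Dom (VCat C) u)). \<lambda>a''\<in>Obj (fibre_cat (Cod (VCat C) u')).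
     \<lambda>c\<in>pel (fibre_comp u u') a a''. case (SOME t. t \<in> c) of (a', s', s) \<Rightarrow> Cmp (VCat E) s' s)"

definition fibre_psh where
  "fibre_psh = \<lparr>pcat = (\<lambda>x\<in>Ob C. fibre_cat x), pfun = (\<lambda>f\<in>Hor C. fibre_fun f), pprof = (\<lambda>u\<in>Ver C. fibre_prof u),
     psq = (\<lambda>\<alpha>\<in>Sq C. fibre_sq \<alpha>),
     pmu = (\<lambda>u\<in>Ver C. \<lambda>u'\<in>{u' \<in> Ver C. Dom (VCat C) u' = Cod (VCat C) u}. fibre_mu u u')\<rparr>"

lemma fibre_cat_sel [simp]:
  "e \<in> Obj (fibre_cat x) \<longleftrightarrow> e \<in> Ob E \<and> fO P e = x" "w \<in> Arr (fibre_cat x) \<longleftrightarrow> w \<in> Ver E \<and> fV P w = Ident (VCat C) x"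
  "\<lbrakk>w \<in> Ver E; fV P w = Ident (VCat C) x\<rbrakk> \<Longrightarrow> Dom (fibre_cat x) w = Dom (VCat E) w"
  "\<lbrakk>w \<in> Ver E; fV P w = Ident (VCat C) x\<rbrakk> \<Longrightarrow> Cod (fibre_cat x) w = Cod (VCat E) w"
  "\<lbrakk>e \<in> Ob E; fO P e = x\<rbrakk> \<Longrightarrow> Ident (fibre_cat x) e = Ident (VCat E) e"
  "\<lbrakk>n \<in> Ver E; fV P n = Ident (VCat C) x; m \<in> Ver E; fV P m = Ident (VCat C) x; Cod (VCat E) m = Dom (VCat E) n\<rbrakk> \<Longrightarrow>
    Cmp (fibre_cat x) n m = Cmp (VCat E) n m"
  by (simp_all add: fibre_cat_def Let_def)

lemma fibre_bounds:
  "\<lbrakk>w \<in> Ver E; fV P w = u\<rbrakk> \<Longrightarrow> fO P (Dom (VCat E) w) = Dom (VCat C) u"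
  "\<lbrakk>w \<in> Ver E; fV P w = u\<rbrakk> \<Longrightarrow> fO P (Cod (VCat E) w) = Cod (VCat C) u"
  by auto

lemma fibre_bounds_Ident [simp]:
  "\<lbrakk>x \<in> Ob C; w \<in> Ver E; fV P w = Ident (VCat C) x\<rbrakk> \<Longrightarrow> fO P (Dom (VCat E) w) = x"
  "\<lbrakk>x \<in> Ob C; w \<in> Ver E; fV P w = Ident (VCat C) x\<rbrakk> \<Longrightarrow> fO P (Cod (VCat E) w) = x"
  using fibre_bounds[of w "Ident (VCat C) x"] by simp_all

lemma small_category_fibre: "x \<in> Ob C \<Longrightarrow> small_category (fibre_cat x)"
proof (intro small_category.intro category.intro small_category_axioms.intro)
  assume "x \<in> Ob C"
  show "small (Obj (fibre_cat x))" "small (Arr (fibre_cat x))"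
    by (rule small_subset[OF E.H.small_Obj] small_subset[OF E.V.small_Arr]; auto)+
  show "Dom (fibre_cat x) \<in> extensional (Arr (fibre_cat x))" "Cod (fibre_cat x) \<in> extensional (Arr (fibre_cat x))"
    "Ident (fibre_cat x) \<in> extensional (Obj (fibre_cat x))" "Cmp (fibre_cat x) \<in> extensional (Arr (fibre_cat x))"
    by (simp_all add: fibre_cat_def Let_def)
  show "Cmp (fibre_cat x) n \<in> extensional (Into (fibre_cat x) (Dom (fibre_cat x) n))" if "n \<in> Arr (fibre_cat x)" for n
    using that by (auto simp: fibre_cat_def Let_def Into_def extensional_def)
qed (auto simp: E.V.Cmp_assoc)

lemma category_fibre: "x \<in> Ob C \<Longrightarrow> category (fibre_cat x)"
  using small_category_fibre small_category.axioms(1) by blast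

lemma fibre_prof_sel [simp]:
  "\<lbrakk>a \<in> Ob E; fO P a = Dom (VCat C) u; a' \<in> Ob E; fO P a' = Cod (VCat C) u\<rbrakk> \<Longrightarrow>
    w \<in> pel (fibre_prof u) a a' \<longleftrightarrow> w \<in> Ver E \<and> fV P w = u \<and> Dom (VCat E) w = a \<and> Cod (VCat E) w = a'"
  "\<lbrakk>u \<in> Ver C; m \<in> Ver E; fV P m = Ident (VCat C) (Dom (VCat C) u); n \<in> Ver E; fV P n = Ident (VCat C) (Cod (VCat C) u);
     s \<in> Ver E; fV P s = u; Dom (VCat E) s = Cod (VCat E) m; Cod (VCat E) s = Dom (VCat E) n\<rbrakk> \<Longrightarrow>
    pact (fibre_prof u) m n s = Cmp (VCat E) n (Cmp (VCat E) s m)"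
  by (simp_all add: fibre_prof_def Let_def)

lemma small_profunctor_fibre:
  assumes u: "u \<in> Ver C"
  shows "small_profunctor (fibre_cat (Dom (VCat C) u)) (fibre_cat (Cod (VCat C) u)) (fibre_prof u)"
  unfolding small_profunctor_def profunctor_def
proof (intro conjI ballI impI, goal_cases)
  case (3)
  then show ?case using u by (auto simp: fibre_prof_def Let_def)
next
  case (4 a a' s)
  then show ?case using u by auto
next
  case (5 m k n l s)
  then show ?case using u by (auto simp: E.V.Cmp_assoc)
next
  case (6 a a')
  then show ?case by (intro small_subset[OF E.V.small_Arr]) auto
qed (simp_all add: fibre_prof_def Let_def)

lemma fibre_mu_class:
  assumes "u \<in> Ver C" "u' \<in> Ver C" "Cod (VCat C) u = Dom (VCat C) u'" "s \<in> Ver E" "s' \<in> Ver E" "fV P s = u" "fV P s' = u'"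
    "Dom (VCat E) s = a" "Cod (VCat E) s = a'" "Dom (VCat E) s' = a'" "Cod (VCat E) s' = a''"
  shows "fibre_class u u' a a' a'' s' s \<in> pel (fibre_comp u u') a a''"
    "fibre_mu u u' a a'' (fibre_class u u' a a' a'' s' s) = Cmp (VCat E) s' s"
proof -
  let ?c = "fibre_class u u' a a' a'' s' s"
  have o: "a \<in> Ob E" "fO P a = Dom (VCat C) u" "a' \<in> Ob E" "fO P a' = Dom (VCat C) u'" "a'' \<in> Ob E" "fO P a'' = Cod (VCat C) u'"
    using E.dc_V(1,2)[OF assms(4)] E.dc_V(1,2)[OF assms(5)] fibre_bounds[OF assms(4,6)] fibre_bounds[OF assms(5,7)]
    by (simp_all only: assms(3,8-11))
  show c: "?c \<in> pel (fibre_comp u u') a a''"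
    using o assms by (auto simp: prof_comp_def coend_class_def coend_pairs_def intro!: quotientI)
  \<comment> \<open>The composite of a representative is invariant under generating steps by associativity.\<close>
  define val where "val = (\<lambda>(b' :: 'u, t', t). Cmp (VCat E) t' t)"
  have step: "val p = val q"
    if pq: "(p, q) \<in> coend_step (fibre_cat (Dom (VCat C) u)) (fibre_cat (Dom (VCat C) u')) (fibre_cat (Cod (VCat C) u'))
      (fibre_prof u') (fibre_prof u) a a''" for p q
  proof -
    from pq obtain m t' t where m: "m \<in> Ver E" "fV P m = Ident (VCat C) (Dom (VCat C) u')"
      and t: "t' \<in> pel (fibre_prof u') (Cod (VCat E) m) a''" "t \<in> pel (fibre_prof u) a (Dom (VCat E) m)"
      and p: "p = (Cod (VCat E) m, t', pact (fibre_prof u) (Ident (VCat E) a) m t)"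
      and q: "q = (Dom (VCat E) m, pact (fibre_prof u') m (Ident (VCat E) a'') t', t)"
      unfolding coend_step_def using o assms(2) by auto
    have "fO P (Dom (VCat E) m) = Dom (VCat C) u'" "fO P (Cod (VCat E) m) = Dom (VCat C) u'"
      using m assms(2) by simp_all
    then have t: "t' \<in> Ver E" "fV P t' = u'" "Dom (VCat E) t' = Cod (VCat E) m" "Cod (VCat E) t' = a''"
      "t \<in> Ver E" "fV P t = u" "Dom (VCat E) t = a" "Cod (VCat E) t = Dom (VCat E) m"
      using t m o assms(1-3) by simp_all
    show ?thesis using t m o assms(1-3) by (simp add: p q val_def E.V.Cmp_assoc)
  qed
  have "val p = Cmp (VCat E) s' s" if "p \<in> ?c" for p
  proof -
    have "val (a', s', s) = val p"
      by (rule coend_invariant[OF _ step]) (use that in \<open>auto simp: coend_class_def\<close>)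
    then show ?thesis by (simp add: val_def)
  qed
  moreover have "(SOME t. t \<in> ?c) \<in> ?c" by (rule someI[of "\<lambda>t. t \<in> ?c"], rule coend_class_self)
  ultimately have "val (SOME t. t \<in> ?c) = Cmp (VCat E) s' s" by blast
  then show "fibre_mu u u' a a'' ?c = Cmp (VCat E) s' s"
    using o c by (simp add: fibre_mu_def val_def)
qed

lemma fibre_class_cases:
  assumes "c \<in> pel (fibre_comp u u') a a''" "u \<in> Ver C" "u' \<in> Ver C" "Cod (VCat C) u = Dom (VCat C) u'"
    "a \<in> Ob E" "fO P a = Dom (VCat C) u" "a'' \<in> Ob E" "fO P a'' = Cod (VCat C) u'"
  obtains a' s' s where "c = fibre_class u u' a a' a'' s' s" "s \<in> Ver E" "s' \<in> Ver E" "fV P s = u" "fV P s' = u'"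
    "Dom (VCat E) s = a" "Cod (VCat E) s = a'" "Dom (VCat E) s' = a'" "Cod (VCat E) s' = a''"
proof -
  have "c \<in> coend_pairs (fibre_cat (Dom (VCat C) u')) (fibre_prof u') (fibre_prof u) a a'' //
      coend_rel (fibre_cat (Dom (VCat C) u)) (fibre_cat (Dom (VCat C) u')) (fibre_cat (Cod (VCat C) u')) (fibre_prof u') (fibre_prof u) a a''"
    using assms by (simp add: prof_comp_def)
  then obtain p where p: "p \<in> coend_pairs (fibre_cat (Dom (VCat C) u')) (fibre_prof u') (fibre_prof u) a a''"
    and c: "c = coend_rel (fibre_cat (Dom (VCat C) u)) (fibre_cat (Dom (VCat C) u')) (fibre_cat (Cod (VCat C) u'))
      (fibre_prof u') (fibre_prof u) a a'' `` {p}"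
    by (rule quotientE)
  obtain a' s' s where e: "p = (a', s', s)" by (cases p)
  have "a' \<in> Ob E" "fO P a' = Dom (VCat C) u'" "s' \<in> pel (fibre_prof u') a' a''" "s \<in> pel (fibre_prof u) a a'"
    using p by (simp_all add: e coend_pairs_def)
  then show ?thesis
    using assms(2-8) by (intro that[of a' s' s]) (simp_all add: c e coend_class_def)
qed

lemma fibre_mu_nat:
  assumes u: "u \<in> Ver C" "u' \<in> Ver C" "Cod (VCat C) u = Dom (VCat C) u'"
  shows "prof_nat (fibre_cat (Dom (VCat C) u)) (fibre_cat (Cod (VCat C) u')) (fibre_comp u u')
    (fibre_prof (Cmp (VCat C) u' u)) (fibre_mu u u')"
  unfolding prof_nat_def
proof (intro conjI ballI)
  show "fibre_mu u u' \<in> (\<Pi>\<^sub>E a\<in>Obj (fibre_cat (Dom (VCat C) u)). \<Pi>\<^sub>E a'\<in>Obj (fibre_cat (Cod (VCat C) u')).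
      pel (fibre_comp u u') a a' \<rightarrow>\<^sub>E pel (fibre_prof (Cmp (VCat C) u' u)) a a')"
  proof (intro PiE_I)
    fix a a'' c
    assume a: "a \<in> Obj (fibre_cat (Dom (VCat C) u))" "a'' \<in> Obj (fibre_cat (Cod (VCat C) u'))" "c \<in> pel (fibre_comp u u') a a''"
    show "fibre_mu u u' a a'' c \<in> pel (fibre_prof (Cmp (VCat C) u' u)) a a''"
      by (rule fibre_class_cases[OF a(3) u]) (use a u in \<open>simp_all add: fibre_mu_class\<close>)
  qed (auto simp: fibre_mu_def)
next
  fix m n c
  assume mn: "m \<in> Arr (fibre_cat (Dom (VCat C) u))" "n \<in> Arr (fibre_cat (Cod (VCat C) u'))"
    and c: "c \<in> pel (fibre_comp u u') (Cod (fibre_cat (Dom (VCat C) u)) m) (Dom (fibre_cat (Cod (VCat C) u')) n)"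
  from mn have m: "m \<in> Ver E" "fV P m = Ident (VCat C) (Dom (VCat C) u)" and n: "n \<in> Ver E" "fV P n = Ident (VCat C) (Cod (VCat C) u')"
    by simp_all
  obtain a' s' s where s: "c = fibre_class u u' (Cod (VCat E) m) a' (Dom (VCat E) n) s' s" "s \<in> Ver E" "s' \<in> Ver E" "fV P s = u" "fV P s' = u'"
    "Dom (VCat E) s = Cod (VCat E) m" "Cod (VCat E) s = a'" "Dom (VCat E) s' = a'" "Cod (VCat E) s' = Dom (VCat E) n"
    by (rule fibre_class_cases[of c u u' "Cod (VCat E) m" "Dom (VCat E) n"]) (use c m n u in simp_all)
  have a': "a' \<in> Ob E" "fO P a' = Dom (VCat C) u'" using E.dc_V(1)[OF s(3)] fibre_bounds(1)[OF s(3,5)] by (simp_all only: s(8))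
  have "pact (fibre_comp u u') m n c = fibre_class u u' (Dom (VCat E) m) a' (Cod (VCat E) n)
      (pact (fibre_prof u') (Ident (VCat E) a') n s') (pact (fibre_prof u) m (Ident (VCat E) a') s)"
    using pact_prof_comp[OF category_fibre category_fibre category_fibre
        small_profunctor_fibre[OF u(1), unfolded small_profunctor_def u(3), THEN conjunct1]
        small_profunctor_fibre[OF u(2), unfolded small_profunctor_def, THEN conjunct1], of m n a' s s'] s a' m n u
    by simp
  then show "fibre_mu u u' (Dom (fibre_cat (Dom (VCat C) u)) m) (Cod (fibre_cat (Cod (VCat C) u')) n) (pact (fibre_comp u u') m n c) =
      pact (fibre_prof (Cmp (VCat C) u' u)) m n (fibre_mu u u' (Cod (fibre_cat (Dom (VCat C) u)) m) (Dom (fibre_cat (Cod (VCat C) u')) n) c)"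
    using s a' m n u by (simp add: fibre_mu_class E.V.Cmp_assoc)
qed

end

context fibration
begin

lemma fibre_psh_sel [simp]:
  "x \<in> Ob C \<Longrightarrow> pcat fibre_psh x = fibre_cat x" "f \<in> Hor C \<Longrightarrow> pfun fibre_psh f = fibre_fun f"
  "u \<in> Ver C \<Longrightarrow> pprof fibre_psh u = fibre_prof u" "\<alpha> \<in> Sq C \<Longrightarrow> psq fibre_psh \<alpha> = fibre_sq \<alpha>"
  "\<lbrakk>u \<in> Ver C; u' \<in> Ver C; Cod (VCat C) u = Dom (VCat C) u'\<rbrakk> \<Longrightarrow> pmu fibre_psh u u' = fibre_mu u u'"
  by (simp_all add: fibre_psh_def)

lemma fibre_fun_sel [simp]:
  "\<lbrakk>f \<in> Hor C; e \<in> Ob E; Cod (HCat C) f = fO P e\<rbrakk> \<Longrightarrow> fo (fibre_fun f) e = reO f e"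
  "\<lbrakk>f \<in> Hor C; m \<in> Ver E; fV P m = Ident (VCat C) (Cod (HCat C) f)\<rbrakk> \<Longrightarrow> fa (fibre_fun f) m = reV (Ident (SVCat C) f) m"
  by (simp_all add: fibre_fun_def)

lemma fibre_sq_sel [simp]:
  "\<lbrakk>\<alpha> \<in> Sq C; s \<in> Ver E; fV P s = rgt C \<alpha>; Dom (VCat E) s = a; Cod (VCat E) s = a'\<rbrakk> \<Longrightarrow> fibre_sq \<alpha> a a' s = reV \<alpha> s"
  using fibre_bounds[of s "rgt C \<alpha>"] E.dc_V(1,2)[of s] by (auto simp: fibre_sq_def simp del: on_bounds)

lemma fibre_mu_sel [simp]:
  assumes "u \<in> Ver C" "u' \<in> Ver C" "Dom (VCat C) u = x" "Cod (VCat C) u = x'" "Dom (VCat C) u' = x'" "Cod (VCat C) u' = x''"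
    "s \<in> Ver E" "s' \<in> Ver E" "fV P s = u" "fV P s' = u'"
    "Dom (VCat E) s = a" "Cod (VCat E) s = a'" "Dom (VCat E) s' = a'" "Cod (VCat E) s' = a''"
  shows "fibre_mu u u' a a'' (coend_class (fibre_cat x) (fibre_cat x') (fibre_cat x'') (fibre_prof u') (fibre_prof u) a a' a'' s' s) =
    Cmp (VCat E) s' s"
  using fibre_mu_class(2)[of u u' s s' a a' a''] assms by simp

lemma small_functor_fibre:
  assumes f: "f \<in> Hor C"
  shows "small_functor (fibre_cat (Cod (HCat C) f)) (fibre_cat (Dom (HCat C) f)) (fibre_fun f)"
proof -
  have "reV (Ident (SVCat C) f) (Cmp (VCat E) n m) = Cmp (VCat E) (reV (Ident (SVCat C) f) n) (reV (Ident (SVCat C) f) m)"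
    if "n \<in> Ver E" "m \<in> Ver E" "Cod (VCat E) m = Dom (VCat E) n" "fV P n = Ident (VCat C) (Cod (HCat C) f)"
      "fV P m = Ident (VCat C) (Cod (HCat C) f)" for n m
    using reV_vcomp[of m n "Ident (SVCat C) f" "Ident (SVCat C) f"] that f by simp
  then show ?thesis
    using f by (auto simp: small_functor_def is_functor_def fibre_fun_def reV_vid)
qed

lemma fibre_sq_nat:
  assumes a: "\<alpha> \<in> Sq C"
  shows "prof_nat (fibre_cat (Dom (VCat C) (rgt C \<alpha>))) (fibre_cat (Cod (VCat C) (rgt C \<alpha>))) (fibre_prof (rgt C \<alpha>))
    (prof_restrict (fibre_prof (lft C \<alpha>)) (fibre_fun (upper C \<alpha>)) (fibre_fun (lower C \<alpha>))) (fibre_sq \<alpha>)"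
  unfolding prof_nat_def prof_restrict_def
proof (intro conjI ballI, goal_cases)
  case 1
  have "fibre_sq \<alpha> b b' s \<in> pel (fibre_prof (lft C \<alpha>)) (fo (fibre_fun (upper C \<alpha>)) b) (fo (fibre_fun (lower C \<alpha>)) b')"
    if "b \<in> Obj (fibre_cat (Dom (VCat C) (rgt C \<alpha>)))" "b' \<in> Obj (fibre_cat (Cod (VCat C) (rgt C \<alpha>)))"
      "s \<in> pel (fibre_prof (rgt C \<alpha>)) b b'" for b b' s
    using that a by simp
  then show ?case by (simp add: PiE_iff fibre_sq_def del: fibre_cat_sel)
next
  case (2 m n s)
  let ?x = "Dom (VCat C) (rgt C \<alpha>)" and ?x' = "Cod (VCat C) (rgt C \<alpha>)"
  have m: "m \<in> Ver E" "fV P m = Ident (VCat C) ?x" "n \<in> Ver E" "fV P n = Ident (VCat C) ?x'" using 2 by simp_all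
  then have s: "s \<in> Ver E" "fV P s = rgt C \<alpha>" "Dom (VCat E) s = Cod (VCat E) m" "Cod (VCat E) s = Dom (VCat E) n"
    using 2 a by simp_all
  have b: "Ident (SVCat C) (upper C \<alpha>) \<in> Sq C" "Ident (SVCat C) (lower C \<alpha>) \<in> Sq C"
    "rgt C (Ident (SVCat C) (upper C \<alpha>)) = fV P m" "rgt C (Ident (SVCat C) (lower C \<alpha>)) = fV P n"
    "lower C (Ident (SVCat C) (upper C \<alpha>)) = upper C \<alpha>" "lower C \<alpha> = upper C (Ident (SVCat C) (lower C \<alpha>))"
    using a m by simp_all
  note c = E.V.Cmp_in[OF s(1) m(1) s(3)[symmetric]] E.V.Cod_Cmp[OF s(1) m(1) s(3)[symmetric]]
  have "fV P (Cmp (VCat E) s m) = rgt C \<alpha>" using m s a by simp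
  then have "reV (Cmp (SVCat C) (Ident (SVCat C) (lower C \<alpha>)) \<alpha>) (Cmp (VCat E) n (Cmp (VCat E) s m)) =
      Cmp (VCat E) (reV (Ident (SVCat C) (lower C \<alpha>)) n) (reV \<alpha> (Cmp (VCat E) s m))"
    using c s(4) by (intro reV_vcomp a b m) simp_all
  moreover have "reV (Cmp (SVCat C) \<alpha> (Ident (SVCat C) (upper C \<alpha>))) (Cmp (VCat E) s m) =
      Cmp (VCat E) (reV \<alpha> s) (reV (Ident (SVCat C) (upper C \<alpha>)) m)"
    by (rule reV_vcomp[OF m(1) s(1) s(3)[symmetric] b(1) a b(3) s(2)[symmetric] b(5)])
  ultimately have "reV \<alpha> (Cmp (VCat E) n (Cmp (VCat E) s m)) =
      Cmp (VCat E) (reV (Ident (SVCat C) (lower C \<alpha>)) n) (Cmp (VCat E) (reV \<alpha> s) (reV (Ident (SVCat C) (upper C \<alpha>)) m))"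
    using a by simp
  then show ?case using m s a by simp
qed

lemma fibre_hom_prof: "x \<in> Ob C \<Longrightarrow> fibre_prof (Ident (VCat C) x) = hom_prof (fibre_cat x)"
  unfolding fibre_prof_def hom_prof_def Let_def
  by (simp add: fun_eq_iff restrict_def) (auto simp: fun_eq_iff Hom_def)

text \<open>
  The laws for horizontal composition hold strictly since a lift of a composite is the composite
  of the lifts; the laws for the comparison maps are associativity and unitality of vertical
  composition.
\<close>

lemma fibre_presheaf: "lax_double_presheaf C fibre_psh"
proof (rule lax_double_presheaf.intro, goal_cases)
  case 1 show ?case by (rule dc_cod)
next
  case (9 f x y) then show ?case using small_functor_fibre[of f] by auto
next
  case (10 u x x') then show ?case using small_profunctor_fibre[of u] by auto
next
  case (11 \<alpha> u v y y') then show ?case using fibre_sq_nat[of \<alpha>] by auto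
next
  case (12 u x x' u' x'') then show ?case using fibre_mu_nat[of u u'] by auto
next
  case (13 f x y g z)
  have e: "reV (Ident (SVCat C) (Cmp (HCat C) g f)) m = reV (Ident (SVCat C) f) (reV (Ident (SVCat C) g) m)"
    if "m \<in> Ver E" "fV P m = Ident (VCat C) z" for m
    using 13 that by (simp flip: C.Cmp_vert_Ident)
  show ?case
    using 13 by (auto simp: fibre_fun_def fctr_comp_def e intro!: restrict_ext)
next
  case (14 x)
  then show ?case by (auto simp: fibre_fun_def fctr_id_def C.Ident_Ident intro!: restrict_ext)
next
  case (15 \<alpha> u v \<beta> w z z' a a' s)
  have c: "\<alpha> \<in> Sq C" "\<beta> \<in> Sq C" "rgt C \<alpha> = v" "lft C \<beta> = v" "rgt C \<beta> = w" "w \<in> Ver C" "Dom (VCat C) w = z" "Cod (VCat C) w = z'"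
    using 15(1-3) by simp_all
  have "z \<in> Ob C" "z' \<in> Ob C" using C.dc_V(1,2)[OF c(6)] c by simp_all
  then have s: "s \<in> Ver E" "fV P s = w" "Dom (VCat E) s = a" "Cod (VCat E) s = a'" "a \<in> Ob E" "a' \<in> Ob E" "fO P a = z" "fO P a' = z'"
    using 15(4-6) c by simp_all
  show ?case using c s by simp
next
  case (16 u x x' a a' s)
  have c: "u \<in> Ver C" "Dom (VCat C) u = x" "Cod (VCat C) u = x'" using 16(1) by simp_all
  have "x \<in> Ob C" "x' \<in> Ob C" using C.dc_V(1,2)[OF c(1)] c by simp_all
  then have s: "s \<in> Ver E" "fV P s = u" "Dom (VCat E) s = a" "Cod (VCat E) s = a'"
    using 16(2-4) c by simp_all
  show ?case using c s by simp
next
  case (17 \<alpha> u v \<alpha>' u' v' y y' y'' f f' f'' a a' a'' s s')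
  have c: "\<alpha> \<in> Sq C" "\<alpha>' \<in> Sq C" "lft C \<alpha> = u" "rgt C \<alpha> = v" "lft C \<alpha>' = u'" "rgt C \<alpha>' = v'" "lower C \<alpha> = upper C \<alpha>'"
    "u \<in> Ver C" "u' \<in> Ver C" "v \<in> Ver C" "v' \<in> Ver C" "Dom (VCat C) v = y" "Cod (VCat C) v = y'" "Dom (VCat C) v' = y'" "Cod (VCat C) v' = y''"
    using 17(1-5) C.dc_SH(1)[of \<alpha>] C.dc_SH(1)[of \<alpha>'] by auto
  have o: "y \<in> Ob C" "y' \<in> Ob C" "y'' \<in> Ob C" using C.dc_V(1,2)[OF c(10)] C.dc_V(1,2)[OF c(11)] c(12-15) by simp_all
  have s: "s \<in> Ver E" "fV P s = v" "Dom (VCat E) s = a" "Cod (VCat E) s = a'" "s' \<in> Ver E" "fV P s' = v'" "Dom (VCat E) s' = a'"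
    "Cod (VCat E) s' = a''" "a \<in> Ob E" "a' \<in> Ob E" "a'' \<in> Ob E" "fO P a = y" "fO P a' = y'" "fO P a'' = y''"
    using 17 c o by simp_all
  have "Cod (VCat C) u = Dom (VCat C) u'" using C.vert_composable(1)[OF c(1,2,7)] c by simp
  then show ?case using c o s reV_vcomp[of s s' \<alpha> \<alpha>'] by (simp add: 17(6-8))
next
  case (18 u x x' u' x'' u'' x''' a a' a'' a''' s s' s'')
  have c: "u \<in> Ver C" "u' \<in> Ver C" "u'' \<in> Ver C" "Dom (VCat C) u = x" "Cod (VCat C) u = x'" "Dom (VCat C) u' = x'" "Cod (VCat C) u' = x''"
    "Dom (VCat C) u'' = x''" "Cod (VCat C) u'' = x'''" using 18(1-3) by simp_all
  have o: "x \<in> Ob C" "x' \<in> Ob C" "x'' \<in> Ob C" "x''' \<in> Ob C"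
    using C.dc_V(1,2)[OF c(1)] C.dc_V(1,2)[OF c(2)] C.dc_V(1,2)[OF c(3)] c by simp_all
  have s: "s \<in> Ver E" "fV P s = u" "Dom (VCat E) s = a" "Cod (VCat E) s = a'" "s' \<in> Ver E" "fV P s' = u'" "Dom (VCat E) s' = a'"
    "Cod (VCat E) s' = a''" "s'' \<in> Ver E" "fV P s'' = u''" "Dom (VCat E) s'' = a''" "Cod (VCat E) s'' = a'''"
    using 18 c o by simp_all
  show ?case using c o s by (simp add: E.V.Cmp_assoc)
next
  case (19 x) then show ?case by (simp add: fibre_hom_prof)
next
  case (20 f x y a b m)
  then show ?case by auto
next
  case (21 u x x' a b a' m s)
  have c: "u \<in> Ver C" "Dom (VCat C) u = x" "Cod (VCat C) u = x'" using 21(1) by simp_all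
  have o: "x \<in> Ob C" "x' \<in> Ob C" using C.dc_V(1,2)[OF c(1)] c by simp_all
  have f: "a \<in> Ob E" "fO P a = x" "b \<in> Ob E" "fO P b = x" "a' \<in> Ob E" "fO P a' = x'" "m \<in> Ver E"
    "fV P m = Ident (VCat C) x" using 21(2-5) o by simp_all
  have "Dom (VCat E) m = a" "Cod (VCat E) m = b" using 21(5) o f by simp_all
  moreover have "s \<in> Ver E" "fV P s = u" "Dom (VCat E) s = b" "Cod (VCat E) s = a'" using 21(6) c f by simp_all
  ultimately show ?case using c o f by simp
next
  case (22 u x x' a a' b' s m)
  have c: "u \<in> Ver C" "Dom (VCat C) u = x" "Cod (VCat C) u = x'" using 22(1) by simp_all
  have o: "x \<in> Ob C" "x' \<in> Ob C" using C.dc_V(1,2)[OF c(1)] c by simp_all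
  have f: "a \<in> Ob E" "fO P a = x" "a' \<in> Ob E" "fO P a' = x'" "b' \<in> Ob E" "fO P b' = x'" "m \<in> Ver E"
    "fV P m = Ident (VCat C) x'" using 22(2-4,6) o by simp_all
  have "Dom (VCat E) m = a'" "Cod (VCat E) m = b'" using 22(6) o f by simp_all
  moreover have "s \<in> Ver E" "fV P s = u" "Dom (VCat E) s = a" "Cod (VCat E) s = a'" using 22(5) c f by simp_all
  ultimately show ?case using c o f by simp
qed (auto simp: fibre_psh_def small_category_fibre)

text \<open>
  An object or vertical morphism of the total double category is determined by its second
  component, because the base component is its image under the fibration.
\<close>

definition fibre_iso where
  "fibre_iso = \<lparr>dsrc = groth C fibre_psh, dtgt = E, fO = (\<lambda>p\<in>groth_Ob C fibre_psh. usnd p),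
     fH = (\<lambda>h\<in>groth_Hor C fibre_psh. hlift P (ufst h) (usnd h)),
     fV = (\<lambda>w\<in>groth_Ver C fibre_psh. velem w),
     fS = (\<lambda>\<sigma>\<in>groth_Sq C fibre_psh. slift P (vbase \<sigma>) (velem \<sigma>))\<rparr>"

lemma fibre_iso: "over (groth_proj C fibre_psh) (groth C fibre_psh) C fibre_iso P E"
  "iso_arr (One (DFib C)) (groth_proj C fibre_psh, fibre_iso, P)"
proof -
  interpret X: lax_double_presheaf C fibre_psh by (rule fibre_presheaf)
  note E = grothE[where X = fibre_psh]
  show o: "over (groth_proj C fibre_psh) (groth C fibre_psh) C fibre_iso P E"
  proof (rule overI[OF X.groth_fibration fibration_axioms], goal_cases)
    case (12 w u)
    then show ?case by (auto elim!: E simp: fibre_iso_def vmul_def)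
  next
    case (13 h)
    then show ?case by (auto elim!: E simp: fibre_iso_def reO_def simp flip: on_bounds(1))
  next
    case (15 \<sigma>)
    then show ?case by (auto elim!: E simp: fibre_iso_def simp flip: reV_def)
  qed (auto elim!: E simp: fibre_iso_def)
  have "bij_betw (fO fibre_iso) (groth_Ob C fibre_psh) (Ob E)"
    by (rule bij_betw_byWitness[where f' = "\<lambda>e. upair (fO P e) e"]) (auto elim!: E simp: fibre_iso_def)
  moreover have "bij_betw (fV fibre_iso) (groth_Ver C fibre_psh) (Ver E)"
    by (rule bij_betw_byWitness[where f' = "\<lambda>w. vcode (fV P w) (Dom (VCat E) w) (Cod (VCat E) w) w"])
      (auto elim!: E simp: fibre_iso_def)
  ultimately show "iso_arr (One (DFib C)) (groth_proj C fibre_psh, fibre_iso, P)"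
    by (intro over_iso[OF o]) simp_all
qed

end

lemma groth_proj_src [simp]: "dsrc (groth_proj C X) = groth C X"
  by (simp add: groth_proj_def)

theorem two_equivalence_Groth: "two_equivalence (Psh C) (DFib C) (Groth C)"
proof (rule two_equivalence_criterion[OF twocategory_Psh twocategory_DFib twofunctor_Groth], goal_cases)
  case (1 X Y g)
  obtain p H q where g: "g = (p, H, q)" by (cases g)
  interpret groth_over C X Y H
    using 1 by (auto simp: g groth_over_def)
  show ?case
    using 1 trans groth_map_trans by (intro bexI[of _ trans]) (auto simp: g ptransf_iff)
next
  case (2 X Y F G)
  then show ?case using groth_map_inject[of C F X Y G] by (simp add: ptransf_iff)
next
  case (3 X Y \<tau>)
  obtain p A q where t: "\<tau> = (p, A, q)" by (cases \<tau>)
  have A: "over_cell (groth_proj C X) (groth C X) C (vsrc A) (vtgt A) A (groth_proj C Y) (groth C Y)"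
    and X: "lax_double_presheaf C X" and Y: "lax_double_presheaf C Y"
    using 3 by (auto simp: t)
  interpret A: over_cell "groth_proj C X" "groth C X" C "vsrc A" "vtgt A" A "groth_proj C Y" "groth C Y"
    by (rule A)
  interpret S: groth_over C X Y "vsrc A" using X Y A.F.over_axioms by (simp add: groth_over_def)
  interpret T: groth_over C X Y "vtgt A" using X Y A.F'.over_axioms by (simp add: groth_over_def)
  obtain B where "pmodf C B S.trans T.trans X Y" "groth_mod C B = A"
    using groth_mod_surj[OF S.trans T.trans, unfolded S.groth_map_trans T.groth_map_trans, OF A] by blast
  then show ?case using 3 by (intro bexI[of _ B]) (auto simp: t pmodf_iff)
next
  case (4 X Y A B)
  then have e: "groth_mod C A = groth_mod C B" by simp
  have A: "pmodf C A (msrc A) (mtgt A) X Y" and B: "pmodf C B (msrc B) (mtgt B) X Y" using 4 by (simp_all add: pmodf_iff)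
  have p: "ptransf C (msrc A) X Y" "ptransf C (mtgt A) X Y" "ptransf C (msrc B) X Y" "ptransf C (mtgt B) X Y"
    using 4 globular_modification_parallel[of C A] globular_modification_parallel[of C B] by (auto simp: ptransf_iff)
  have "groth_map C (msrc A) = groth_map C (msrc B)" "groth_map C (mtgt A) = groth_map C (mtgt B)"
    using pmodf.groth_mod_sel(1,2)[OF A] pmodf.groth_mod_sel(1,2)[OF B] e by simp_all
  then have "msrc A = msrc B" "mtgt A = mtgt B"
    using groth_map_inject[OF p(1,3)] groth_map_inject[OF p(2,4)] by simp_all
  then show ?case using groth_mod_inject[OF A _ e] B by simp
next
  case (5 P)
  obtain E where "fibration P E C" using 5 by auto
  then interpret fibration P E C .
  show ?case
    using fibre_presheaf fibre_iso by (intro bexI[of _ fibre_psh] bexI[of _ "(groth_proj C fibre_psh, fibre_iso, P)"]) simp_all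
qed

section \<open>Pullback of discrete double fibrations\<close>

lemma pull_set_mem [simp]: "upair c e \<in> pull_set S T g p \<longleftrightarrow> c \<in> S \<and> e \<in> T \<and> g c = p e"
  by (auto simp: pull_set_def)

lemma pull_setE: "z \<in> pull_set S T g p \<Longrightarrow> (\<And>c e. z = upair c e \<Longrightarrow> c \<in> S \<Longrightarrow> e \<in> T \<Longrightarrow> g c = p e \<Longrightarrow> thesis) \<Longrightarrow> thesis"
  by (auto simp: pull_set_def)

lemma small_pull_set: "small S \<Longrightarrow> small T \<Longrightarrow> small (pull_set S T g p)"
proof -
  assume a: "small S" "small T"
  have "small (\<Union>c\<in>S. upair c ` T)" by (intro small_UN a small_image)
  then show ?thesis by (rule small_subset) (auto simp: pull_set_def)
qed

lemma pull_cat_sets [simp]: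
  "Obj (pull_cat A B G P) = pull_set (Obj A) (Obj B) (fo G) (fo P)"
  "Arr (pull_cat A B G P) = pull_set (Arr A) (Arr B) (fa G) (fa P)"
  by (simp_all add: pull_cat_def Let_def)

lemma pull_cat_sel [simp]:
  "upair c e \<in> pull_set (Arr A) (Arr B) (fa G) (fa P) \<Longrightarrow> Dom (pull_cat A B G P) (upair c e) = upair (Dom A c) (Dom B e)"
  "upair c e \<in> pull_set (Arr A) (Arr B) (fa G) (fa P) \<Longrightarrow> Cod (pull_cat A B G P) (upair c e) = upair (Cod A c) (Cod B e)"
  "upair c e \<in> pull_set (Obj A) (Obj B) (fo G) (fo P) \<Longrightarrow> Ident (pull_cat A B G P) (upair c e) = upair (Ident A c) (Ident B e)"
  "\<lbrakk>upair c' e' \<in> pull_set (Arr A) (Arr B) (fa G) (fa P); upair c e \<in> pull_set (Arr A) (Arr B) (fa G) (fa P);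
     Cod A c = Dom A c'; Cod B e = Dom B e'\<rbrakk> \<Longrightarrow>
    Cmp (pull_cat A B G P) (upair c' e') (upair c e) = upair (Cmp A c' c) (Cmp B e' e)"
  by (simp_all add: pull_cat_def Let_def del: pull_set_mem)

lemma small_category_pull:
  assumes A: "small_category A" and B: "small_category B" and G: "is_functor A D (fo G) (fa G)" and P: "is_functor B D (fo P) (fa P)"
  shows "small_category (pull_cat A B G P)"
proof -
  interpret A: small_category A by (rule A)
  interpret B: small_category B by (rule B)
  have f [simp]: "m \<in> Arr A \<Longrightarrow> n \<in> Arr B \<Longrightarrow> fa G m = fa P n \<Longrightarrow> fo G (Dom A m) = fo P (Dom B n)"
    "m \<in> Arr A \<Longrightarrow> n \<in> Arr B \<Longrightarrow> fa G m = fa P n \<Longrightarrow> fo G (Cod A m) = fo P (Cod B n)"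
    "a \<in> Obj A \<Longrightarrow> fa G (Ident A a) = Ident D (fo G a)" "b \<in> Obj B \<Longrightarrow> fa P (Ident B b) = Ident D (fo P b)"
    "\<lbrakk>k \<in> Arr A; m \<in> Arr A; Cod A m = Dom A k\<rbrakk> \<Longrightarrow> fa G (Cmp A k m) = Cmp D (fa G k) (fa G m)"
    "\<lbrakk>l \<in> Arr B; n \<in> Arr B; Cod B n = Dom B l\<rbrakk> \<Longrightarrow> fa P (Cmp B l n) = Cmp D (fa P l) (fa P n)"
    for m n k l a b
    using is_functor_simps[OF G] is_functor_simps[OF P] by auto metis+
  show ?thesis
  proof (intro small_category.intro category.intro small_category_axioms.intro)
    show "small (Obj (pull_cat A B G P))" "small (Arr (pull_cat A B G P))"
      by (simp_all add: small_pull_set A.small_Obj A.small_Arr B.small_Obj B.small_Arr)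
  qed (auto elim!: pull_setE simp: A.Cmp_assoc B.Cmp_assoc, auto simp: pull_cat_def Let_def Into_def)
qed

text \<open>
  The cells of the pullback are the codes of pairs of cells with the same image; lifts are
  computed in the second component.
\<close>

locale pulled = G: dfunctor G C D + P: fibration P E D for G C D P and E :: "'u::universe dblcat"
begin

lemma pull_cats: "HCat (pull G P) = pull_cat (HCat C) (HCat E) \<lparr>fo = fO G, fa = fH G\<rparr> \<lparr>fo = fO P, fa = fH P\<rparr>"
  "VCat (pull G P) = pull_cat (VCat C) (VCat E) \<lparr>fo = fO G, fa = fV G\<rparr> \<lparr>fo = fO P, fa = fV P\<rparr>"
  "SHCat (pull G P) = pull_cat (SHCat C) (SHCat E) \<lparr>fo = fV G, fa = fS G\<rparr> \<lparr>fo = fV P, fa = fS P\<rparr>"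
  "SVCat (pull G P) = pull_cat (SVCat C) (SVCat E) \<lparr>fo = fH G, fa = fS G\<rparr> \<lparr>fo = fH P, fa = fS P\<rparr>"
  by (simp_all add: pull_def Let_def)

lemma pull_sets [simp]:
  "Obj (HCat (pull G P)) = pull_set (Ob C) (Ob E) (fO G) (fO P)" "Obj (VCat (pull G P)) = pull_set (Ob C) (Ob E) (fO G) (fO P)"
  "Arr (HCat (pull G P)) = pull_set (Hor C) (Hor E) (fH G) (fH P)" "Obj (SVCat (pull G P)) = pull_set (Hor C) (Hor E) (fH G) (fH P)"
  "Arr (VCat (pull G P)) = pull_set (Ver C) (Ver E) (fV G) (fV P)" "Obj (SHCat (pull G P)) = pull_set (Ver C) (Ver E) (fV G) (fV P)"
  "Arr (SHCat (pull G P)) = pull_set (Sq C) (Sq E) (fS G) (fS P)" "Arr (SVCat (pull G P)) = pull_set (Sq C) (Sq E) (fS G) (fS P)"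
  by (simp_all add: pull_cats)

lemma over_match [simp]:
  "\<lbrakk>f \<in> Hor C; h \<in> Hor E; fH G f = fH P h\<rbrakk> \<Longrightarrow> fO G (Dom (HCat C) f) = fO P (Dom (HCat E) h)"
  "\<lbrakk>f \<in> Hor C; h \<in> Hor E; fH G f = fH P h\<rbrakk> \<Longrightarrow> fO G (Cod (HCat C) f) = fO P (Cod (HCat E) h)"
  "\<lbrakk>u \<in> Ver C; w \<in> Ver E; fV G u = fV P w\<rbrakk> \<Longrightarrow> fO G (Dom (VCat C) u) = fO P (Dom (VCat E) w)"
  "\<lbrakk>u \<in> Ver C; w \<in> Ver E; fV G u = fV P w\<rbrakk> \<Longrightarrow> fO G (Cod (VCat C) u) = fO P (Cod (VCat E) w)"
  "\<lbrakk>\<alpha> \<in> Sq C; \<sigma> \<in> Sq E; fS G \<alpha> = fS P \<sigma>\<rbrakk> \<Longrightarrow> fV G (lft C \<alpha>) = fV P (lft E \<sigma>)"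
  "\<lbrakk>\<alpha> \<in> Sq C; \<sigma> \<in> Sq E; fS G \<alpha> = fS P \<sigma>\<rbrakk> \<Longrightarrow> fV G (rgt C \<alpha>) = fV P (rgt E \<sigma>)"
  "\<lbrakk>\<alpha> \<in> Sq C; \<sigma> \<in> Sq E; fS G \<alpha> = fS P \<sigma>\<rbrakk> \<Longrightarrow> fH G (upper C \<alpha>) = fH P (upper E \<sigma>)"
  "\<lbrakk>\<alpha> \<in> Sq C; \<sigma> \<in> Sq E; fS G \<alpha> = fS P \<sigma>\<rbrakk> \<Longrightarrow> fH G (lower C \<alpha>) = fH P (lower E \<sigma>)"
  by (simp_all flip: G.on_bounds P.on_bounds)

lemma pull_bounds [simp]:
  "\<lbrakk>f \<in> Hor C; h \<in> Hor E; fH G f = fH P h\<rbrakk> \<Longrightarrow> Dom (HCat (pull G P)) (upair f h) = upair (Dom (HCat C) f) (Dom (HCat E) h)"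
  "\<lbrakk>f \<in> Hor C; h \<in> Hor E; fH G f = fH P h\<rbrakk> \<Longrightarrow> Cod (HCat (pull G P)) (upair f h) = upair (Cod (HCat C) f) (Cod (HCat E) h)"
  "\<lbrakk>u \<in> Ver C; w \<in> Ver E; fV G u = fV P w\<rbrakk> \<Longrightarrow> Dom (VCat (pull G P)) (upair u w) = upair (Dom (VCat C) u) (Dom (VCat E) w)"
  "\<lbrakk>u \<in> Ver C; w \<in> Ver E; fV G u = fV P w\<rbrakk> \<Longrightarrow> Cod (VCat (pull G P)) (upair u w) = upair (Cod (VCat C) u) (Cod (VCat E) w)"
  "\<lbrakk>\<alpha> \<in> Sq C; \<sigma> \<in> Sq E; fS G \<alpha> = fS P \<sigma>\<rbrakk> \<Longrightarrow> lft (pull G P) (upair \<alpha> \<sigma>) = upair (lft C \<alpha>) (lft E \<sigma>)"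
  "\<lbrakk>\<alpha> \<in> Sq C; \<sigma> \<in> Sq E; fS G \<alpha> = fS P \<sigma>\<rbrakk> \<Longrightarrow> rgt (pull G P) (upair \<alpha> \<sigma>) = upair (rgt C \<alpha>) (rgt E \<sigma>)"
  "\<lbrakk>\<alpha> \<in> Sq C; \<sigma> \<in> Sq E; fS G \<alpha> = fS P \<sigma>\<rbrakk> \<Longrightarrow> upper (pull G P) (upair \<alpha> \<sigma>) = upair (upper C \<alpha>) (upper E \<sigma>)"
  "\<lbrakk>\<alpha> \<in> Sq C; \<sigma> \<in> Sq E; fS G \<alpha> = fS P \<sigma>\<rbrakk> \<Longrightarrow> lower (pull G P) (upair \<alpha> \<sigma>) = upair (lower C \<alpha>) (lower E \<sigma>)"
  by (simp_all add: pull_cats)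

lemma pull_Ident [simp]:
  "\<lbrakk>x \<in> Ob C; e \<in> Ob E; fO G x = fO P e\<rbrakk> \<Longrightarrow> Ident (HCat (pull G P)) (upair x e) = upair (Ident (HCat C) x) (Ident (HCat E) e)"
  "\<lbrakk>x \<in> Ob C; e \<in> Ob E; fO G x = fO P e\<rbrakk> \<Longrightarrow> Ident (VCat (pull G P)) (upair x e) = upair (Ident (VCat C) x) (Ident (VCat E) e)"
  "\<lbrakk>u \<in> Ver C; w \<in> Ver E; fV G u = fV P w\<rbrakk> \<Longrightarrow> Ident (SHCat (pull G P)) (upair u w) = upair (Ident (SHCat C) u) (Ident (SHCat E) w)"
  "\<lbrakk>f \<in> Hor C; h \<in> Hor E; fH G f = fH P h\<rbrakk> \<Longrightarrow> Ident (SVCat (pull G P)) (upair f h) = upair (Ident (SVCat C) f) (Ident (SVCat E) h)"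
  by (simp_all add: pull_cats)

lemma pull_Cmp [simp]:
  "\<lbrakk>f \<in> Hor C; h \<in> Hor E; fH G f = fH P h; f' \<in> Hor C; h' \<in> Hor E; fH G f' = fH P h'; Cod (HCat C) f = Dom (HCat C) f';
     Cod (HCat E) h = Dom (HCat E) h'\<rbrakk> \<Longrightarrow>
    Cmp (HCat (pull G P)) (upair f' h') (upair f h) = upair (Cmp (HCat C) f' f) (Cmp (HCat E) h' h)"
  "\<lbrakk>u \<in> Ver C; w \<in> Ver E; fV G u = fV P w; u' \<in> Ver C; w' \<in> Ver E; fV G u' = fV P w'; Cod (VCat C) u = Dom (VCat C) u';
     Cod (VCat E) w = Dom (VCat E) w'\<rbrakk> \<Longrightarrow>
    Cmp (VCat (pull G P)) (upair u' w') (upair u w) = upair (Cmp (VCat C) u' u) (Cmp (VCat E) w' w)"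
  "\<lbrakk>\<alpha> \<in> Sq C; \<sigma> \<in> Sq E; fS G \<alpha> = fS P \<sigma>; \<alpha>' \<in> Sq C; \<sigma>' \<in> Sq E; fS G \<alpha>' = fS P \<sigma>'; rgt C \<alpha> = lft C \<alpha>';
     rgt E \<sigma> = lft E \<sigma>'\<rbrakk> \<Longrightarrow>
    Cmp (SHCat (pull G P)) (upair \<alpha>' \<sigma>') (upair \<alpha> \<sigma>) = upair (Cmp (SHCat C) \<alpha>' \<alpha>) (Cmp (SHCat E) \<sigma>' \<sigma>)"
  "\<lbrakk>\<alpha> \<in> Sq C; \<sigma> \<in> Sq E; fS G \<alpha> = fS P \<sigma>; \<alpha>' \<in> Sq C; \<sigma>' \<in> Sq E; fS G \<alpha>' = fS P \<sigma>'; lower C \<alpha> = upper C \<alpha>';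
     lower E \<sigma> = upper E \<sigma>'\<rbrakk> \<Longrightarrow>
    Cmp (SVCat (pull G P)) (upair \<alpha>' \<sigma>') (upair \<alpha> \<sigma>) = upair (Cmp (SVCat C) \<alpha>' \<alpha>) (Cmp (SVCat E) \<sigma>' \<sigma>)"
  by (simp_all add: pull_cats)

lemma pull_double_category: "double_category (pull G P)"
proof (rule double_category.intro, goal_cases)
  case 1 show ?case unfolding pull_cats
    using G.parts(1) P.parts(1) by (intro small_category_pull[OF G.E.HCat P.E.HCat]) (auto simp: small_functor_def)
next
  case 2 show ?case unfolding pull_cats
    using G.parts(2) P.parts(2) by (intro small_category_pull[OF G.E.VCat P.E.VCat]) (auto simp: small_functor_def)
next
  case 3 show ?case unfolding pull_cats
    using G.parts(3) P.parts(3) by (intro small_category_pull[OF G.E.SHCat P.E.SHCat]) (auto simp: small_functor_def)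
next
  case 4 show ?case unfolding pull_cats
    using G.parts(4) P.parts(4) by (intro small_category_pull[OF G.E.SVCat P.E.SVCat]) (auto simp: small_functor_def)
qed (auto elim!: pull_setE simp: G.E.vert_composable P.E.vert_composable G.E.interchange P.E.interchange
    G.E.Cmp_vert_Ident P.E.Cmp_vert_Ident G.E.Cmp_hor_Ident P.E.Cmp_hor_Ident G.E.Ident_Ident P.E.Ident_Ident)

lemma pull_proj_sel [simp]:
  "dsrc (pull_proj G P) = pull G P" "dtgt (pull_proj G P) = C"
  "\<lbrakk>x \<in> Ob C; e \<in> Ob E; fO G x = fO P e\<rbrakk> \<Longrightarrow> fO (pull_proj G P) (upair x e) = x"
  "\<lbrakk>f \<in> Hor C; h \<in> Hor E; fH G f = fH P h\<rbrakk> \<Longrightarrow> fH (pull_proj G P) (upair f h) = f"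
  "\<lbrakk>u \<in> Ver C; w \<in> Ver E; fV G u = fV P w\<rbrakk> \<Longrightarrow> fV (pull_proj G P) (upair u w) = u"
  "\<lbrakk>\<alpha> \<in> Sq C; \<sigma> \<in> Sq E; fS G \<alpha> = fS P \<sigma>\<rbrakk> \<Longrightarrow> fS (pull_proj G P) (upair \<alpha> \<sigma>) = \<alpha>"
  by (simp_all add: pull_proj_def)

lemma pull_proj_dfunctor: "dfunctor (pull_proj G P) (pull G P) C"
  by (rule dfunctorI[OF pull_double_category G.dc_dom])
    (auto elim!: pull_setE, auto simp: pull_proj_def)

lemma pull_fibration: "fibration (pull_proj G P) (pull G P) C"
proof (rule fibrationI[OF pull_proj_dfunctor], goal_cases)
  case (1 z f)
  then obtain y e where e: "z = upair y e" "y \<in> Ob C" "e \<in> Ob E" "fO G y = fO P e" by (auto elim!: pull_setE)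
  then have f: "Cod (HCat C) f = y" using 1 by simp
  have G: "Cod (HCat D) (fH G f) = fO P e" using 1 e f by simp
  show ?case
    by (rule ex1I[of _ "upair f (hlift P (fH G f) e)"])
      (use 1 e f G in \<open>auto elim!: pull_setE intro!: P.hlift_eqI[symmetric] simp del: G.on_bounds\<close>)
next
  case (2 z \<alpha>)
  then obtain v w where e: "z = upair v w" "v \<in> Ver C" "w \<in> Ver E" "fV G v = fV P w" by (auto elim!: pull_setE)
  then have f: "rgt C \<alpha> = v" using 2 by simp
  have G: "rgt D (fS G \<alpha>) = fV P w" using 2 e f by simp
  show ?case
    by (rule ex1I[of _ "upair \<alpha> (slift P (fS G \<alpha>) w)"])
      (use 2 e f G in \<open>auto elim!: pull_setE intro!: P.slift_eqI[symmetric] simp del: G.on_bounds\<close>)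
qed

end

lemma pulled_iff: "pulled G C D P E \<longleftrightarrow> dfunctor G C D \<and> fibration P E D"
  by (auto simp: pulled_def)

subsection \<open>Functoriality of pullback\<close>

locale pulled_over = G: dfunctor G C D + F: over P E D F Q E' for G C D P E F Q and E' :: "'u::universe dblcat"
begin

sublocale GP: pulled G C D P E by unfold_locales
sublocale GQ: pulled G C D Q E' by unfold_locales

lemma pull_map_sel [simp]:
  "dsrc (pull_map G (P, F, Q)) = pull G P" "dtgt (pull_map G (P, F, Q)) = pull G Q"
  "\<lbrakk>x \<in> Ob C; e \<in> Ob E; fO G x = fO P e\<rbrakk> \<Longrightarrow> fO (pull_map G (P, F, Q)) (upair x e) = upair x (fO F e)"
  "\<lbrakk>f \<in> Hor C; h \<in> Hor E; fH G f = fH P h\<rbrakk> \<Longrightarrow> fH (pull_map G (P, F, Q)) (upair f h) = upair f (fH F h)"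
  "\<lbrakk>u \<in> Ver C; w \<in> Ver E; fV G u = fV P w\<rbrakk> \<Longrightarrow> fV (pull_map G (P, F, Q)) (upair u w) = upair u (fV F w)"
  "\<lbrakk>\<alpha> \<in> Sq C; \<sigma> \<in> Sq E; fS G \<alpha> = fS P \<sigma>\<rbrakk> \<Longrightarrow> fS (pull_map G (P, F, Q)) (upair \<alpha> \<sigma>) = upair \<alpha> (fS F \<sigma>)"
  by (simp_all add: pull_map_def)

lemma pull_map_over: "over (pull_proj G P) (pull G P) C (pull_map G (P, F, Q)) (pull_proj G Q) (pull G Q)"
  by (rule overI[OF GP.pull_fibration GQ.pull_fibration])
    (auto elim!: pull_setE, auto simp: pull_map_def)

end

locale pulled_cell = G: dfunctor G C D + A: over_cell P E D F F' A Q E'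
  for G C D P E F F' A Q and E' :: "'u::universe dblcat"
begin

sublocale S: pulled_over G C D P E F Q E' by unfold_locales
sublocale T: pulled_over G C D P E F' Q E' by unfold_locales

lemma pull_vtrans_sel [simp]:
  "vsrc (pull_vtrans G (P, A, Q)) = pull_map G (P, F, Q)" "vtgt (pull_vtrans G (P, A, Q)) = pull_map G (P, F', Q)"
  "\<lbrakk>x \<in> Ob C; e \<in> Ob E; fO G x = fO P e\<rbrakk> \<Longrightarrow> vO (pull_vtrans G (P, A, Q)) (upair x e) = upair (Ident (VCat C) x) (vO A e)"
  "\<lbrakk>f \<in> Hor C; h \<in> Hor E; fH G f = fH P h\<rbrakk> \<Longrightarrow> vH (pull_vtrans G (P, A, Q)) (upair f h) = upair (Ident (SVCat C) f) (vH A h)"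
  by (simp_all add: pull_vtrans_def A.A.vsrc A.A.vtgt)

lemma pull_vtrans_over: "over_cell (pull_proj G P) (pull G P) C (pull_map G (P, F, Q)) (pull_map G (P, F', Q))
    (pull_vtrans G (P, A, Q)) (pull_proj G Q) (pull G Q)"
  by (rule over_cellI[OF S.pull_map_over T.pull_map_over])
    (auto elim!: pull_setE simp: A.A.natural_Ver, auto simp: pull_vtrans_def)

end

lemma DFib_pf_sel [simp]:
  "ps0 DFib_pf = DFib" "on0 (ps1 DFib_pf G) = pull_proj G"
  "on1 (ps1 DFib_pf G) (P, F, Q) = (pull_proj G P, pull_map G (P, F, Q), pull_proj G Q)"
  "on2 (ps1 DFib_pf G) (P, A, Q) = (pull_proj G P, pull_vtrans G (P, A, Q), pull_proj G Q)"
  "ps2 DFib_pf B P = (pull_proj (htgt B) P, pull_htrans B P, pull_proj (hsrc B) P)"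
  "ps_comp DFib_pf G H P = (pull_proj G (pull_proj H P), pull_assoc G H P, pull_proj (dfun_comp H G) P)"
  "ps_unit DFib_pf C P = (P, pull_unit C P, pull_proj (dfun_id C) P)"
  by (simp_all add: DFib_pf_def)

lemma twofunctor_pull:
  assumes G: "dfunctor G C D"
  shows "twofunctor (DFib D) (DFib C) (ps1 DFib_pf G)"
proof (rule twofunctor_into_DFibI[OF twocategory_DFib, where m = "pull_map G" and c = "pull_vtrans G" and E = "pull G"], goal_cases)
  case (1 f) then show ?case by (cases f) simp
next
  case (2 \<sigma>) then show ?case by (cases \<sigma>) simp
next
  case (3 P)
  then obtain E where "fibration P E D" by auto
  then interpret pulled G C D P E using G by (simp add: pulled_iff)
  show ?case by (simp add: pull_fibration)
next
  case (4 f)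
  obtain P F Q where f: "f = (P, F, Q)" by (cases f)
  interpret G: dfunctor G C D by (rule G)
  have "over P (dsrc P) D F Q (dsrc Q)" using 4 by (simp add: f)
  then obtain E E' where "over P E D F Q E'" by blast
  then interpret over P E D F Q E' .
  interpret pulled_over G C D P E F Q E' by unfold_locales
  show ?case by (simp add: f pull_map_over)
next
  case (5 P a)
  interpret G: dfunctor G C D by (rule G)
  obtain E where E: "fibration P E D" using 5 by auto
  interpret I: over P E D "dfun_id E" P E by (rule over_id[OF E])
  interpret pulled_over G C D P E "dfun_id E" P E by unfold_locales
  show ?case using 5 by (auto elim!: pull_setE)
next
  case (6 P a)
  interpret G: dfunctor G C D by (rule G)
  obtain E where E: "fibration P E D" using 6 by auto
  interpret I: over P E D "dfun_id E" P E by (rule over_id[OF E])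
  interpret pulled_over G C D P E "dfun_id E" P E by unfold_locales
  show ?case using 6 by (auto elim!: pull_setE)
next
  case (7 g f a)
  interpret G: dfunctor G C D by (rule G)
  obtain P F Q H R where f: "f = (P, F, Q)" "g = (Q, H, R)" using 7(3) by (cases f; cases g) auto
  have "over P (dsrc P) D F Q (dsrc Q)" "over Q (dsrc Q) D H R (dsrc R)" using 7(1,2) by (simp_all add: f)
  then obtain E E' E'' where F: "over P E D F Q E'" and H: "over Q E' D H R E''" by blast
  interpret F: over P E D F Q E' by (rule F)
  interpret H: over Q E' D H R E'' by (rule H)
  interpret HF: over P E D "dfun_comp H F" R E'' by (rule over_comp[OF F H])
  interpret pF: pulled_over G C D P E F Q E' by unfold_locales
  interpret pH: pulled_over G C D Q E' H R E'' by unfold_locales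
  interpret pHF: pulled_over G C D P E "dfun_comp H F" R E'' by unfold_locales
  show ?case using 7 by (auto elim!: pull_setE simp: f)
next
  case (8 g f a)
  interpret G: dfunctor G C D by (rule G)
  obtain P F Q H R where f: "f = (P, F, Q)" "g = (Q, H, R)" using 8(3) by (cases f; cases g) auto
  have "over P (dsrc P) D F Q (dsrc Q)" "over Q (dsrc Q) D H R (dsrc R)" using 8(1,2) by (simp_all add: f)
  then obtain E E' E'' where F: "over P E D F Q E'" and H: "over Q E' D H R E''" by blast
  interpret F: over P E D F Q E' by (rule F)
  interpret H: over Q E' D H R E'' by (rule H)
  interpret HF: over P E D "dfun_comp H F" R E'' by (rule over_comp[OF F H])
  interpret pF: pulled_over G C D P E F Q E' by unfold_locales
  interpret pH: pulled_over G C D Q E' H R E'' by unfold_locales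
  interpret pHF: pulled_over G C D P E "dfun_comp H F" R E'' by unfold_locales
  show ?case using 8 by (auto elim!: pull_setE simp: f)
next
  case (9 \<sigma>)
  interpret G: dfunctor G C D by (rule G)
  obtain P A Q where s: "\<sigma> = (P, A, Q)" by (cases \<sigma>)
  have "over_cell P (dsrc P) D (vsrc A) (vtgt A) A Q (dsrc Q)" using 9 by (simp add: s)
  then obtain E F F' E' where A: "over_cell P E D F F' A Q E'" by blast
  interpret A: over_cell P E D F F' A Q E' by (rule A)
  interpret pulled_cell G C D P E F F' A Q E' by unfold_locales
  show ?case using pull_vtrans_over by (simp add: s A.A.vsrc A.A.vtgt)
next
  case (10 f a)
  interpret G: dfunctor G C D by (rule G)
  obtain P F Q where f: "f = (P, F, Q)" by (cases f)
  have "over P (dsrc P) D F Q (dsrc Q)" using 10 by (simp add: f)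
  then obtain E E' where F: "over P E D F Q E'" by blast
  interpret F: over P E D F Q E' by (rule F)
  interpret I: over_cell P E D F F "vtrans_id F" Q E' by (rule over_cell_id[OF F])
  interpret pulled_cell G C D P E F F "vtrans_id F" Q E' by unfold_locales
  show ?case using 10 by (auto elim!: pull_setE simp: f)
next
  case (11 \<tau> \<sigma> a)
  interpret G: dfunctor G C D by (rule G)
  obtain P A Q where s: "\<sigma> = (P, A, Q)" by (cases \<sigma>)
  obtain B where t: "\<tau> = (P, B, Q)" using 11(3) by (cases \<tau>) (auto simp: s)
  have "over_cell P (dsrc P) D (vsrc A) (vtgt A) A Q (dsrc Q)" "over_cell P (dsrc P) D (vtgt A) (vtgt B) B Q (dsrc Q)"
    using 11(1-3) by (simp_all add: s t)
  then obtain E F F' F'' E' where A: "over_cell P E D F F' A Q E'" and B: "over_cell P E D F' F'' B Q E'" by blast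
  interpret A: over_cell P E D F F' A Q E' by (rule A)
  interpret B: over_cell P E D F' F'' B Q E' by (rule B)
  interpret BA: over_cell P E D F F'' "vtrans_vcomp B A" Q E' by (rule over_cell_vcomp[OF A B])
  interpret pA: pulled_cell G C D P E F F' A Q E' by unfold_locales
  interpret pB: pulled_cell G C D P E F' F'' B Q E' by unfold_locales
  interpret pBA: pulled_cell G C D P E F F'' "vtrans_vcomp B A" Q E' by unfold_locales
  show ?case using 11 by (auto elim!: pull_setE simp: s t A.A.vsrc)
next
  case (12 \<tau> \<sigma> a)
  interpret G: dfunctor G C D by (rule G)
  obtain P A Q where s: "\<sigma> = (P, A, Q)" by (cases \<sigma>)
  obtain B R where t: "\<tau> = (Q, B, R)" using 12(3) by (cases \<tau>) (auto simp: s)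
  have "over_cell P (dsrc P) D (vsrc A) (vtgt A) A Q (dsrc Q)" "over_cell Q (dsrc Q) D (vsrc B) (vtgt B) B R (dsrc R)"
    using 12(1,2) by (simp_all add: s t)
  then obtain E F F' E' H H' E'' where A: "over_cell P E D F F' A Q E'" and B: "over_cell Q E' D H H' B R E''" by blast
  interpret A: over_cell P E D F F' A Q E' by (rule A)
  interpret B: over_cell Q E' D H H' B R E'' by (rule B)
  interpret BA: over_cell P E D "dfun_comp H F" "dfun_comp H' F'" "vtrans_hcomp B A" R E'' by (rule over_cell_hcomp[OF A B])
  interpret pA: pulled_cell G C D P E F F' A Q E' by unfold_locales
  interpret pB: pulled_cell G C D Q E' H H' B R E'' by unfold_locales
  interpret pBA: pulled_cell G C D P E "dfun_comp H F" "dfun_comp H' F'" "vtrans_hcomp B A" R E'' by unfold_locales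
  show ?case using 12 by (auto elim!: pull_setE simp: s t A.A.vsrc A.A.vtgt B.A.vsrc B.A.vtgt)
qed

subsection \<open>Reindexing along horizontal transformations\<close>

text \<open>
  Reindexing can be read off from any cell of the right shape, because such a cell is the lift.
\<close>

lemma (in fibration) re_of_cell [simp]:
  "\<lbrakk>h \<in> Hor E; fH P h = f; Cod (HCat E) h = e\<rbrakk> \<Longrightarrow> reO f e = Dom (HCat E) h"
  "\<lbrakk>\<sigma> \<in> Sq E; fS P \<sigma> = \<alpha>; rgt E \<sigma> = w\<rbrakk> \<Longrightarrow> reV \<alpha> w = lft E \<sigma>"
  using hlift_eqI[of h e f] slift_eqI[of \<sigma> w \<alpha>] by (simp_all add: reO_def reV_def)

locale pulled_htrans = B: htransf B G G' C D + P: fibration P E D for B G G' C D P and E :: "'u::universe dblcat"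
begin

sublocale S: pulled G' C D P E by unfold_locales
sublocale T: pulled G C D P E by unfold_locales

lemma pull_htrans_sel [simp]:
  "dsrc (pull_htrans B P) = pull G' P" "dtgt (pull_htrans B P) = pull G P"
  "\<lbrakk>x \<in> Ob C; e \<in> Ob E; fO G' x = fO P e\<rbrakk> \<Longrightarrow> fO (pull_htrans B P) (upair x e) = upair x (P.reO (hO B x) e)"
  "\<lbrakk>f \<in> Hor C; h \<in> Hor E; fH G' f = fH P h\<rbrakk> \<Longrightarrow> fH (pull_htrans B P) (upair f h) =
    upair f (hlift P (fH G f) (P.reO (hO B (Cod (HCat C) f)) (Cod (HCat E) h)))"
  "\<lbrakk>u \<in> Ver C; w \<in> Ver E; fV G' u = fV P w\<rbrakk> \<Longrightarrow> fV (pull_htrans B P) (upair u w) = upair u (P.reV (hV B u) w)"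
  "\<lbrakk>\<alpha> \<in> Sq C; \<sigma> \<in> Sq E; fS G' \<alpha> = fS P \<sigma>\<rbrakk> \<Longrightarrow> fS (pull_htrans B P) (upair \<alpha> \<sigma>) =
    upair \<alpha> (slift P (fS G \<alpha>) (P.reV (hV B (rgt C \<alpha>)) (rgt E \<sigma>)))"
  by (simp_all add: pull_htrans_def Let_def P.reO_def P.reV_def)

text \<open>
  On horizontal morphisms and squares the two composites in a naturality square of the
  transformation are equal, hence so are their lifts; this makes the boundaries match.
\<close>

lemma pull_htrans_over: "over (pull_proj G' P) (pull G' P) C (pull_htrans B P) (pull_proj G P) (pull G P)"
proof (rule overI[OF S.pull_fibration T.pull_fibration], goal_cases)
  case (11 z)
  then show ?case by (auto elim!: pull_setE simp: P.reV_vid)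
next
  case (12 w u)
  then show ?case by (auto elim!: pull_setE simp: P.reV_vcomp)
next
  case (13 z)
  then obtain f h where z: "z = upair f h" "f \<in> Hor C" "h \<in> Hor E" "fH G' f = fH P h" by (auto elim!: pull_setE)
  let ?e = "P.reO (hO B (Cod (HCat C) f)) (Cod (HCat E) h)"
  have "fO G' (Cod (HCat C) f) = fO P (Cod (HCat E) h)" using z by simp
  then have e: "?e \<in> Ob E" "fO P ?e = fO G (Cod (HCat C) f)" using z by simp_all
  have "P.reO (fH G f) ?e = P.reO (Cmp (HCat D) (hO B (Cod (HCat C) f)) (fH G f)) (Cod (HCat E) h)"
    using z by simp
  also have "\<dots> = P.reO (Cmp (HCat D) (fH G' f) (hO B (Dom (HCat C) f))) (Cod (HCat E) h)"
    by (simp only: B.natural(1)[OF z(2)])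
  also have "\<dots> = P.reO (hO B (Dom (HCat C) f)) (Dom (HCat E) h)"
    using z by simp
  finally have "Dom (HCat E) (hlift P (fH G f) ?e) = P.reO (hO B (Dom (HCat C) f)) (Dom (HCat E) h)"
    by (simp add: P.reO_def)
  then show ?case using z e by simp
next
  case (15 z)
  then obtain \<alpha> \<sigma> where z: "z = upair \<alpha> \<sigma>" "\<alpha> \<in> Sq C" "\<sigma> \<in> Sq E" "fS G' \<alpha> = fS P \<sigma>" by (auto elim!: pull_setE)
  let ?w = "P.reV (hV B (rgt C \<alpha>)) (rgt E \<sigma>)"
  have "fV G' (rgt C \<alpha>) = fV P (rgt E \<sigma>)" using z by simp
  then have w: "?w \<in> Ver E" "fV P ?w = fV G (rgt C \<alpha>)" using z by simp_all
  have "P.reV (fS G \<alpha>) ?w = P.reV (Cmp (SHCat D) (hV B (rgt C \<alpha>)) (fS G \<alpha>)) (rgt E \<sigma>)"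
    using z by simp
  also have "\<dots> = P.reV (Cmp (SHCat D) (fS G' \<alpha>) (hV B (lft C \<alpha>))) (rgt E \<sigma>)"
    by (simp only: B.natural(2)[OF z(2)])
  also have "\<dots> = P.reV (hV B (lft C \<alpha>)) (lft E \<sigma>)"
    using z by simp
  finally have "lft E (slift P (fS G \<alpha>) ?w) = P.reV (hV B (lft C \<alpha>)) (lft E \<sigma>)"
    by (simp add: P.reV_def)
  then show ?case using z w by simp
qed (auto elim!: pull_setE, auto simp: pull_htrans_def Let_def)

end

subsection \<open>Iterated pullback\<close>

text \<open>
  In an iterated pullback the middle component is the image of the first one, and dropping it is
  an isomorphism.
\<close>

locale pulled_twice = G: dfunctor G C D + H: dfunctor H D B + P: fibration P E B
  for G C D H B P and E :: "'u::universe dblcat"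
begin

sublocale HP: pulled H D B P E by unfold_locales
sublocale K: fibration "pull_proj H P" "pull H P" D by (rule HP.pull_fibration)
sublocale S: pulled G C D "pull_proj H P" "pull H P" by unfold_locales
sublocale HG: dfunctor "dfun_comp H G" C B by (rule dfunctor_comp[OF H.dfunctor_axioms G.dfunctor_axioms])
sublocale T: pulled "dfun_comp H G" C B P E by unfold_locales

lemma pull_assoc_sel [simp]:
  "dsrc (pull_assoc G H P) = pull G (pull_proj H P)" "dtgt (pull_assoc G H P) = pull (dfun_comp H G) P"
  "\<lbrakk>x \<in> Ob C; e \<in> Ob E; fO H (fO G x) = fO P e; y = fO G x\<rbrakk> \<Longrightarrow> fO (pull_assoc G H P) (upair x (upair y e)) = upair x e"
  "\<lbrakk>u \<in> Ver C; w \<in> Ver E; fV H (fV G u) = fV P w; v = fV G u\<rbrakk> \<Longrightarrow> fV (pull_assoc G H P) (upair u (upair v w)) = upair u w"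
  by (auto simp: pull_assoc_def Let_def)

lemma pull_assoc_over: "over (pull_proj G (pull_proj H P)) (pull G (pull_proj H P)) C (pull_assoc G H P)
    (pull_proj (dfun_comp H G) P) (pull (dfun_comp H G) P)"
  by (rule overI[OF S.pull_fibration T.pull_fibration])
    (auto elim!: pull_setE simp: pull_assoc_def Let_def)

lemma pull_assoc_iso: "iso_arr (One (DFib C)) (pull_proj G (pull_proj H P), pull_assoc G H P, pull_proj (dfun_comp H G) P)"
proof (rule over_iso[OF pull_assoc_over])
  show "bij_betw (fO (pull_assoc G H P)) (Ob (pull G (pull_proj H P))) (Ob (pull (dfun_comp H G) P))"
    by (rule bij_betw_byWitness[where f' = "\<lambda>z. upair (ufst z) (upair (fO G (ufst z)) (usnd z))"])
      (auto elim!: pull_setE)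
  show "bij_betw (fV (pull_assoc G H P)) (Ver (pull G (pull_proj H P))) (Ver (pull (dfun_comp H G) P))"
    by (rule bij_betw_byWitness[where f' = "\<lambda>z. upair (ufst z) (upair (fV G (ufst z)) (usnd z))"])
      (auto elim!: pull_setE)
qed

end

locale pulled_id = P: fibration P E C for P C and E :: "'u::universe dblcat"
begin

sublocale I: dfunctor "dfun_id C" C C by (rule dfunctor_id[OF P.dc_cod])
sublocale T: pulled "dfun_id C" C C P E by unfold_locales

lemma pull_unit_sel [simp]:
  "dsrc (pull_unit C P) = E" "dtgt (pull_unit C P) = pull (dfun_id C) P"
  "e \<in> Ob E \<Longrightarrow> fO (pull_unit C P) e = upair (fO P e) e" "w \<in> Ver E \<Longrightarrow> fV (pull_unit C P) w = upair (fV P w) w"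
  by (auto simp: pull_unit_def Let_def)

lemma pull_unit_over: "over P E C (pull_unit C P) (pull_proj (dfun_id C) P) (pull (dfun_id C) P)"
  by (rule overI[OF P.fibration_axioms T.pull_fibration]) (auto simp: pull_unit_def Let_def)

lemma pull_unit_iso: "iso_arr (One (DFib C)) (P, pull_unit C P, pull_proj (dfun_id C) P)"
proof (rule over_iso[OF pull_unit_over])
  show "bij_betw (fO (pull_unit C P)) (Ob E) (Ob (pull (dfun_id C) P))"
    by (rule bij_betw_byWitness[where f' = usnd]) (auto elim!: pull_setE)
  show "bij_betw (fV (pull_unit C P)) (Ver E) (Ver (pull (dfun_id C) P))"
    by (rule bij_betw_byWitness[where f' = usnd]) (auto elim!: pull_setE)
qed

end

subsection \<open>Pullback as a pseudo-functor\<close>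

lemma coop_DblCat_h [simp]:
  "Obj (One (coop DblCat_h)) = Collect double_category" "Arr (One (coop DblCat_h)) = Collect double_functor"
  "Dom (One (coop DblCat_h)) = dtgt" "Cod (One (coop DblCat_h)) = dsrc" "Ident (One (coop DblCat_h)) = dfun_id"
  "Cmp (One (coop DblCat_h)) g f = dfun_comp f g"
  "Arr (Vert (coop DblCat_h)) = Collect horizontal_transformation" "Dom (Vert (coop DblCat_h)) = htgt"
  "Cod (Vert (coop DblCat_h)) = hsrc" "Ident (Vert (coop DblCat_h)) = htrans_id" "Cmp (Vert (coop DblCat_h)) c b = htrans_vcomp b c"
  "Arr (Horiz (coop DblCat_h)) = Collect horizontal_transformation" "Dom (Horiz (coop DblCat_h)) b = dtgt (hsrc b)"
  "Cod (Horiz (coop DblCat_h)) b = dsrc (hsrc b)" "Cmp (Horiz (coop DblCat_h)) c b = htrans_hcomp b c"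
  by (simp_all add: coop_def opcat_def)

lemma twofunctor_comp: "twofunctor K L F \<Longrightarrow> twofunctor L M G \<Longrightarrow> twofunctor K M (twofun_comp G F)"
  by (auto simp: twofunctor_def is_functor_def twofun_comp_def Pi_def)

lemma twofunctor_id: "twofunctor K K twofun_id"
  by (auto simp: twofunctor_def is_functor_def twofun_id_def)

lemma (in over) re_natural:
  "\<lbrakk>e \<in> Ob E; f \<in> Hor C; Cod (HCat C) f = fO P e\<rbrakk> \<Longrightarrow> fO F (P.reO f e) = Q.reO f (fO F e)"
  "\<lbrakk>w \<in> Ver E; \<alpha> \<in> Sq C; rgt C \<alpha> = fV P w\<rbrakk> \<Longrightarrow> fV F (P.reV \<alpha> w) = Q.reV \<alpha> (fV F w)"
  by (simp_all add: P.reO_def Q.reO_def P.reV_def Q.reV_def flip: on_hlift on_slift)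

lemma (in over_cell) re_cell:
  "\<lbrakk>e \<in> Ob E; f \<in> Hor C; Cod (HCat C) f = fO P e\<rbrakk> \<Longrightarrow>
    F.Q.reV (Ident (SVCat C) f) (vO A e) = vO A (F.P.reO f e)"
  using F.Q.re_of_cell(2)[of "vH A (hlift P f e)" "Ident (SVCat C) f" "vO A e"] by (simp add: F.P.reO_def)

lemma pull_proj_src [simp]: "dsrc (pull_proj G P) = pull G P"
  by (simp add: pull_proj_def)

lemma two_natural_pull_htrans:
  assumes B: "htransf B G G' C D"
  shows "two_natural (DFib D) (DFib C) (ps1 DFib_pf G') (ps1 DFib_pf G) (ps2 DFib_pf B)"
proof -
  interpret B: htransf B G G' C D by (rule B)
  show ?thesis
  proof (rule two_natural_into_DFibI[OF twocategory_DFib twofunctor_pull twofunctor_pull, where n = "pull_htrans B"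
        and ES = "pull G'" and ET = "pull G"], goal_cases)
    case 1 show ?case by unfold_locales
  next
    case 2 show ?case by unfold_locales
  next
    case (3 P) show ?case by (simp add: pull_proj_def)
  next
    case (4 P) show ?case by (simp add: pull_proj_def)
  next
    case (5 P) show ?case by simp
  next
    case (6 P)
    then obtain E where "fibration P E D" by auto
    then interpret P: fibration P E D .
    interpret pulled_htrans B G G' C D P E by unfold_locales
    show ?case by (simp add: pull_htrans_over)
  next
    case (7 f a)
    obtain P F Q where f: "f = (P, F, Q)" by (cases f)
    have "over P (dsrc P) D F Q (dsrc Q)" using 7 by (simp add: f)
    then obtain E E' where "over P E D F Q E'" by blast
    then interpret over P E D F Q E' .
    interpret p: pulled_htrans B G G' C D P E by unfold_locales
    interpret q: pulled_htrans B G G' C D Q E' by unfold_locales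
    interpret G: pulled_over G C D P E F Q E' by unfold_locales
    interpret G': pulled_over G' C D P E F Q E' by unfold_locales
    show ?case using 7 by (auto elim!: pull_setE simp: f re_natural)
  next
    case (8 f a)
    obtain P F Q where f: "f = (P, F, Q)" by (cases f)
    have "over P (dsrc P) D F Q (dsrc Q)" using 8 by (simp add: f)
    then obtain E E' where "over P E D F Q E'" by blast
    then interpret over P E D F Q E' .
    interpret p: pulled_htrans B G G' C D P E by unfold_locales
    interpret q: pulled_htrans B G G' C D Q E' by unfold_locales
    interpret G: pulled_over G C D P E F Q E' by unfold_locales
    interpret G': pulled_over G' C D P E F Q E' by unfold_locales
    show ?case using 8 by (auto elim!: pull_setE simp: f re_natural)
  next
    case (9 \<sigma> a)
    obtain P A Q where s: "\<sigma> = (P, A, Q)" by (cases \<sigma>)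
    have "over_cell P (dsrc P) D (vsrc A) (vtgt A) A Q (dsrc Q)" using 9 by (simp add: s)
    then obtain E F F' E' where "over_cell P E D F F' A Q E'" by blast
    then interpret over_cell P E D F F' A Q E' .
    interpret p: pulled_htrans B G G' C D P E by unfold_locales
    interpret q: pulled_htrans B G G' C D Q E' by unfold_locales
    interpret G: pulled_cell G C D P E F F' A Q E' by unfold_locales
    interpret G': pulled_cell G' C D P E F F' A Q E' by unfold_locales
    show ?case using 9 by (auto elim!: pull_setE simp: s re_cell)
  qed
qed

lemma pull_htrans_id:
  assumes G: "dfunctor G C D" and P: "fibration P E D"
  shows "pull_htrans (htrans_id G) P = dfun_id (pull G P)"
proof -
  interpret I: htransf "htrans_id G" G G C D by (rule htransf_id[OF G])
  interpret P: fibration P E D by (rule P)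
  interpret pulled_htrans "htrans_id G" G G C D P E by unfold_locales
  show ?thesis
    by (rule over_eqI[OF pull_htrans_over over_id[OF S.pull_fibration]]) (auto elim!: pull_setE)
qed

lemma pull_htrans_vcomp:
  assumes B: "htransf B G' G'' C D" and A: "htransf A G G' C D" and P: "fibration P E D"
  shows "pull_htrans (htrans_vcomp B A) P = dfun_comp (pull_htrans A P) (pull_htrans B P)"
proof -
  interpret B: htransf B G' G'' C D by (rule B)
  interpret A: htransf A G G' C D by (rule A)
  interpret BA: htransf "htrans_vcomp B A" G G'' C D by (rule htransf_vcomp[OF B A])
  interpret P: fibration P E D by (rule P)
  interpret pB: pulled_htrans B G' G'' C D P E by unfold_locales
  interpret pA: pulled_htrans A G G' C D P E by unfold_locales
  interpret pBA: pulled_htrans "htrans_vcomp B A" G G'' C D P E by unfold_locales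
  show ?thesis
    by (rule over_eqI[OF pBA.pull_htrans_over over_comp[OF pB.pull_htrans_over pA.pull_htrans_over]])
      (auto elim!: pull_setE simp: A.G.dsrc A.G.dtgt)
qed

lemma (in pulled) re_pull:
  "\<lbrakk>y \<in> Ob C; e \<in> Ob E; fO G y = fO P e; f \<in> Hor C; Cod (HCat C) f = y\<rbrakk> \<Longrightarrow>
    fibration.reO (pull_proj G P) (pull G P) f (upair y e) = upair (Dom (HCat C) f) (P.reO (fH G f) e)"
  "\<lbrakk>u \<in> Ver C; w \<in> Ver E; fV G u = fV P w; \<alpha> \<in> Sq C; rgt C \<alpha> = u\<rbrakk> \<Longrightarrow>
    fibration.reV (pull_proj G P) (pull G P) \<alpha> (upair u w) = upair (lft C \<alpha>) (P.reV (fS G \<alpha>) w)"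
proof -
  interpret R: fibration "pull_proj G P" "pull G P" C by (rule pull_fibration)
  assume a: "y \<in> Ob C" "e \<in> Ob E" "fO G y = fO P e" "f \<in> Hor C" "Cod (HCat C) f = y"
  have "Cod (HCat D) (fH G f) = fO P e" using a by simp
  then show "R.reO f (upair y e) = upair (Dom (HCat C) f) (P.reO (fH G f) e)"
    using R.re_of_cell(1)[of "upair f (hlift P (fH G f) e)" f "upair y e"] a by (simp add: P.reO_def del: G.on_bounds)
next
  interpret R: fibration "pull_proj G P" "pull G P" C by (rule pull_fibration)
  assume a: "u \<in> Ver C" "w \<in> Ver E" "fV G u = fV P w" "\<alpha> \<in> Sq C" "rgt C \<alpha> = u"
  have "rgt D (fS G \<alpha>) = fV P w" using a by simp
  then show "R.reV \<alpha> (upair u w) = upair (lft C \<alpha>) (P.reV (fS G \<alpha>) w)"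
    using R.re_of_cell(2)[of "upair \<alpha> (slift P (fS G \<alpha>) w)" \<alpha> "upair u w"] a by (simp add: P.reV_def del: G.on_bounds)
qed

lemma pull_assoc_natural:
  assumes B: "htransf B F F' L K" and A: "htransf A G G' M L" and P: "fibration P E K"
  shows "dfun_comp (pull_assoc G F P) (dfun_comp (pull_htrans A (pull_proj F P))
      (pull_map G' (pull_proj F' P, pull_htrans B P, pull_proj F P))) =
    dfun_comp (pull_htrans (htrans_hcomp B A) P) (pull_assoc G' F' P)"
proof -
  interpret B: htransf B F F' L K by (rule B)
  interpret A: htransf A G G' M L by (rule A)
  interpret BA: htransf "htrans_hcomp B A" "dfun_comp F G" "dfun_comp F' G'" M K by (rule htransf_hcomp[OF B A])
  interpret P: fibration P E K by (rule P)
  interpret pB: pulled_htrans B F F' L K P E by unfold_locales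
  interpret FP: fibration "pull_proj F P" "pull F P" L by (rule pB.T.pull_fibration)
  interpret F'P: fibration "pull_proj F' P" "pull F' P" L by (rule pB.S.pull_fibration)
  interpret o: over "pull_proj F' P" "pull F' P" L "pull_htrans B P" "pull_proj F P" "pull F P" by (rule pB.pull_htrans_over)
  interpret pA: pulled_htrans A G G' M L "pull_proj F P" "pull F P" by unfold_locales
  interpret m: pulled_over G' M L "pull_proj F' P" "pull F' P" "pull_htrans B P" "pull_proj F P" "pull F P" by unfold_locales
  interpret t: pulled_twice G M L F K P E by unfold_locales
  interpret t': pulled_twice G' M L F' K P E by unfold_locales
  interpret pBA: pulled_htrans "htrans_hcomp B A" "dfun_comp F G" "dfun_comp F' G'" M K P E by unfold_locales
  show ?thesis
    by (rule over_eqI[OF over_comp[OF over_comp[OF m.pull_map_over pA.pull_htrans_over] t.pull_assoc_over]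
          over_comp[OF t'.pull_assoc_over pBA.pull_htrans_over]])
      (auto elim!: pull_setE simp: pB.T.re_pull)
qed

lemma pull_assoc_assoc:
  assumes H: "dfunctor H N M" and G: "dfunctor G M L" and F: "dfunctor F L K" and P: "fibration P E K"
  shows "dfun_comp (pull_assoc (dfun_comp G H) F P) (pull_assoc H G (pull_proj F P)) =
    dfun_comp (pull_assoc H (dfun_comp F G) P) (pull_map H (pull_proj G (pull_proj F P), pull_assoc G F P, pull_proj (dfun_comp F G) P))"
proof -
  interpret F: dfunctor F L K by (rule F)
  interpret G: dfunctor G M L by (rule G)
  interpret H: dfunctor H N M by (rule H)
  interpret P: fibration P E K by (rule P)
  interpret FG: pulled_twice G M L F K P E by unfold_locales
  interpret GH: pulled_twice H N M G L "pull_proj F P" "pull F P" by unfold_locales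
  interpret X: pulled_twice "dfun_comp G H" N L F K P E by unfold_locales
  interpret Y: pulled_twice H N M "dfun_comp F G" K P E by unfold_locales
  interpret o: over "pull_proj G (pull_proj F P)" "pull G (pull_proj F P)" M "pull_assoc G F P"
    "pull_proj (dfun_comp F G) P" "pull (dfun_comp F G) P" by (rule FG.pull_assoc_over)
  interpret m: pulled_over H N M "pull_proj G (pull_proj F P)" "pull G (pull_proj F P)" "pull_assoc G F P"
    "pull_proj (dfun_comp F G) P" "pull (dfun_comp F G) P" by unfold_locales
  note eq = dfun_comp_assoc[OF F G H]
  show ?thesis
    by (rule over_eqI[OF over_comp[OF GH.pull_assoc_over X.pull_assoc_over]
          over_comp[OF m.pull_map_over Y.pull_assoc_over, folded eq]])
      (auto elim!: pull_setE)
qed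

lemma pull_assoc_unit:
  assumes F: "dfunctor F L K" and P: "fibration P E K"
  shows "dfun_comp (pull_assoc F (dfun_id K) P) (pull_map F (P, pull_unit K P, pull_proj (dfun_id K) P)) = dfun_id (pull F P)"
    "dfun_comp (pull_assoc (dfun_id L) F P) (pull_unit L (pull_proj F P)) = dfun_id (pull F P)"
proof -
  interpret F: dfunctor F L K by (rule F)
  interpret P: fibration P E K by (rule P)
  interpret p: pulled F L K P E by unfold_locales
  interpret FP: fibration "pull_proj F P" "pull F P" L by (rule p.pull_fibration)
  interpret i: pulled_id P K E by unfold_locales
  interpret o: over P E K "pull_unit K P" "pull_proj (dfun_id K) P" "pull (dfun_id K) P" by (rule i.pull_unit_over)
  interpret m: pulled_over F L K P E "pull_unit K P" "pull_proj (dfun_id K) P" "pull (dfun_id K) P" by unfold_locales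
  interpret t: pulled_twice F L K "dfun_id K" K P E by unfold_locales
  interpret j: pulled_id "pull_proj F P" L "pull F P" by unfold_locales
  interpret t': pulled_twice "dfun_id L" L L F K P E by unfold_locales
  show "dfun_comp (pull_assoc F (dfun_id K) P) (pull_map F (P, pull_unit K P, pull_proj (dfun_id K) P)) = dfun_id (pull F P)"
    by (rule over_eqI[OF over_comp[OF m.pull_map_over t.pull_assoc_over, unfolded dfun_comp_id_left[OF F]] over_id[OF p.pull_fibration]])
      (auto elim!: pull_setE)
  show "dfun_comp (pull_assoc (dfun_id L) F P) (pull_unit L (pull_proj F P)) = dfun_id (pull F P)"
    by (rule over_eqI[OF over_comp[OF j.pull_unit_over t'.pull_assoc_over, unfolded dfun_comp_id_right[OF F]] over_id[OF p.pull_fibration]])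
      (auto elim!: pull_setE)
qed

lemma two_natural_iso_pull_assoc:
  assumes H: "dfunctor H D B" and G: "dfunctor G C D"
  shows "two_natural_iso (DFib B) (DFib C) (twofun_comp (ps1 DFib_pf G) (ps1 DFib_pf H)) (ps1 DFib_pf (dfun_comp H G)) (ps_comp DFib_pf G H)"
proof -
  interpret G: dfunctor G C D by (rule G)
  interpret H: dfunctor H D B by (rule H)
  note T = twofunctor_pull[OF dfunctor_comp[OF H G]] and S = twofunctor_comp[OF twofunctor_pull[OF H] twofunctor_pull[OF G]]
  have "two_natural (DFib B) (DFib C) (twofun_comp (ps1 DFib_pf G) (ps1 DFib_pf H)) (ps1 DFib_pf (dfun_comp H G)) (ps_comp DFib_pf G H)"
  proof (rule two_natural_into_DFibI[OF twocategory_DFib S T, where n = "pull_assoc G H"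
        and ES = "\<lambda>P. pull G (pull_proj H P)" and ET = "pull (dfun_comp H G)"], goal_cases)
    case (1 P) show ?case by (simp add: pull_proj_def twofun_comp_def)
  next
    case (2 P) show ?case by (simp add: pull_proj_def)
  next
    case (3 P) show ?case by (simp add: twofun_comp_def)
  next
    case (4 P)
    then obtain E where "fibration P E B" by auto
    then interpret P: fibration P E B .
    interpret pulled_twice G C D H B P E by unfold_locales
    show ?case by (simp add: twofun_comp_def pull_assoc_over)
  next
    case (5 f a)
    obtain P F Q where f: "f = (P, F, Q)" by (cases f)
    have "over P (dsrc P) B F Q (dsrc Q)" using 5 by (simp add: f)
    then obtain E E' where "over P E B F Q E'" by blast
    then interpret over P E B F Q E' .
    interpret p: pulled_twice G C D H B P E by unfold_locales
    interpret q: pulled_twice G C D H B Q E' by unfold_locales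
    interpret m: pulled_over H D B P E F Q E' by unfold_locales
    interpret o: over "pull_proj H P" "pull H P" D "pull_map H (P, F, Q)" "pull_proj H Q" "pull H Q" by (rule m.pull_map_over)
    interpret mm: pulled_over G C D "pull_proj H P" "pull H P" "pull_map H (P, F, Q)" "pull_proj H Q" "pull H Q" by unfold_locales
    interpret n: pulled_over "dfun_comp H G" C B P E F Q E' by unfold_locales
    show ?case using 5 by (auto elim!: pull_setE simp: f twofun_comp_def)
  next
    case (6 f a)
    obtain P F Q where f: "f = (P, F, Q)" by (cases f)
    have "over P (dsrc P) B F Q (dsrc Q)" using 6 by (simp add: f)
    then obtain E E' where "over P E B F Q E'" by blast
    then interpret over P E B F Q E' .
    interpret p: pulled_twice G C D H B P E by unfold_locales
    interpret q: pulled_twice G C D H B Q E' by unfold_locales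
    interpret m: pulled_over H D B P E F Q E' by unfold_locales
    interpret o: over "pull_proj H P" "pull H P" D "pull_map H (P, F, Q)" "pull_proj H Q" "pull H Q" by (rule m.pull_map_over)
    interpret mm: pulled_over G C D "pull_proj H P" "pull H P" "pull_map H (P, F, Q)" "pull_proj H Q" "pull H Q" by unfold_locales
    interpret n: pulled_over "dfun_comp H G" C B P E F Q E' by unfold_locales
    show ?case using 6 by (auto elim!: pull_setE simp: f twofun_comp_def)
  next
    case (7 \<sigma> a)
    obtain P A Q where s: "\<sigma> = (P, A, Q)" by (cases \<sigma>)
    have "over_cell P (dsrc P) B (vsrc A) (vtgt A) A Q (dsrc Q)" using 7 by (simp add: s)
    then obtain E F F' E' where "over_cell P E B F F' A Q E'" by blast
    then interpret over_cell P E B F F' A Q E' .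
    interpret p: pulled_twice G C D H B P E by unfold_locales
    interpret q: pulled_twice G C D H B Q E' by unfold_locales
    interpret m: pulled_cell H D B P E F F' A Q E' by unfold_locales
    interpret o: over_cell "pull_proj H P" "pull H P" D "pull_map H (P, F, Q)" "pull_map H (P, F', Q)" "pull_vtrans H (P, A, Q)"
      "pull_proj H Q" "pull H Q" by (rule m.pull_vtrans_over)
    interpret mm: pulled_cell G C D "pull_proj H P" "pull H P" "pull_map H (P, F, Q)" "pull_map H (P, F', Q)" "pull_vtrans H (P, A, Q)"
      "pull_proj H Q" "pull H Q" by unfold_locales
    interpret n: pulled_cell "dfun_comp H G" C B P E F F' A Q E' by unfold_locales
    show ?case using 7 by (auto elim!: pull_setE simp: s twofun_comp_def)
  qed
  moreover have "iso_arr (One (DFib C)) (ps_comp DFib_pf G H P)" if "P \<in> Cells0 (DFib B)" for P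
  proof -
    obtain E where "fibration P E B" using \<open>P \<in> Cells0 (DFib B)\<close> by auto
    then interpret P: fibration P E B .
    interpret pulled_twice G C D H B P E by unfold_locales
    show ?thesis using pull_assoc_iso by simp
  qed
  ultimately show ?thesis by (simp add: two_natural_iso_def)
qed

lemma two_natural_iso_pull_unit:
  assumes C: "double_category C"
  shows "two_natural_iso (DFib C) (DFib C) twofun_id (ps1 DFib_pf (dfun_id C)) (ps_unit DFib_pf C)"
proof -
  interpret I: dfunctor "dfun_id C" C C by (rule dfunctor_id[OF C])
  note T = twofunctor_pull[OF dfunctor_id[OF C]]
  have "two_natural (DFib C) (DFib C) twofun_id (ps1 DFib_pf (dfun_id C)) (ps_unit DFib_pf C)"
  proof (rule two_natural_into_DFibI[OF twocategory_DFib twofunctor_id T, where n = "pull_unit C"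
        and ES = dsrc and ET = "pull (dfun_id C)"], goal_cases)
    case (1 P) show ?case by (simp add: twofun_id_def)
  next
    case (2 P) show ?case by (simp add: pull_proj_def)
  next
    case (3 P) show ?case by (simp add: twofun_id_def)
  next
    case (4 P)
    then obtain E where E: "fibration P E C" "dsrc P = E" by (auto simp: fibration_iff)
    then interpret pulled_id P C E by (simp add: pulled_id_def)
    show ?case by (simp add: twofun_id_def pull_unit_over)
  next
    case (5 f a)
    obtain P F Q where f: "f = (P, F, Q)" by (cases f)
    have "over P (dsrc P) C F Q (dsrc Q)" using 5 by (simp add: f)
    then obtain E E' where "over P E C F Q E'" by blast
    then interpret over P E C F Q E' .
    interpret p: pulled_id P C E by unfold_locales
    interpret q: pulled_id Q C E' by unfold_locales
    interpret m: pulled_over "dfun_id C" C C P E F Q E' by unfold_locales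
    show ?case using 5 by (auto simp: f twofun_id_def)
  next
    case (6 f a)
    obtain P F Q where f: "f = (P, F, Q)" by (cases f)
    have "over P (dsrc P) C F Q (dsrc Q)" using 6 by (simp add: f)
    then obtain E E' where "over P E C F Q E'" by blast
    then interpret over P E C F Q E' .
    interpret p: pulled_id P C E by unfold_locales
    interpret q: pulled_id Q C E' by unfold_locales
    interpret m: pulled_over "dfun_id C" C C P E F Q E' by unfold_locales
    show ?case using 6 by (auto simp: f twofun_id_def)
  next
    case (7 \<sigma> a)
    obtain P A Q where s: "\<sigma> = (P, A, Q)" by (cases \<sigma>)
    have "over_cell P (dsrc P) C (vsrc A) (vtgt A) A Q (dsrc Q)" using 7 by (simp add: s)
    then obtain E F F' E' where "over_cell P E C F F' A Q E'" by blast
    then interpret over_cell P E C F F' A Q E' .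
    interpret p: pulled_id P C E by unfold_locales
    interpret q: pulled_id Q C E' by unfold_locales
    interpret m: pulled_cell "dfun_id C" C C P E F F' A Q E' by unfold_locales
    show ?case using 7 by (auto simp: s twofun_id_def)
  qed
  moreover have "iso_arr (One (DFib C)) (ps_unit DFib_pf C P)" if "P \<in> Cells0 (DFib C)" for P
  proof -
    obtain E where "fibration P E C" using \<open>P \<in> Cells0 (DFib C)\<close> by auto
    then interpret pulled_id P C E by (simp add: pulled_id_def)
    show ?thesis using pull_unit_iso by simp
  qed
  ultimately show ?thesis by (simp add: two_natural_iso_def)
qed

lemma pseudofunctor_DFib: "pseudofunctor (coop DblCat_h) DFib_pf"
proof (rule pseudofunctor.intro, goal_cases)
  case 1 show ?case by (rule twocategory_coop[OF twocategory_DblCat_h])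
next
  case 2 show ?case by (simp add: twocategory_DFib)
next
  case (3 f)
  then show ?case using twofunctor_pull[of f "dsrc f" "dtgt f"] by (simp add: dfunctor_iff)
next
  case (4 b)
  then show ?case using two_natural_pull_htrans[OF horizontal_transformation_htransf] by simp
next
  case (5 f k l P)
  then show ?case using pull_htrans_id[of f l k P "dsrc P"] by (simp add: dfunctor_iff)
next
  case (6 b k l c P)
  then show ?case
    using pull_htrans_vcomp[of b "hsrc b" "htgt b" l k c "hsrc c" P "dsrc P"] by (simp add: htransf_iff)
next
  case (7 f k l g m)
  then show ?case using two_natural_iso_pull_assoc[of f l k g m] by (simp add: dfunctor_iff)
next
  case (8 k)
  then show ?case using two_natural_iso_pull_unit[of k] by simp
next
  case (9 b k l c m P f f' g g')
  then show ?case
    using pull_assoc_natural[of b f' f l k c g' g m P "dsrc P"] by (simp add: htransf_iff)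
next
  case (10 f k l g m h n P)
  then show ?case
    using pull_assoc_assoc[of h n m g l f k P "dsrc P"] dfun_comp_assoc[of f l k g m h n] by (simp add: dfunctor_iff)
next
  case (11 f k l P)
  then show ?case
    using pull_assoc_unit(1)[of f l k P "dsrc P"] dfun_comp_id_left[of f l k] by (simp add: dfunctor_iff)
next
  case (12 f k l P)
  then show ?case
    using pull_assoc_unit(2)[of f l k P "dsrc P"] dfun_comp_id_right[of f l k] by (simp add: dfunctor_iff)
qed

section \<open>Precomposition of lax double presheaves\<close>

lemma Psh_pf_sel [simp]:
  "ps0 Psh_pf = Psh" "on0 (ps1 Psh_pf G) = psh_pre G" "on1 (ps1 Psh_pf G) = ptrans_pre G" "on2 (ps1 Psh_pf G) = pmod_pre G"
  "ps2 Psh_pf = psh_htrans" "ps_comp Psh_pf G H X = ptrans_id (dsrc G) (psh_pre G (psh_pre H X))" "ps_unit Psh_pf = ptrans_id"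
  by (simp_all add: Psh_pf_def)

context dfunctor
begin

lemma psh_pre_sel [simp]:
  "x \<in> Ob E \<Longrightarrow> pcat (psh_pre F X) x = pcat X (fO F x)" "f \<in> Hor E \<Longrightarrow> pfun (psh_pre F X) f = pfun X (fH F f)"
  "u \<in> Ver E \<Longrightarrow> pprof (psh_pre F X) u = pprof X (fV F u)" "\<alpha> \<in> Sq E \<Longrightarrow> psq (psh_pre F X) \<alpha> = psq X (fS F \<alpha>)"
  "\<lbrakk>u \<in> Ver E; u' \<in> Ver E; Cod (VCat E) u = Dom (VCat E) u'\<rbrakk> \<Longrightarrow> pmu (psh_pre F X) u u' = pmu X (fV F u) (fV F u')"
  by (simp_all add: psh_pre_def Let_def)

lemma vmul_pre [simp]:
  "\<lbrakk>u \<in> Ver E; u' \<in> Ver E; Cod (VCat E) u = Dom (VCat E) u'\<rbrakk> \<Longrightarrow> vmul E (psh_pre F X) u u' = vmul C X (fV F u) (fV F u')"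
  by (simp add: vmul_def fun_eq_iff)

lemma psh_pre_presheaf:
  assumes X: "lax_double_presheaf C X" shows "lax_double_presheaf E (psh_pre F X)"
proof -
  interpret X: lax_double_presheaf C X by (rule X)
  show ?thesis
  proof (rule lax_double_presheaf.intro, goal_cases)
    case 1 show ?case by (rule dc_dom)
  next
    case (8 x) then show ?case using X.pcat[of "fO F x"] by simp
  next
    case (9 f x y) then show ?case using X.pfun[of "fH F f" "fO F x" "fO F y"] by auto
  next
    case (10 u x x') then show ?case using X.pprof[of "fV F u" "fO F x" "fO F x'"] by auto
  next
    case (11 \<alpha> u v y y') then show ?case using X.psq[of "fS F \<alpha>" "fV F u" "fV F v" "fO F y" "fO F y'"] by auto
  next
    case (12 u x x' u' x'') then show ?case using X.pmu[of "fV F u" "fO F x" "fO F x'" "fV F u'" "fO F x''"] by auto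
  next
    case (13 f x y g z) then show ?case using X.pfun_Cmp[of "fH F f" "fO F x" "fO F y" "fH F g" "fO F z"] by auto
  next
    case (14 x) then show ?case using X.pfun_Ident[of "fO F x"] by simp
  next
    case (15 \<alpha> u v \<beta> w z z' a a' s)
    then show ?case using X.psq_Cmp[of "fS F \<alpha>" "fV F u" "fV F v" "fS F \<beta>" "fV F w" "fO F z" "fO F z'" a a' s] by auto
  next
    case (16 u x x' a a' s)
    then show ?case using X.psq_Ident[of "fV F u" "fO F x" "fO F x'" a a' s] by auto
  next
    case (17 \<alpha> u v \<alpha>' u' v' y y' y'' f f' f'' a a' a'' s s')
    have c: "\<alpha> \<in> Sq E" "\<alpha>' \<in> Sq E" "lower E \<alpha> = upper E \<alpha>'" "lft E \<alpha> = u" "rgt E \<alpha> = v" "lft E \<alpha>' = u'" "rgt E \<alpha>' = v'"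
      "u \<in> Ver E" "v \<in> Ver E" "u' \<in> Ver E" "v' \<in> Ver E" "Dom (VCat E) v = y" "Cod (VCat E) v = y'" "Dom (VCat E) v' = y'" "Cod (VCat E) v' = y''"
      using 17(1-5) E.dc_SH(1)[of \<alpha>] E.dc_SH(1)[of \<alpha>'] by auto
    have o: "y \<in> Ob E" "y' \<in> Ob E" "y'' \<in> Ob E" using E.dc_V(1,2)[OF c(9)] E.dc_V(1,2)[OF c(11)] c(12-15) by simp_all
    have "Cod (VCat E) u = Dom (VCat E) u'" using E.vert_composable(1)[OF c(1,2,3)] c(4-7) by simp
    then show ?case
      unfolding vmul_def[symmetric] using X.vmul_natural[of "fS F \<alpha>" "fS F \<alpha>'" a a' a'' s s'] 17(6-) c o
      by simp
  next
    case (18 u x x' u' x'' u'' x''' a a' a'' a''' s s' s'')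
    then have e: "x = Dom (VCat E) u" "x' = Cod (VCat E) u" "x'' = Cod (VCat E) u'" "x''' = Cod (VCat E) u''"
      "Dom (VCat E) u' = Cod (VCat E) u" "Dom (VCat E) u'' = Cod (VCat E) u'" and c: "u \<in> Ver E" "u' \<in> Ver E" "u'' \<in> Ver E" by simp_all
    have p: "a \<in> Obj (pcat X (Dom (VCat C) (fV F u)))" "a' \<in> Obj (pcat X (Dom (VCat C) (fV F u')))"
      "a'' \<in> Obj (pcat X (Dom (VCat C) (fV F u'')))" "a''' \<in> Obj (pcat X (Cod (VCat C) (fV F u'')))"
      "s \<in> pel (pprof X (fV F u)) a a'" "s' \<in> pel (pprof X (fV F u')) a' a''" "s'' \<in> pel (pprof X (fV F u'')) a'' a'''"
      using 18(4-)[unfolded e(1-4)] c by (simp_all add: e(5,6))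
    show ?case
      unfolding vmul_def[symmetric]
      using X.vmul_assoc[of "fV F u" "fV F u'" "fV F u''" a a' a'' a''' s s' s''] p c e(5,6)
      by (simp add: vmul_pre)
  next
    case (19 x) then show ?case using X.normal_pprof[of "fO F x"] by simp
  next
    case (20 f x y a b m)
    then have e: "x = Dom (HCat E) f" "y = Cod (HCat E) f" and f: "f \<in> Hor E" by simp_all
    show ?case
      using X.normal_psq[of "fH F f" "fO F (Dom (HCat E) f)" "fO F (Cod (HCat E) f)" a b m] 20(2-)[unfolded e] f
      by simp
  next
    case (21 u x x' a b a' m s)
    then have e: "x = Dom (VCat E) u" "x' = Cod (VCat E) u" and u: "u \<in> Ver E" by simp_all
    show ?case
      using X.normal_pmu_left[of "fV F u" "fO F (Dom (VCat E) u)" "fO F (Cod (VCat E) u)" a b a' m s] 21(2-)[unfolded e] u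
      by (simp add: e)
  next
    case (22 u x x' a a' b' s m)
    then have e: "x = Dom (VCat E) u" "x' = Cod (VCat E) u" and u: "u \<in> Ver E" by simp_all
    show ?case
      using X.normal_pmu_right[of "fV F u" "fO F (Dom (VCat E) u)" "fO F (Cod (VCat E) u)" a a' b' s m] 22(2-)[unfolded e] u
      by (simp add: e)
  qed (simp_all add: psh_pre_def Let_def)
qed

end

locale presheaf_pre = G: dfunctor G E C + F: ptransf C F X Y for G E C F X and Y :: "'u::universe psh"
begin

lemma ptrans_pre_sel [simp]:
  "psrc (ptrans_pre G F) = psh_pre G X" "ptgt (ptrans_pre G F) = psh_pre G Y"
  "x \<in> Ob E \<Longrightarrow> tfun (ptrans_pre G F) x = tfun F (fO G x)" "u \<in> Ver E \<Longrightarrow> tprof (ptrans_pre G F) u = tprof F (fV G u)"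
  by (simp_all add: ptrans_pre_def F.psrc F.ptgt)

lemma ptrans_pre: "ptransf E (ptrans_pre G F) (psh_pre G X) (psh_pre G Y)"
proof (rule ptransfI, goal_cases)
  case 1 show ?case by (rule G.psh_pre_presheaf) unfold_locales
next
  case 2 show ?case by (rule G.psh_pre_presheaf) unfold_locales
next
  case (7 x) then show ?case using F.tfun_functor[of "fO G x"] by simp
next
  case (8 u) then show ?case using F.tprof_nat[of "fV G u"] by (simp add: prof_nat_def prof_restrict_def)
next
  case (9 f b) then show ?case using F.tfun_hor(1)[of "fH G f" b] by simp
next
  case (10 f m) then show ?case using F.tfun_hor(2)[of "fH G f" m] by simp
next
  case (11 \<alpha> a a' s) then show ?case using F.tprof_psq[of "fS G \<alpha>" a a' s] by simp
next
  case (12 u u' a a' a'' s s') then show ?case using F.tprof_vmul[of "fV G u" "fV G u'" a a' a'' s s'] by simp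
qed (auto, simp_all add: ptrans_pre_def)

end

locale presheaf_mod_pre = G: dfunctor G E C + A: pmodf C A F F' X Y for G E C A F F' X and Y :: "'u::universe psh"
begin

sublocale S: presheaf_pre G E C F X Y by unfold_locales
sublocale T: presheaf_pre G E C F' X Y by unfold_locales

lemma pmod_pre_sel [simp]:
  "msrc (pmod_pre G A) = ptrans_pre G F" "mtgt (pmod_pre G A) = ptrans_pre G F'"
  "x \<in> Ob E \<Longrightarrow> mcomp (pmod_pre G A) x = mcomp A (fO G x)"
  by (simp_all add: pmod_pre_def A.msrc A.mtgt)

lemma pmod_pre: "pmodf E (pmod_pre G A) (ptrans_pre G F) (ptrans_pre G F') (psh_pre G X) (psh_pre G Y)"
proof (rule pmodfI[OF S.ptrans_pre T.ptrans_pre], goal_cases)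
  case 3
  have "mcomp A (fO G x) \<in> (\<Pi>\<^sub>E a\<in>Obj (pcat X (fO G x)). Hom (pcat Y (fO G x)) (fo (tfun F (fO G x)) a) (fo (tfun F' (fO G x)) a))"
    if "x \<in> Ob E" for x using A.mcomp_in that by (auto simp: PiE_def Pi_def)
  then show ?case by (simp add: PiE_iff) (simp add: pmod_pre_def)
next
  case (4 f b) then show ?case by (simp add: A.mcomp_hor)
next
  case (5 u a a' s) then show ?case by (simp add: A.mcomp_ver)
qed simp_all

end

lemma psh_pre_comp:
  assumes "dfunctor H D B" "dfunctor G C D"
  shows "psh_pre (dfun_comp H G) X = psh_pre G (psh_pre H X)" "ptrans_pre (dfun_comp H G) F = ptrans_pre G (ptrans_pre H F)"
    "pmod_pre (dfun_comp H G) A = pmod_pre G (pmod_pre H A)"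
proof -
  interpret H: dfunctor H D B by (rule assms(1))
  interpret G: dfunctor G C D by (rule assms(2))
  show o: "psh_pre (dfun_comp H G) X = psh_pre G (psh_pre H X)" for X
    by (auto simp: psh_pre_def Let_def intro!: restrict_ext)
  show m: "ptrans_pre (dfun_comp H G) F = ptrans_pre G (ptrans_pre H F)" for F
    by (auto simp: ptrans_pre_def o intro!: restrict_ext)
  show "pmod_pre (dfun_comp H G) A = pmod_pre G (pmod_pre H A)"
    by (auto simp: pmod_pre_def m intro!: restrict_ext)
qed

lemma psh_pre_id:
  assumes X: "lax_double_presheaf C X" shows "psh_pre (dfun_id C) X = X"
proof -
  interpret X: lax_double_presheaf C X by (rule X)
  have "(\<lambda>x\<in>Ob C. pcat X (fO (dfun_id C) x)) = pcat X"
    by (rule extensionalityI[of _ "Ob C"]) (simp_all add: X.pcat_ext)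
  moreover have "(\<lambda>f\<in>Hor C. pfun X (fH (dfun_id C) f)) = pfun X"
    by (rule extensionalityI[of _ "Hor C"]) (simp_all add: X.pfun_ext)
  moreover have "(\<lambda>u\<in>Ver C. pprof X (fV (dfun_id C) u)) = pprof X"
    by (rule extensionalityI[of _ "Ver C"]) (simp_all add: X.pprof_ext)
  moreover have "(\<lambda>\<alpha>\<in>Sq C. psq X (fS (dfun_id C) \<alpha>)) = psq X"
    by (rule extensionalityI[of _ "Sq C"]) (simp_all add: X.psq_ext)
  moreover have "(\<lambda>u'\<in>{u' \<in> Ver C. Dom (VCat C) u' = Cod (VCat C) u}. pmu X (fV (dfun_id C) u) (fV (dfun_id C) u')) = pmu X u"
    if "u \<in> Ver C" for u
    by (rule extensionalityI[of _ "{u' \<in> Ver C. Dom (VCat C) u' = Cod (VCat C) u}"]) (simp_all add: X.pmu_ext2 that)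
  then have "(\<lambda>u\<in>Ver C. \<lambda>u'\<in>{u' \<in> Ver C. Dom (VCat C) u' = Cod (VCat C) u}. pmu X (fV (dfun_id C) u) (fV (dfun_id C) u')) = pmu X"
    by (rule_tac extensionalityI[of _ "Ver C"]) (simp_all add: X.pmu_ext)
  ultimately show ?thesis by (simp add: psh_pre_def Let_def)
qed

lemma ptrans_pre_id:
  assumes F: "ptransf C F X Y" shows "ptrans_pre (dfun_id C) F = F"
proof -
  interpret F: ptransf C F X Y by (rule F)
  interpret I: dfunctor "dfun_id C" C C by (rule dfunctor_id[OF F.X.base])
  interpret presheaf_pre "dfun_id C" C C F X Y by unfold_locales
  note e = psh_pre_id[OF F.X.lax_double_presheaf_axioms] psh_pre_id[OF F.Y.lax_double_presheaf_axioms]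
  show ?thesis by (rule ptrans_eqI[OF ptrans_pre[unfolded e] F]) simp_all
qed

lemma pmod_pre_id:
  assumes A: "pmodf C A F F' X Y" shows "pmod_pre (dfun_id C) A = A"
proof -
  interpret A: pmodf C A F F' X Y by (rule A)
  interpret I: dfunctor "dfun_id C" C C by (rule dfunctor_id[OF A.F.X.base])
  interpret presheaf_mod_pre "dfun_id C" C C A F F' X Y by unfold_locales
  note e = psh_pre_id[OF A.F.X.lax_double_presheaf_axioms] psh_pre_id[OF A.F.Y.lax_double_presheaf_axioms]
    ptrans_pre_id[OF A.F.ptransf_axioms] ptrans_pre_id[OF A.F'.ptransf_axioms]
  show ?thesis by (rule pmod_eqI[OF pmod_pre[unfolded e] A]) simp_all
qed

lemma ptrans_pre_ops:
  assumes G: "dfunctor G C D"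
  shows "lax_double_presheaf D X \<Longrightarrow> ptrans_pre G (ptrans_id D X) = ptrans_id C (psh_pre G X)"
    "\<lbrakk>ptransf D H Y Z; ptransf D F X Y\<rbrakk> \<Longrightarrow> ptrans_pre G (ptrans_comp D H F) = ptrans_comp C (ptrans_pre G H) (ptrans_pre G F)"
proof -
  interpret G: dfunctor G C D by (rule G)
  show "ptrans_pre G (ptrans_id D X) = ptrans_id C (psh_pre G X)" if X: "lax_double_presheaf D X"
  proof -
    interpret X: lax_double_presheaf D X by (rule X)
    interpret F: ptransf D "ptrans_id D X" X X by (rule ptransf_id[OF X])
    interpret presheaf_pre G C D "ptrans_id D X" X X by unfold_locales
    show ?thesis by (rule ptrans_eqI[OF ptrans_pre ptransf_id[OF G.psh_pre_presheaf[OF X]]]) simp_all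
  qed
  show "ptrans_pre G (ptrans_comp D H F) = ptrans_comp C (ptrans_pre G H) (ptrans_pre G F)"
    if H: "ptransf D H Y Z" and F: "ptransf D F X Y"
  proof -
    interpret H: ptransf D H Y Z by (rule H)
    interpret F: ptransf D F X Y by (rule F)
    interpret HF: ptransf D "ptrans_comp D H F" X Z by (rule ptransf_comp[OF H F])
    interpret pH: presheaf_pre G C D H Y Z by unfold_locales
    interpret pF: presheaf_pre G C D F X Y by unfold_locales
    interpret pHF: presheaf_pre G C D "ptrans_comp D H F" X Z by unfold_locales
    show ?thesis by (rule ptrans_eqI[OF pHF.ptrans_pre ptransf_comp[OF pH.ptrans_pre pF.ptrans_pre]]) (simp_all add: F.psrc)
  qed
qed

lemma twofunctor_pre:
  assumes G: "dfunctor G C D" shows "twofunctor (Psh D) (Psh C) (ps1 Psh_pf G)"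
proof -
  interpret G: dfunctor G C D by (rule G)
  note pt = presheaf_transformation_ptransf and par = globular_modification_parallel
  have pre: "ptransf C (ptrans_pre G F) (psh_pre G X) (psh_pre G Y)" if "ptransf D F X Y" for F X Y
    by (rule presheaf_pre.ptrans_pre[OF presheaf_pre.intro[OF G that]])
  have mpre: "pmodf C (pmod_pre G A) (ptrans_pre G F) (ptrans_pre G F') (psh_pre G X) (psh_pre G Y)" if "pmodf D A F F' X Y" for A F F' X Y
    by (rule presheaf_mod_pre.pmod_pre[OF presheaf_mod_pre.intro[OF G that]])
  have gm: "pmodf D A (msrc A) (mtgt A) (psrc (msrc A)) (ptgt (msrc A))" if "globular_modification D A" for A
    using that by (simp add: pmodf_iff)
  have v1: "pmod_pre G (pmod_id D F) = pmod_id C (ptrans_pre G F)" if F: "ptransf D F X Y" for F X Y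
  proof -
    interpret F: ptransf D F X Y by (rule F)
    interpret A: pmodf D "pmod_id D F" F F X Y by (rule pmodf_id[OF F])
    interpret presheaf_mod_pre G C D "pmod_id D F" F F X Y by unfold_locales
    show ?thesis by (rule pmod_eqI[OF pmod_pre pmodf_id[OF S.ptrans_pre]]) (simp_all add: F.psrc F.ptgt)
  qed
  have v2: "pmod_pre G (pmod_vcomp D B A) = pmod_vcomp C (pmod_pre G B) (pmod_pre G A)"
    if B: "pmodf D B F' F'' X Y" and A: "pmodf D A F F' X Y" for A B F F' F'' X Y
  proof -
    interpret A: pmodf D A F F' X Y by (rule A)
    interpret B: pmodf D B F' F'' X Y by (rule B)
    interpret BA: pmodf D "pmod_vcomp D B A" F F'' X Y by (rule pmodf_vcomp[OF B A])
    interpret pA: presheaf_mod_pre G C D A F F' X Y by unfold_locales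
    interpret pB: presheaf_mod_pre G C D B F' F'' X Y by unfold_locales
    interpret pBA: presheaf_mod_pre G C D "pmod_vcomp D B A" F F'' X Y by unfold_locales
    show ?thesis by (rule pmod_eqI[OF pBA.pmod_pre pmodf_vcomp[OF pB.pmod_pre pA.pmod_pre]]) (simp_all add: A.F.psrc A.F.ptgt A.msrc)
  qed
  have h2: "pmod_pre G (pmod_hcomp D B A) = pmod_hcomp C (pmod_pre G B) (pmod_pre G A)"
    if B: "pmodf D B H H' Y Z" and A: "pmodf D A F F' X Y" for A B F F' H H' X Y Z
  proof -
    interpret A: pmodf D A F F' X Y by (rule A)
    interpret B: pmodf D B H H' Y Z by (rule B)
    interpret BA: pmodf D "pmod_hcomp D B A" "ptrans_comp D H F" "ptrans_comp D H' F'" X Z by (rule pmodf_hcomp[OF B A])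
    interpret pA: presheaf_mod_pre G C D A F F' X Y by unfold_locales
    interpret pB: presheaf_mod_pre G C D B H H' Y Z by unfold_locales
    interpret pBA: presheaf_mod_pre G C D "pmod_hcomp D B A" "ptrans_comp D H F" "ptrans_comp D H' F'" X Z by unfold_locales
    show ?thesis
      by (rule pmod_eqI[OF pBA.pmod_pre pmodf_hcomp[OF pB.pmod_pre pA.pmod_pre,
              folded ptrans_pre_ops(2)[OF G B.F.ptransf_axioms A.F.ptransf_axioms] ptrans_pre_ops(2)[OF G B.F'.ptransf_axioms A.F'.ptransf_axioms]]])
        (simp_all add: A.F.psrc A.F.ptgt A.msrc A.mtgt B.msrc B.F.ptgt)
  qed
  have "is_functor (One (Psh D)) (One (Psh C)) (psh_pre G) (ptrans_pre G)"
    unfolding is_functor_def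
  proof (intro conjI ballI impI, goal_cases)
    case 1 show ?case by (simp add: G.psh_pre_presheaf)
  next
    case 2 show ?case using pre[OF pt] by (auto simp: ptransf_iff)
  next
    case (3 F) then show ?case using pre[OF pt, of F] by (simp add: ptransf_iff)
  next
    case (4 F) then show ?case using pre[OF pt, of F] by (simp add: ptransf_iff)
  next
    case (5 X) then show ?case by (simp add: ptrans_pre_ops(1)[OF G])
  next
    case (6 H F) then show ?case using ptrans_pre_ops(2)[OF G, of H "psrc H" "ptgt H" F "psrc F"] by (simp add: ptransf_iff)
  qed
  moreover have "is_functor (Vert (Psh D)) (Vert (Psh C)) (ptrans_pre G) (pmod_pre G)"
    unfolding is_functor_def
  proof (intro conjI ballI impI, goal_cases)
    case 1 show ?case using pre[OF pt] by (auto simp: ptransf_iff)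
  next
    case 2 show ?case using mpre[OF gm] by (auto simp: pmodf_iff)
  next
    case (3 A) then show ?case using mpre[OF gm, of A] by (simp add: pmodf_iff)
  next
    case (4 A) then show ?case using mpre[OF gm, of A] by (simp add: pmodf_iff)
  next
    case (5 F) then show ?case using v1[OF pt, of F] by simp
  next
    case (6 B A)
    then show ?case using v2[of B "msrc B" "mtgt B" "psrc (msrc A)" "ptgt (msrc A)" A "msrc A"] par[of D A] by (simp add: pmodf_iff)
  qed
  moreover have "is_functor (Horiz (Psh D)) (Horiz (Psh C)) (psh_pre G) (pmod_pre G)"
    unfolding is_functor_def
  proof (intro conjI ballI impI, goal_cases)
    case 1 show ?case by (simp add: G.psh_pre_presheaf)
  next
    case 2 show ?case using mpre[OF gm] by (auto simp: pmodf_iff)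
  next
    case (3 A) then show ?case using mpre[OF gm, of A] by (simp add: pmodf_iff)
  next
    case (4 A) then show ?case using mpre[OF gm, of A] by (simp add: pmodf_iff)
  next
    case (5 X) then show ?case using v1[OF ptransf_id[of D X]] by (simp add: ptrans_pre_ops(1)[OF G])
  next
    case (6 B A)
    then show ?case using h2[of B "msrc B" "mtgt B" "psrc (msrc B)" "ptgt (msrc B)" A "msrc A" "mtgt A" "psrc (msrc A)"] by (simp add: pmodf_iff)
  qed
  ultimately show ?thesis by (simp add: twofunctor_def)
qed

locale presheaf_htrans = B: htransf B G G' C D + X: lax_double_presheaf D X for B G G' C D and X :: "'u::universe psh"
begin

lemma psh_htrans_sel [simp]:
  "psrc (psh_htrans B X) = psh_pre G' X" "ptgt (psh_htrans B X) = psh_pre G X"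
  "x \<in> Ob C \<Longrightarrow> tfun (psh_htrans B X) x = pfun X (hO B x)" "u \<in> Ver C \<Longrightarrow> tprof (psh_htrans B X) u = psq X (hV B u)"
  by (simp_all add: psh_htrans_def)

lemma psh_htrans: "ptransf C (psh_htrans B X) (psh_pre G' X) (psh_pre G X)"
proof (rule ptransfI, goal_cases)
  case 1 show ?case by (rule B.G'.psh_pre_presheaf) unfold_locales
next
  case 2 show ?case by (rule B.G.psh_pre_presheaf) unfold_locales
next
  case (7 x) then show ?case using X.pfun_functor[of "hO B x"] by simp
next
  case (8 u)
  then show ?case using X.psq[of "hV B u" "fV G u" "fV G' u"] by (simp add: prof_nat_def prof_restrict_def)
next
  case (9 f b)
  have "fo (pfun X (Cmp (HCat D) (fH G' f) (hO B (Dom (HCat C) f)))) b = fo (pfun X (Cmp (HCat D) (hO B (Cod (HCat C) f)) (fH G f))) b"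
    using 9 by (simp only: B.natural)
  then show ?case using 9 by simp
next
  case (10 f m)
  have "fa (pfun X (Cmp (HCat D) (fH G' f) (hO B (Dom (HCat C) f)))) m = fa (pfun X (Cmp (HCat D) (hO B (Cod (HCat C) f)) (fH G f))) m"
    using 10 by (simp only: B.natural)
  then show ?case
    using 10 X.pfun_Cmp[of "hO B (Dom (HCat C) f)" _ "fO G' (Dom (HCat C) f)" "fH G' f" "fO G' (Cod (HCat C) f)"]
      X.pfun_Cmp[of "fH G f" _ "fO G (Cod (HCat C) f)" "hO B (Cod (HCat C) f)" "fO G' (Cod (HCat C) f)"] by simp
next
  case (11 \<alpha> a a' s)
  have "psq X (Cmp (SHCat D) (fS G' \<alpha>) (hV B (lft C \<alpha>))) a a' s = psq X (Cmp (SHCat D) (hV B (rgt C \<alpha>)) (fS G \<alpha>)) a a' s"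
    using 11 by (simp only: B.natural)
  then show ?case using 11 by simp
next
  case (12 u u' a a' a'' s s')
  then show ?case using X.vmul_natural[of "hV B u" "hV B u'" a a' a'' s s'] by simp
next
  case (13 x a b m) then show ?case by auto
qed (auto, simp_all add: psh_htrans_def)

end

lemma two_natural_psh_htrans:
  assumes B: "htransf B G G' C D"
  shows "two_natural (Psh D) (Psh C) (ps1 Psh_pf G') (ps1 Psh_pf G) (psh_htrans B)"
  unfolding two_natural_def
proof (intro conjI ballI, goal_cases)
  case (1 X)
  interpret B: htransf B G G' C D by (rule B)
  interpret X: lax_double_presheaf D X using 1 by simp
  interpret presheaf_htrans B G G' C D X by unfold_locales
  show ?case using psh_htrans by (simp add: ptransf_iff)
next
  case (2 F)
  obtain X Y where st: "psrc F = X" "ptgt F = Y" by simp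
  interpret B: htransf B G G' C D by (rule B)
  interpret F: ptransf D F X Y using 2 st by (simp add: ptransf_iff)
  interpret x: presheaf_htrans B G G' C D X by unfold_locales
  interpret y: presheaf_htrans B G G' C D Y by unfold_locales
  interpret S: presheaf_pre G' C D F X Y by unfold_locales
  interpret T: presheaf_pre G C D F X Y by unfold_locales
  have e: "psq Y (hV B u) (fo (tfun F (fO G' (Dom (VCat C) u))) a) (fo (tfun F (fO G' (Cod (VCat C) u))) a') (tprof F (fV G' u) a a' s) =
      tprof F (fV G u) (fo (pfun X (hO B (Dom (VCat C) u))) a) (fo (pfun X (hO B (Cod (VCat C) u))) a') (psq X (hV B u) a a' s)"
    if "u \<in> Ver C" "a \<in> Obj (pcat X (fO G' (Dom (VCat C) u)))" "a' \<in> Obj (pcat X (fO G' (Cod (VCat C) u)))"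
      "s \<in> pel (pprof X (fV G' u)) a a'" for u a a' s
    using F.tprof_psq[of "hV B u" a a' s] that by simp
  have "ptrans_comp C (ptrans_pre G F) (psh_htrans B X) = ptrans_comp C (psh_htrans B Y) (ptrans_pre G' F)"
    by (rule ptrans_eqI[OF ptransf_comp[OF T.ptrans_pre x.psh_htrans] ptransf_comp[OF y.psh_htrans S.ptrans_pre]])
      (simp_all add: F.tfun_hor_at e)
  then show ?case by (simp add: st)
next
  case (3 A)
  obtain X Y F F' where st: "msrc A = F" "mtgt A = F'" "psrc F = X" "ptgt F = Y" by simp
  interpret B: htransf B G G' C D by (rule B)
  interpret A: pmodf D A F F' X Y using 3 st by (simp add: pmodf_iff)
  interpret x: presheaf_htrans B G G' C D X by unfold_locales
  interpret y: presheaf_htrans B G G' C D Y by unfold_locales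
  interpret S: presheaf_mod_pre G' C D A F F' X Y by unfold_locales
  interpret T: presheaf_mod_pre G C D A F F' X Y by unfold_locales
  have sq: "psq Y (hV B u) (fo (tfun H (fO G' (Dom (VCat C) u))) a) (fo (tfun H (fO G' (Cod (VCat C) u))) a') (tprof H (fV G' u) a a' s) =
      tprof H (fV G u) (fo (pfun X (hO B (Dom (VCat C) u))) a) (fo (pfun X (hO B (Cod (VCat C) u))) a') (psq X (hV B u) a a' s)"
    if "u \<in> Ver C" "a \<in> Obj (pcat X (fO G' (Dom (VCat C) u)))" "a' \<in> Obj (pcat X (fO G' (Cod (VCat C) u)))"
      "s \<in> pel (pprof X (fV G' u)) a a'" "ptransf D H X Y" for H u a a' s
    using ptransf.tprof_psq[of D H X Y "hV B u" a a' s] that by simp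
  have e: "ptrans_comp C (ptrans_pre G H) (psh_htrans B X) = ptrans_comp C (psh_htrans B Y) (ptrans_pre G' H)" if "H = F \<or> H = F'" for H
  proof -
    interpret H: ptransf D H X Y using that A.F.ptransf_axioms A.F'.ptransf_axioms by auto
    interpret S': presheaf_pre G' C D H X Y by unfold_locales
    interpret T': presheaf_pre G C D H X Y by unfold_locales
    show ?thesis
      by (rule ptrans_eqI[OF ptransf_comp[OF T'.ptrans_pre x.psh_htrans] ptransf_comp[OF y.psh_htrans S'.ptrans_pre]])
        (simp_all add: H.tfun_hor_at sq[OF _ _ _ _ H.ptransf_axioms])
  qed
  have m: "mcomp A (fO G x) (fo (pfun X (hO B x)) a) = fa (pfun Y (hO B x)) (mcomp A (fO G' x) a)"
    if "x \<in> Ob C" "a \<in> Obj (pcat X (fO G' x))" for x a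
    using A.mcomp_hor[of "hO B x" "fO G x" "fO G' x" a] that by simp
  have "pmod_hcomp C (pmod_pre G A) (pmod_id C (psh_htrans B X)) = pmod_hcomp C (pmod_id C (psh_htrans B Y)) (pmod_pre G' A)"
    by (rule pmod_eqI[OF pmodf_hcomp[OF T.pmod_pre pmodf_id[OF x.psh_htrans]]
          pmodf_hcomp[OF pmodf_id[OF y.psh_htrans] S.pmod_pre, folded e[of F, simplified] e[of F', simplified]]])
      (simp_all add: m A.F.tfun_hor_at A.F'.tfun_hor_at)
  then show ?case by (simp add: st)
qed

text \<open>
  The identities relate 2-functors that agree on all cells. The comparison transformations of
  precomposition, which is strictly functorial, are of this kind.
\<close>

lemma two_natural_iso_Ident:
  assumes K: "twocategory K" and L: "twocategory L" and S: "twofunctor K L S" and T: "twofunctor K L T"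
    and eq: "\<And>x. x \<in> Cells0 K \<Longrightarrow> on0 T x = on0 S x" "\<And>f. f \<in> Cells1 K \<Longrightarrow> on1 T f = on1 S f"
      "\<And>\<sigma>. \<sigma> \<in> Cells2 K \<Longrightarrow> on2 T \<sigma> = on2 S \<sigma>"
    and \<eta>: "\<And>x. x \<in> Cells0 K \<Longrightarrow> \<eta> x = Ident (One L) (on0 S x)"
  shows "two_natural_iso K L S T \<eta>"
proof -
  interpret K: twocategory K by (rule K)
  interpret L: twocategory L by (rule L)
  have F: "is_functor (One K) (One L) (on0 S) (on1 S)" "is_functor (Horiz K) (Horiz L) (on0 S) (on2 S)"
    using S by (simp_all add: twofunctor_def)
  note f = is_functor_simps(1-4)[OF F(1)] is_functor_simps(2-4)[OF F(2)]
  have "iso_arr (One L) (Ident (One L) y)" if "y \<in> Cells0 L" for y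
    unfolding iso_arr_def using that by (intro conjI bexI[of _ "Ident (One L) y"]) simp_all
  then show ?thesis
    unfolding two_natural_iso_def two_natural_def using f by (simp add: eq \<eta> flip: L.Ident_Horiz)
qed

lemma psh_htrans_ops:
  shows "\<lbrakk>dfunctor G C D; lax_double_presheaf D X\<rbrakk> \<Longrightarrow> psh_htrans (htrans_id G) X = ptrans_id C (psh_pre G X)"
    "\<lbrakk>htransf B G' G'' C D; htransf A G G' C D; lax_double_presheaf D X\<rbrakk> \<Longrightarrow>
      psh_htrans (htrans_vcomp B A) X = ptrans_comp C (psh_htrans A X) (psh_htrans B X)"
    "\<lbrakk>htransf B H H' D D'; htransf A G G' C D; lax_double_presheaf D' X\<rbrakk> \<Longrightarrow>
      psh_htrans (htrans_hcomp B A) X = ptrans_comp C (psh_htrans A (psh_pre H X)) (ptrans_pre G' (psh_htrans B X))"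
proof -
  show "psh_htrans (htrans_id G) X = ptrans_id C (psh_pre G X)" if G: "dfunctor G C D" and X: "lax_double_presheaf D X"
  proof -
    interpret G: dfunctor G C D by (rule G)
    interpret X: lax_double_presheaf D X by (rule X)
    interpret I: htransf "htrans_id G" G G C D by (rule htransf_id[OF G])
    interpret presheaf_htrans "htrans_id G" G G C D X by unfold_locales
    show ?thesis by (rule ptrans_eqI[OF psh_htrans ptransf_id[OF G.psh_pre_presheaf[OF X]]]) simp_all
  qed
  show "psh_htrans (htrans_vcomp B A) X = ptrans_comp C (psh_htrans A X) (psh_htrans B X)"
    if B: "htransf B G' G'' C D" and A: "htransf A G G' C D" and X: "lax_double_presheaf D X"
  proof -
    interpret B: htransf B G' G'' C D by (rule B)
    interpret A: htransf A G G' C D by (rule A)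
    interpret BA: htransf "htrans_vcomp B A" G G'' C D by (rule htransf_vcomp[OF B A])
    interpret X: lax_double_presheaf D X by (rule X)
    interpret b: presheaf_htrans B G' G'' C D X by unfold_locales
    interpret a: presheaf_htrans A G G' C D X by unfold_locales
    interpret ba: presheaf_htrans "htrans_vcomp B A" G G'' C D X by unfold_locales
    show ?thesis
      by (rule ptrans_eqI[OF ba.psh_htrans ptransf_comp[OF a.psh_htrans b.psh_htrans]]) (simp_all add: A.G.dsrc A.G.dtgt)
  qed
  show "psh_htrans (htrans_hcomp B A) X = ptrans_comp C (psh_htrans A (psh_pre H X)) (ptrans_pre G' (psh_htrans B X))"
    if B: "htransf B H H' D D'" and A: "htransf A G G' C D" and X: "lax_double_presheaf D' X"
  proof -
    interpret B: htransf B H H' D D' by (rule B)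
    interpret A: htransf A G G' C D by (rule A)
    interpret BA: htransf "htrans_hcomp B A" "dfun_comp H G" "dfun_comp H' G'" C D' by (rule htransf_hcomp[OF B A])
    interpret X: lax_double_presheaf D' X by (rule X)
    interpret HX: lax_double_presheaf D "psh_pre H X" by (rule B.G.psh_pre_presheaf[OF X])
    interpret b: presheaf_htrans B H H' D D' X by unfold_locales
    interpret a: presheaf_htrans A G G' C D "psh_pre H X" by unfold_locales
    interpret ba: presheaf_htrans "htrans_hcomp B A" "dfun_comp H G" "dfun_comp H' G'" C D' X by unfold_locales
    interpret t: ptransf D "psh_htrans B X" "psh_pre H' X" "psh_pre H X" by (rule b.psh_htrans)
    interpret p: presheaf_pre G' C D "psh_htrans B X" "psh_pre H' X" "psh_pre H X" by unfold_locales
    note e = psh_pre_comp(1)[OF B.G.dfunctor_axioms A.G.dfunctor_axioms] psh_pre_comp(1)[OF B.G'.dfunctor_axioms A.G'.dfunctor_axioms]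
    show ?thesis
      by (rule ptrans_eqI[OF ba.psh_htrans[unfolded e] ptransf_comp[OF a.psh_htrans p.ptrans_pre]]) simp_all
  qed
qed

lemma pseudofunctor_Psh: "pseudofunctor (coop DblCat_h) Psh_pf"
proof (rule pseudofunctor.intro, goal_cases)
  case 1 show ?case by (rule twocategory_coop[OF twocategory_DblCat_h])
next
  case 2 show ?case by (simp add: twocategory_Psh)
next
  case (3 f)
  then show ?case using twofunctor_pre[of f "dsrc f" "dtgt f"] by (simp add: dfunctor_iff)
next
  case (4 b)
  then show ?case using two_natural_psh_htrans[OF horizontal_transformation_htransf] by simp
next
  case (5 f k l X)
  then show ?case using psh_htrans_ops(1)[of f l k X] by (simp add: dfunctor_iff)
next
  case (6 b k l c X)
  then show ?case
    using psh_htrans_ops(2)[of b "hsrc b" "htgt b" l k c "hsrc c" X] by (simp add: htransf_iff)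
next
  case (7 f k l g m)
  then have f: "dfunctor f l k" and g: "dfunctor g m l" by (simp_all add: dfunctor_iff)
  show ?case
    using two_natural_iso_Ident[OF twocategory_Psh twocategory_Psh twofunctor_comp[OF twofunctor_pre[OF f] twofunctor_pre[OF g]]
        twofunctor_pre[OF dfunctor_comp[OF f g]], of "ps_comp Psh_pf g f"] 7
    by (simp add: twofun_comp_def psh_pre_comp[OF f g])
next
  case (8 k)
  then have k: "double_category k" by simp
  show ?case
    using two_natural_iso_Ident[OF twocategory_Psh twocategory_Psh twofunctor_id twofunctor_pre[OF dfunctor_id[OF k]], of "ps_unit Psh_pf k"]
    by (simp add: twofun_id_def psh_pre_id ptrans_pre_id[OF presheaf_transformation_ptransf] pmod_pre_id[OF pmodf_iff[THEN iffD2]])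
next
  case (9 b k l c m X f f' g g')
  then have b: "htransf b f' f l k" and c: "htransf c g' g m l" and X: "lax_double_presheaf k X" by (simp_all add: htransf_iff)
  note d = htransf_dfunctors[OF b] htransf_dfunctors[OF c]
  note t = presheaf_htrans.psh_htrans[OF presheaf_htrans.intro[OF htransf_hcomp[OF b c] X], unfolded psh_pre_comp[OF d(1,3)] psh_pre_comp[OF d(2,4)]]
  show ?case using 9 ptrans_comp_id[OF t] psh_htrans_ops(3)[OF b c X] d by (simp add: dfunctor_iff)
next
  case (10 f k l g m h n X)
  then have d: "dfunctor f l k" "dfunctor g m l" "dfunctor h n m" and X: "lax_double_presheaf k X" by (simp_all add: dfunctor_iff)
  have Y: "lax_double_presheaf m (psh_pre g (psh_pre f X))" by (intro dfunctor.psh_pre_presheaf[OF d(2)] dfunctor.psh_pre_presheaf[OF d(1)] X)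
  show ?case
    using 10 by (simp add: ptrans_pre_ops(1)[OF d(3) Y] psh_pre_comp[OF d(1,2)] psh_pre_comp[OF d(2,3)])
next
  case (11 f k l X)
  then have d: "dfunctor f l k" and X: "lax_double_presheaf k X" by (simp_all add: dfunctor_iff)
  show ?case
    using 11 ptrans_comp_id(1)[OF ptransf_id[OF dfunctor.psh_pre_presheaf[OF d X]]] by (simp add: ptrans_pre_ops(1)[OF d X] psh_pre_id[OF X])
next
  case (12 f k l X)
  then have d: "dfunctor f l k" and X: "lax_double_presheaf k X" by (simp_all add: dfunctor_iff)
  note fX = dfunctor.psh_pre_presheaf[OF d X]
  show ?case
    using 12 ptrans_comp_id(1)[OF ptransf_id[OF fX]] by (simp add: psh_pre_id[OF fX])
qed

section \<open>Pseudo-naturality of the Grothendieck construction\<close>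

text \<open>
  The component at \<open>X\<close> deletes the copy of the image in the target of
  \<open>G\<close> from the codes \<open>(x, (G x, a))\<close> and \<open>(u, (G u, a, a',
  s))\<close> of cells of the pullback.
\<close>

definition pn_map :: "'u::universe dfun \<Rightarrow> 'u psh \<Rightarrow> 'u dfun" where
  "pn_map G X = (let Q = pull G (groth_proj (dtgt G) X); r = (\<lambda>z. upair (ufst z) (usnd (usnd z)));
      s = (\<lambda>z. vcode (ufst z) (vdomc (usnd z)) (vcodc (usnd z)) (velem (usnd z))) in
    \<lparr>dsrc = Q, dtgt = groth (dsrc G) (psh_pre G X), fO = restrict r (Ob Q), fH = restrict r (Hor Q),
     fV = restrict s (Ver Q), fS = restrict s (Sq Q)\<rparr>)"

definition pn :: "'u::universe dfun \<Rightarrow> 'u psh \<Rightarrow> 'u dfun \<times> 'u dfun \<times> 'u dfun" where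
  "pn G X = (pull_proj G (groth_proj (dtgt G) X), pn_map G X, groth_proj (dsrc G) (psh_pre G X))"

text \<open>
  Reindexing in a total double category is the action of the presheaf, as the cells with the
  required right-hand side are explicit.
\<close>

lemma (in lax_double_presheaf) groth_re:
  "\<lbrakk>f \<in> Hor C; Cod (HCat C) f = y; b \<in> Obj (pcat X y)\<rbrakk> \<Longrightarrow>
    fibration.reO (groth_proj C X) (groth C X) f (upair y b) = upair (Dom (HCat C) f) (fo (pfun X f) b)"
  "\<lbrakk>\<alpha> \<in> Sq C; rgt C \<alpha> = v; b \<in> Obj (pcat X (Dom (VCat C) v)); b' \<in> Obj (pcat X (Cod (VCat C) v)); t \<in> pel (pprof X v) b b'\<rbrakk> \<Longrightarrow>
    fibration.reV (groth_proj C X) (groth C X) \<alpha> (vcode v b b' t) =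
      vcode (lft C \<alpha>) (fo (pfun X (upper C \<alpha>)) b) (fo (pfun X (lower C \<alpha>)) b') (psq X \<alpha> b b' t)"
proof -
  interpret P: fibration "groth_proj C X" "groth C X" C by (rule groth_fibration)
  show "P.reO f (upair y b) = upair (Dom (HCat C) f) (fo (pfun X f) b)"
    if "f \<in> Hor C" "Cod (HCat C) f = y" "b \<in> Obj (pcat X y)"
    using P.re_of_cell(1)[of "upair f b" f "upair y b"] that by simp
  show "P.reV \<alpha> (vcode v b b' t) =
      vcode (lft C \<alpha>) (fo (pfun X (upper C \<alpha>)) b) (fo (pfun X (lower C \<alpha>)) b') (psq X \<alpha> b b' t)"
    if "\<alpha> \<in> Sq C" "rgt C \<alpha> = v" "b \<in> Obj (pcat X (Dom (VCat C) v))" "b' \<in> Obj (pcat X (Cod (VCat C) v))" "t \<in> pel (pprof X v) b b'"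
    using P.re_of_cell(2)[of "vcode \<alpha> b b' t" \<alpha> "vcode v b b' t"] that C.dc_SH(3)[of \<alpha>] by auto
qed

locale pulled_groth = G: dfunctor G C D + X: lax_double_presheaf D X for G C D and X :: "'u::universe psh"
begin

sublocale GX: lax_double_presheaf C "psh_pre G X" by (rule G.psh_pre_presheaf) unfold_locales
sublocale P: fibration "groth_proj D X" "groth D X" D by (rule X.groth_fibration)
sublocale T: pulled G C D "groth_proj D X" "groth D X" by unfold_locales
sublocale Q: fibration "groth_proj C (psh_pre G X)" "groth C (psh_pre G X)" C by (rule GX.groth_fibration)

lemma pn_map_sel [simp]:
  "dsrc (pn_map G X) = pull G (groth_proj D X)" "dtgt (pn_map G X) = groth C (psh_pre G X)"
  "\<lbrakk>x \<in> Ob C; y = fO G x; a \<in> Obj (pcat X (fO G x))\<rbrakk> \<Longrightarrow> fO (pn_map G X) (upair x (upair y a)) = upair x a"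
  "\<lbrakk>f \<in> Hor C; g = fH G f; b \<in> Obj (pcat X (fO G (Cod (HCat C) f)))\<rbrakk> \<Longrightarrow> fH (pn_map G X) (upair f (upair g b)) = upair f b"
  "\<lbrakk>u \<in> Ver C; v = fV G u; a \<in> Obj (pcat X (fO G (Dom (VCat C) u))); a' \<in> Obj (pcat X (fO G (Cod (VCat C) u)));
     s \<in> pel (pprof X (fV G u)) a a'\<rbrakk> \<Longrightarrow> fV (pn_map G X) (upair u (vcode v a a' s)) = vcode u a a' s"
  "\<lbrakk>\<alpha> \<in> Sq C; \<beta> = fS G \<alpha>; a \<in> Obj (pcat X (fO G (Dom (VCat C) (rgt C \<alpha>)))); a' \<in> Obj (pcat X (fO G (Cod (VCat C) (rgt C \<alpha>))));
     s \<in> pel (pprof X (fV G (rgt C \<alpha>))) a a'\<rbrakk> \<Longrightarrow> fS (pn_map G X) (upair \<alpha> (vcode \<beta> a a' s)) = vcode \<alpha> a a' s"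
  by (simp_all add: pn_map_def Let_def)

lemma pn_map_over: "over (pull_proj G (groth_proj D X)) (pull G (groth_proj D X)) C (pn_map G X)
    (groth_proj C (psh_pre G X)) (groth C (psh_pre G X))"
  by (rule overI[OF T.pull_fibration Q.fibration_axioms])
    (auto elim!: pull_setE grothE, auto simp: pn_map_def Let_def)

lemma pn_map_iso: "iso_arr (One (DFib C)) (pn G X)"
  unfolding pn_def G.dsrc G.dtgt
proof (rule over_iso[OF pn_map_over])
  show "bij_betw (fO (pn_map G X)) (Ob (pull G (groth_proj D X))) (Ob (groth C (psh_pre G X)))"
    by (rule bij_betw_byWitness[where f' = "\<lambda>z. upair (ufst z) (upair (fO G (ufst z)) (usnd z))"])
      (auto elim!: pull_setE grothE)
  show "bij_betw (fV (pn_map G X)) (Ver (pull G (groth_proj D X))) (Ver (groth C (psh_pre G X)))"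
    by (rule bij_betw_byWitness[where f' = "\<lambda>w. upair (vbase w) (vcode (fV G (vbase w)) (vdomc w) (vcodc w) (velem w))"])
      (auto elim!: pull_setE grothE)
qed

end

lemma two_natural_iso_pn:
  assumes G: "dfunctor G C D"
  shows "two_natural_iso (Psh D) (DFib C) (twofun_comp (ps1 DFib_pf G) (Groth D)) (twofun_comp (Groth C) (ps1 Psh_pf G)) (pn G)"
proof -
  interpret G: dfunctor G C D by (rule G)
  have "two_natural (Psh D) (DFib C) (twofun_comp (ps1 DFib_pf G) (Groth D)) (twofun_comp (Groth C) (ps1 Psh_pf G)) (pn G)"
  proof (rule two_natural_into_DFibI[OF twocategory_Psh twofunctor_comp[OF twofunctor_Groth twofunctor_pull[OF G]]
        twofunctor_comp[OF twofunctor_pre[OF G] twofunctor_Groth], where n = "pn_map G"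
        and ES = "\<lambda>X. pull G (groth_proj D X)" and ET = "\<lambda>X. groth C (psh_pre G X)"], goal_cases)
    case (1 X) show ?case by (simp add: twofun_comp_def)
  next
    case (2 X) show ?case by (simp add: twofun_comp_def groth_proj_def)
  next
    case (3 X) show ?case by (simp add: twofun_comp_def pn_def)
  next
    case (4 X)
    then interpret X: lax_double_presheaf D X by simp
    interpret pulled_groth G C D X by unfold_locales
    show ?case by (simp add: twofun_comp_def pn_map_over)
  next
    case (5 F a)
    obtain X Y where st: "psrc F = X" "ptgt F = Y" by simp
    interpret F: ptransf D F X Y using 5 st by (simp add: ptransf_iff)
    interpret x: pulled_groth G C D X by unfold_locales
    interpret y: pulled_groth G C D Y by unfold_locales
    interpret o: over "groth_proj D X" "groth D X" D "groth_map D F" "groth_proj D Y" "groth D Y" by (rule F.groth_map_over)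
    interpret m: pulled_over G C D "groth_proj D X" "groth D X" "groth_map D F" "groth_proj D Y" "groth D Y" by unfold_locales
    interpret p: presheaf_pre G C D F X Y by unfold_locales
    interpret GF: ptransf C "ptrans_pre G F" "psh_pre G X" "psh_pre G Y" by (rule p.ptrans_pre)
    show ?case using 5 by (auto elim!: pull_setE grothE simp: st twofun_comp_def)
  next
    case (6 F a)
    obtain X Y where st: "psrc F = X" "ptgt F = Y" by simp
    interpret F: ptransf D F X Y using 6 st by (simp add: ptransf_iff)
    interpret x: pulled_groth G C D X by unfold_locales
    interpret y: pulled_groth G C D Y by unfold_locales
    interpret o: over "groth_proj D X" "groth D X" D "groth_map D F" "groth_proj D Y" "groth D Y" by (rule F.groth_map_over)
    interpret m: pulled_over G C D "groth_proj D X" "groth D X" "groth_map D F" "groth_proj D Y" "groth D Y" by unfold_locales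
    interpret p: presheaf_pre G C D F X Y by unfold_locales
    interpret GF: ptransf C "ptrans_pre G F" "psh_pre G X" "psh_pre G Y" by (rule p.ptrans_pre)
    show ?case using 6 by (auto elim!: pull_setE grothE simp: st twofun_comp_def)
  next
    case (7 A a)
    obtain X Y F F' where st: "msrc A = F" "mtgt A = F'" "psrc F = X" "ptgt F = Y" by simp
    interpret A: pmodf D A F F' X Y using 7 st by (simp add: pmodf_iff)
    interpret x: pulled_groth G C D X by unfold_locales
    interpret y: pulled_groth G C D Y by unfold_locales
    interpret o: over_cell "groth_proj D X" "groth D X" D "groth_map D F" "groth_map D F'" "groth_mod D A" "groth_proj D Y" "groth D Y"
      by (rule A.groth_mod_over)
    interpret m: pulled_cell G C D "groth_proj D X" "groth D X" "groth_map D F" "groth_map D F'" "groth_mod D A" "groth_proj D Y" "groth D Y"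
      by unfold_locales
    interpret p: presheaf_mod_pre G C D A F F' X Y by unfold_locales
    interpret GA: pmodf C "pmod_pre G A" "ptrans_pre G F" "ptrans_pre G F'" "psh_pre G X" "psh_pre G Y" by (rule p.pmod_pre)
    show ?case using 7 by (auto elim!: pull_setE grothE simp: st twofun_comp_def)
  qed
  moreover have "iso_arr (One (DFib C)) (pn G X)" if "X \<in> Cells0 (Psh D)" for X
  proof -
    interpret X: lax_double_presheaf D X using that by simp
    interpret pulled_groth G C D X by unfold_locales
    show ?thesis by (rule pn_map_iso)
  qed
  ultimately show ?thesis by (simp add: two_natural_iso_def)
qed

text \<open>
  Both composites reindex the second component along the transformation, once as a lift in the
  total double category and once by the action of the presheaf.
\<close>

lemma pn_map_natural:
  assumes B: "htransf B G G' C D" and X: "lax_double_presheaf D X"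
  shows "dfun_comp (pn_map G X) (pull_htrans B (groth_proj D X)) = dfun_comp (groth_map C (psh_htrans B X)) (pn_map G' X)"
proof -
  interpret B: htransf B G G' C D by (rule B)
  interpret X: lax_double_presheaf D X by (rule X)
  interpret s: pulled_groth G C D X by unfold_locales
  interpret t: pulled_groth G' C D X by unfold_locales
  interpret b: pulled_htrans B G G' C D "groth_proj D X" "groth D X" by unfold_locales
  interpret h: presheaf_htrans B G G' C D X by unfold_locales
  interpret m: ptransf C "psh_htrans B X" "psh_pre G' X" "psh_pre G X" by (rule h.psh_htrans)
  show ?thesis
    by (rule over_eqI[OF over_comp[OF b.pull_htrans_over s.pn_map_over] over_comp[OF t.pn_map_over m.groth_map_over]])
      (auto elim!: pull_setE grothE simp: X.groth_re)
qed

lemma pn_map_comp: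
  assumes H: "dfunctor H D B" and G: "dfunctor G C D" and X: "lax_double_presheaf B X"
  shows "dfun_comp (pn_map (dfun_comp H G) X) (pull_assoc G H (groth_proj B X)) =
    dfun_comp (groth_map C (ptrans_id C (psh_pre G (psh_pre H X))))
      (dfun_comp (pn_map G (psh_pre H X)) (pull_map G (pull_proj H (groth_proj B X), pn_map H X, groth_proj D (psh_pre H X))))"
proof -
  interpret H: dfunctor H D B by (rule H)
  interpret G: dfunctor G C D by (rule G)
  interpret HG: dfunctor "dfun_comp H G" C B by (rule dfunctor_comp[OF H G])
  interpret X: lax_double_presheaf B X by (rule X)
  interpret h: pulled_groth H D B X by unfold_locales
  interpret g: pulled_groth G C D "psh_pre H X" by unfold_locales
  interpret hg: pulled_groth "dfun_comp H G" C B X by unfold_locales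
  interpret t: pulled_twice G C D H B "groth_proj B X" "groth B X" by unfold_locales
  interpret o: over "pull_proj H (groth_proj B X)" "pull H (groth_proj B X)" D "pn_map H X" "groth_proj D (psh_pre H X)"
    "groth D (psh_pre H X)" by (rule h.pn_map_over)
  interpret m: pulled_over G C D "pull_proj H (groth_proj B X)" "pull H (groth_proj B X)" "pn_map H X" "groth_proj D (psh_pre H X)"
    "groth D (psh_pre H X)" by unfold_locales
  interpret i: ptransf C "ptrans_id C (psh_pre G (psh_pre H X))" "psh_pre G (psh_pre H X)" "psh_pre G (psh_pre H X)"
    by (rule ptransf_id) unfold_locales
  show ?thesis
    by (rule over_eqI[OF over_comp[OF t.pull_assoc_over hg.pn_map_over, unfolded psh_pre_comp(1)[OF H G]]
          over_comp[OF over_comp[OF m.pull_map_over g.pn_map_over] i.groth_map_over]])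
      (auto elim!: pull_setE grothE)
qed

lemma pn_map_unit:
  assumes X: "lax_double_presheaf C X"
  shows "dfun_comp (pn_map (dfun_id C) X) (pull_unit C (groth_proj C X)) = groth_map C (ptrans_id C X)"
proof -
  interpret X: lax_double_presheaf C X by (rule X)
  interpret I: dfunctor "dfun_id C" C C by (rule dfunctor_id[OF X.base])
  interpret g: pulled_groth "dfun_id C" C C X by unfold_locales
  interpret u: pulled_id "groth_proj C X" C "groth C X" by unfold_locales
  interpret i: ptransf C "ptrans_id C X" X X by (rule ptransf_id[OF X])
  show ?thesis
    by (rule over_eqI[OF over_comp[OF u.pull_unit_over g.pn_map_over, unfolded psh_pre_id[OF X]] i.groth_map_over])
      (auto elim!: grothE)
qed

lemma pseudonatural_Groth: "pseudonatural (coop DblCat_h) Psh_pf DFib_pf Groth pn"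
proof (rule pseudonatural.intro, goal_cases)
  case 1 show ?case by (rule pseudofunctor_Psh)
next
  case 2 show ?case by (rule pseudofunctor_DFib)
next
  case (3 k) show ?case by (simp add: twofunctor_Groth)
next
  case (4 f k l)
  then show ?case using two_natural_iso_pn[of f l k] by (simp add: dfunctor_iff)
next
  case (5 b k l X)
  then have b: "htransf b (hsrc b) (htgt b) l k" and X: "lax_double_presheaf k X" by (simp_all add: htransf_iff)
  note d = htransf_dfunctors[OF b, unfolded dfunctor_iff]
  show ?case using pn_map_natural[OF b X] d by (simp add: pn_def psh_htrans_def)
next
  case (6 f k l g m X)
  then have d: "dfunctor f l k" "dfunctor g m l" and X: "lax_double_presheaf k X" by (simp_all add: dfunctor_iff)
  show ?case using pn_map_comp[OF d X] d by (simp add: pn_def psh_pre_comp[OF d] dfunctor_iff)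
next
  case (7 k X)
  then show ?case using pn_map_unit[of k X] by (simp add: pn_def psh_pre_id)
qed

theorem theorem2:
  shows "(\<forall>C :: 'u::universe dblcat. double_category C \<longrightarrow> two_equivalence (Psh C) (DFib C) (Groth C)) \<and>
    (\<exists>pn. pseudonatural (coop (DblCat_h :: ('u dblcat, 'u dfun, 'u htrans) twocat)) Psh_pf DFib_pf Groth pn)"
  using two_equivalence_Groth pseudonatural_Groth by blast

end
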